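(* Let $\Omega$ and $F$ be as in the context. Suppose $u,v\in C(\bar\Omega)$ and $f\in C(\Omega)$ satisfy, in the viscosity sense, $$F(D^2u,Du,u,x)\le f\le F(D^2v,Dv,v,x)\quad\text{in }\Omega,$$ and $u(\tilde x)>v(\tilde x)$ for some $\tilde x\in\Omega$. Assume also that one of the following holds: (i) $f\le0$ and $u<0$ in $\Omega$, and $v\ge0$ on $\partial\Omega$; or (ii) $f\ge0$ and $v>0$ in $\Omega$, and $u\le0$ on $\partial\Omega$. Then $v\equiv tu$ for some $t>0$.
   Context: $\Omega\subseteq\mathbb{R}^n$ is a bounded, smooth, connected open set; $\mathbb{S}^n$ denotes the real symmetric $n\times n$ matrices. For $0<\gamma\le\Gamma$ and $M\in\mathbb{S}^n$ the Pucci operators are $\mathcal{P}^+_{\gamma,\Gamma}(M)=\sup_A[-\mathrm{tr}(AM)]$ and $\mathcal{P}^-_{\gamma,\Gamma}(M)=\inf_A[-\mathrm{tr}(AM)]$, with $A$ ranging over symmetric matrices whose eigenvalues lie in $[\gamma,\Gamma]$. The nonlinearity $F:\mathbb{S}^n\times\mathbb{R}^n\times\mathbb{R}\times\Omega\to\mathbb{R}$ satisfies: (F1) for each $K>0$ there are an increasing continuous $\omega_K:[0,\infty)\to[0,\infty)$ with $\omega_K(0)=0$ and $\nu\in(1/2,1]$ such that $|F(M,p,z,x)-F(M,p,z,y)|\le\omega_K(|x-y|^\nu(|M|+1))$ whenever $|p|,|z|\le K$; (F2) there are constants $\delta_1,\delta_0\ge0$, $0<\gamma\le\Gamma$ with $\mathcal{P}^-_{\gamma,\Gamma}(M-N)-\delta_1|p-q|-\delta_0|z-w|\le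 F(M,p,z,x)-F(N,q,w,x)\le\mathcal{P}^+_{\gamma,\Gamma}(M-N)+\delta_1|p-q|+\delta_0|z-w|$ for all arguments; (F3) $F(tM,tp,tz,x)=tF(M,p,z,x)$ for all $t\ge0$. Viscosity sense: for $f\in C(\Omega)$, $u\in C(\Omega)$ satisfies $F(D^2u,Du,u,x)\le f$ ($\ge f$) if whenever $\varphi\in C^2(\Omega)$ and $u-\varphi$ has a local maximum (minimum) at $x_0$, then $F(D^2\varphi(x_0),D\varphi(x_0),u(x_0),x_0)\le f(x_0)$ (resp. $\ge$). *)

theory Defs
  imports "HOL-Analysis.Analysis"
begin

definition symmetric_mat :: "real^'n^'n \<Rightarrow> bool" where
  "symmetric_mat M \<longleftrightarrow> transpose M = M"

definition pucci_set :: "real \<Rightarrow> real \<Rightarrow> (real^'n^'n) set" where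
  "pucci_set \<gamma> \<Gamma> = {A. symmetric_mat A \<and>
      (\<forall>(c::real) x. x \<noteq> 0 \<and> A *v x = c *\<^sub>R x \<longrightarrow> \<gamma> \<le> c \<and> c \<le> \<Gamma>)}"

definition pucci_plus :: "real \<Rightarrow> real \<Rightarrow> real^'n^'n \<Rightarrow> real" where
  "pucci_plus \<gamma> \<Gamma> M = (SUP A\<in>pucci_set \<gamma> \<Gamma>. - trace (A ** M))"

definition pucci_minus :: "real \<Rightarrow> real \<Rightarrow> real^'n^'n \<Rightarrow> real" where
  "pucci_minus \<gamma> \<Gamma> M = (INF A\<in>pucci_set \<gamma> \<Gamma>. - trace (A ** M))"

text \<open>C-infinity on an open set S: there is a family of functions containing g,
  all continuous on S, and closed under taking partial derivatives on S.
  (Equivalently: all partial derivatives of all orders exist and are continuous on S.)\<close>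
definition smooth_on :: "(real^'n \<Rightarrow> real) \<Rightarrow> (real^'n) set \<Rightarrow> bool" where
  "smooth_on g S \<longleftrightarrow> (\<exists>\<F>. g \<in> \<F> \<and> (\<forall>h\<in>\<F>. continuous_on S h \<and>
      (\<forall>i. \<exists>h'\<in>\<F>. \<forall>x\<in>S. ((\<lambda>t. h (x + t *\<^sub>R axis i 1)) has_real_derivative h' x) (at 0))))"

definition smooth_domain :: "(real^'n) set \<Rightarrow> bool" where
  "smooth_domain \<Omega> \<longleftrightarrow> open \<Omega> \<and>
     (\<forall>x0\<in>frontier \<Omega>. \<exists>r>0. \<exists>\<rho>. smooth_on \<rho> (ball x0 r) \<and>
        (\<exists>i d. d \<noteq> 0 \<and> ((\<lambda>t. \<rho> (x0 + t *\<^sub>R axis i 1)) has_real_derivative d) (at 0)) \<and>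
        \<Omega> \<inter> ball x0 r = {x\<in>ball x0 r. \<rho> x < 0})"

definition C2_with :: "(real^'n \<Rightarrow> real) \<Rightarrow> (real^'n \<Rightarrow> real^'n) \<Rightarrow> (real^'n \<Rightarrow> real^'n^'n)
    \<Rightarrow> (real^'n) set \<Rightarrow> bool" where
  "C2_with \<phi> D\<phi> D2\<phi> S \<longleftrightarrow>
     (\<forall>x\<in>S. (\<phi> has_derivative (\<lambda>h. D\<phi> x \<bullet> h)) (at x) \<and>
            (D\<phi> has_derivative (\<lambda>h. D2\<phi> x *v h)) (at x)) \<and> continuous_on S D2\<phi>"

definition visc_sub ::
  "(real^'n^'n \<Rightarrow> real^'n \<Rightarrow> real \<Rightarrow> real^'n \<Rightarrow> real) \<Rightarrow> (real^'n \<Rightarrow> real) \<Rightarrow>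
   (real^'n \<Rightarrow> real) \<Rightarrow> (real^'n) set \<Rightarrow> bool" where
  "visc_sub F f u \<Omega> \<longleftrightarrow> (\<forall>\<phi> D\<phi> D2\<phi> x0. C2_with \<phi> D\<phi> D2\<phi> \<Omega> \<and> x0 \<in> \<Omega> \<and>
      (\<exists>e>0. \<forall>y\<in>ball x0 e \<inter> \<Omega>. u y - \<phi> y \<le> u x0 - \<phi> x0) \<longrightarrow>
      F (D2\<phi> x0) (D\<phi> x0) (u x0) x0 \<le> f x0)"

definition visc_super ::
  "(real^'n^'n \<Rightarrow> real^'n \<Rightarrow> real \<Rightarrow> real^'n \<Rightarrow> real) \<Rightarrow> (real^'n \<Rightarrow> real) \<Rightarrow>
   (real^'n \<Rightarrow> real) \<Rightarrow> (real^'n) set \<Rightarrow> bool" where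
  "visc_super F f u \<Omega> \<longleftrightarrow> (\<forall>\<phi> D\<phi> D2\<phi> x0. C2_with \<phi> D\<phi> D2\<phi> \<Omega> \<and> x0 \<in> \<Omega> \<and>
      (\<exists>e>0. \<forall>y\<in>ball x0 e \<inter> \<Omega>. u y - \<phi> y \<ge> u x0 - \<phi> x0) \<longrightarrow>
      F (D2\<phi> x0) (D\<phi> x0) (u x0) x0 \<ge> f x0)"

end

theory Submission
  imports Defs "HOL-Analysis.Analysis"
begin

text \<open>
  If \<open>F(D\<^sup>2u, Du, u, x) \<le> f\<close> and \<open>F(D\<^sup>2v, Dv, v, x) \<ge> g\<close> with \<open>f \<le> g\<close>, then \<open>w = u - v\<close> is a viscosity
  subsolution of the extremal inequality \<open>P\<^sup>-(D\<^sup>2w) - \<delta>\<^sub>1 |Dw| - \<delta>\<^sub>0 |w| \<le> 0\<close>. This is seen by doubling the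
  variables and applying the theorem on sums. Since \<open>\<nu>\<close> is only assumed to exceed \<open>1/2\<close>, one first
  shows, following Ishii and Lions with a concave function of \<open>|x - y|\<close> as penalty, that
  \<open>|x - y|\<close> is of order \<open>1/\<alpha>\<close> and not just \<open>1/sqrt \<alpha>\<close> at the maximum of the doubled function.

  The extremal inequality gives a strong maximum principle for \<open>w\<close> by Hopf's barrier, and the
  exterior balls of a smooth domain give barriers showing that \<open>u \<le> v\<close> holds on \<open>\<Omega>\<close> as soon as it holds on
  \<open>\<partial>\<Omega>\<close> and on a compact \<open>K \<subseteq> \<Omega>\<close> that does not depend on \<open>u\<close> and \<open>v\<close>. If \<open>v > 0\<close> and \<open>f \<ge> 0\<close>, then
  \<open>t v\<close> with \<open>t \<ge> 1\<close> is a supersolution for \<open>t f \<ge> f\<close>. Taking for \<open>t\<close> the maximum of \<open>u/v\<close> on \<open>K\<close> one gets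
  \<open>u \<le> t v\<close> with equality at a point of \<open>K\<close>, hence everywhere. The case \<open>u < 0\<close> reduces to this one by
  passing to \<open>- F(-M, -p, -z, x)\<close>.
\<close>

section \<open>Rademacher's theorem\<close>

text \<open>At a maximum of the doubled function with penalty |x - y|^2 / (2 \<epsilon>) the matrix
  Y may have size 1/\<epsilon>. Even with |x - y| of order \<epsilon>, the space error |x - y|^\<nu>
  |Y| is then only known to be of order \<epsilon>^(\<nu> - 1), which blows up for \<nu> < 1. The
  way out is that Y is large only if trace (Y - X) is: the form inequality is tested on the almost
  equal vectors \<xi> and (1 +- t) \<xi>, with t of order \<epsilon>^\<nu>. Ellipticity pays for
  that trace, and the remainder is of order \<epsilon>^(2 \<nu> - 1). In the Lipschitz step the
  space error, measured against the concavity L / sqrt d of the penalty, leaves d^(\<nu> - 1/2).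
  Both remainders vanish because \<nu> > 1/2. The zero-order term has no sign, so comparison can
  fail on \<Omega> as a whole, as eigenfunctions show. It does hold in a thin layer at the boundary,
  where barriers outweigh the term with \<open>\<delta>\<^sub>0\<close>; K is the complement of the
  layer.\<close>

lemma bilipschitz_real_eq_integral:
  fixes G :: "real \<Rightarrow> real"
  assumes low: "\<And>x y. x \<le> y \<Longrightarrow> y - x \<le> G y - G x"
    and upp: "\<And>x y. x \<le> y \<Longrightarrow> G y - G x \<le> C * (y - x)"
  obtains h where "\<And>a b. a \<le> b \<Longrightarrow> (h has_integral (G b - G a)) {a..b}"
proof -
  have mono: "G x \<le> G y" if "x \<le> y" for x y using low[OF that] that by linarith
  have smono: "G x < G y" if "x < y" for x y using low[of x y] that by linarith
  have inj: "inj G" using smono by (metis injI linorder_cases less_irrefl)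
  have absupp: "\<bar>G y - G x\<bar> \<le> \<bar>C\<bar> * \<bar>y - x\<bar>" for x y
  proof (cases "x \<le> y")
    case True
    have "C * (y - x) \<le> \<bar>C\<bar> * \<bar>y - x\<bar>" using True by (simp add: mult_right_mono)
    with True show ?thesis using upp[of x y] mono[of x y] by linarith
  next
    case False
    have "C * (x - y) \<le> \<bar>C\<bar> * \<bar>y - x\<bar>" using False by (simp add: mult_right_mono)
    with False show ?thesis using upp[of y x] mono[of y x] by linarith
  qed
  have contG: "continuous_on UNIV G"
  proof (rule continuous_onI)
    fix x e :: real assume "e > 0"
    show "\<exists>d>0. \<forall>x'\<in>UNIV. dist x' x < d \<longrightarrow> dist (G x') (G x) \<le> e"
    proof (intro exI[of _ "e / (\<bar>C\<bar>+1)"] conjI ballI impI)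
      show "e / (\<bar>C\<bar>+1) > 0" using \<open>e > 0\<close> by (simp add: add_nonneg_pos)
      fix x' assume "dist x' x < e / (\<bar>C\<bar>+1)"
      then have "(\<bar>C\<bar>+1) * \<bar>x' - x\<bar> < e"
        by (simp add: dist_real_def field_simps add_nonneg_pos)
      moreover have "\<bar>C\<bar> * \<bar>x'-x\<bar> \<le> (\<bar>C\<bar>+1) * \<bar>x' - x\<bar>" by (simp add: mult_right_mono)
      ultimately show "dist (G x') (G x) \<le> e" using absupp[of x' x] by (simp add: dist_real_def)
    qed
  qed
  have surj: "surj G"
  proof -
    have "\<exists>x. G x = y" for y
    proof -
      define r where "r = \<bar>y - G 0\<bar>"
      have "G (-r) \<le> y" "y \<le> G r" using low[of "-r" 0] low[of 0 r] by (auto simp: r_def)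
      moreover have "-r \<le> r" by (simp add: r_def)
      ultimately show ?thesis
        using IVT'[of G "-r" y r] contG continuous_on_subset by blast
    qed
    then show ?thesis by (metis surjI)
  qed
  define I where "I = inv G"
  have GI: "G (I y) = y" for y using surj by (simp add: I_def surj_f_inv_f)
  have IG: "I (G x) = x" for x using inj by (simp add: I_def)
  have Ilip: "\<bar>I y - I x\<bar> \<le> \<bar>y - x\<bar>" for x y
    using low[of "I x" "I y"] low[of "I y" "I x"] by (simp add: GI) linarith
  have contI: "continuous_on UNIV I"
    by (rule continuous_onI) (metis Ilip dist_real_def dual_order.trans less_imp_le)
  have mI[measurable]: "I \<in> borel_measurable borel"
    by (rule borel_measurable_continuous_onI[OF contI])
  have vim: "I -` A = G ` A" for A
    using GI IG by (auto simp: image_iff) metis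
  \<comment> \<open>The measure \<mu> A = |G(A)|, written as a distribution under the 1-Lipschitz
    inverse \<open>I\<close>. Its Radon-Nikodym density is the integrand sought; \<mu> is absolutely
    continuous because the Lipschitz function \<open>G\<close> maps null sets to null sets.\<close>
  define \<mu> where "\<mu> = distr lborel borel I"
  have mu: "emeasure \<mu> A = emeasure lborel (G ` A)" if "A \<in> sets borel" for A
    using that by (simp add: \<mu>_def emeasure_distr vim)
  have ac: "absolutely_continuous lborel \<mu>"
    unfolding absolutely_continuous_def
  proof
    fix A assume A: "A \<in> null_sets (lborel :: real measure)"
    then have Ab: "A \<in> sets borel" by auto
    have "negligible A" using A by (simp add: negligible_iff_null_sets null_sets_completionI)
    then have "negligible (G ` A)"
      by (intro negligible_locally_Lipschitz_image)
         (auto intro!: exI[of _ UNIV] exI[of _ "\<bar>C\<bar>"] simp: absupp)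
    moreover have "G ` A \<in> sets borel" using Ab measurable_sets[OF mI Ab] by (simp add: vim)
    ultimately have "emeasure lborel (G ` A) = 0"
      by (simp add: negligible_iff_null_sets null_sets_completion_iff null_setsD1)
    then show "A \<in> null_sets \<mu>" using mu[OF Ab] Ab by (auto simp: \<mu>_def intro!: null_setsI)
  qed
  have "sets \<mu> = sets lborel" by (simp add: \<mu>_def)
  from sigma_finite_measure.Radon_Nikodym[OF sigma_finite_lborel ac this] obtain f
    where f[measurable]: "f \<in> borel_measurable lborel" and dens: "density lborel f = \<mu>" by blast
  have Gint: "G ` {a..b} = {G a..G b}" if "a \<le> b" for a b
  proof
    show "G ` {a..b} \<subseteq> {G a..G b}" using mono by auto
    show "{G a..G b} \<subseteq> G ` {a..b}"
    proof
      fix y assume "y \<in> {G a..G b}"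
      then have "a \<le> I y \<and> I y \<le> b" using smono GI by (metis atLeastAtMost_iff not_le)
      then show "y \<in> G ` {a..b}" using GI by (metis atLeastAtMost_iff imageI)
    qed
  qed
  have nn: "(\<integral>\<^sup>+x. f x * indicator {a..b} x \<partial>lborel) = ennreal (G b - G a)" if "a \<le> b" for a b
  proof -
    have "(\<integral>\<^sup>+x. f x * indicator {a..b} x \<partial>lborel) = emeasure (density lborel f) {a..b}"
      by (simp add: emeasure_density)
    also have "\<dots> = emeasure lborel {G a..G b}" using mu[of "{a..b}"] by (simp add: dens Gint that)
    finally show ?thesis using mono[OF that] by simp
  qed
  define h where "h = (\<lambda>x. enn2real (f x))"
  have "(h has_integral (G b - G a)) {a..b}" if ab: "a \<le> b" for a b
  proof -
    have "AE x in lborel. f x * indicator {a..b} x \<noteq> \<infinity>"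
      by (rule nn_integral_PInf_AE) (auto simp: nn[OF ab])
    then have "AE x in lborel. ennreal (h x * indicator {a..b} x) = f x * indicator {a..b} x"
      by eventually_elim (auto simp: h_def indicator_def ennreal_enn2real top.not_eq_extremum)
    then have "(\<integral>\<^sup>+x. ennreal (h x * indicator {a..b} x) \<partial>lborel) = ennreal (G b - G a)"
      using nn[OF ab] by (simp cong: nn_integral_cong_AE)
    then have "((\<lambda>x. h x * indicator {a..b} x) has_integral (G b - G a)) UNIV"
      using mono[OF ab] by (intro nn_integral_has_integral) (auto simp: h_def)
    moreover have "(\<lambda>x. h x * indicator {a..b} x) = (\<lambda>x. if x \<in> {a..b} then h x else 0)"
      by (auto simp: indicator_def)
    ultimately show ?thesis by (simp only: has_integral_restrict_UNIV)
  qed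
  then show ?thesis by (rule that)
qed

lemma lipschitz_real_ae_differentiable:
  fixes g :: "real \<Rightarrow> real"
  assumes lip: "\<And>x y. \<bar>g x - g y\<bar> \<le> L * \<bar>x - y\<bar>"
  obtains N where "negligible N" "\<And>x. x \<notin> N \<Longrightarrow> \<exists>D. (g has_real_derivative D) (at x)"
proof -
  \<comment> \<open>Adding (L + 1) x brings all slopes into [1, 2 L + 1]; the lower bound 1 is what
    makes the inverse Lipschitz in the preceding lemma.\<close>
  define C where "C = L + 1"
  define G where "G = (\<lambda>x. C * x + g x)"
  have "y - x \<le> G y - G x" "G y - G x \<le> (2*L+1) * (y - x)" if "x \<le> y" for x y
    using lip[of y x] that by (auto simp: G_def C_def algebra_simps)
  then obtain h where h: "\<And>a b. a \<le> b \<Longrightarrow> (h has_integral (G b - G a)) {a..b}"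
    using bilipschitz_real_eq_integral[of G "2*L+1"] by blast
  \<comment> \<open>The differentiation theorem applied below concerns averages over [x, x + t] with
    t > 0, so left difference quotients are treated as right ones of the reflected
    integrand.\<close>
  have h': "((\<lambda>x. h (-x)) has_integral (G (-a) - G (-b))) {a..b}" if "a \<le> b" for a b
    using h[of "-b" "-a"] that by (simp add: has_integral_reflect_real[of h _ "-a" "-b", simplified])
  have i1: "h integrable_on cbox a b" and i2: "(\<lambda>x. h (-x)) integrable_on cbox a b" for a b
    using h[of a b] h'[of a b] by (cases "a \<le> b"; force simp: integrable_on_def)+
  obtain N1 where N1: "negligible N1" "\<And>x e. \<lbrakk>x \<notin> N1; 0 < e\<rbrakk> \<Longrightarrow>
       \<exists>d>0. \<forall>t. 0 < t \<and> t < d \<longrightarrow> norm (integral (cbox x (x + t *\<^sub>R One)) h /\<^sub>R t ^ DIM(real) - h x) < e"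
    using integrable_ccontinuous_explicit[of h] i1 by metis
  obtain N2 where N2: "negligible N2" "\<And>x e. \<lbrakk>x \<notin> N2; 0 < e\<rbrakk> \<Longrightarrow>
       \<exists>d>0. \<forall>t. 0 < t \<and> t < d \<longrightarrow> norm (integral (cbox x (x + t *\<^sub>R One)) (\<lambda>x. h (-x)) /\<^sub>R t ^ DIM(real) - h (-x)) < e"
    using integrable_ccontinuous_explicit[of "\<lambda>x. h (-x)"] i2 by metis
  have "negligible (N1 \<union> uminus ` N2)"
    using N1(1) N2(1) by (intro negligible_Un negligible_differentiable_image_negligible) (auto intro!: derivative_intros simp: differentiable_on_def)
  moreover have "\<exists>D. (g has_real_derivative D) (at x)" if x: "x \<notin> N1 \<union> uminus ` N2" for x
  proof -
    have xN: "x \<notin> N1" "-x \<notin> N2" using x by (auto simp: image_iff)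
    have "((\<lambda>t. (G (x + t) - G x) / t) \<longlongrightarrow> h x) (at 0)"
    proof (rule LIM_I)
      fix e :: real assume "e > 0"
      obtain d1 where d1: "d1 > 0" "\<And>t. 0 < t \<Longrightarrow> t < d1 \<Longrightarrow> norm (integral (cbox x (x + t *\<^sub>R One)) h /\<^sub>R t ^ DIM(real) - h x) < e"
        using N1(2)[OF xN(1) \<open>e > 0\<close>] by blast
      obtain d2 where d2: "d2 > 0" "\<And>t. 0 < t \<Longrightarrow> t < d2 \<Longrightarrow> norm (integral (cbox (-x) (-x + t *\<^sub>R One)) (\<lambda>x. h (-x)) /\<^sub>R t ^ DIM(real) - h (- (- x))) < e"
        using N2(2)[OF xN(2) \<open>e > 0\<close>] by blast
      have "norm ((G (x + t) - G x) / t - h x) < e" if t: "t \<noteq> 0" "norm t < min d1 d2" for t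
      proof (cases "t > 0")
        case True
        have "integral {x..x+t} h = G (x+t) - G x" using h[of x "x+t"] True by (auto intro: integral_unique)
        then show ?thesis using d1(2)[of t] True t by (simp add: divide_inverse mult.commute)
      next
        case False
        have "((\<lambda>x. h (-x)) has_integral (G x - G (x+t))) (cbox (-x) (-x + (-t) *\<^sub>R One))"
          using h'[of "-x" "-x + (-t) *\<^sub>R One"] False by (simp add: add.commute)
        then have "integral (cbox (-x) (-x + (-t) *\<^sub>R One)) (\<lambda>x. h (-x)) = G x - G (x+t)"
          by (rule integral_unique)
        then have "norm ((G x - G (x+t)) /\<^sub>R (-t) ^ DIM(real) - h (-(-x))) < e"
          using d2(2)[of "-t"] False t by (simp only:) auto
        moreover have "(G x - G (x+t)) /\<^sub>R (-t) ^ DIM(real) - h (-(-x)) = (G (x + t) - G x) / t - h x"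
          using t by (simp add: field_simps)
        ultimately show ?thesis by simp
      qed
      then show "\<exists>s>0. \<forall>t. t \<noteq> 0 \<and> norm (t - 0) < s \<longrightarrow> norm ((G (x + t) - G x) / t - h x) < e"
        using d1(1) d2(1) by (intro exI[of _ "min d1 d2"]) auto
    qed
    then have "(G has_real_derivative h x) (at x)" by (simp add: DERIV_def)
    then have "((\<lambda>x. G x - C * x) has_real_derivative (h x - C)) (at x)"
      by (auto intro!: derivative_eq_intros)
    then show ?thesis by (auto simp: G_def)
  qed
  ultimately show ?thesis by (rule that)
qed

lemma continuous_on_of_norm_bound:
  fixes f :: "'a::real_normed_vector \<Rightarrow> real"
  assumes lip: "\<And>x y. \<bar>f x - f y\<bar> \<le> L * norm (x - y)"
  shows "continuous_on S f"
proof -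
  have "\<bar>f x - f y\<bar> \<le> \<bar>L\<bar> * norm (x - y)" for x y
    using lip[of x y] mult_right_mono[OF abs_ge_self[of L] norm_ge_zero[of "x - y"]] by linarith
  then have "\<bar>L\<bar>-lipschitz_on S f" by (auto intro!: lipschitz_onI simp: dist_norm)
  then show ?thesis by (rule lipschitz_on_continuous_on)
qed

text \<open>The set where the difference quotients fail to converge is Borel, and by the
  one-dimensional theorem it meets every line parallel to \<open>e\<close> in a null set; Fubini
  does the rest.\<close>

lemma lipschitz_ae_directional_derivative:
  fixes f :: "'a::euclidean_space \<Rightarrow> real"
  assumes lip: "\<And>x y. \<bar>f x - f y\<bar> \<le> L * norm (x - y)"
  obtains N where "N \<in> null_sets lborel"
    "\<And>x. x \<notin> N \<Longrightarrow> \<exists>D. ((\<lambda>t. (f (x + t *\<^sub>R e) - f x) / t) \<longlongrightarrow> D) (at 0)"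
proof -
  define q where "q = (\<lambda>t x. (f (x + t *\<^sub>R e) - f x) / t)"
  have contf: "continuous_on UNIV f" by (rule continuous_on_of_norm_bound[OF lip])
  have contq: "continuous_on UNIV (q t)" for t
    unfolding q_def divide_inverse by (intro continuous_intros continuous_on_compose2[OF contf]) auto
  \<comment> \<open>Convergence is expressed by the Cauchy property, with s and t ranging over all
    small reals. The uncountable intersections over s and t are intersections of closed sets, hence
    closed, and only countable operations remain.\<close>
  define S where "S = (\<lambda>n. {s::real. s \<noteq> 0 \<and> \<bar>s\<bar> < 1 / real (Suc n)})"
  define Good where "Good = (\<Inter>k. \<Union>n. \<Inter>s\<in>S n. \<Inter>t\<in>S n. {x. \<bar>q s x - q t x\<bar> \<le> 1 / real (Suc k)})"
  define Bad where "Bad = - Good"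
  have Bad_iff: "x \<notin> Bad \<longleftrightarrow> (\<forall>k. \<exists>n. \<forall>s\<in>S n. \<forall>t\<in>S n. \<bar>q s x - q t x\<bar> \<le> 1 / real (Suc k))" for x
    unfolding Bad_def Good_def by simp
  have "closed {x. \<bar>q s x - q t x\<bar> \<le> c}" for s t c
    by (intro closed_Collect_le continuous_intros contq)
  then have Bad[measurable]: "Bad \<in> sets borel"
    unfolding Bad_def Good_def by (intro borel_comp sets.countable_INT'' sets.countable_UN'' closed_INT borel_closed ballI) auto
  have lim: "\<exists>D. ((\<lambda>t. q t x) \<longlongrightarrow> D) (at 0)" if x: "x \<notin> Bad" for x
  proof -
    have *: "\<exists>d>0. \<forall>s t. s \<noteq> 0 \<and> t \<noteq> 0 \<and> \<bar>s\<bar> < d \<and> \<bar>t\<bar> < d \<longrightarrow> \<bar>q s x - q t x\<bar> < \<epsilon>" if "\<epsilon> > 0" for \<epsilon>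
    proof -
      obtain k where k: "1 / real (Suc k) < \<epsilon>" using \<open>\<epsilon> > 0\<close> nat_approx_posE by blast
      obtain n where n: "\<And>s t. s \<in> S n \<Longrightarrow> t \<in> S n \<Longrightarrow> \<bar>q s x - q t x\<bar> \<le> 1 / real (Suc k)"
        using x Bad_iff by blast
      show ?thesis
      proof (intro exI[of _ "1 / real (Suc n)"] conjI allI impI)
        fix s t assume "s \<noteq> 0 \<and> t \<noteq> 0 \<and> \<bar>s\<bar> < 1 / real (Suc n) \<and> \<bar>t\<bar> < 1 / real (Suc n)"
        then show "\<bar>q s x - q t x\<bar> < \<epsilon>" using n[of s t] k unfolding S_def by auto
      qed simp
    qed
    have "Cauchy (\<lambda>n. q (1 / real (Suc n)) x)"
    proof (rule metric_CauchyI)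
      fix \<epsilon> :: real assume "\<epsilon> > 0"
      then obtain d where d: "d > 0" "\<And>s t. s \<noteq> 0 \<Longrightarrow> t \<noteq> 0 \<Longrightarrow> \<bar>s\<bar> < d \<Longrightarrow> \<bar>t\<bar> < d \<Longrightarrow> \<bar>q s x - q t x\<bar> < \<epsilon>"
        using * by metis
      obtain M where M: "1 / real (Suc M) < d" using d(1) nat_approx_posE by blast
      have "1 / real (Suc m) < d" if "m \<ge> M" for m
        using M that by (smt (verit) frac_le of_nat_0_less_iff of_nat_mono Suc_le_mono zero_less_Suc)
      then show "\<exists>M. \<forall>m\<ge>M. \<forall>n\<ge>M. dist (q (1 / real (Suc m)) x) (q (1 / real (Suc n)) x) < \<epsilon>"
        by (intro exI[of _ M]) (auto simp: dist_real_def intro!: d(2))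
    qed
    then obtain D where D: "(\<lambda>n. q (1 / real (Suc n)) x) \<longlonglongrightarrow> D"
      using Cauchy_convergent_iff convergent_def by blast
    have "((\<lambda>t. q t x) \<longlongrightarrow> D) (at 0)"
    proof (rule LIM_I)
      fix \<epsilon> :: real assume "\<epsilon> > 0"
      then obtain d where d: "d > 0" "\<And>s t. s \<noteq> 0 \<Longrightarrow> t \<noteq> 0 \<Longrightarrow> \<bar>s\<bar> < d \<Longrightarrow> \<bar>t\<bar> < d \<Longrightarrow> \<bar>q s x - q t x\<bar> < \<epsilon>/2"
        using *[of "\<epsilon>/2"] by (auto simp: field_simps)
      have "\<bar>q t x - D\<bar> \<le> \<epsilon>/2" if t: "t \<noteq> 0" "\<bar>t\<bar> < d" for t
      proof (rule LIMSEQ_le_const2)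
        show "(\<lambda>n. \<bar>q t x - q (1 / real (Suc n)) x\<bar>) \<longlonglongrightarrow> \<bar>q t x - D\<bar>" by (intro tendsto_intros D)
        obtain M where M: "1 / real (Suc M) < d" using d(1) nat_approx_posE by blast
        have small: "1 / real (Suc m) < d" if "m \<ge> M" for m
          using M that by (smt (verit) frac_le of_nat_0_less_iff of_nat_mono Suc_le_mono zero_less_Suc)
        have "\<bar>q t x - q (1 / real (Suc n)) x\<bar> \<le> \<epsilon> / 2" if "n \<ge> M" for n
          using d(2)[of t "1 / real (Suc n)"] t small[OF that] by (auto simp del: of_nat_Suc)
        then show "\<exists>N. \<forall>n\<ge>N. \<bar>q t x - q (1 / real (Suc n)) x\<bar> \<le> \<epsilon> / 2" by blast
      qed
      then show "\<exists>s>0. \<forall>t. t \<noteq> 0 \<and> norm (t - 0) < s \<longrightarrow> norm (q t x - D) < \<epsilon>"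
        using d(1) \<open>\<epsilon> > 0\<close> by (intro exI[of _ d]) (auto, smt (verit) field_sum_of_halves)
    qed
    then show ?thesis by blast
  qed
  have good: "x \<notin> Bad" if D: "((\<lambda>t. q t x) \<longlongrightarrow> D) (at 0)" for x D
  proof -
    have "\<exists>n. \<forall>s\<in>S n. \<forall>t\<in>S n. \<bar>q s x - q t x\<bar> \<le> 1 / real (Suc k)" for k
    proof -
      define c where "c = 1 / real (Suc k)"
      have "c > 0" by (simp add: c_def)
      then obtain d where d: "d > 0" "\<And>t. t \<noteq> 0 \<Longrightarrow> \<bar>t\<bar> < d \<Longrightarrow> \<bar>q t x - D\<bar> < c / 2"
        using LIM_D[OF D, of "c / 2"] by auto
      obtain n where n: "1 / real (Suc n) < d" using d(1) nat_approx_posE by blast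
      have "\<bar>q s x - q t x\<bar> \<le> c" if "s \<in> S n" "t \<in> S n" for s t
      proof -
        have "\<bar>q s x - D\<bar> < c / 2" "\<bar>q t x - D\<bar> < c / 2"
          using d(2)[of s] d(2)[of t] that n unfolding S_def by (auto simp del: of_nat_Suc)
        then show ?thesis by linarith
      qed
      then show ?thesis unfolding c_def by blast
    qed
    then show ?thesis using Bad_iff by blast
  qed
  have line: "emeasure lborel {t::real. x + t *\<^sub>R e \<in> Bad} = 0" for x
  proof -
    have "\<bar>f (x + s *\<^sub>R e) - f (x + t *\<^sub>R e)\<bar> \<le> (L * norm e) * \<bar>s - t\<bar>" for s t
      using lip[of "x + s *\<^sub>R e" "x + t *\<^sub>R e"] by (simp add: scaleR_diff_left[symmetric] mult_ac)
    from lipschitz_real_ae_differentiable[OF this] obtain N where N: "negligible N"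
      "\<And>t. t \<notin> N \<Longrightarrow> \<exists>D. ((\<lambda>t. f (x + t *\<^sub>R e)) has_real_derivative D) (at t)" by metis
    have "x + t *\<^sub>R e \<notin> Bad" if "t \<notin> N" for t
    proof -
      obtain D where "((\<lambda>t. f (x + t *\<^sub>R e)) has_real_derivative D) (at t)" using N(2)[OF \<open>t \<notin> N\<close>] by blast
      then have "((\<lambda>s. q s (x + t *\<^sub>R e)) \<longlongrightarrow> D) (at 0)"
        by (simp add: DERIV_def q_def algebra_simps)
      then show ?thesis by (rule good)
    qed
    then have "negligible {t. x + t *\<^sub>R e \<in> Bad}" by (intro negligible_subset[OF N(1)]) blast
    moreover have "{t. x + t *\<^sub>R e \<in> Bad} \<in> sets lborel" by measurable
    ultimately show ?thesis
      by (simp add: negligible_iff_null_sets null_sets_completion_iff null_setsD1)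
  qed
  \<comment> \<open>Averaging over the translates of \<open>Bad\<close> by multiples t e with t in
    [0, 1], instead of slicing along coordinates, handles an arbitrary direction
    \<open>e\<close>.\<close>
  have "emeasure lborel Bad = (\<integral>\<^sup>+x. indicator Bad (t *\<^sub>R e + x) \<partial>lborel)" for t
  proof -
    have "emeasure lborel Bad = (\<integral>\<^sup>+x. indicator Bad x \<partial>distr lborel borel ((+) (t *\<^sub>R e)))"
      by (simp add: lborel_distr_plus)
    then show ?thesis by (subst (asm) nn_integral_distr) auto
  qed
  then have "emeasure lborel Bad = (\<integral>\<^sup>+t. (\<integral>\<^sup>+x. indicator {0..1::real} t * indicator Bad (t *\<^sub>R e + x) \<partial>lborel) \<partial>lborel)"
    by (simp add: nn_integral_cmult nn_integral_multc)
  also have "\<dots> = (\<integral>\<^sup>+x. (\<integral>\<^sup>+t. indicator {0..1::real} t * indicator Bad (t *\<^sub>R e + x) \<partial>lborel) \<partial>lborel)"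
    by (rule lborel_pair.Fubini') measurable
  also have "\<dots> = (\<integral>\<^sup>+x. 0 \<partial>(lborel :: 'a measure))"
  proof (rule nn_integral_cong)
    fix x :: 'a
    have "(\<integral>\<^sup>+t. indicator {0..1::real} t * indicator Bad (t *\<^sub>R e + x) \<partial>lborel) \<le> (\<integral>\<^sup>+t. indicator {t::real. x + t *\<^sub>R e \<in> Bad} t \<partial>lborel)"
      by (rule nn_integral_mono) (auto simp: indicator_def add.commute)
    also have "\<dots> = emeasure lborel {t::real. x + t *\<^sub>R e \<in> Bad}" by (rule nn_integral_indicator) measurable
    finally show "(\<integral>\<^sup>+t. indicator {0..1::real} t * indicator Bad (t *\<^sub>R e + x) \<partial>lborel) = 0" using line by simp
  qed
  finally have "Bad \<in> null_sets lborel" using Bad by (auto intro!: null_setsI)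
  then show ?thesis using lim by (intro that[of Bad]) (auto simp: q_def)
qed

text \<open>\<open>E n\<close> is a mixed second difference divided by the step; it tends to D3 - D2
  - D1. Its integral over a box becomes, after a translation, that of a bounded function against the
  difference of the indicators of two boxes that approach each other, and so tends to 0. A limit
  whose integral over every box is 0 vanishes almost everywhere.\<close>

lemma lipschitz_ae_directional_derivative_additive:
  fixes f :: "'a::euclidean_space \<Rightarrow> real"
  assumes lip: "\<And>x y. \<bar>f x - f y\<bar> \<le> L * norm (x - y)"
  obtains N where "negligible N"
    "\<And>x D1 D2 D3. \<lbrakk>x \<notin> N;
        ((\<lambda>t. (f (x + t *\<^sub>R e1) - f x) / t) \<longlongrightarrow> D1) (at 0);
        ((\<lambda>t. (f (x + t *\<^sub>R e2) - f x) / t) \<longlongrightarrow> D2) (at 0);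
        ((\<lambda>t. (f (x + t *\<^sub>R (e1 + e2)) - f x) / t) \<longlongrightarrow> D3) (at 0)\<rbrakk> \<Longrightarrow> D3 = D1 + D2"
proof -
  define S where "S = (\<lambda>n x. (f (x + (1 / real (Suc n)) *\<^sub>R e1) - f x) * real (Suc n))"
  define v where "v = (\<lambda>n. (1 / real (Suc n)) *\<^sub>R e2)"
  define E where "E = (\<lambda>n x. S n (x + v n) - S n x)"
  define l where "l = (\<lambda>x. lim (\<lambda>n. E n x))"
  define C where "C = L * norm e1"
  have contf: "continuous_on A f" for A by (rule continuous_on_of_norm_bound[OF lip])
  have "continuous_on UNIV (S n)" for n
    unfolding S_def by (intro continuous_intros continuous_on_compose2[OF contf[of UNIV]]) auto
  then have mS[measurable]: "S n \<in> borel_measurable borel" for n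
    by (rule borel_measurable_continuous_onI)
  have mE[measurable]: "E n \<in> borel_measurable borel" for n unfolding E_def by measurable
  have ml[measurable]: "l \<in> borel_measurable borel" unfolding l_def by measurable
  have Sb: "\<bar>S n x\<bar> \<le> C" for n x
  proof -
    have "\<bar>f (x + (1 / real (Suc n)) *\<^sub>R e1) - f x\<bar> \<le> C / real (Suc n)"
      using lip[of "x + (1 / real (Suc n)) *\<^sub>R e1" x] by (simp add: C_def)
    then show ?thesis by (simp add: S_def abs_mult pos_le_divide_eq del: of_nat_Suc)
  qed
  have Eb: "\<bar>E n x\<bar> \<le> 2 * C" for n x
    using Sb[of n x] Sb[of n "x + v n"] by (simp add: E_def)
  have Elim: "(\<lambda>n. E n x) \<longlonglongrightarrow> D3 - D2 - D1" if
        "((\<lambda>t. (f (x + t *\<^sub>R e1) - f x) / t) \<longlongrightarrow> D1) (at 0)"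
        "((\<lambda>t. (f (x + t *\<^sub>R e2) - f x) / t) \<longlongrightarrow> D2) (at 0)"
        "((\<lambda>t. (f (x + t *\<^sub>R (e1 + e2)) - f x) / t) \<longlongrightarrow> D3) (at 0)" for x D1 D2 D3
  proof -
    have "filterlim (\<lambda>n. 1 / real (Suc n)) (at 0) sequentially"
      by (intro filterlim_atI) (use LIMSEQ_inverse_real_of_nat in \<open>auto simp: inverse_eq_divide\<close>)
    note fl = filterlim_compose[OF _ this]
    have "(\<lambda>n. (f (x + (1 / real (Suc n)) *\<^sub>R (e1 + e2)) - f x) / (1 / real (Suc n))
       - (f (x + (1 / real (Suc n)) *\<^sub>R e2) - f x) / (1 / real (Suc n))
       - (f (x + (1 / real (Suc n)) *\<^sub>R e1) - f x) / (1 / real (Suc n))) \<longlonglongrightarrow> D3 - D2 - D1"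
      by (intro tendsto_diff fl[OF that(1)] fl[OF that(2)] fl[OF that(3)])
    then show ?thesis by (simp add: E_def S_def v_def scaleR_add_right algebra_simps)
  qed
  obtain N1 where N1: "N1 \<in> null_sets lborel"
    "\<And>x. x \<notin> N1 \<Longrightarrow> \<exists>D. ((\<lambda>t. (f (x + t *\<^sub>R e1) - f x) / t) \<longlongrightarrow> D) (at 0)"
    using lipschitz_ae_directional_derivative[of f L "e1", OF lip] by blast
  obtain N2 where N2: "N2 \<in> null_sets lborel"
    "\<And>x. x \<notin> N2 \<Longrightarrow> \<exists>D. ((\<lambda>t. (f (x + t *\<^sub>R e2) - f x) / t) \<longlongrightarrow> D) (at 0)"
    using lipschitz_ae_directional_derivative[of f L "e2", OF lip] by blast
  obtain N3 where N3: "N3 \<in> null_sets lborel"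
    "\<And>x. x \<notin> N3 \<Longrightarrow> \<exists>D. ((\<lambda>t. (f (x + t *\<^sub>R (e1 + e2)) - f x) / t) \<longlongrightarrow> D) (at 0)"
    using lipschitz_ae_directional_derivative[of f L "e1 + e2", OF lip] by blast
  have aelim: "AE x in lborel. (\<lambda>n. E n x) \<longlonglongrightarrow> l x"
    using AE_not_in[OF N1(1)] AE_not_in[OF N2(1)] AE_not_in[OF N3(1)]
  proof eventually_elim
    case (elim x)
    then obtain D1 D2 D3 where "(\<lambda>n. E n x) \<longlonglongrightarrow> D3 - D2 - D1"
      using N1(2) N2(2) N3(2) Elim by meson
    then show ?case unfolding l_def using convergent_LIMSEQ_iff convergentI by blast
  qed
  have int0: "set_integrable lborel (cbox a b) l \<and> (LINT x:cbox a b|lborel. l x) = 0" for a b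
  proof -
    define I where "I = (\<lambda>x. indicator (cbox a b) x :: real)"
    have mI[measurable]: "I \<in> borel_measurable borel" by (simp add: I_def)
    have intI: "integrable lborel (\<lambda>x. 2 * C * I x)"
      by (auto simp: I_def intro!: integrable_real_indicator emeasure_lborel_cbox_finite)
    have Cnn: "C \<ge> 0" using Sb[of 0 0] by linarith
    have b1: "AE x in lborel. norm (I x * E n x) \<le> 2 * C * I x" for n
      using Eb Cnn by (auto simp: I_def indicator_def)
    have l1: "AE x in lborel. (\<lambda>n. I x * E n x) \<longlonglongrightarrow> I x * l x"
      using aelim by eventually_elim (intro tendsto_intros)
    have int_l: "integrable lborel (\<lambda>x. I x * l x)"
      by (rule integrable_dominated_convergence[OF _ _ intI l1 b1]) measurable
    have lim_l: "(\<lambda>n. \<integral>x. I x * E n x \<partial>lborel) \<longlonglongrightarrow> (\<integral>x. I x * l x \<partial>lborel)"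
      by (rule integral_dominated_convergence[OF _ _ intI l1 b1]) measurable
    have intS: "integrable lborel (\<lambda>x. I x * S n (x + w))" for n w
    proof (rule Bochner_Integration.integrable_bound[OF intI])
      have "norm (I x * S n (x + w)) \<le> norm (2 * C * I x)" for x
        using Sb[of n "x + w"] Cnn by (auto simp: I_def indicator_def)
      then show "AE x in lborel. norm (I x * S n (x + w)) \<le> norm (2 * C * I x)" by simp
    qed measurable
    have intS': "integrable lborel (\<lambda>x. I (x - w) * S n x)" for n w
    proof -
      have "integrable (distr lborel borel ((+) w)) (\<lambda>x. I (x - w) * S n x)"
        by (subst integrable_distr_eq) (use intS[of n w] in \<open>auto simp: add.commute\<close>)
      then show ?thesis by (simp add: lborel_distr_plus)
    qed
    have shift: "(\<integral>x. I x * S n (x + w) \<partial>lborel) = (\<integral>x. I (x - w) * S n x \<partial>lborel)" for n w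
    proof -
      have "(\<integral>x. I (x - w) * S n x \<partial>lborel) = (\<integral>x. I (x - w) * S n x \<partial>distr lborel borel ((+) w))"
        by (simp add: lborel_distr_plus)
      also have "\<dots> = (\<integral>x. I x * S n (x + w) \<partial>lborel)"
        by (subst integral_distr) (auto simp: add.commute)
      finally show ?thesis by simp
    qed
    have eq: "(\<integral>x. I x * E n x \<partial>lborel) = (\<integral>x. (I (x - v n) - I x) * S n x \<partial>lborel)" for n
    proof -
      have "(\<integral>x. I x * E n x \<partial>lborel) = (\<integral>x. I x * S n (x + v n) \<partial>lborel) - (\<integral>x. I x * S n x \<partial>lborel)"
        using intS[of n "v n"] intS[of n 0] by (simp add: E_def right_diff_distrib)
      also have "\<dots> = (\<integral>x. I (x - v n) * S n x \<partial>lborel) - (\<integral>x. I x * S n x \<partial>lborel)"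
        by (simp only: shift)
      also have "\<dots> = (\<integral>x. (I (x - v n) - I x) * S n x \<partial>lborel)"
        using intS'[where w = "v n" and n = n] intS[of n 0] by (simp add: left_diff_distrib)
      finally show ?thesis .
    qed
    \<comment> \<open>A ball that contains the box and all its translates by \<open>v n\<close>
      carries the common majorant \<open>J\<close>.\<close>
    obtain R where "\<forall>y\<in>cbox a b. dist 0 y \<le> R"
      using bounded_cbox[of a b] bounded_any_center[of "cbox a b" 0] by blast
    then have R: "cbox a b \<subseteq> cball 0 R" by auto
    define J where "J = (\<lambda>x::'a. indicator (cball 0 (R + norm e2)) x :: real)"
    have intJ: "integrable lborel (\<lambda>x. 2 * C * J x)"
      by (auto simp: J_def intro!: integrable_real_indicator emeasure_lborel_cball_finite)
    have vn: "norm (v n) \<le> norm e2" for n using mult_left_mono[of 1 "1 + real n" "norm e2"] by (simp add: v_def divide_le_eq)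
    have b2: "norm ((I (x - v n) - I x) * S n x) \<le> 2 * C * J x" for n x
    proof (cases "x \<in> cball 0 (R + norm e2)")
      case True
      have "\<bar>I (x - v n) - I x\<bar> \<le> 2" by (auto simp: I_def indicator_def)
      then show ?thesis using True Sb[of n x] by (simp add: J_def abs_mult mult_mono)
    next
      case False
      have nx: "norm x > R + norm e2" using False by simp
      have "x \<notin> cbox a b" "x - v n \<notin> cbox a b"
        using R nx vn[of n] norm_triangle_sub[of x "v n"] by (auto simp: subset_iff) (smt (verit) norm_ge_zero)+
      then show ?thesis using Cnn by (simp add: I_def J_def)
    qed
    have v0: "v \<longlonglongrightarrow> 0"
      unfolding v_def using tendsto_scaleR[OF LIMSEQ_inverse_real_of_nat tendsto_const[of e2]]
      by (simp add: inverse_eq_divide)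
    have "frontier (cbox a b) \<in> null_sets lborel"
      using negligible_frontier_interval[of a b]
      by (simp add: negligible_iff_null_sets null_sets_completion_iff frontier_def)
    then have "AE x in lborel. x \<notin> frontier (cbox a b)" by (rule AE_not_in)
    \<comment> \<open>Off the frontier of the box, which is null, x and x - v n are eventually both
      inside or both outside.\<close>
    then have l2: "AE x in lborel. (\<lambda>n. (I (x - v n) - I x) * S n x) \<longlonglongrightarrow> 0"
    proof eventually_elim
      case (elim x)
      have "(\<lambda>n. x - v n) \<longlonglongrightarrow> x - 0" by (intro tendsto_intros v0)
      then have *: "\<forall>\<^sub>F n in sequentially. x - v n \<in> U" if "open U" "x \<in> U" for U
        using topological_tendstoD[of _ x] that by simp
      have "\<forall>\<^sub>F n in sequentially. I (x - v n) = I x"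
      proof (cases "x \<in> interior (cbox a b)")
        case True
        from *[OF open_interior True] show ?thesis
        proof eventually_elim
          case (elim n)
          then have "x \<in> cbox a b" "x - v n \<in> cbox a b" using True interior_subset by blast+
          then show ?case by (simp add: I_def)
        qed
      next
        case False
        then have "x \<in> - cbox a b" using elim by (auto simp: frontier_def)
        have "\<forall>\<^sub>F n in sequentially. x - v n \<in> - cbox a b"
          by (rule *) (use \<open>x \<in> - cbox a b\<close> in \<open>auto simp: open_Compl\<close>)
        then show ?thesis
          by eventually_elim (use \<open>x \<in> - cbox a b\<close> in \<open>simp add: I_def\<close>)
      qed
      then have "\<forall>\<^sub>F n in sequentially. 0 = (I (x - v n) - I x) * S n x" by eventually_elim simp
      then show ?case by (rule tendsto_eventually[OF eventually_mono]) simp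
    qed
    have "(\<lambda>n. \<integral>x. (I (x - v n) - I x) * S n x \<partial>lborel) \<longlonglongrightarrow> (\<integral>x. 0 \<partial>(lborel :: 'a measure))"
      by (rule integral_dominated_convergence[OF _ _ intJ l2]) (use b2 in auto)
    then have "(\<integral>x. I x * l x \<partial>lborel) = 0"
      using lim_l LIMSEQ_unique unfolding eq by fastforce
    then show ?thesis using int_l
      by (simp add: set_integrable_def set_lebesgue_integral_def I_def)
  qed
  have hk: "l integrable_on cbox a b" "integral (cbox a b) l = 0" for a b
    using set_borel_integral_eq_integral[of "cbox a b" l] int0[of a b] by auto
  obtain N where N: "negligible N" "\<And>x e. \<lbrakk>x \<notin> N; 0 < e\<rbrakk> \<Longrightarrow>
       \<exists>d>0. \<forall>h. 0 < h \<and> h < d \<longrightarrow> norm (integral (cbox x (x + h *\<^sub>R One)) l /\<^sub>R h ^ DIM('a) - l x) < e"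
    using integrable_ccontinuous_explicit[of l] hk(1) by metis
  show ?thesis
  proof (rule that[OF N(1)])
    fix x D1 D2 D3 assume x: "x \<notin> N" and D:
        "((\<lambda>t. (f (x + t *\<^sub>R e1) - f x) / t) \<longlongrightarrow> D1) (at 0)"
        "((\<lambda>t. (f (x + t *\<^sub>R e2) - f x) / t) \<longlongrightarrow> D2) (at 0)"
        "((\<lambda>t. (f (x + t *\<^sub>R (e1 + e2)) - f x) / t) \<longlongrightarrow> D3) (at 0)"
    have "norm (l x) < e" if "e > 0" for e
    proof -
      obtain d where "d > 0" "\<forall>h. 0 < h \<and> h < d \<longrightarrow> norm (integral (cbox x (x + h *\<^sub>R One)) l /\<^sub>R h ^ DIM('a) - l x) < e"
        using N(2)[OF x \<open>e > 0\<close>] by blast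
      then show ?thesis using hk(2) by (auto dest!: spec[of _ "d/2"])
    qed
    then have "l x = 0" using less_irrefl zero_less_norm_iff by blast
    moreover have "l x = D3 - D2 - D1" using Elim[OF D] by (simp add: l_def limI)
    ultimately show "D3 = D1 + D2" by simp
  qed
qed

text \<open>Difference quotients are Lipschitz in the direction with constant L, whatever the step.
  So existence and additivity of the derivatives pass from a countable dense set to all directions,
  and compactness of the unit sphere makes the convergence uniform in the direction.\<close>

theorem rademacher:
  fixes f :: "'a::euclidean_space \<Rightarrow> real"
  assumes lip: "\<And>x y. \<bar>f x - f y\<bar> \<le> L * norm (x - y)"
  obtains N where "negligible N" "\<And>x. x \<notin> N \<Longrightarrow> f differentiable (at x)"
proof -
  define q where "q = (\<lambda>x e t. (f (x + t *\<^sub>R e) - f x) / t)"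
  define P where "P = (\<lambda>x e D. (q x e \<longlongrightarrow> D) (at 0))"
  obtain \<D> :: "'a set" where \<D>: "countable \<D>" "\<And>X. open X \<Longrightarrow> X \<noteq> {} \<Longrightarrow> \<exists>d\<in>\<D>. d \<in> X"
    using countable_dense_exists by metis
  have "\<forall>e. \<exists>N. negligible N \<and> (\<forall>x. x \<notin> N \<longrightarrow> (\<exists>D. P x e D))"
  proof
    fix e
    obtain N where "N \<in> null_sets lborel" "\<And>x. x \<notin> N \<Longrightarrow> \<exists>D. ((\<lambda>t. (f (x + t *\<^sub>R e) - f x) / t) \<longlongrightarrow> D) (at 0)"
      using lipschitz_ae_directional_derivative[of f L e, OF lip] by blast
    then show "\<exists>N. negligible N \<and> (\<forall>x. x \<notin> N \<longrightarrow> (\<exists>D. P x e D))"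
      by (auto simp: P_def q_def negligible_iff_null_sets intro: null_sets_completionI)
  qed
  then obtain N1 where N1: "\<And>e. negligible (N1 e)" "\<And>e x. x \<notin> N1 e \<Longrightarrow> \<exists>D. P x e D" by metis
  have "\<forall>e1 e2. \<exists>N. negligible N \<and> (\<forall>x D1 D2 D3. x \<notin> N \<longrightarrow> P x e1 D1 \<longrightarrow> P x e2 D2 \<longrightarrow> P x (e1 + e2) D3 \<longrightarrow> D3 = D1 + D2)"
  proof (intro allI)
    fix e1 e2
    obtain N where "negligible N"
    "\<And>x D1 D2 D3. \<lbrakk>x \<notin> N;
        ((\<lambda>t. (f (x + t *\<^sub>R e1) - f x) / t) \<longlongrightarrow> D1) (at 0);
        ((\<lambda>t. (f (x + t *\<^sub>R e2) - f x) / t) \<longlongrightarrow> D2) (at 0);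
        ((\<lambda>t. (f (x + t *\<^sub>R (e1 + e2)) - f x) / t) \<longlongrightarrow> D3) (at 0)\<rbrakk> \<Longrightarrow> D3 = D1 + D2"
      by (rule lipschitz_ae_directional_derivative_additive[of f L e1 e2, OF lip]) (rule that; assumption)
    then show "\<exists>N. negligible N \<and> (\<forall>x D1 D2 D3. x \<notin> N \<longrightarrow> P x e1 D1 \<longrightarrow> P x e2 D2 \<longrightarrow> P x (e1 + e2) D3 \<longrightarrow> D3 = D1 + D2)"
      unfolding P_def q_def by (intro exI[of _ N]) blast
  qed
  then obtain N2 where N2: "\<And>e1 e2. negligible (N2 e1 e2)"
    "\<And>e1 e2 x D1 D2 D3. x \<notin> N2 e1 e2 \<Longrightarrow> P x e1 D1 \<Longrightarrow> P x e2 D2 \<Longrightarrow> P x (e1 + e2) D3 \<Longrightarrow> D3 = D1 + D2"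
    by metis
  \<comment> \<open>The sum of two directions from \<open>\<D>\<close> need not lie in
    \<open>\<D>\<close>. This does no harm: the exceptional sets of additivity suppose that the
    three derivatives exist, and outside N existence is extended to every direction before
    additivity is invoked.\<close>
  define N where "N = (\<Union>(N1 ` \<D>)) \<union> (\<Union>((\<lambda>(d,d'). N2 d d') ` (\<D> \<times> \<D>)))"
  have "negligible N"
    unfolding N_def using \<D>(1) N1(1) N2(1)
    by (intro negligible_Un negligible_countable_Union countable_image countable_SIGMA) auto
  moreover have "f differentiable (at x)" if x: "x \<notin> N" for x
  proof -
    have qlip: "\<bar>q x e t - q x e' t\<bar> \<le> L * norm (e - e')" if "t \<noteq> 0" for e e' t
    proof -
      have "\<bar>f (x + t *\<^sub>R e) - f (x + t *\<^sub>R e')\<bar> \<le> L * (\<bar>t\<bar> * norm (e - e'))"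
        using lip[of "x + t *\<^sub>R e" "x + t *\<^sub>R e'"] by (simp add: scaleR_diff_right[symmetric])
      moreover have "q x e t - q x e' t = (f (x + t *\<^sub>R e) - f (x + t *\<^sub>R e')) / t"
        by (simp add: q_def diff_divide_distrib[symmetric])
      ultimately show ?thesis using that by (simp add: abs_divide divide_le_eq mult_ac)
    qed
    have Plip: "\<bar>a - b\<bar> \<le> L * norm (e - e')" if "P x e a" "P x e' b" for a b e e'
    proof (rule tendsto_upperbound)
      show "((\<lambda>t. \<bar>q x e t - q x e' t\<bar>) \<longlongrightarrow> \<bar>a - b\<bar>) (at 0)"
        using that unfolding P_def by (intro tendsto_intros)
      show "\<forall>\<^sub>F t in at 0. \<bar>q x e t - q x e' t\<bar> \<le> L * norm (e - e')"
        using qlip by (auto simp: eventually_at_filter)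
    qed simp
    have seq: "\<exists>d. (\<forall>n. d n \<in> \<D>) \<and> d \<longlonglongrightarrow> e" for e
    proof -
      have "\<forall>n. \<exists>d\<in>\<D>. d \<in> ball e (1 / real (Suc n))" by (intro allI \<D>(2)) auto
      then obtain d where d: "\<And>n. d n \<in> \<D>" "\<And>n. d n \<in> ball e (1 / real (Suc n))" by metis
      have "(\<lambda>n. dist (d n) e) \<longlonglongrightarrow> 0"
      proof (rule tendsto_sandwich[OF _ _ tendsto_const LIMSEQ_inverse_real_of_nat])
        show "\<forall>\<^sub>F n in sequentially. dist (d n) e \<le> inverse (real (Suc n))"
          using d(2) by (auto simp: dist_commute inverse_eq_divide less_imp_le simp del: of_nat_Suc)
      qed auto
      then show ?thesis using d(1) tendsto_dist_iff by blast
    qed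
    have "\<exists>D. P x e D" for e
    proof -
      obtain d where d: "\<And>n. d n \<in> \<D>" "d \<longlonglongrightarrow> e" using seq by metis
      have "\<forall>n. \<exists>a. P x (d n) a" using N1(2) x d(1) unfolding N_def by blast
      then obtain a where a: "\<And>n. P x (d n) (a n)" by metis
      have "Cauchy a"
      proof (rule metric_CauchyI)
        fix \<epsilon> :: real assume "\<epsilon> > 0"
        have "Cauchy d" using d(2) LIMSEQ_imp_Cauchy by blast
        then obtain M where M: "\<And>m n. m \<ge> M \<Longrightarrow> n \<ge> M \<Longrightarrow> dist (d m) (d n) < \<epsilon> / (\<bar>L\<bar> + 1)"
          using \<open>\<epsilon> > 0\<close> by (meson metric_CauchyD divide_pos_pos abs_ge_zero add_nonneg_pos zero_less_one)
        have "dist (a m) (a n) < \<epsilon>" if "m \<ge> M" "n \<ge> M" for m n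
        proof -
          have "norm (d m - d n) * (\<bar>L\<bar> + 1) < \<epsilon>"
            using M[OF that] by (simp add: dist_norm field_simps add_nonneg_pos)
          moreover have "L * norm (d m - d n) \<le> norm (d m - d n) * (\<bar>L\<bar> + 1)"
            by (simp add: mult.commute mult_right_mono)
          ultimately show ?thesis using Plip[OF a[of m] a[of n]] by (simp add: dist_real_def)
        qed
        then show "\<exists>M. \<forall>m\<ge>M. \<forall>n\<ge>M. dist (a m) (a n) < \<epsilon>" by blast
      qed
      then obtain D where D: "a \<longlonglongrightarrow> D" using Cauchy_convergent_iff convergent_def by blast
      have "(q x e \<longlongrightarrow> D) (at 0)"
      proof (rule tendstoI)
        fix \<epsilon> :: real assume "\<epsilon> > 0"
        have "(\<lambda>n. L * norm (e - d n) + \<bar>a n - D\<bar>) \<longlonglongrightarrow> L * norm (e - e) + \<bar>D - D\<bar>"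
          by (intro tendsto_intros d D)
        then have "\<forall>\<^sub>F n in sequentially. L * norm (e - d n) + \<bar>a n - D\<bar> < \<epsilon>/2"
          using \<open>\<epsilon> > 0\<close> by (intro order_tendstoD(2)) auto
        then obtain n where n: "L * norm (e - d n) + \<bar>a n - D\<bar> < \<epsilon>/2"
          using eventually_sequentially by auto
        have "\<forall>\<^sub>F t in at 0. dist (q x (d n) t) (a n) < \<epsilon>/2"
          using tendstoD[OF a[of n, unfolded P_def], of "\<epsilon>/2"] \<open>\<epsilon> > 0\<close> by simp
        moreover have "\<forall>\<^sub>F t in at (0::real). t \<noteq> 0" by (simp add: eventually_at_filter)
        ultimately show "\<forall>\<^sub>F t in at 0. dist (q x e t) D < \<epsilon>"
        proof eventually_elim
          case (elim t)
          then show ?case using qlip[OF elim(2), of e "d n"] n unfolding dist_real_def by linarith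
        qed
      qed
      then show ?thesis unfolding P_def by blast
    qed
    then obtain D where D: "\<And>e. P x e (D e)" by metis
    have uniq: "a = b" if "P x e a" "P x e b" for a b e
      using that unfolding P_def by (intro tendsto_unique[of "at (0::real)"]) auto
    have Dlim: "(\<lambda>n. D (d n)) \<longlonglongrightarrow> D e" if "d \<longlonglongrightarrow> e" for d e
    proof -
      have "(\<lambda>n. L * norm (d n - e)) \<longlonglongrightarrow> L * norm (e - e)" by (intro tendsto_intros that)
      then have "(\<lambda>n. L * norm (d n - e)) \<longlonglongrightarrow> 0" by simp
      then have "(\<lambda>n. D (d n) - D e) \<longlonglongrightarrow> 0"
        by (rule Lim_null_comparison[rotated]) (simp add: Plip D)
      then show ?thesis by (simp add: LIM_zero_iff)
    qed
    have "linear D"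
    proof (rule linearI)
      fix e e'
      obtain d where d: "\<And>n. d n \<in> \<D>" "d \<longlonglongrightarrow> e" using seq by metis
      obtain d' where d': "\<And>n. d' n \<in> \<D>" "d' \<longlonglongrightarrow> e'" using seq by metis
      have "D (d n + d' n) = D (d n) + D (d' n)" for n
      proof (rule N2(2)[OF _ D D D])
        show "x \<notin> N2 (d n) (d' n)" using x d(1)[of n] d'(1)[of n] unfolding N_def by blast
      qed
      moreover have "(\<lambda>n. D (d n + d' n)) \<longlonglongrightarrow> D (e + e')" by (intro Dlim tendsto_intros d d')
      moreover have "(\<lambda>n. D (d n) + D (d' n)) \<longlonglongrightarrow> D e + D e'" by (intro Dlim tendsto_intros d d')
      ultimately show "D (e + e') = D e + D e'" using LIMSEQ_unique by simp
    next
      fix c :: real and e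
      show "D (c *\<^sub>R e) = c *\<^sub>R D e"
      proof (cases "c = 0")
        case True
        have "P x 0 0" by (simp add: P_def q_def)
        from uniq[OF D this] show ?thesis using True by simp
      next
        case False
        have "filterlim (\<lambda>t. c * t) (at 0) (at 0)"
          using False by (intro filterlim_atI tendsto_mult_right_zero tendsto_ident_at) (auto simp: eventually_at_filter)
        then have "((\<lambda>t. q x e (c * t)) \<longlongrightarrow> D e) (at 0)"
          using D[of e] unfolding P_def by (rule filterlim_compose[rotated])
        then have "((\<lambda>t. c * q x e (c * t)) \<longlongrightarrow> c * D e) (at 0)" by (intro tendsto_intros)
        moreover have "(\<lambda>t. c * q x e (c * t)) = q x (c *\<^sub>R e)"
          using False by (auto simp: q_def fun_eq_iff mult.commute)
        ultimately have "P x (c *\<^sub>R e) (c * D e)" by (simp add: P_def)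
        from uniq[OF D this] show ?thesis by simp
      qed
    qed
    have "((\<lambda>h. norm (f (x + h) - f x - D h) / norm h) \<longlongrightarrow> 0) (at 0)"
    proof (rule LIM_I)
      fix \<epsilon> :: real assume "\<epsilon> > 0"
      \<comment> \<open>Replacing a direction by a point of an \<eta>-net of the sphere changes the
        quotient and the limit by at most \<epsilon>/4 each.\<close>
      define \<eta> where "\<eta> = \<epsilon> / (4 * (\<bar>L\<bar> + 1))"
      have "\<eta> > 0" using \<open>\<epsilon> > 0\<close> by (auto simp: \<eta>_def add_nonneg_pos)
      moreover have "(\<bar>L\<bar> + 1) * \<eta> = \<epsilon>/4" by (simp add: \<eta>_def field_simps add_nonneg_pos)
      moreover have "L * \<eta> \<le> (\<bar>L\<bar> + 1) * \<eta>" using \<open>\<eta> > 0\<close> by (intro mult_right_mono) auto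
      ultimately have \<eta>: "\<eta> > 0" "L * \<eta> \<le> \<epsilon>/4" by auto
      obtain k where k: "finite k" "sphere 0 1 \<subseteq> (\<Union>e\<in>k. ball (e::'a) \<eta>)"
        using \<eta>(1) compact_sphere[of "0::'a" 1] unfolding compact_eq_totally_bounded by metis
      have "\<forall>e\<in>k. \<forall>\<^sub>F t in at 0. dist (q x e t) (D e) < \<epsilon>/4"
        using D \<open>\<epsilon> > 0\<close> unfolding P_def by (intro ballI tendstoD) auto
      then have "\<forall>\<^sub>F t in at 0. \<forall>e\<in>k. dist (q x e t) (D e) < \<epsilon>/4"
        using k(1) by (simp add: eventually_ball_finite)
      then obtain \<delta> where \<delta>: "\<delta> > 0" "\<And>t e. t \<noteq> 0 \<Longrightarrow> \<bar>t\<bar> < \<delta> \<Longrightarrow> e \<in> k \<Longrightarrow> dist (q x e t) (D e) < \<epsilon>/4"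
        by (auto simp: eventually_at dist_real_def)
      have "norm (f (x + h) - f x - D h) / norm h < \<epsilon>" if h: "h \<noteq> 0" "norm h < \<delta>" for h
      proof -
        define e where "e = h /\<^sub>R norm h"
        have he: "h = norm h *\<^sub>R e" and "norm e = 1" using h by (auto simp: e_def)
        then obtain e0 where e0: "e0 \<in> k" "norm (e - e0) < \<eta>"
          using k(2) by (force simp: dist_norm norm_minus_commute)
        have *: "L * norm (e - e0) \<le> \<epsilon>/4"
        proof (cases "L \<ge> 0")
          case True then show ?thesis using e0(2) \<eta>(2) by (meson less_imp_le mult_left_mono order.trans)
        next
          case False then have "L * norm (e - e0) \<le> 0" by (simp add: mult_nonpos_nonneg)
          then show ?thesis using \<open>\<epsilon> > 0\<close> by simp
        qed
        have "(f (x + h) - f x - D h) = norm h * (q x e (norm h) - D e)"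
          using h(1) he[symmetric] linear_cmul[OF \<open>linear D\<close>, of "norm h" e] by (simp add: q_def field_simps)
        then have "norm (f (x + h) - f x - D h) / norm h = \<bar>q x e (norm h) - D e\<bar>"
          using h(1) by (simp add: abs_mult)
        moreover have "\<bar>q x e (norm h) - q x e0 (norm h)\<bar> \<le> \<epsilon>/4" using qlip[of "norm h" e e0] * h(1) by auto
        moreover have "\<bar>q x e0 (norm h) - D e0\<bar> < \<epsilon>/4" using \<delta>(2)[of "norm h" e0] h e0 by (auto simp: dist_real_def)
        moreover have "\<bar>D e - D e0\<bar> \<le> \<epsilon>/4" using Plip[OF D[of e] D[of e0]] * by auto
        ultimately show ?thesis using \<open>\<epsilon> > 0\<close> by linarith
      qed
      then show "\<exists>s>0. \<forall>h. h \<noteq> 0 \<and> norm (h - 0) < s \<longrightarrow> norm (norm (f (x + h) - f x - D h) / norm h - 0) < \<epsilon>"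
        using \<delta>(1) by (intro exI[of _ \<delta>]) auto
    qed
    then have "(f has_derivative D) (at x)"
      using \<open>linear D\<close> by (simp add: has_derivative_at linear_conv_bounded_linear)
    then show ?thesis by (auto simp: differentiable_def)
  qed
  ultimately show ?thesis by (rule that)
qed

section \<open>Second-order expansions of semiconvex functions\<close>

text \<open>Serves to identify a subgradient with the slope of a paraboloid that touches from
  above.\<close>

lemma quadratic_le_zero:
  fixes a b :: "'a::real_inner"
  assumes "\<And>h. a \<bullet> h \<le> C * (h \<bullet> h)"
  shows "a = 0"
proof -
  define \<tau> where "\<tau> = 1 / (2 * (\<bar>C\<bar> + 1))"
  have t: "\<tau> > 0" "C * \<tau> \<le> 1/2"
    by (auto simp: \<tau>_def divide_le_eq)
  have "\<tau> * (a \<bullet> a) \<le> (C * \<tau>) * (\<tau> * (a \<bullet> a))"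
    using assms[of "\<tau> *\<^sub>R a"] by (simp add: algebra_simps)
  also have "\<dots> \<le> 1/2 * (\<tau> * (a \<bullet> a))" using t by (intro mult_right_mono) auto
  finally have "\<tau> * (a \<bullet> a) \<le> 0" by simp
  then have "a \<bullet> a \<le> 0" using t by (simp add: mult_le_0_iff)
  then show ?thesis using inner_ge_zero[of a] by (simp add: antisym)
qed

text \<open>\<open>J\<close> is the gradient of the Legendre conjugate: \<open>J s\<close> minimizes
  K y - s . y. Strong convexity of \<open>K\<close> dualizes to Lipschitz continuity of
  \<open>J\<close>.\<close>

lemma strongly_convex_conjugate:
  fixes K :: "'a::euclidean_space \<Rightarrow> real"
  assumes sc: "\<And>z. \<exists>s. \<forall>y. K y \<ge> K z + s \<bullet> (y - z) + 1/2 * ((y - z) \<bullet> (y - z))"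
  obtains J where
    "continuous_on UNIV K"
    "\<And>s y. K y \<ge> K (J s) + s \<bullet> (y - J s) + 1/4 * ((y - J s) \<bullet> (y - J s))"
    "\<And>s s'. norm (J s - J s') \<le> 2 * norm (s - s')"
proof -
  obtain S where S: "\<And>z y. K y \<ge> K z + S z \<bullet> (y - z) + 1/2 * ((y - z) \<bullet> (y - z))"
    using sc by metis
  have "convex_on UNIV K"
  proof (rule convex_onI)
    fix t :: real and x y :: 'a assume t: "0 < t" "t < 1"
    define m where "m = (1 - t) *\<^sub>R x + t *\<^sub>R y"
    have "K x \<ge> K m + S m \<bullet> (x - m)" "K y \<ge> K m + S m \<bullet> (y - m)"
      using S[of m x] S[of m y] by (auto intro: order.trans[rotated] simp: inner_ge_zero)
    then have "(1-t) * K x + t * K y \<ge> (1-t) * (K m + S m \<bullet> (x - m)) + t * (K m + S m \<bullet> (y - m))"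
      using t by (intro add_mono mult_left_mono) auto
    moreover have "(1-t) * (K m + S m \<bullet> (x - m)) + t * (K m + S m \<bullet> (y - m))
        = K m + S m \<bullet> ((1-t) *\<^sub>R (x - m) + t *\<^sub>R (y - m))"
      by (simp add: inner_add_right algebra_simps)
    moreover have "(1-t) *\<^sub>R (x - m) + t *\<^sub>R (y - m) = 0"
      by (simp add: m_def algebra_simps)
    ultimately show "K ((1 - t) *\<^sub>R x + t *\<^sub>R y) \<le> (1 - t) * K x + t * K y"
      by (simp add: m_def)
  qed simp
  then have cont: "continuous_on UNIV K" by (intro convex_on_continuous) auto
  have "\<exists>z. \<forall>y. K y \<ge> K z + s \<bullet> (y - z)" for s
  proof -
    \<comment> \<open>By strong convexity at 0, outside this ball K y - s . y is at least its value
      at 0, so a minimum over the ball is global.\<close>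
    define R where "R = 2 * norm (S 0 - s)"
    have cont': "continuous_on (cball 0 R) (\<lambda>y. K y - s \<bullet> y)"
      by (intro continuous_intros continuous_on_subset[OF cont]) auto
    have "R \<ge> 0" by (simp add: R_def)
    then obtain z where z: "z \<in> cball 0 R" "\<And>y. y \<in> cball 0 R \<Longrightarrow> K z - s \<bullet> z \<le> K y - s \<bullet> y"
      using continuous_attains_inf[OF compact_cball _ cont'] by auto
    have "K z - s \<bullet> z \<le> K y - s \<bullet> y" for y
    proof (cases "y \<in> cball 0 R")
      case False
      then have y: "norm y > R" by simp
      have "K z - s \<bullet> z \<le> K 0" using z(2)[of 0] \<open>R \<ge> 0\<close> by simp
      also have "K 0 \<le> K y - s \<bullet> y"
      proof -
        have "- (norm (S 0 - s) * norm y) \<le> (S 0 - s) \<bullet> y"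
          using Cauchy_Schwarz_ineq2[of "S 0 - s" y] by (simp add: abs_le_iff)
        moreover have "norm (S 0 - s) * norm y \<le> 1/2 * (norm y * norm y)"
          using mult_right_mono[of "norm (S 0 - s)" "norm y / 2" "norm y"] y by (simp add: R_def)
        ultimately show ?thesis using S[of 0 y]
          by (simp add: inner_diff_left dot_square_norm power2_eq_square)
      qed
      finally show ?thesis .
    qed (use z in auto)
    then show ?thesis by (intro exI[of _ z]) (auto simp: inner_diff_right algebra_simps)
  qed
  then obtain J where J0: "\<And>s y. K y \<ge> K (J s) + s \<bullet> (y - J s)" by metis
  \<comment> \<open>So far s is merely a subgradient at \<open>J s\<close>. The quadratic gain comes
    from strong convexity at the midpoint of \<open>J s\<close> and y, hence 1/4 instead of
    1/2.\<close>
  have J: "K y \<ge> K (J s) + s \<bullet> (y - J s) + 1/4 * ((y - J s) \<bullet> (y - J s))" for s y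
  proof -
    define d where "d = y - J s"
    define m where "m = J s + (1/2) *\<^sub>R d"
    have low: "K (J s) \<ge> K m - 1/2 * (S m \<bullet> d) + 1/8 * (d \<bullet> d)"
      using S[of m "J s"] by (simp add: m_def)
    have "y - m = d - (1/2) *\<^sub>R d" by (simp add: m_def d_def)
    also have "\<dots> = (1/2) *\<^sub>R d" using scaleR_left_diff_distrib[of 1 "1/2" d] by simp
    finally have ym: "y - m = (1/2) *\<^sub>R d" .
    have low':  "K y \<ge> K m + 1/2 * (S m \<bullet> d) + 1/8 * (d \<bullet> d)"
      using S[of m y] by (simp add: ym)
    moreover have "K m \<ge> K (J s) + 1/2 * (s \<bullet> d)" using J0[of s m] by (simp add: m_def)
    then show ?thesis using low low' by (simp add: d_def[symmetric])
  qed
  have "norm (J s - J s') \<le> 2 * norm (s - s')" for s s'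
  proof -
    define d where "d = J s - J s'"
    have "K (J s') \<ge> K (J s) - s \<bullet> d + 1/4 * (d \<bullet> d)"
      using J[of s "J s'"] by (simp add: d_def inner_diff_left inner_diff_right inner_commute algebra_simps)
    moreover have "K (J s) \<ge> K (J s') + s' \<bullet> d + 1/4 * (d \<bullet> d)"
      using J[of s' "J s"] by (simp add: d_def)
    ultimately have "1/2 * (d \<bullet> d) \<le> (s - s') \<bullet> d" by (simp add: inner_diff_left)
    also have "\<dots> \<le> norm (s - s') * norm d" by (rule norm_cauchy_schwarz)
    finally have "norm d * norm d \<le> (2 * norm (s - s')) * norm d"
      by (simp add: dot_square_norm power2_eq_square)
    then have "norm d \<le> 2 * norm (s - s')" by (cases "d = 0") auto
    then show ?thesis by (simp add: d_def)
  qed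
  with cont J that show ?thesis by blast
qed

lemma lipschitz_vector_ae_differentiable:
  fixes f :: "'a::euclidean_space \<Rightarrow> 'b::euclidean_space"
  assumes lip: "\<And>x y. norm (f x - f y) \<le> L * norm (x - y)"
  obtains N where "negligible N" "\<And>x. x \<notin> N \<Longrightarrow> f differentiable (at x)"
proof -
  have "\<forall>b\<in>Basis. \<exists>N. negligible N \<and> (\<forall>x. x \<notin> N \<longrightarrow> (\<lambda>x. f x \<bullet> b) differentiable (at x))"
  proof
    fix b :: 'b assume b: "b \<in> Basis"
    have "\<bar>f x \<bullet> b - f y \<bullet> b\<bar> \<le> L * norm (x - y)" for x y
      using Basis_le_norm[OF b, of "f x - f y"] lip[of x y] by (simp add: inner_diff_left)
    from rademacher[OF this] show "\<exists>N. negligible N \<and> (\<forall>x. x \<notin> N \<longrightarrow> (\<lambda>x. f x \<bullet> b) differentiable (at x))"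
      by metis
  qed
  then obtain N where N: "\<And>b. b \<in> Basis \<Longrightarrow> negligible (N b)"
    "\<And>b x. b \<in> Basis \<Longrightarrow> x \<notin> N b \<Longrightarrow> (\<lambda>x. f x \<bullet> b) differentiable (at x)" by metis
  show ?thesis
  proof (rule that[of "\<Union>(N ` Basis)"])
    show "negligible (\<Union>(N ` Basis))" using N(1) by (intro negligible_Union) auto
    show "f differentiable (at x)" if "x \<notin> \<Union>(N ` Basis)" for x
      using that N(2) by (subst differentiable_componentwise_within) auto
  qed
qed

text \<open>The conjugate f of \<open>K\<close> has gradient \<open>J\<close>, so differentiability
  of \<open>J\<close> at s gives a second-order expansion of f. The paraboloid above
  \<open>K\<close> becomes one below f, which makes the Hessian of f at s positive definite, and
  Legendre duality returns an expansion of \<open>K\<close> with the inverse Hessian.\<close>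

lemma strongly_convex_second_order_expansion:
  fixes K :: "'a::euclidean_space \<Rightarrow> real"
  assumes sc: "\<And>z. \<exists>s. \<forall>y. K y \<ge> K z + s \<bullet> (y - z) + 1/2 * ((y - z) \<bullet> (y - z))"
    and J: "\<And>s y. K y \<ge> K (J s) + s \<bullet> (y - J s) + 1/4 * ((y - J s) \<bullet> (y - J s))"
    and Jlip: "\<And>s s'. norm (J s - J s') \<le> 2 * norm (s - s')"
    and above: "\<And>y. K y \<le> K z + s \<bullet> (y - z) + A/2 * ((y - z) \<bullet> (y - z))" and A: "A > 0"
    and Jd: "J differentiable (at s)"
  obtains M where "linear M" "\<And>x y. M x \<bullet> y = x \<bullet> M y"
    "\<And>\<epsilon>. \<epsilon> > 0 \<Longrightarrow> \<exists>\<delta>>0. \<forall>h. norm h < \<delta> \<longrightarrow> \<bar>K (z + h) - K z - s \<bullet> h - 1/2 * (h \<bullet> M h)\<bar> \<le> \<epsilon> * (h \<bullet> h)"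
proof -
  define f where "f = (\<lambda>s. s \<bullet> J s - K (J s))"
  have fenchel: "f t \<ge> t \<bullet> y - K y" for t y
  proof -
    have "K y \<ge> K (J t) + t \<bullet> (y - J t)" using J[of t y] inner_ge_zero[of "y - J t"] by linarith
    then show ?thesis by (simp add: f_def inner_diff_right)
  qed
  have J_eq: "J t = y" if "\<And>x. K x \<ge> K y + t \<bullet> (x - y)" for t y
  proof -
    have "K (J t) \<ge> K y + t \<bullet> (J t - y)" by (rule that)
    moreover have "t \<bullet> (J t - y) = - (t \<bullet> (y - J t))" by (simp add: inner_diff_right)
    ultimately have "(y - J t) \<bullet> (y - J t) \<le> 0" using J[of t y] by linarith
    then show ?thesis by (metis eq_iff_diff_eq_0 inner_eq_zero_iff inner_ge_zero antisym)
  qed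
  have sub_ex: "\<exists>t. J t = y" for y
    using sc[of y] J_eq by (metis add_increasing2 inner_ge_zero mult_nonneg_nonneg order.trans zero_le_divide_1_iff zero_le_numeral le_add_same_cancel1)
  have Js: "J s = z"
  proof -
    obtain t where t: "\<And>y. K y \<ge> K z + t \<bullet> (y - z) + 1/2 * ((y - z) \<bullet> (y - z))" using sc by metis
    have t': "K y \<ge> K z + t \<bullet> (y - z)" for y using t[of y] inner_ge_zero[of "y - z"] by linarith
    have "t - s = 0"
    proof (rule quadratic_le_zero)
      fix h show "(t - s) \<bullet> h \<le> A/2 * (h \<bullet> h)"
        using t'[of "z + h"] above[of "z + h"] by (simp add: inner_diff_left)
    qed
    then show ?thesis using J_eq[of z s] t' by simp
  qed
  have fs: "f s = s \<bullet> z - K z" by (simp add: f_def Js)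
  \<comment> \<open>Conjugation reverses the order: the paraboloid of opening A above
    \<open>K\<close> yields one of opening 1/A below f.\<close>
  have f_low: "f (s + \<sigma>) \<ge> f s + \<sigma> \<bullet> z + 1/(2*A) * (\<sigma> \<bullet> \<sigma>)" for \<sigma>
  proof -
    have "K (z + (1/A) *\<^sub>R \<sigma>) \<le> K z + (s \<bullet> \<sigma>)/A + 1/(2*A) * (\<sigma> \<bullet> \<sigma>)"
      using above[of "z + (1/A) *\<^sub>R \<sigma>"] A by (simp add: field_simps power2_eq_square)
    then show ?thesis using fenchel[of "s + \<sigma>" "z + (1/A) *\<^sub>R \<sigma>"] A
      by (simp add: fs inner_add_left inner_add_right inner_commute field_simps)
  qed
  have f_sub: "f t' \<ge> f t + (t' - t) \<bullet> J t" for t t'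
    using fenchel[of t' "J t"] by (simp add: f_def inner_diff_left)
  have f_der: "(f has_derivative (\<lambda>h. J t \<bullet> h)) (at t)" for t
  proof -
    have "((\<lambda>h. norm (f (t + h) - f t - J t \<bullet> h) / norm h) \<longlongrightarrow> 0) (at 0)"
    proof (rule Lim_null_comparison)
      show "((\<lambda>h. 2 * norm h) \<longlongrightarrow> 0) (at (0::'a))"
        using tendsto_mult_right_zero[OF tendsto_norm_zero[OF tendsto_ident_at[of "0::'a"]]] by simp
      have "norm (f (t + h) - f t - J t \<bullet> h) / norm h \<le> 2 * norm h" if "h \<noteq> 0" for h
      proof -
        have "f (t + h) - f t - J t \<bullet> h \<ge> 0" using f_sub[of t "t + h"] by (simp add: inner_commute)
        moreover have "f (t + h) - f t - J t \<bullet> h \<le> h \<bullet> (J (t + h) - J t)"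
          using f_sub[of "t + h" t] by (simp add: inner_diff_right inner_commute)
        moreover have "h \<bullet> (J (t + h) - J t) \<le> norm h * (2 * norm h)"
          using norm_cauchy_schwarz[of h "J (t + h) - J t"] mult_left_mono[OF Jlip[of "t + h" t] norm_ge_zero[of h]] by simp
        ultimately show ?thesis using that by (simp add: divide_le_eq mult_ac)
      qed
      then show "\<forall>\<^sub>F h in at 0. norm (norm (f (t + h) - f t - J t \<bullet> h) / norm h) \<le> 2 * norm h"
        by (auto simp: eventually_at_filter)
    qed
    then show ?thesis by (simp add: has_derivative_at bounded_linear_inner_right)
  qed
  obtain G where G: "(J has_derivative G) (at s)" using Jd by (auto simp: differentiable_def)
  then have linG: "linear G" using has_derivative_linear by blast
  \<comment> \<open>The derivative of \<open>J\<close> enters the expansion only through its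
    quadratic form, so its symmetric part will do.\<close>
  define H where "H = (\<lambda>x. (1/2) *\<^sub>R (G x + adjoint G x))"
  have linH: "linear H"
    unfolding H_def by (intro linear_compose_scale_right linear_compose_add linG adjoint_linear)
  have Hsym: "H x \<bullet> y = x \<bullet> H y" for x y
    by (simp add: H_def inner_add_left inner_add_right adjoint_works[OF linG] adjoint_clauses[OF linG])
  have HG: "x \<bullet> H x = x \<bullet> G x" for x
    using adjoint_works[OF linG, of x x] by (simp add: H_def inner_add_right inner_commute)
  have f_exp: "\<exists>\<delta>>0. \<forall>\<sigma>. norm \<sigma> < \<delta> \<longrightarrow> \<bar>f (s + \<sigma>) - f s - \<sigma> \<bullet> z - 1/2 * (\<sigma> \<bullet> H \<sigma>)\<bar> \<le> \<epsilon> * (\<sigma> \<bullet> \<sigma>)" if "\<epsilon> > 0" for \<epsilon>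
  proof -
    obtain \<delta> where \<delta>: "\<delta> > 0" "\<And>y. norm (y - s) < \<delta> \<Longrightarrow> norm (J y - J s - G (y - s)) \<le> \<epsilon> * norm (y - s)"
      using G \<open>\<epsilon> > 0\<close> unfolding has_derivative_at_alt by blast
    have "\<bar>f (s + \<sigma>) - f s - \<sigma> \<bullet> z - 1/2 * (\<sigma> \<bullet> H \<sigma>)\<bar> \<le> \<epsilon> * (\<sigma> \<bullet> \<sigma>)" if \<sigma>: "norm \<sigma> < \<delta>" for \<sigma>
    proof -
      define \<psi> where "\<psi> = (\<lambda>\<tau>::real. f (s + \<tau> *\<^sub>R \<sigma>) - \<tau> * (\<sigma> \<bullet> z) - \<tau>^2 / 2 * (\<sigma> \<bullet> G \<sigma>))"
      have d: "(\<psi> has_derivative (\<lambda>h. (J (s + \<tau> *\<^sub>R \<sigma>) \<bullet> \<sigma> - \<sigma> \<bullet> z - \<tau> * (\<sigma> \<bullet> G \<sigma>)) * h)) (at \<tau> within X)" for \<tau> X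
        unfolding \<psi>_def
        by (auto intro!: derivative_eq_intros has_derivative_compose[OF _ f_der, of _ _ _ _] simp: algebra_simps)
      have "\<exists>\<xi>\<in>{0<..<1}. \<psi> 1 - \<psi> 0 = (J (s + \<xi> *\<^sub>R \<sigma>) \<bullet> \<sigma> - \<sigma> \<bullet> z - \<xi> * (\<sigma> \<bullet> G \<sigma>)) * (1 - 0)"
        by (rule mvt_simple) (auto intro: d)
      then obtain \<xi> where \<xi>: "0 < \<xi>" "\<xi> < 1" "\<psi> 1 - \<psi> 0 = J (s + \<xi> *\<^sub>R \<sigma>) \<bullet> \<sigma> - \<sigma> \<bullet> z - \<xi> * (\<sigma> \<bullet> G \<sigma>)" by auto
      have "\<psi> 1 - \<psi> 0 = (J (s + \<xi> *\<^sub>R \<sigma>) - J s - G (\<xi> *\<^sub>R \<sigma>)) \<bullet> \<sigma>"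
        by (simp only: \<xi>(3) Js inner_diff_left linear_cmul[OF linG] inner_scaleR_left) (simp add: inner_commute)
      also have "\<bar>\<dots>\<bar> \<le> norm (J (s + \<xi> *\<^sub>R \<sigma>) - J s - G (\<xi> *\<^sub>R \<sigma>)) * norm \<sigma>" by (rule Cauchy_Schwarz_ineq2)
      also have "\<dots> \<le> (\<epsilon> * norm \<sigma>) * norm \<sigma>"
      proof (rule mult_right_mono)
        have le: "norm (\<xi> *\<^sub>R \<sigma>) \<le> norm \<sigma>" using \<xi> by (simp add: mult_left_le_one_le)
        have "norm (J (s + \<xi> *\<^sub>R \<sigma>) - J s - G (\<xi> *\<^sub>R \<sigma>)) \<le> \<epsilon> * norm (\<xi> *\<^sub>R \<sigma>)"
          using \<delta>(2)[of "s + \<xi> *\<^sub>R \<sigma>"] le \<sigma> by simp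
        also have "\<dots> \<le> \<epsilon> * norm \<sigma>" using le \<open>\<epsilon> > 0\<close> by (intro mult_left_mono) auto
        finally show "norm (J (s + \<xi> *\<^sub>R \<sigma>) - J s - G (\<xi> *\<^sub>R \<sigma>)) \<le> \<epsilon> * norm \<sigma>" .
      qed simp
      finally show ?thesis by (simp add: \<psi>_def HG dot_square_norm power2_eq_square algebra_simps)
    qed
    then show ?thesis using \<delta>(1) by blast
  qed
  have Hpos: "\<sigma> \<bullet> H \<sigma> \<ge> 1/(2*A) * (\<sigma> \<bullet> \<sigma>)" for \<sigma>
  proof (cases "\<sigma> = 0")
    case False
    obtain \<delta> where \<delta>: "\<delta> > 0" "\<And>\<sigma>. norm \<sigma> < \<delta> \<Longrightarrow> \<bar>f (s + \<sigma>) - f s - \<sigma> \<bullet> z - 1/2 * (\<sigma> \<bullet> H \<sigma>)\<bar> \<le> 1/(4*A) * (\<sigma> \<bullet> \<sigma>)"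
      using f_exp[of "1/(4*A)"] A by auto
    define \<tau> where "\<tau> = \<delta> / (2 * norm \<sigma>)"
    have "\<tau> > 0" "norm (\<tau> *\<^sub>R \<sigma>) < \<delta>" using \<delta>(1) False by (auto simp: \<tau>_def)
    define c where "c = 1/(4*A)"
    have c: "1/(2*A) = 2 * c" by (simp add: c_def)
    have "1/2 * ((\<tau> *\<^sub>R \<sigma>) \<bullet> H (\<tau> *\<^sub>R \<sigma>)) \<ge> c * ((\<tau> *\<^sub>R \<sigma>) \<bullet> (\<tau> *\<^sub>R \<sigma>))"
      using \<delta>(2)[OF \<open>norm (\<tau> *\<^sub>R \<sigma>) < \<delta>\<close>, folded c_def] f_low[of "\<tau> *\<^sub>R \<sigma>", unfolded c] by linarith
    then have "\<tau>^2 * (1/(2*A) * (\<sigma> \<bullet> \<sigma>)) \<le> \<tau>^2 * (\<sigma> \<bullet> H \<sigma>)"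
      unfolding c by (simp add: linear_cmul[OF linH] power2_eq_square algebra_simps)
    then show ?thesis using \<open>\<tau> > 0\<close> by (subst (asm) mult_le_cancel_left_pos) auto
  qed simp
  have "inj H"
  proof (rule linear_injective_0[OF linH, THEN iffD2], intro allI impI)
    fix x assume "H x = 0"
    then have "1/(2*A) * (x \<bullet> x) \<le> 0" using Hpos[of x] by simp
    then have "x \<bullet> x \<le> 0" using A by (simp add: divide_le_eq)
    then show "x = 0" using inner_ge_zero[of x] by (simp add: antisym)
  qed
  then obtain M where M: "linear M" "\<And>x. M (H x) = x" "\<And>x. H (M x) = x"
    using linear_injective_isomorphism[OF linH] by metis
  have Msym: "M x \<bullet> y = x \<bullet> M y" for x y
    using Hsym[of "M x" "M y"] by (simp add: M(3))
  have Mb: "norm (M x) \<le> 2 * A * norm x" for x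
  proof -
    have "1/(2*A) * (M x \<bullet> M x) \<le> norm (M x) * norm x"
      using Hpos[of "M x"] norm_cauchy_schwarz[of "M x" x] by (simp add: M(3))
    then have "norm (M x) * norm (M x) \<le> norm (M x) * (2 * A * norm x)"
      using A by (simp add: dot_square_norm power2_eq_square field_simps)
    then show ?thesis by (cases "M x = 0") (use A in auto)
  qed
  have K_exp: "\<exists>\<delta>>0. \<forall>h. norm h < \<delta> \<longrightarrow> \<bar>K (z + h) - K z - s \<bullet> h - 1/2 * (h \<bullet> M h)\<bar> \<le> \<epsilon> * (h \<bullet> h)" if "\<epsilon> > 0" for \<epsilon>
  proof -
    \<comment> \<open>The dual increments satisfy |\<sigma>| \<le> 2 A |h|, which turns an error
      \<epsilon>' |\<sigma>|^2 into \<epsilon> |h|^2.\<close>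
    define \<epsilon>' where "\<epsilon>' = \<epsilon> / (4 * A^2)"
    have e': "\<epsilon>' > 0" using A \<open>\<epsilon> > 0\<close> by (simp add: \<epsilon>'_def)
    have bound: "\<epsilon>' * (\<sigma> \<bullet> \<sigma>) \<le> \<epsilon> * (h \<bullet> h)" if "norm \<sigma> \<le> 2 * A * norm h" for \<sigma> h :: 'a
    proof -
      have "(norm \<sigma>)^2 \<le> (2 * A * norm h)^2" using that by (intro power_mono) auto
      then have "\<epsilon>' * (norm \<sigma>)^2 \<le> \<epsilon>' * (2 * A * norm h)^2" using e' by (intro mult_left_mono) auto
      also have "\<dots> = \<epsilon> * (norm h)^2" using A by (simp add: \<epsilon>'_def power_mult_distrib)
      finally show ?thesis by (simp add: dot_square_norm)
    qed
    obtain \<delta> where \<delta>: "\<delta> > 0" "\<And>\<sigma>. norm \<sigma> < \<delta> \<Longrightarrow> \<bar>f (s + \<sigma>) - f s - \<sigma> \<bullet> z - 1/2 * (\<sigma> \<bullet> H \<sigma>)\<bar> \<le> \<epsilon>' * (\<sigma> \<bullet> \<sigma>)"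
      using f_exp[OF e'] by blast
    have "\<bar>K (z + h) - K z - s \<bullet> h - 1/2 * (h \<bullet> M h)\<bar> \<le> \<epsilon> * (h \<bullet> h)" if h: "norm h < \<delta> / (2 * A)" for h
    proof -
      have small: "norm \<sigma> < \<delta>" if "norm \<sigma> \<le> 2 * A * norm h" for \<sigma> :: 'a
        using that h A by (simp add: field_simps)
      \<comment> \<open>Lower bound: Fenchel's inequality at the slope s + M h. For the upper bound
        below, a slope t with J t = z + h gives equality in Fenchel's inequality.\<close>
      have "K (z + h) \<ge> (s + M h) \<bullet> (z + h) - f (s + M h)" using fenchel[of "s + M h" "z + h"] by simp
      moreover have "\<bar>f (s + M h) - f s - M h \<bullet> z - 1/2 * (M h \<bullet> h)\<bar> \<le> \<epsilon> * (h \<bullet> h)"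
        using \<delta>(2)[OF small[OF Mb]] bound[OF Mb[of h]] by (simp add: M(3))
      ultimately have lower: "K (z + h) - K z - s \<bullet> h - 1/2 * (h \<bullet> M h) \<ge> - (\<epsilon> * (h \<bullet> h))"
        by (simp add: fs inner_add_left inner_add_right inner_commute abs_le_iff)
      obtain t where t: "J t = z + h" using sub_ex by blast
      define \<sigma> where "\<sigma> = t - s"
      have ft: "K (z + h) = t \<bullet> (z + h) - f t" by (simp add: f_def t)
      have "1/(2*A) * (\<sigma> \<bullet> \<sigma>) \<le> \<sigma> \<bullet> h"
        using f_low[of \<sigma>] f_sub[of t s] by (simp add: \<sigma>_def t inner_add_right inner_diff_left)
      also have "\<dots> \<le> norm \<sigma> * norm h" by (rule norm_cauchy_schwarz)
      finally have "norm \<sigma> * norm \<sigma> \<le> norm \<sigma> * (2 * A * norm h)"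
        using A by (simp add: dot_square_norm power2_eq_square field_simps)
      then have nb: "norm \<sigma> \<le> 2 * A * norm h" by (cases "\<sigma> = 0") (use A in auto)
      have "\<bar>f t - f s - \<sigma> \<bullet> z - 1/2 * (\<sigma> \<bullet> H \<sigma>)\<bar> \<le> \<epsilon> * (h \<bullet> h)"
        using \<delta>(2)[OF small[OF nb]] bound[OF nb] by (simp add: \<sigma>_def)
      moreover have "\<sigma> \<bullet> h - 1/2 * (\<sigma> \<bullet> H \<sigma>) \<le> 1/2 * (h \<bullet> M h)"
      proof -
        have "0 \<le> (\<sigma> - M h) \<bullet> H (\<sigma> - M h)"
          using Hpos[of "\<sigma> - M h"] A inner_ge_zero[of "\<sigma> - M h"] by (meson order.trans mult_nonneg_nonneg divide_nonneg_pos zero_le_one mult_pos_pos zero_less_numeral)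
        also have "\<dots> = \<sigma> \<bullet> H \<sigma> - 2 * (\<sigma> \<bullet> h) + h \<bullet> M h"
          using Hsym[of "M h" \<sigma>] by (simp add: linear_diff[OF linH] M(3) inner_diff_left inner_diff_right inner_commute)
        finally show ?thesis by simp
      qed
      moreover have "K (z + h) = s \<bullet> z + s \<bullet> h + \<sigma> \<bullet> z + \<sigma> \<bullet> h - f t"
        by (simp add: ft \<sigma>_def inner_add_right inner_diff_left)
      ultimately have "K (z + h) - K z - s \<bullet> h - 1/2 * (h \<bullet> M h) \<le> \<epsilon> * (h \<bullet> h)"
        using fs by linarith
      with lower show ?thesis by linarith
    qed
    moreover have "\<delta> / (2 * A) > 0" using \<delta>(1) A by simp
    ultimately show ?thesis by blast
  qed
  from that[OF M(1) Msym K_exp] show ?thesis .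
qed

text \<open>Jensen's lemma and Alexandrov's theorem at once: the slopes at which the maximum point of a perturbed
  semiconvex function fails to have a second-order expansion form a Lipschitz image of a null set.\<close>

lemma semiconvex_max_second_order:
  fixes w :: "'a::euclidean_space \<Rightarrow> real"
  assumes semi: "\<And>z. \<exists>s. \<forall>y. w y \<ge> w z + s \<bullet> (y - z) - \<Lambda>/2 * ((y - z) \<bullet> (y - z))" and \<Lambda>: "\<Lambda> \<ge> 0"
    and w0: "w 0 = 0" and up: "\<And>z. w z \<le> - \<kappa> * (z \<bullet> z)" and \<kappa>: "\<kappa> > 0" and \<eta>: "\<eta> > 0"
  obtains z p D where "norm z \<le> \<eta>" "norm p \<le> \<eta>" "\<And>y. w y \<le> w z + p \<bullet> (y - z)"
    "linear D" "\<And>x y. D x \<bullet> y = x \<bullet> D y" "\<And>h. h \<bullet> D h \<le> 0"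
    "\<And>\<epsilon>. \<epsilon> > 0 \<Longrightarrow> \<exists>\<delta>>0. \<forall>h. norm h < \<delta> \<longrightarrow> \<bar>w (z + h) - w z - p \<bullet> h - 1/2 * (h \<bullet> D h)\<bar> \<le> \<epsilon> * (h \<bullet> h)"
proof -
  \<comment> \<open>One more than the semiconvexity constant, so that \<open>K\<close> is strongly
    convex with modulus 1.\<close>
  define A where "A = \<Lambda> + 1"
  have A: "A > 0" using \<Lambda> by (simp add: A_def)
  define K where "K = (\<lambda>z. w z + A/2 * (z \<bullet> z))"
  have sq: "y \<bullet> y = z \<bullet> z + 2 * (z \<bullet> (y - z)) + (y - z) \<bullet> (y - z)" for y z :: 'a
    by (simp add: inner_diff_left inner_diff_right inner_commute)
  have sc: "\<exists>s. \<forall>y. K y \<ge> K z + s \<bullet> (y - z) + 1/2 * ((y - z) \<bullet> (y - z))" for z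
  proof -
    obtain s where s: "\<And>y. w y \<ge> w z + s \<bullet> (y - z) - \<Lambda>/2 * ((y - z) \<bullet> (y - z))" using semi by metis
    have "K y \<ge> K z + (s + A *\<^sub>R z) \<bullet> (y - z) + 1/2 * ((y - z) \<bullet> (y - z))" for y
      using s[of y] unfolding K_def sq[of y z]
      by (simp add: A_def inner_add_left distrib_left distrib_right add_divide_distrib)
    then show ?thesis by blast
  qed
  obtain J where contK: "continuous_on UNIV K"
    and J: "\<And>s y. K y \<ge> K (J s) + s \<bullet> (y - J s) + 1/4 * ((y - J s) \<bullet> (y - J s))"
    and Jlip: "\<And>s s'. norm (J s - J s') \<le> 2 * norm (s - s')"
    using strongly_convex_conjugate[OF sc] by metis
  obtain N where N: "negligible N" "\<And>s. s \<notin> N \<Longrightarrow> J differentiable (at s)"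
    using lipschitz_vector_ae_differentiable[OF Jlip] by metis
  \<comment> \<open>At a maximum point z of w - p . y the function \<open>K\<close> has slope s = p
    + A z, and z = J s; so p = T s. A slope p outside the null set T(N) therefore comes from a point
    s at which \<open>J\<close> is differentiable.\<close>
  define T where "T = (\<lambda>s. s - A *\<^sub>R J s)"
  have "norm (T s - T s') \<le> (1 + 2 * A) * norm (s - s')" for s s'
  proof -
    have "T s - T s' = (s - s') - A *\<^sub>R (J s - J s')" by (simp add: T_def algebra_simps)
    then have "norm (T s - T s') \<le> norm (s - s') + A * norm (J s - J s')"
      using norm_triangle_ineq4[of "s - s'" "A *\<^sub>R (J s - J s')"] A by simp
    also have "A * norm (J s - J s') \<le> A * (2 * norm (s - s'))" using Jlip A by (intro mult_left_mono) auto
    finally show ?thesis by (simp add: algebra_simps)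
  qed
  then have TN: "negligible (T ` N)"
    using N(1) by (intro negligible_locally_Lipschitz_image) (auto intro!: exI[of _ UNIV] exI[of _ "1 + 2 * A"])
  \<comment> \<open>Since w lies below - \<kappa> |z|^2, a slope with |p| < \<kappa> \<eta> keeps
    the maximum of w - p . y within distance \<eta> of 0.\<close>
  define r where "r = min \<eta> (\<kappa> * \<eta>)"
  have r: "r > 0" using \<kappa> \<eta> by (simp add: r_def)
  have "\<not> ball 0 r \<subseteq> T ` N"
  proof
    assume "ball 0 r \<subseteq> T ` N"
    then have "negligible (ball (0::'a) r)" using TN negligible_subset by blast
    moreover have "\<not> negligible (ball (0::'a) r)" by (rule open_not_negligible) (use r in auto)
    ultimately show False by blast
  qed
  then obtain p where p: "norm p < r" "p \<notin> T ` N" by (auto simp: subset_iff)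
  have contw: "continuous_on UNIV w"
  proof -
    have "continuous_on UNIV (\<lambda>z. K z - A/2 * (z \<bullet> z))" by (intro continuous_intros contK)
    then show ?thesis by (simp add: K_def)
  qed
  have far: "w y - p \<bullet> y < 0" if "norm y > \<eta>" for y
  proof -
    have "- (p \<bullet> y) \<le> norm p * norm y" using Cauchy_Schwarz_ineq2[of p y] by (simp add: abs_le_iff)
    also have "\<dots> < (\<kappa> * norm y) * norm y"
    proof (rule mult_strict_right_mono)
      have "norm p < \<kappa> * \<eta>" using p by (simp add: r_def)
      also have "\<dots> \<le> \<kappa> * norm y" using that \<kappa> by (intro mult_left_mono) auto
      finally show "norm p < \<kappa> * norm y" .
      show "0 < norm y" using that \<eta> by linarith
    qed
    finally show ?thesis using up[of y] by (simp add: dot_square_norm power2_eq_square)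
  qed
  have "continuous_on (cball 0 \<eta>) (\<lambda>y. w y - p \<bullet> y)"
    by (intro continuous_intros continuous_on_subset[OF contw]) auto
  then obtain z where z: "z \<in> cball 0 \<eta>" "\<And>y. y \<in> cball 0 \<eta> \<Longrightarrow> w y - p \<bullet> y \<le> w z - p \<bullet> z"
    using continuous_attains_sup[OF compact_cball, of 0 \<eta> "\<lambda>y. w y - p \<bullet> y"] \<eta> by auto
  have max: "w y \<le> w z + p \<bullet> (y - z)" for y
  proof (cases "y \<in> cball 0 \<eta>")
    case True then show ?thesis using z(2)[of y] by (simp add: inner_diff_right)
  next
    case False
    then have "w y - p \<bullet> y < 0" by (intro far) simp
    also have "0 \<le> w z - p \<bullet> z" using z(2)[of 0] \<eta> w0 by simp
    finally show ?thesis by (simp add: inner_diff_right)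
  qed
  define s where "s = p + A *\<^sub>R z"
  have above: "K y \<le> K z + s \<bullet> (y - z) + A/2 * ((y - z) \<bullet> (y - z))" for y
    using max[of y] unfolding K_def sq[of y z] s_def by (simp add: inner_add_left distrib_left)
  have "J s = z"
  proof -
    obtain t where t: "\<And>y. K y \<ge> K z + t \<bullet> (y - z) + 1/2 * ((y - z) \<bullet> (y - z))" using sc by metis
    have t': "K y \<ge> K z + t \<bullet> (y - z)" for y using t[of y] inner_ge_zero[of "y - z"] by linarith
    have "t - s = 0"
    proof (rule quadratic_le_zero)
      fix h show "(t - s) \<bullet> h \<le> A/2 * (h \<bullet> h)"
        using t'[of "z + h"] above[of "z + h"] by (simp add: inner_diff_left)
    qed
    then have "K (J s) \<ge> K z + s \<bullet> (J s - z)" using t' by simp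
    moreover have "s \<bullet> (J s - z) = - (s \<bullet> (z - J s))" by (simp add: inner_diff_right)
    ultimately have "(z - J s) \<bullet> (z - J s) \<le> 0" using J[of s z] by linarith
    then show ?thesis by (metis eq_iff_diff_eq_0 inner_eq_zero_iff inner_ge_zero antisym)
  qed
  then have "T s = p" by (simp add: T_def s_def)
  then have "s \<notin> N" using p(2) by blast
  obtain M where M: "linear M" "\<And>x y. M x \<bullet> y = x \<bullet> M y"
    "\<And>\<epsilon>. \<epsilon> > 0 \<Longrightarrow> \<exists>\<delta>>0. \<forall>h. norm h < \<delta> \<longrightarrow> \<bar>K (z + h) - K z - s \<bullet> h - 1/2 * (h \<bullet> M h)\<bar> \<le> \<epsilon> * (h \<bullet> h)"
    using strongly_convex_second_order_expansion[OF sc J Jlip above A N(2)[OF \<open>s \<notin> N\<close>]] by metis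
  define D where "D = (\<lambda>x. M x - A *\<^sub>R x)"
  have linD: "linear D" unfolding D_def by (intro linear_compose_sub M(1) linear_scaleR)
  have Dsym: "D x \<bullet> y = x \<bullet> D y" for x y
    by (simp add: D_def inner_diff_left inner_diff_right M(2))
  have exp: "\<exists>\<delta>>0. \<forall>h. norm h < \<delta> \<longrightarrow> \<bar>w (z + h) - w z - p \<bullet> h - 1/2 * (h \<bullet> D h)\<bar> \<le> \<epsilon> * (h \<bullet> h)" if "\<epsilon> > 0" for \<epsilon>
  proof -
    have "w (z + h) - w z - p \<bullet> h - 1/2 * (h \<bullet> D h) = K (z + h) - K z - s \<bullet> h - 1/2 * (h \<bullet> M h)" for h
      using sq[of "z + h" z] by (simp add: K_def s_def D_def inner_add_left inner_diff_right algebra_simps)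
    then show ?thesis using M(3)[OF that] by simp
  qed
  have "h \<bullet> D h \<le> 0" for h
  proof (rule ccontr)
    assume "\<not> h \<bullet> D h \<le> 0"
    then have pos: "h \<bullet> D h > 0" by simp
    then have h0: "h \<noteq> 0" by auto
    define \<epsilon> where "\<epsilon> = (h \<bullet> D h) / (4 * (h \<bullet> h))"
    have "\<epsilon> > 0" using pos h0 by (simp add: \<epsilon>_def)
    then obtain \<delta> where \<delta>: "\<delta> > 0" "\<And>h. norm h < \<delta> \<Longrightarrow> \<bar>w (z + h) - w z - p \<bullet> h - 1/2 * (h \<bullet> D h)\<bar> \<le> \<epsilon> * (h \<bullet> h)"
      using exp by metis
    define \<tau> where "\<tau> = \<delta> / (2 * norm h)"
    have \<tau>: "\<tau> > 0" "norm (\<tau> *\<^sub>R h) < \<delta>" using \<delta>(1) h0 by (auto simp: \<tau>_def)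
    have "w (z + \<tau> *\<^sub>R h) \<le> w z + p \<bullet> (\<tau> *\<^sub>R h)" using max[of "z + \<tau> *\<^sub>R h"] by simp
    then have "1/2 * ((\<tau> *\<^sub>R h) \<bullet> D (\<tau> *\<^sub>R h)) \<le> \<epsilon> * ((\<tau> *\<^sub>R h) \<bullet> (\<tau> *\<^sub>R h))"
      using \<delta>(2)[OF \<tau>(2)] by linarith
    then have "\<tau>^2 * (1/2 * (h \<bullet> D h)) \<le> \<tau>^2 * (\<epsilon> * (h \<bullet> h))"
      by (simp add: linear_cmul[OF linD] power2_eq_square algebra_simps)
    then have "1/2 * (h \<bullet> D h) \<le> \<epsilon> * (h \<bullet> h)" using \<tau>(1) by (subst (asm) mult_le_cancel_left_pos) auto
    also have "\<dots> = (h \<bullet> D h) / 4" using h0 by (simp add: \<epsilon>_def)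
    finally show False using pos by simp
  qed
  moreover have "norm z \<le> \<eta>" "norm p \<le> \<eta>" using z(1) p(1) by (auto simp: r_def)
  ultimately show ?thesis using that[of z p D] max linD Dsym exp by blast
qed

section \<open>The theorem on sums\<close>

lemma local_linear_le_quadratic:
  fixes a :: "'a::real_inner"
  assumes "\<delta> > 0" and le: "\<And>h. norm h < \<delta> \<Longrightarrow> a \<bullet> h \<le> C * (h \<bullet> h)"
  shows "a = 0"
proof (rule ccontr)
  assume a: "a \<noteq> 0"
  define \<tau> where "\<tau> = min (1 / (2 * (\<bar>C\<bar> + 1))) (\<delta> / (2 * norm a))"
  have t: "\<tau> > 0" using a \<open>\<delta> > 0\<close> by (simp add: \<tau>_def)
  have "\<tau> * norm a \<le> \<delta> / 2"
    using a mult_right_mono[of \<tau> "\<delta> / (2 * norm a)" "norm a"] by (simp add: \<tau>_def)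
  then have "norm (\<tau> *\<^sub>R a) < \<delta>" using t \<open>\<delta> > 0\<close> by simp
  from le[OF this] have "\<tau> * (a \<bullet> a) \<le> (C * \<tau>) * (\<tau> * (a \<bullet> a))" by (simp add: algebra_simps)
  moreover have "C * \<tau> \<le> 1/2"
  proof -
    have "C * \<tau> \<le> (\<bar>C\<bar> + 1) * \<tau>" using t by (intro mult_right_mono) auto
    also have "\<dots> \<le> (\<bar>C\<bar> + 1) * (1 / (2 * (\<bar>C\<bar> + 1)))" by (intro mult_left_mono) (auto simp: \<tau>_def)
    also have "\<dots> = 1/2" by (simp add: field_simps)
    finally show ?thesis .
  qed
  then have "(C * \<tau>) * (\<tau> * (a \<bullet> a)) \<le> 1/2 * (\<tau> * (a \<bullet> a))" using t by (intro mult_right_mono) auto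
  moreover have "\<tau> * (a \<bullet> a) > 0" using t a by simp
  ultimately show False by linarith
qed

lemma local_quadratic_nonneg:
  fixes E :: "'a::real_inner \<Rightarrow> 'a"
  assumes "linear E" and loc: "\<And>\<epsilon>. \<epsilon> > 0 \<Longrightarrow> \<exists>\<delta>>0. \<forall>h. norm h < \<delta> \<longrightarrow> - \<epsilon> * (h \<bullet> h) \<le> h \<bullet> E h"
  shows "0 \<le> h \<bullet> E h"
proof (rule ccontr)
  assume "\<not> 0 \<le> h \<bullet> E h"
  then have neg: "h \<bullet> E h < 0" by simp
  then have h0: "h \<noteq> 0" by auto
  define \<epsilon> where "\<epsilon> = - (h \<bullet> E h) / (2 * (h \<bullet> h))"
  have "\<epsilon> > 0" using neg h0 by (simp add: \<epsilon>_def divide_neg_pos)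
  then obtain \<delta> where \<delta>: "\<delta> > 0" "\<And>h. norm h < \<delta> \<Longrightarrow> - \<epsilon> * (h \<bullet> h) \<le> h \<bullet> E h" using loc by metis
  define \<tau> where "\<tau> = \<delta> / (2 * norm h)"
  have \<tau>: "\<tau> > 0" "norm (\<tau> *\<^sub>R h) < \<delta>" using \<delta>(1) h0 by (auto simp: \<tau>_def)
  have "\<tau>^2 * (- \<epsilon> * (h \<bullet> h)) \<le> \<tau>^2 * (h \<bullet> E h)"
    using \<delta>(2)[OF \<tau>(2)] by (simp add: linear_cmul[OF assms(1)] power2_eq_square algebra_simps)
  then have "- \<epsilon> * (h \<bullet> h) \<le> h \<bullet> E h" using \<tau>(1) by (subst (asm) mult_le_cancel_left_pos) auto
  then show False using neg h0 by (simp add: \<epsilon>_def)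
qed

lemma sup_convolution_exists:
  fixes a :: "'a::euclidean_space \<Rightarrow> real"
  assumes "continuous_on (cball 0 \<rho>) a" "\<rho> > 0"
  obtains \<alpha> where "\<And>x. \<alpha> x \<in> cball 0 \<rho>"
    "\<And>x \<xi>. \<xi> \<in> cball 0 \<rho> \<Longrightarrow> a \<xi> - \<mu> * ((x - \<xi>) \<bullet> (x - \<xi>)) \<le> a (\<alpha> x) - \<mu> * ((x - \<alpha> x) \<bullet> (x - \<alpha> x))"
proof -
  have "\<exists>z\<in>cball 0 \<rho>. \<forall>\<xi>\<in>cball 0 \<rho>. a \<xi> - \<mu> * ((x - \<xi>) \<bullet> (x - \<xi>)) \<le> a z - \<mu> * ((x - z) \<bullet> (x - z))" for x
    using assms(2) by (intro continuous_attains_sup compact_cball continuous_intros assms(1)) auto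
  then show ?thesis using that by metis
qed

text \<open>Sup-convolution makes a and b semiconvex and keeps a quadratic bound for their sum, with
  Z replaced by V = Z + 2 \<theta> Z^2. The lemma on maxima of semiconvex functions then supplies a
  second-order expansion in the product space, and upper expansions are carried back from the
  sup-convolutions to a and b.\<close>

theorem theorem_on_sums_at_zero:
  fixes a b :: "'a::euclidean_space \<Rightarrow> real" and Z :: "'a \<Rightarrow> 'a"
  assumes Z: "linear Z" "\<And>x y. Z x \<bullet> y = x \<bullet> Z y" "\<And>x. norm (Z x) \<le> \<zeta> * norm x" and \<zeta>: "\<zeta> \<ge> 0"
    and cont: "continuous_on (cball 0 \<rho>) a" "continuous_on (cball 0 \<rho>) b" and \<rho>: "\<rho> > 0"
    and zero: "a 0 = 0" "b 0 = 0"
    and max: "\<And>\<xi> \<eta>. \<xi> \<in> cball 0 \<rho> \<Longrightarrow> \<eta> \<in> cball 0 \<rho> \<Longrightarrow> a \<xi> + b \<eta> \<le> 1/2 * ((\<xi> - \<eta>) \<bullet> Z (\<xi> - \<eta>))"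
    and \<theta>: "\<theta> > 0" and \<kappa>: "\<kappa> > 0" and \<epsilon>: "\<epsilon> > 0"
  obtains x y p q X Y where "norm x < \<epsilon>" "norm y < \<epsilon>" "norm p < \<epsilon>" "norm q < \<epsilon>"
    "linear X" "\<And>x y. X x \<bullet> y = x \<bullet> X y" "linear Y" "\<And>x y. Y x \<bullet> y = x \<bullet> Y y"
    "\<And>e. e > 0 \<Longrightarrow> \<exists>\<delta>>0. \<forall>h. norm h < \<delta> \<longrightarrow> a (x + h) \<le> a x + p \<bullet> h + 1/2 * (h \<bullet> X h) + e * (h \<bullet> h)"
    "\<And>e. e > 0 \<Longrightarrow> \<exists>\<delta>>0. \<forall>h. norm h < \<delta> \<longrightarrow> b (y + h) \<le> b y - q \<bullet> h - 1/2 * (h \<bullet> Y h) + e * (h \<bullet> h)"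
    "\<And>\<xi> \<eta>. \<xi> \<bullet> X \<xi> - \<eta> \<bullet> Y \<eta> \<le> (\<xi> - \<eta>) \<bullet> Z (\<xi> - \<eta>) + 2 * \<theta> * (Z (\<xi> - \<eta>) \<bullet> Z (\<xi> - \<eta>)) + \<kappa> * (\<xi> \<bullet> \<xi> + \<eta> \<bullet> \<eta>)"
    "\<And>\<xi>. \<xi> \<bullet> X \<xi> \<ge> - (1/\<theta> + 2 * \<zeta>) * (\<xi> \<bullet> \<xi>)"
    "\<And>\<eta>. \<eta> \<bullet> Y \<eta> \<le> (1/\<theta> + 2 * \<zeta>) * (\<eta> \<bullet> \<eta>)"
proof -
  \<comment> \<open>Chosen so that the displacement error (1/(4 \<theta>) + \<zeta>/2) |k|^2 in
    \<open>sum_le\<close> is lam/4 |k|^2, which the penalties of the two sup-convolutions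
    absorb.\<close>
  define lam where "lam = 1/\<theta> + 2 * \<zeta>"
  have lam: "lam > 0" using \<theta> \<zeta> by (simp add: lam_def add_pos_nonneg)
  obtain \<alpha> where \<alpha>: "\<And>x. \<alpha> x \<in> cball 0 \<rho>"
    "\<And>x \<xi>. \<xi> \<in> cball 0 \<rho> \<Longrightarrow> a \<xi> - lam/2 * ((x - \<xi>) \<bullet> (x - \<xi>)) \<le> a (\<alpha> x) - lam/2 * ((x - \<alpha> x) \<bullet> (x - \<alpha> x))"
    using sup_convolution_exists[OF cont(1) \<rho>] by metis
  obtain \<beta> where \<beta>: "\<And>x. \<beta> x \<in> cball 0 \<rho>"
    "\<And>x \<xi>. \<xi> \<in> cball 0 \<rho> \<Longrightarrow> b \<xi> - lam/2 * ((x - \<xi>) \<bullet> (x - \<xi>)) \<le> b (\<beta> x) - lam/2 * ((x - \<beta> x) \<bullet> (x - \<beta> x))"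
    using sup_convolution_exists[OF cont(2) \<rho>] by metis
  define ah where "ah = (\<lambda>x. a (\<alpha> x) - lam/2 * ((x - \<alpha> x) \<bullet> (x - \<alpha> x)))"
  define bh where "bh = (\<lambda>x. b (\<beta> x) - lam/2 * ((x - \<beta> x) \<bullet> (x - \<beta> x)))"
  have sq: "(y - c) \<bullet> (y - c) = (x - c) \<bullet> (x - c) - 2 * ((c - x) \<bullet> (y - x)) + (y - x) \<bullet> (y - x)" for x y c :: 'a
    by (simp add: inner_diff_left inner_diff_right inner_commute)
  have ah_semi: "ah y \<ge> ah x + (lam *\<^sub>R (\<alpha> x - x)) \<bullet> (y - x) - lam/2 * ((y - x) \<bullet> (y - x))" for x y
    using \<alpha>(2)[OF \<alpha>(1), of x y] unfolding ah_def sq[of y "\<alpha> x" x] by (simp add: algebra_simps)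
  have bh_semi: "bh y \<ge> bh x + (lam *\<^sub>R (\<beta> x - x)) \<bullet> (y - x) - lam/2 * ((y - x) \<bullet> (y - x))" for x y
    using \<beta>(2)[OF \<beta>(1), of x y] unfolding bh_def sq[of y "\<beta> x" x] by (simp add: algebra_simps)
  have zero_mem: "0 \<in> cball (0::'a) \<rho>" using \<rho> by simp
  have h0: "ah 0 \<ge> 0" "bh 0 \<ge> 0"
    using \<alpha>(2)[OF zero_mem, of 0] \<beta>(2)[OF zero_mem, of 0] zero by (simp_all add: ah_def bh_def)
  define V where "V = (\<lambda>e. Z e + (2 * \<theta>) *\<^sub>R Z (Z e))"
  have linV: "linear V"
    unfolding V_def by (intro linear_compose_add linear_compose_scale_right Z(1) linear_compose[OF Z(1) Z(1), unfolded o_def])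
  have Vsym: "V x \<bullet> y = x \<bullet> V y" for x y by (simp add: V_def inner_add_left inner_add_right Z(2))
  have V_eq: "e \<bullet> V e = e \<bullet> Z e + 2 * \<theta> * (Z e \<bullet> Z e)" for e
    by (simp add: V_def inner_add_right Z(2))
  have sum_le: "ah x + bh y \<le> 1/2 * ((x - y) \<bullet> V (x - y))" for x y
  proof -
    define e where "e = x - y"
    define u1 where "u1 = \<alpha> x - x"
    define u2 where "u2 = \<beta> y - y"
    define k where "k = u1 - u2"
    have d: "\<alpha> x - \<beta> y = e + k" by (simp add: e_def k_def u1_def u2_def)
    have "a (\<alpha> x) + b (\<beta> y) \<le> 1/2 * ((e + k) \<bullet> Z (e + k))"
      using max[OF \<alpha>(1) \<beta>(1), of x y] by (simp only: d)
    also have "\<dots> = 1/2 * (e \<bullet> Z e) + Z e \<bullet> k + 1/2 * (k \<bullet> Z k)"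
      using Z(2)[of e k] by (simp add: linear_add[OF Z(1)] inner_add_left inner_add_right inner_commute algebra_simps)
    also have "Z e \<bullet> k \<le> \<theta> * (Z e \<bullet> Z e) + 1/(4*\<theta>) * (k \<bullet> k)"
    proof -
      have "0 \<le> ((2 * \<theta>) *\<^sub>R Z e - k) \<bullet> ((2 * \<theta>) *\<^sub>R Z e - k)" by (rule inner_ge_zero)
      then have "4 * \<theta> * (Z e \<bullet> k) \<le> 4 * \<theta> * (\<theta> * (Z e \<bullet> Z e)) + k \<bullet> k"
        by (simp add: inner_diff_left inner_diff_right inner_commute algebra_simps)
      then have "4 * \<theta> * (Z e \<bullet> k) \<le> 4 * \<theta> * (\<theta> * (Z e \<bullet> Z e) + 1/(4*\<theta>) * (k \<bullet> k))"
        using \<theta> by (simp add: distrib_left)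
      then show ?thesis using \<theta> by (subst (asm) mult_le_cancel_left_pos) auto
    qed
    also have "k \<bullet> Z k \<le> \<zeta> * (k \<bullet> k)"
      using norm_cauchy_schwarz[of k "Z k"] mult_left_mono[OF Z(3)[of k] norm_ge_zero[of k]]
      by (simp add: dot_square_norm power2_eq_square mult_ac)
    also have "1/2 * (e \<bullet> Z e) + (\<theta> * (Z e \<bullet> Z e) + 1/(4*\<theta>) * (k \<bullet> k)) + 1/2 * (\<zeta> * (k \<bullet> k))
       = 1/2 * (e \<bullet> V e) + lam/4 * (k \<bullet> k)"
      using \<theta> by (simp add: V_eq lam_def field_simps)
    also have "lam/4 * (k \<bullet> k) \<le> lam/4 * (2 * (u1 \<bullet> u1 + u2 \<bullet> u2))"
    proof (rule mult_left_mono)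
      have "0 \<le> (u1 + u2) \<bullet> (u1 + u2)" by (rule inner_ge_zero)
      then show "k \<bullet> k \<le> 2 * (u1 \<bullet> u1 + u2 \<bullet> u2)"
        by (simp add: k_def inner_diff_left inner_diff_right inner_add_left inner_add_right inner_commute)
    qed (use lam in simp)
    finally have "a (\<alpha> x) + b (\<beta> y) - lam/2 * (u1 \<bullet> u1) - lam/2 * (u2 \<bullet> u2) \<le> 1/2 * (e \<bullet> V e)"
      by (simp add: algebra_simps)
    moreover have "u1 \<bullet> u1 = (x - \<alpha> x) \<bullet> (x - \<alpha> x)" "u2 \<bullet> u2 = (y - \<beta> y) \<bullet> (y - \<beta> y)"
      by (simp_all add: u1_def u2_def inner_diff_left inner_diff_right)
    ultimately show ?thesis by (simp add: ah_def bh_def e_def)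
  qed
  \<comment> \<open>The block matrix with V on the diagonal and -V off it, plus \<kappa> times the
    identity. The \<kappa> makes 0 a strict maximum with a quadratic gap, as the lemma on semiconvex
    maxima requires.\<close>
  define B where "B = (\<lambda>z::'a\<times>'a. (V (fst z - snd z) + \<kappa> *\<^sub>R fst z, - V (fst z - snd z) + \<kappa> *\<^sub>R snd z))"
  have linB: "linear B"
    by (rule linearI) (simp_all add: B_def linear_diff[OF linV] linear_add[OF linV] linear_cmul[OF linV] algebra_simps)
  have Bsym: "B z \<bullet> z' = z \<bullet> B z'" for z z'
    using Vsym[of "fst z - snd z" "fst z' - snd z'"]
    by (simp add: B_def inner_prod_def inner_diff_left inner_diff_right inner_add_left inner_add_right algebra_simps)
  have B_eq: "z \<bullet> B z = (fst z - snd z) \<bullet> V (fst z - snd z) + \<kappa> * (z \<bullet> z)" for z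
    by (simp add: B_def inner_prod_def inner_diff_left inner_diff_right inner_add_left inner_add_right algebra_simps)
  obtain CB where CB: "CB > 0" "\<And>z. norm (B z) \<le> CB * norm z"
    using linear_bounded_pos[OF linB] by metis
  define w where "w = (\<lambda>z. ah (fst z) + bh (snd z) - 1/2 * (z \<bullet> B z))"
  have qexp: "1/2 * (z' \<bullet> B z') = 1/2 * (z \<bullet> B z) + B z \<bullet> (z' - z) + 1/2 * ((z' - z) \<bullet> B (z' - z))" for z z'
    using Bsym[of z z'] by (simp add: linear_diff[OF linB] inner_diff_left inner_diff_right inner_commute algebra_simps)
  have semi: "\<exists>s. \<forall>z'. w z' \<ge> w z + s \<bullet> (z' - z) - (lam + CB)/2 * ((z' - z) \<bullet> (z' - z))" for z
  proof (intro exI allI)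
    fix z'
    define h where "h = z' - z"
    have "h \<bullet> B h \<le> CB * (h \<bullet> h)"
      using norm_cauchy_schwarz[of h "B h"] mult_left_mono[OF CB(2)[of h] norm_ge_zero[of h]]
      by (simp add: dot_square_norm power2_eq_square mult_ac)
    moreover have "h \<bullet> h = fst h \<bullet> fst h + snd h \<bullet> snd h" by (simp add: inner_prod_def)
    moreover have "(lam *\<^sub>R (\<alpha> (fst z) - fst z), lam *\<^sub>R (\<beta> (snd z) - snd z)) \<bullet> h
       = (lam *\<^sub>R (\<alpha> (fst z) - fst z)) \<bullet> fst h + (lam *\<^sub>R (\<beta> (snd z) - snd z)) \<bullet> snd h" by (simp add: inner_prod_def)
    moreover have "fst h = fst z' - fst z" "snd h = snd z' - snd z" by (simp_all add: h_def)
    ultimately show "w z' \<ge> w z + ((lam *\<^sub>R (\<alpha> (fst z) - fst z), lam *\<^sub>R (\<beta> (snd z) - snd z)) - B z) \<bullet> (z' - z) - (lam + CB)/2 * ((z' - z) \<bullet> (z' - z))"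
      using ah_semi[where x = "fst z" and y = "fst z'"] bh_semi[where x = "snd z" and y = "snd z'"] qexp[of z' z]
      unfolding w_def h_def[symmetric] inner_diff_left[of _ "B z" h] by (simp add: field_simps)
  qed
  have up: "w z \<le> - (\<kappa>/2) * (z \<bullet> z)" for z
    using sum_le[of "fst z" "snd z"] by (simp add: w_def B_eq add_divide_distrib)
  have w0: "w 0 = 0"
    using up[of 0] h0 by (simp add: w_def)
  \<comment> \<open>Small enough that the slopes, of size at most (1 + CB) \<epsilon>1, stay below
    \<epsilon>, and that the points x + p/lam and y - q/lam at which a and b are finally expanded
    stay within min \<epsilon> \<rho> of 0.\<close>
  define \<epsilon>1 where "\<epsilon>1 = min \<epsilon> (min \<epsilon> \<rho> * lam / (1 + lam)) / (2 * (1 + CB))"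
  have e1: "\<epsilon>1 > 0" "(1 + CB) * \<epsilon>1 < \<epsilon>" "\<epsilon>1 + (1 + CB) * \<epsilon>1 / lam < min \<epsilon> \<rho>"
  proof -
    show pos: "\<epsilon>1 > 0" using \<epsilon> \<rho> lam CB(1) by (simp add: \<epsilon>1_def)
    have m: "min \<epsilon> \<rho> > 0" using \<epsilon> \<rho> by simp
    have eq: "(1 + CB) * \<epsilon>1 = min \<epsilon> (min \<epsilon> \<rho> * lam / (1 + lam)) / 2"
      using CB(1) by (simp add: \<epsilon>1_def field_simps)
    also have "\<dots> \<le> \<epsilon> / 2" by simp
    finally show "(1 + CB) * \<epsilon>1 < \<epsilon>" using \<epsilon> by linarith
    have "(1 + CB) * \<epsilon>1 \<le> min \<epsilon> \<rho> * lam / (1 + lam) / 2"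
      unfolding eq by (intro divide_right_mono min.cobounded2) simp
    then have "(1 + CB) * \<epsilon>1 * (1 + 1/lam) \<le> min \<epsilon> \<rho> * lam / (1 + lam) / 2 * (1 + 1/lam)"
      using lam by (intro mult_right_mono) auto
    also have "\<dots> = min \<epsilon> \<rho> / 2" using lam by (simp add: divide_simps)
    finally have "(1 + CB) * \<epsilon>1 + (1 + CB) * \<epsilon>1 / lam \<le> min \<epsilon> \<rho> / 2" by (simp add: distrib_left)
    moreover have "\<epsilon>1 \<le> (1 + CB) * \<epsilon>1" using CB(1) pos by simp
    ultimately show "\<epsilon>1 + (1 + CB) * \<epsilon>1 / lam < min \<epsilon> \<rho>" using m by linarith
  qed
  obtain z P D where z: "norm z \<le> \<epsilon>1" and P: "norm P \<le> \<epsilon>1" and D: "linear D" "\<And>x y. D x \<bullet> y = x \<bullet> D y" "\<And>h. h \<bullet> D h \<le> 0"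
    and wexp: "\<And>e. e > 0 \<Longrightarrow> \<exists>\<delta>>0. \<forall>h. norm h < \<delta> \<longrightarrow> \<bar>w (z + h) - w z - P \<bullet> h - 1/2 * (h \<bullet> D h)\<bar> \<le> e * (h \<bullet> h)"
    by (rule semiconvex_max_second_order[where w = w and \<Lambda> = "lam + CB" and \<kappa> = "\<kappa>/2" and \<eta> = \<epsilon>1])
       (use semi up w0 lam CB(1) \<kappa> e1(1) in auto)
  define x where "x = fst z"
  define y where "y = snd z"
  define R where "R = P + B z"
  define p where "p = fst R"
  define q where "q = - snd R"
  define E where "E = (\<lambda>h. D h + B h)"
  have linE: "linear E" unfolding E_def by (intro linear_compose_add D linB)
  have Esym: "E h \<bullet> h' = h \<bullet> E h'" for h h' by (simp add: E_def inner_add_left inner_add_right D(2) Bsym)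
  have E_le: "h \<bullet> E h \<le> h \<bullet> B h" for h using D(3)[of h] by (simp add: E_def inner_add_right)
  \<comment> \<open>The diagonal blocks of \<open>E\<close>. The off-diagonal blocks contribute
    nothing to the form, because ah x + bh y separates the variables.\<close>
  define X where "X = (\<lambda>\<xi>. fst (E (\<xi>, 0)))"
  define Y where "Y = (\<lambda>\<eta>. - snd (E (0, \<eta>)))"
  have pair_lin: "linear (\<lambda>\<xi>. E (\<xi>, 0))" "linear (\<lambda>\<xi>. E (0, \<xi>))"
    using linear_add[OF linE, symmetric] linear_cmul[OF linE, symmetric] by (auto intro!: linearI)
  have linX: "linear X" unfolding X_def using linear_compose[OF pair_lin(1) linear_fst] by (simp add: o_def)
  have linY: "linear Y" unfolding Y_def using linear_compose_neg[OF linear_compose[OF pair_lin(2) linear_snd]] by (simp add: o_def)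
  have Xsym: "X \<xi> \<bullet> \<xi>' = \<xi> \<bullet> X \<xi>'" for \<xi> \<xi>' using Esym[of "(\<xi>,0)" "(\<xi>',0)"] by (simp add: X_def inner_prod_def)
  have Ysym: "Y \<xi> \<bullet> \<xi>' = \<xi> \<bullet> Y \<xi>'" for \<xi> \<xi>' using Esym[of "(0,\<xi>)" "(0,\<xi>')"] by (simp add: Y_def inner_prod_def)
  have exp: "\<exists>\<delta>>0. \<forall>h. norm h < \<delta> \<longrightarrow> \<bar>ah (x + fst h) + bh (y + snd h) - ah x - bh y - R \<bullet> h - 1/2 * (h \<bullet> E h)\<bar> \<le> e * (h \<bullet> h)"
    if "e > 0" for e
  proof -
    have "ah (x + fst h) + bh (y + snd h) - ah x - bh y - R \<bullet> h - 1/2 * (h \<bullet> E h)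
       = w (z + h) - w z - P \<bullet> h - 1/2 * (h \<bullet> D h)" for h
    proof -
      have "R \<bullet> h = P \<bullet> h + B z \<bullet> h" "h \<bullet> E h = h \<bullet> D h + h \<bullet> B h"
        "w (z + h) = ah (x + fst h) + bh (y + snd h) - 1/2 * ((z + h) \<bullet> B (z + h))"
        "w z = ah x + bh y - 1/2 * (z \<bullet> B z)"
        by (simp_all add: w_def x_def y_def R_def E_def inner_add_left inner_add_right)
      moreover have "1/2 * ((z + h) \<bullet> B (z + h)) = 1/2 * (z \<bullet> B z) + B z \<bullet> h + 1/2 * (h \<bullet> B h)"
        using qexp[of "z + h" z] by (simp only: add_diff_cancel_left')
      ultimately show ?thesis by argo
    qed
    then show ?thesis using wexp[OF that] by simp
  qed
  have expa: "\<exists>\<delta>>0. \<forall>h. norm h < \<delta> \<longrightarrow> \<bar>ah (x + h) - ah x - p \<bullet> h - 1/2 * (h \<bullet> X h)\<bar> \<le> e * (h \<bullet> h)" if "e > 0" for e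
  proof -
    obtain \<delta> where "\<delta> > 0" and \<delta>: "\<And>h. norm h < \<delta> \<Longrightarrow> \<bar>ah (x + fst h) + bh (y + snd h) - ah x - bh y - R \<bullet> h - 1/2 * (h \<bullet> E h)\<bar> \<le> e * (h \<bullet> h)"
      using exp[OF \<open>e > 0\<close>] by metis
    have "\<bar>ah (x + h) - ah x - p \<bullet> h - 1/2 * (h \<bullet> X h)\<bar> \<le> e * (h \<bullet> h)" if "norm h < \<delta>" for h
      using \<delta>[of "(h, 0)"] that by (simp add: inner_prod_def X_def p_def norm_Pair)
    then show ?thesis using \<open>\<delta> > 0\<close> by blast
  qed
  have expb: "\<exists>\<delta>>0. \<forall>h. norm h < \<delta> \<longrightarrow> \<bar>bh (y + h) - bh y + q \<bullet> h + 1/2 * (h \<bullet> Y h)\<bar> \<le> e * (h \<bullet> h)" if "e > 0" for e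
  proof -
    obtain \<delta> where "\<delta> > 0" and \<delta>: "\<And>h. norm h < \<delta> \<Longrightarrow> \<bar>ah (x + fst h) + bh (y + snd h) - ah x - bh y - R \<bullet> h - 1/2 * (h \<bullet> E h)\<bar> \<le> e * (h \<bullet> h)"
      using exp[OF \<open>e > 0\<close>] by metis
    have "\<bar>bh (y + h) - bh y + q \<bullet> h + 1/2 * (h \<bullet> Y h)\<bar> \<le> e * (h \<bullet> h)" if "norm h < \<delta>" for h
      using \<delta>[of "(0, h)"] that by (simp add: inner_prod_def Y_def q_def norm_Pair)
    then show ?thesis using \<open>\<delta> > 0\<close> by blast
  qed
  have form_le: "\<xi> \<bullet> X \<xi> - \<eta> \<bullet> Y \<eta> \<le> (\<xi> - \<eta>) \<bullet> V (\<xi> - \<eta>) + \<kappa> * (\<xi> \<bullet> \<xi> + \<eta> \<bullet> \<eta>)" for \<xi> \<eta>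
  proof -
    define E' where "E' = (\<lambda>h. E h - (X (fst h), - Y (snd h)))"
    have "linear (\<lambda>h. (X (fst h), - Y (snd h)))"
      by (rule linearI) (simp_all add: linear_add[OF linX] linear_add[OF linY] linear_cmul[OF linX] linear_cmul[OF linY])
    then have linE': "linear E'" unfolding E'_def by (intro linear_compose_sub linE)
    have "0 \<le> (\<xi>, \<eta>) \<bullet> E' (\<xi>, \<eta>)"
    proof (rule local_quadratic_nonneg[OF linE'])
      fix e :: real assume "e > 0"
      then have "e/6 > 0" by simp
      obtain \<delta>1 where d1: "\<delta>1 > 0" "\<And>h. norm h < \<delta>1 \<Longrightarrow> \<bar>ah (x + fst h) + bh (y + snd h) - ah x - bh y - R \<bullet> h - 1/2 * (h \<bullet> E h)\<bar> \<le> e/6 * (h \<bullet> h)"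
        using exp[OF \<open>e/6 > 0\<close>] by metis
      obtain \<delta>2 where d2: "\<delta>2 > 0" "\<And>h. norm h < \<delta>2 \<Longrightarrow> \<bar>ah (x + h) - ah x - p \<bullet> h - 1/2 * (h \<bullet> X h)\<bar> \<le> e/6 * (h \<bullet> h)"
        using expa[OF \<open>e/6 > 0\<close>] by metis
      obtain \<delta>3 where d3: "\<delta>3 > 0" "\<And>h. norm h < \<delta>3 \<Longrightarrow> \<bar>bh (y + h) - bh y + q \<bullet> h + 1/2 * (h \<bullet> Y h)\<bar> \<le> e/6 * (h \<bullet> h)"
        using expb[OF \<open>e/6 > 0\<close>] by metis
      have "- e * (h \<bullet> h) \<le> h \<bullet> E' h" if h: "norm h < min \<delta>1 (min \<delta>2 \<delta>3)" for h
      proof -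
        have "norm (fst h) < \<delta>2" "norm (snd h) < \<delta>3" using h norm_fst_le[of "fst h" "snd h", unfolded prod.collapse] norm_snd_le[where x = "fst h" and y = "snd h", unfolded prod.collapse] by auto
        note d2(2)[OF this(1)] d3(2)[OF this(2)]
        moreover note d1(2)[of h]
        moreover have "R \<bullet> h = p \<bullet> fst h - q \<bullet> snd h" by (simp add: p_def q_def inner_prod_def)
        moreover have "h \<bullet> E' h = h \<bullet> E h - fst h \<bullet> X (fst h) + snd h \<bullet> Y (snd h)"
          by (simp add: E'_def inner_diff_right) (simp add: inner_prod_def)
        moreover have "h \<bullet> h = fst h \<bullet> fst h + snd h \<bullet> snd h" by (simp add: inner_prod_def)
        moreover have "e * (h \<bullet> h) = 6 * (e/6 * (h \<bullet> h))" by simp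
        moreover have "e/6 * (fst h \<bullet> fst h) + e/6 * (snd h \<bullet> snd h) = e/6 * (h \<bullet> h)"
          by (simp add: inner_prod_def distrib_left)
        ultimately show ?thesis using h by linarith
      qed
      then show "\<exists>\<delta>>0. \<forall>h. norm h < \<delta> \<longrightarrow> - e * (h \<bullet> h) \<le> h \<bullet> E' h"
        using d1(1) d2(1) d3(1) by (intro exI[of _ "min \<delta>1 (min \<delta>2 \<delta>3)"]) auto
    qed
    then have "\<xi> \<bullet> X \<xi> - \<eta> \<bullet> Y \<eta> \<le> (\<xi>, \<eta>) \<bullet> E (\<xi>, \<eta>)"
      by (simp add: E'_def inner_diff_right)
    also have "\<dots> \<le> (\<xi>, \<eta>) \<bullet> B (\<xi>, \<eta>)" by (rule E_le)
    also have "\<dots> = (\<xi> - \<eta>) \<bullet> V (\<xi> - \<eta>) + \<kappa> * (\<xi> \<bullet> \<xi> + \<eta> \<bullet> \<eta>)"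
      using B_eq[of "(\<xi>, \<eta>)"] by (simp add: inner_prod_def)
    finally show ?thesis .
  qed
  \<comment> \<open>Adding the expansions at h and -h cancels the slopes, so that semiconvexity
    bounds the form from below.\<close>
  have Xlow: "\<xi> \<bullet> X \<xi> \<ge> - lam * (\<xi> \<bullet> \<xi>)" for \<xi>
  proof -
    have lin: "linear (\<lambda>\<xi>. X \<xi> + lam *\<^sub>R \<xi>)" by (intro linear_compose_add linX linear_scaleR)
    have "0 \<le> \<xi> \<bullet> (X \<xi> + lam *\<^sub>R \<xi>)"
    proof (rule local_quadratic_nonneg[OF lin])
      fix e :: real assume "e > 0"
      then have "e/2 > 0" by simp
      from expa[OF this] obtain \<delta> where d: "\<delta> > 0" "\<And>h. norm h < \<delta> \<Longrightarrow> \<bar>ah (x + h) - ah x - p \<bullet> h - 1/2 * (h \<bullet> X h)\<bar> \<le> e/2 * (h \<bullet> h)" by metis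
      have "- e * (h \<bullet> h) \<le> h \<bullet> (X h + lam *\<^sub>R h)" if "norm h < \<delta>" for h
      proof -
        have "ah (x + h) - ah x - p \<bullet> h - 1/2 * (h \<bullet> X h) \<le> e/2 * (h \<bullet> h)"
          using abs_le_D1[OF d(2)[OF that]] .
        moreover have "ah (x - h) - ah x + p \<bullet> h - 1/2 * (h \<bullet> X h) \<le> e/2 * (h \<bullet> h)"
          using abs_le_D1[OF d(2)[of "-h"]] that by (simp add: linear_neg[OF linX])
        moreover have "ah (x + h) \<ge> ah x + lam * ((\<alpha> x - x) \<bullet> h) - lam/2 * (h \<bullet> h)"
          using ah_semi[of x "x + h"] by simp
        moreover have "ah (x - h) \<ge> ah x - lam * ((\<alpha> x - x) \<bullet> h) - lam/2 * (h \<bullet> h)"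
          using ah_semi[of x "x - h"] by simp
        ultimately show ?thesis by (simp add: inner_add_right)
      qed
      then show "\<exists>\<delta>>0. \<forall>h. norm h < \<delta> \<longrightarrow> - e * (h \<bullet> h) \<le> h \<bullet> (X h + lam *\<^sub>R h)" using d(1) by blast
    qed
    then show ?thesis by (simp add: inner_add_right)
  qed
  have Yupp: "\<xi> \<bullet> Y \<xi> \<le> lam * (\<xi> \<bullet> \<xi>)" for \<xi>
  proof -
    have lin: "linear (\<lambda>\<xi>. lam *\<^sub>R \<xi> - Y \<xi>)" by (intro linear_compose_sub linY linear_scaleR)
    have "0 \<le> \<xi> \<bullet> (lam *\<^sub>R \<xi> - Y \<xi>)"
    proof (rule local_quadratic_nonneg[OF lin])
      fix e :: real assume "e > 0"
      then have "e/2 > 0" by simp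
      from expb[OF this] obtain \<delta> where d: "\<delta> > 0" "\<And>h. norm h < \<delta> \<Longrightarrow> \<bar>bh (y + h) - bh y + q \<bullet> h + 1/2 * (h \<bullet> Y h)\<bar> \<le> e/2 * (h \<bullet> h)" by metis
      have "- e * (h \<bullet> h) \<le> h \<bullet> (lam *\<^sub>R h - Y h)" if "norm h < \<delta>" for h
      proof -
        have "bh (y + h) - bh y + q \<bullet> h + 1/2 * (h \<bullet> Y h) \<le> e/2 * (h \<bullet> h)"
          using abs_le_D1[OF d(2)[OF that]] .
        moreover have "bh (y - h) - bh y - q \<bullet> h + 1/2 * (h \<bullet> Y h) \<le> e/2 * (h \<bullet> h)"
          using abs_le_D1[OF d(2)[of "-h"]] that by (simp add: linear_neg[OF linY])
        moreover have "bh (y + h) \<ge> bh y + lam * ((\<beta> y - y) \<bullet> h) - lam/2 * (h \<bullet> h)"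
          using bh_semi[of y "y + h"] by simp
        moreover have "bh (y - h) \<ge> bh y - lam * ((\<beta> y - y) \<bullet> h) - lam/2 * (h \<bullet> h)"
          using bh_semi[of y "y - h"] by simp
        ultimately show ?thesis by (simp add: inner_diff_right)
      qed
      then show "\<exists>\<delta>>0. \<forall>h. norm h < \<delta> \<longrightarrow> - e * (h \<bullet> h) \<le> h \<bullet> (lam *\<^sub>R h - Y h)" using d(1) by blast
    qed
    then show ?thesis by (simp add: inner_diff_right)
  qed
  \<comment> \<open>A paraboloid touching from below has the slope of the expansion. This locates
    the maximizers: \<alpha> x = x + p/lam and \<beta> y = y - q/lam.\<close>
  have grad: "s = g" if le: "\<And>h. G (c + h) \<ge> G c + s \<bullet> h - lam/2 * (h \<bullet> h)" and linW: "linear W"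
      and ex: "\<exists>\<delta>>0. \<forall>h. norm h < \<delta> \<longrightarrow> \<bar>G (c + h) - G c - g \<bullet> h - 1/2 * (h \<bullet> W h)\<bar> \<le> 1 * (h \<bullet> h)"
      for s g c :: 'a and G W
  proof -
    obtain \<delta> where d: "\<delta> > 0" "\<And>h. norm h < \<delta> \<Longrightarrow> \<bar>G (c + h) - G c - g \<bullet> h - 1/2 * (h \<bullet> W h)\<bar> \<le> 1 * (h \<bullet> h)"
      using ex by metis
    obtain C where C: "\<And>h. norm (W h) \<le> C * norm h" using linear_bounded[OF linW] by metis
    have Wb: "h \<bullet> W h \<le> C * (h \<bullet> h)" for h
      using norm_cauchy_schwarz[of h "W h"] mult_left_mono[OF C[of h] norm_ge_zero[of h]]
      by (simp add: dot_square_norm power2_eq_square mult_ac)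
    have "s - g = 0"
    proof (rule local_linear_le_quadratic[OF d(1)])
      fix h :: 'a assume "norm h < \<delta>"
      from abs_le_D1[OF d(2)[OF this]]
      have "s \<bullet> h - g \<bullet> h \<le> h \<bullet> h + lam/2 * (h \<bullet> h) + 1/2 * (h \<bullet> W h)" using le[of h] by linarith
      moreover have "(1 + C/2 + lam/2) * (h \<bullet> h) = h \<bullet> h + 1/2 * (C * (h \<bullet> h)) + lam/2 * (h \<bullet> h)"
        by (simp add: algebra_simps)
      ultimately show "(s - g) \<bullet> h \<le> (1 + C/2 + lam/2) * (h \<bullet> h)"
        using Wb[of h] unfolding inner_diff_left by linarith
    qed
    then show ?thesis by simp
  qed
  have pa: "lam *\<^sub>R (\<alpha> x - x) = p"
    by (rule grad[of ah x _ X]) (use ah_semi[of x "x + h" for h] expa[of 1] linX in auto)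
  have linY': "linear (\<lambda>h. - Y h)" by (intro linear_compose_neg linY)
  have qb: "lam *\<^sub>R (\<beta> y - y) = - q"
    by (rule grad[of bh y _ "\<lambda>h. - Y h"]) (use bh_semi[of y "y + h" for h] expb[of 1] linY' in auto)
  have nR: "norm R \<le> (1 + CB) * \<epsilon>1"
  proof -
    have "norm R \<le> norm P + norm (B z)" unfolding R_def by (rule norm_triangle_ineq)
    also have "\<dots> \<le> \<epsilon>1 + CB * \<epsilon>1" using P CB(2)[of z] mult_left_mono[OF z, of CB] CB(1) by linarith
    finally show ?thesis by (simp add: algebra_simps)
  qed
  have np: "norm p \<le> (1 + CB) * \<epsilon>1" "norm q \<le> (1 + CB) * \<epsilon>1"
    using nR norm_fst_le[of "fst R" "snd R", unfolded prod.collapse] norm_snd_le[where x = "fst R" and y = "snd R", unfolded prod.collapse] by (auto simp: p_def q_def)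
  have nx: "norm x \<le> \<epsilon>1" "norm y \<le> \<epsilon>1"
    using z norm_fst_le[of "fst z" "snd z", unfolded prod.collapse] norm_snd_le[where x = "fst z" and y = "snd z", unfolded prod.collapse] by (auto simp: x_def y_def)
  have \<alpha>x: "\<alpha> x = x + (1/lam) *\<^sub>R p" using lam by (simp add: pa[symmetric])
  have \<beta>y: "\<beta> y = y - (1/lam) *\<^sub>R q" using lam arg_cong[OF qb, of "\<lambda>v. (1/lam) *\<^sub>R v"] by (simp add: algebra_simps)
  have n\<alpha>: "norm (\<alpha> x) < min \<epsilon> \<rho>"
  proof -
    have "norm (\<alpha> x) \<le> norm x + norm p / lam" using norm_triangle_ineq[of x "(1/lam) *\<^sub>R p"] lam by (simp add: \<alpha>x)
    also have "\<dots> \<le> \<epsilon>1 + (1 + CB) * \<epsilon>1 / lam" using nx np lam by (intro add_mono divide_right_mono) auto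
    finally show ?thesis using e1(3) by linarith
  qed
  have n\<beta>: "norm (\<beta> y) < min \<epsilon> \<rho>"
  proof -
    have "norm (\<beta> y) \<le> norm y + norm q / lam" using norm_triangle_ineq4[of y "(1/lam) *\<^sub>R q"] lam by (simp add: \<beta>y)
    also have "\<dots> \<le> \<epsilon>1 + (1 + CB) * \<epsilon>1 / lam" using nx np lam by (intro add_mono divide_right_mono) auto
    finally show ?thesis using e1(3) by linarith
  qed
  \<comment> \<open>Shifting x and \<alpha> x by the same h leaves the penalty unchanged, so
    \<alpha> x + h competes in the definition of ah (x + h): from \<alpha> x on, a rises no more
    than \<open>ah\<close> does from x on.\<close>
  have jet_a: "\<exists>\<delta>>0. \<forall>h. norm h < \<delta> \<longrightarrow> a (\<alpha> x + h) \<le> a (\<alpha> x) + p \<bullet> h + 1/2 * (h \<bullet> X h) + e * (h \<bullet> h)" if "e > 0" for e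
  proof -
    obtain \<delta> where d: "\<delta> > 0" "\<And>h. norm h < \<delta> \<Longrightarrow> \<bar>ah (x + h) - ah x - p \<bullet> h - 1/2 * (h \<bullet> X h)\<bar> \<le> e * (h \<bullet> h)"
      using expa[OF \<open>e > 0\<close>] by metis
    have "a (\<alpha> x + h) \<le> a (\<alpha> x) + p \<bullet> h + 1/2 * (h \<bullet> X h) + e * (h \<bullet> h)" if h: "norm h < min \<delta> (\<rho> - norm (\<alpha> x))" for h
    proof -
      have "\<alpha> x + h \<in> cball 0 \<rho>" using h norm_triangle_ineq[of "\<alpha> x" h] by simp
      from \<alpha>(2)[OF this, of "x + h"] have "a (\<alpha> x + h) \<le> a (\<alpha> x) + (ah (x + h) - ah x)"
        by (simp add: ah_def)
      then show ?thesis using abs_le_D1[OF d(2)[of h]] h by linarith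
    qed
    then show ?thesis using d(1) n\<alpha> by (intro exI[of _ "min \<delta> (\<rho> - norm (\<alpha> x))"]) auto
  qed
  have jet_b: "\<exists>\<delta>>0. \<forall>h. norm h < \<delta> \<longrightarrow> b (\<beta> y + h) \<le> b (\<beta> y) - q \<bullet> h - 1/2 * (h \<bullet> Y h) + e * (h \<bullet> h)" if "e > 0" for e
  proof -
    obtain \<delta> where d: "\<delta> > 0" "\<And>h. norm h < \<delta> \<Longrightarrow> \<bar>bh (y + h) - bh y + q \<bullet> h + 1/2 * (h \<bullet> Y h)\<bar> \<le> e * (h \<bullet> h)"
      using expb[OF \<open>e > 0\<close>] by metis
    have "b (\<beta> y + h) \<le> b (\<beta> y) - q \<bullet> h - 1/2 * (h \<bullet> Y h) + e * (h \<bullet> h)" if h: "norm h < min \<delta> (\<rho> - norm (\<beta> y))" for h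
    proof -
      have "\<beta> y + h \<in> cball 0 \<rho>" using h norm_triangle_ineq[of "\<beta> y" h] by simp
      from \<beta>(2)[OF this, of "y + h"] have "b (\<beta> y + h) \<le> b (\<beta> y) + (bh (y + h) - bh y)"
        by (simp add: bh_def)
      then show ?thesis using abs_le_D1[OF d(2)[of h]] h by linarith
    qed
    then show ?thesis using d(1) n\<beta> by (intro exI[of _ "min \<delta> (\<rho> - norm (\<beta> y))"]) auto
  qed
  show ?thesis
  proof (rule that[of "\<alpha> x" "\<beta> y" p q X Y])
    show "norm (\<alpha> x) < \<epsilon>" "norm (\<beta> y) < \<epsilon>" "norm p < \<epsilon>" "norm q < \<epsilon>"
      using n\<alpha> n\<beta> np e1(2) by auto
    show "\<xi> \<bullet> X \<xi> - \<eta> \<bullet> Y \<eta> \<le> (\<xi> - \<eta>) \<bullet> Z (\<xi> - \<eta>) + 2 * \<theta> * (Z (\<xi> - \<eta>) \<bullet> Z (\<xi> - \<eta>)) + \<kappa> * (\<xi> \<bullet> \<xi> + \<eta> \<bullet> \<eta>)" for \<xi> \<eta>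
      using form_le[of \<xi> \<eta>] by (simp only: V_eq)
    show "\<xi> \<bullet> X \<xi> \<ge> - (1/\<theta> + 2 * \<zeta>) * (\<xi> \<bullet> \<xi>)" for \<xi> using Xlow[of \<xi>] by (simp only: lam_def)
    show "\<eta> \<bullet> Y \<eta> \<le> (1/\<theta> + 2 * \<zeta>) * (\<eta> \<bullet> \<eta>)" for \<eta> using Yupp[of \<eta>] by (simp only: lam_def)
  qed (use linX linY Xsym Ysym jet_a jet_b in auto)
qed

section \<open>Pucci operators\<close>

lemma symmetric_mat_inner:
  assumes "symmetric_mat A"
  shows "(A *v x) \<bullet> y = x \<bullet> (A *v y)"
  using assms dot_lmul_matrix[of x A y] transpose_matrix_vector[of A x] by (simp add: symmetric_mat_def)

lemma symmetric_matD: "symmetric_mat A \<Longrightarrow> A $ i $ j = A $ j $ i"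
  unfolding symmetric_mat_def by (metis transpose_def vec_lambda_beta)

lemma symmetric_matI: "(\<And>i j. A $ i $ j = A $ j $ i) \<Longrightarrow> symmetric_mat A"
  unfolding symmetric_mat_def transpose_def by (simp add: vec_eq_iff)

lemma symmetric_mat_matrix:
  fixes f :: "real^'n \<Rightarrow> real^'n"
  assumes "linear f" "\<And>x y. f x \<bullet> y = x \<bullet> f y"
  shows "symmetric_mat (matrix f)"
proof (rule symmetric_matI)
  fix i j
  show "matrix f $ i $ j = matrix f $ j $ i"
    using assms(2)[of "axis i 1" "axis j 1"] by (simp add: matrix_def inner_axis inner_axis')
qed

lemma symmetric_mat_add: "symmetric_mat A \<Longrightarrow> symmetric_mat B \<Longrightarrow> symmetric_mat (A + B)"
  by (rule symmetric_matI) (metis symmetric_matD vector_add_component)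

lemma symmetric_mat_diff: "symmetric_mat A \<Longrightarrow> symmetric_mat B \<Longrightarrow> symmetric_mat (A - B)"
  by (rule symmetric_matI) (metis symmetric_matD vector_minus_component)

lemma symmetric_mat_minus: "symmetric_mat A \<Longrightarrow> symmetric_mat (- A)"
  by (rule symmetric_matI) (metis symmetric_matD vector_uminus_component)

lemma symmetric_mat_scaleR: "symmetric_mat A \<Longrightarrow> symmetric_mat (c *\<^sub>R A)"
  by (rule symmetric_matI) (metis symmetric_matD vector_scaleR_component)

lemma symmetric_mat_mat [simp]: "symmetric_mat (mat k)"
  by (rule symmetric_matI) (simp add: mat_def)

lemma mat_mult_vec: "mat k *v x = k *\<^sub>R (x :: real^'n)"
  by (simp add: vec_eq_iff matrix_vector_mult_def mat_def if_distrib if_distribR sum.delta cong: if_cong)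

section \<open>Positive semidefinite matrices and traces of products\<close>

definition psd :: "real^'n^'n \<Rightarrow> bool" where
  "psd B \<longleftrightarrow> symmetric_mat B \<and> (\<forall>x. 0 \<le> x \<bullet> (B *v x))"

lemma psd_Cauchy_Schwarz:
  assumes "psd B"
  shows "(y \<bullet> (B *v x))\<^sup>2 \<le> (y \<bullet> (B *v y)) * (x \<bullet> (B *v x))"
proof -
  define a where "a = y \<bullet> (B *v y)"
  define b where "b = y \<bullet> (B *v x)"
  define c where "c = x \<bullet> (B *v x)"
  have q: "0 \<le> s * s * c + 2 * s * t * b + t * t * a" for s t
  proof -
    have "0 \<le> (s *\<^sub>R x + t *\<^sub>R y) \<bullet> (B *v (s *\<^sub>R x + t *\<^sub>R y))" using assms by (simp add: psd_def)
    also have "\<dots> = s * s * c + 2 * s * t * b + t * t * a"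
      using symmetric_mat_inner[of B x y] assms
      by (simp add: psd_def a_def b_def c_def matrix_vector_right_distrib matrix_vector_mult_scaleR inner_add_left inner_add_right inner_commute algebra_simps)
    finally show ?thesis .
  qed
  have a0: "a \<ge> 0" using assms by (simp add: psd_def a_def)
  show ?thesis
  proof (cases "a = 0")
    case True
    have "b = 0"
    proof (rule ccontr)
      assume "b \<noteq> 0"
      \<comment> \<open>Makes the value of the form for s = 1 equal to c - (c + 1) = -1.\<close>
      define t where "t = - (c + 1) / (2 * b)"
      have "2 * t * b = - (c + 1)" using \<open>b \<noteq> 0\<close> by (simp add: t_def)
      then show False using q[of 1 t] True by simp
    qed
    then show ?thesis using True by (simp add: a_def b_def)
  next
    case False
    then have "a > 0" using a0 by simp
    have "0 \<le> a * (a * c - b * b)" using q[of a "- b"] by (simp add: algebra_simps)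
    then have "b * b \<le> a * c" using \<open>a > 0\<close> by (simp add: zero_le_mult_iff)
    then show ?thesis by (simp add: a_def b_def c_def power2_eq_square)
  qed
qed

lemma psd_null_vector:
  assumes "psd B" "x \<bullet> (B *v x) = 0"
  shows "B *v x = 0"
  using psd_Cauchy_Schwarz[OF assms(1), of "B *v x" x] assms(2) by simp

lemma trace_mult: "trace (A ** B) = (\<Sum>i\<in>UNIV. \<Sum>j\<in>UNIV. A $ i $ j * B $ j $ i)"
  by (simp add: trace_def matrix_matrix_mult_def)

text \<open>Peel off a rank one piece for each index, as in Gaussian elimination.\<close>

lemma trace_mult_psd_aux:
  fixes A B :: "real^'n^'n"
  assumes A: "\<And>x. 0 \<le> x \<bullet> (A *v x)" and "finite S" and "psd B" and "\<And>i k. k \<notin> S \<Longrightarrow> B $ i $ k = 0"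
  shows "0 \<le> trace (A ** B)"
  using assms(2-4)
proof (induction S arbitrary: B rule: finite_induct)
  case empty
  then show ?case by (simp add: trace_mult)
next
  case (insert k S)
  have symB: "symmetric_mat B" using insert.prems by (simp add: psd_def)
  define c where "c = B *v axis k 1"
  define b where "b = B $ k $ k"
  have ci: "c $ i = B $ i $ k" for i by (simp add: c_def matrix_vector_mul_component inner_axis)
  have b_eq: "b = axis k 1 \<bullet> (B *v axis k 1)" by (simp add: b_def ci[symmetric] c_def inner_axis')
  show ?case
  proof (cases "b = 0")
    case True
    then have "c = 0" using psd_null_vector[OF insert.prems(1)] b_eq by (simp add: c_def)
    then have "B $ i $ k = 0" for i using ci[of i] by simp
    then have "\<And>i j. j \<notin> S \<Longrightarrow> B $ i $ j = 0" using insert.prems(2) by (metis insert_iff)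
    then show ?thesis using insert.IH[OF insert.prems(1)] by blast
  next
    case False
    have "b \<ge> 0" using insert.prems(1) b_eq by (simp add: psd_def)
    then have b: "b > 0" using False by simp
    \<comment> \<open>A rank one matrix with the same column k as \<open>B\<close>. The
      Cauchy-Schwarz inequality for \<open>B\<close> says that B - C is still positive semidefinite,
      and its column k vanishes.\<close>
    define C where "C = (\<chi> i j. c $ i * c $ j / b)"
    define B' where "B' = B - C"
    have Cx: "x \<bullet> (C *v x) = (c \<bullet> x)\<^sup>2 / b" for x
    proof -
      have "C *v x = (c \<bullet> x / b) *\<^sub>R c"
        by (simp add: vec_eq_iff C_def matrix_vector_mult_def inner_vec_def sum_divide_distrib sum_distrib_left sum_distrib_right algebra_simps)
      then show ?thesis by (simp add: power2_eq_square inner_commute)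
    qed
    have "symmetric_mat C" by (rule symmetric_matI) (simp add: C_def)
    then have symB': "symmetric_mat B'" unfolding B'_def by (intro symmetric_mat_diff symB)
    have "0 \<le> x \<bullet> (B' *v x)" for x
    proof -
      have "(axis k 1 \<bullet> (B *v x))\<^sup>2 \<le> b * (x \<bullet> (B *v x))"
        using psd_Cauchy_Schwarz[OF insert.prems(1), of "axis k 1" x] by (simp add: b_eq)
      moreover have "axis k 1 \<bullet> (B *v x) = c \<bullet> x" using symmetric_mat_inner[OF symB, of "axis k 1" x] by (simp add: c_def)
      ultimately have "(c \<bullet> x)\<^sup>2 / b \<le> x \<bullet> (B *v x)" using b by (simp add: divide_le_eq mult.commute)
      then show ?thesis by (simp add: B'_def matrix_vector_mult_diff_rdistrib inner_diff_right Cx)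
    qed
    then have "psd B'" using symB' by (simp add: psd_def)
    moreover have "B' $ i $ j = 0" if "j \<notin> S" for i j
    proof (cases "j = k")
      case True then show ?thesis using b by (simp add: B'_def C_def ci b_def)
    next
      case False
      then have "j \<notin> insert k S" using that by simp
      then have "B $ i $ j = 0" "B $ k $ j = 0" using insert.prems(2) by blast+
      then show ?thesis using symmetric_matD[OF symB, of j k] by (simp add: B'_def C_def ci)
    qed
    ultimately have "0 \<le> trace (A ** B')" by (rule insert.IH)
    moreover have "trace (A ** C) = (c \<bullet> (A *v c)) / b"
    proof -
      have "trace (A ** C) = (\<Sum>i\<in>UNIV. \<Sum>j\<in>UNIV. (c $ i * (A $ i $ j * c $ j)) / b)"
        unfolding trace_mult C_def by (simp add: algebra_simps)
      also have "\<dots> = (\<Sum>i\<in>UNIV. c $ i * (\<Sum>j\<in>UNIV. A $ i $ j * c $ j)) / b"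
        by (simp only: sum_divide_distrib sum_distrib_left)
      also have "\<dots> = (c \<bullet> (A *v c)) / b" by (simp add: inner_vec_def matrix_vector_mult_def)
      finally show ?thesis .
    qed
    moreover have "trace (A ** B) = trace (A ** B') + trace (A ** C)"
      unfolding trace_mult B'_def by (simp add: right_diff_distrib sum_subtractf)
    ultimately show ?thesis using A[of c] b by simp
  qed
qed

lemma trace_mult_psd:
  fixes A B :: "real^'n^'n"
  assumes "\<And>x. 0 \<le> x \<bullet> (A *v x)" "psd B"
  shows "0 \<le> trace (A ** B)"
  using trace_mult_psd_aux[OF assms(1) finite_class.finite_UNIV assms(2)] by simp

text \<open>The matrices in a Pucci operator are given by bounds on their eigenvalues. The minimum
  of the quadratic form on the unit sphere is attained at an eigenvector, so an eigenvalue bound is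
  a bound for the form.\<close>

lemma min_eigenvalue:
  fixes A :: "real^'n^'n"
  assumes sym: "symmetric_mat A" and ev: "\<And>c x. x \<noteq> 0 \<Longrightarrow> A *v x = c *\<^sub>R x \<Longrightarrow> \<gamma> \<le> c"
  shows "\<gamma> * (x \<bullet> x) \<le> x \<bullet> (A *v x)"
proof -
  have "continuous_on (sphere 0 1) (\<lambda>x. x \<bullet> (A *v x))"
    by (intro continuous_intros linear_continuous_on matrix_vector_mul_bounded_linear)
  moreover have "sphere (0::real^'n) 1 \<noteq> {}" by simp
  ultimately obtain x0 where x0: "norm x0 = 1" "\<And>y. norm y = 1 \<Longrightarrow> x0 \<bullet> (A *v x0) \<le> y \<bullet> (A *v y)"
    using continuous_attains_inf[OF compact_sphere, of 0 1 "\<lambda>x. x \<bullet> (A *v x)"] by auto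
  define m where "m = x0 \<bullet> (A *v x0)"
  have low: "m * (y \<bullet> y) \<le> y \<bullet> (A *v y)" for y
  proof (cases "y = 0")
    case False
    have "m \<le> (y /\<^sub>R norm y) \<bullet> (A *v (y /\<^sub>R norm y))" unfolding m_def using False by (intro x0(2)) simp
    also have "\<dots> = (y \<bullet> (A *v y)) / (norm y)\<^sup>2"
      by (simp add: matrix_vector_mult_scaleR power2_eq_square divide_simps)
    finally show ?thesis using False by (simp add: pos_le_divide_eq dot_square_norm)
  qed simp
  define B where "B = A - mat m"
  have Bx: "B *v y = A *v y - m *\<^sub>R y" for y by (simp add: B_def matrix_vector_mult_diff_rdistrib mat_mult_vec)
  have "psd B" using low sym unfolding psd_def Bx by (auto simp: B_def inner_diff_right intro: symmetric_mat_diff)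
  moreover have "x0 \<bullet> (B *v x0) = 0" using x0(1) by (simp add: Bx inner_diff_right m_def[symmetric] dot_square_norm)
  ultimately have "B *v x0 = 0" by (rule psd_null_vector)
  then have "A *v x0 = m *\<^sub>R x0" by (simp add: Bx)
  moreover have "x0 \<noteq> 0" using x0(1) by auto
  ultimately have "\<gamma> \<le> m" by (rule ev[rotated])
  then show ?thesis using low[of x] mult_right_mono[of \<gamma> m "x \<bullet> x"] by simp
qed

lemma matrix_vector_mult_minus: "(- A) *v x = - (A *v x)" for A :: "real^'n^'m"
  using matrix_vector_mult_diff_rdistrib[of 0 A x] by simp

lemma pucci_set_bounds:
  assumes "A \<in> pucci_set \<gamma> \<Gamma>"
  shows "\<gamma> * (x \<bullet> x) \<le> x \<bullet> (A *v x)" "x \<bullet> (A *v x) \<le> \<Gamma> * (x \<bullet> x)"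
proof -
  have sym: "symmetric_mat A" and ev: "\<And>c x. x \<noteq> 0 \<Longrightarrow> A *v x = c *\<^sub>R x \<Longrightarrow> \<gamma> \<le> c \<and> c \<le> \<Gamma>"
    using assms by (auto simp: pucci_set_def)
  show "\<gamma> * (x \<bullet> x) \<le> x \<bullet> (A *v x)" using min_eigenvalue[OF sym] ev by blast
  have "- \<Gamma> * (x \<bullet> x) \<le> x \<bullet> ((- A) *v x)"
  proof (rule min_eigenvalue[OF symmetric_mat_minus[OF sym]])
    fix c and y :: "real^'a" assume "y \<noteq> 0" "(- A) *v y = c *\<^sub>R y"
    then have "A *v y = (- c) *\<^sub>R y"
      by (metis matrix_vector_mult_minus minus_minus scaleR_minus_left)
    from ev[OF \<open>y \<noteq> 0\<close> this] show "- \<Gamma> \<le> c" by simp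
  qed
  then show "x \<bullet> (A *v x) \<le> \<Gamma> * (x \<bullet> x)" by (simp add: matrix_vector_mult_minus)
qed

lemma norm_matrix_vector_mult_le:
  fixes A :: "real^'n^'m"
  shows "norm (A *v x) \<le> norm A * norm x"
proof -
  have "norm (A *v x) = L2_set (\<lambda>i. norm ((A *v x) $ i)) UNIV" by (simp add: norm_vec_def)
  also have "\<dots> \<le> L2_set (\<lambda>i. norm (A $ i) * norm x) UNIV"
    by (rule L2_set_mono) (auto simp: matrix_vector_mul_component Cauchy_Schwarz_ineq2)
  also have "\<dots> = norm A * norm x" by (simp add: L2_set_left_distrib norm_vec_def)
  finally show ?thesis .
qed

lemma quadratic_form_le_norm:
  fixes A :: "real^'n^'n"
  shows "\<bar>x \<bullet> (A *v x)\<bar> \<le> norm A * (x \<bullet> x)"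
proof -
  have "\<bar>x \<bullet> (A *v x)\<bar> \<le> norm x * norm (A *v x)" by (rule Cauchy_Schwarz_ineq2)
  also have "\<dots> \<le> norm x * (norm A * norm x)" by (intro mult_left_mono norm_matrix_vector_mult_le) simp
  finally show ?thesis by (simp add: dot_square_norm power2_eq_square mult_ac)
qed

lemma norm_mat_le_form:
  fixes M :: "real^'n^'n"
  assumes sym: "symmetric_mat M" and le: "\<And>x. \<bar>x \<bullet> (M *v x)\<bar> \<le> m * (x \<bullet> x)"
  shows "norm M \<le> (real CARD('n))\<^sup>2 * m"
proof -
  have entry: "\<bar>M $ i $ j\<bar> \<le> m" for i j
  proof -
    define q where "q = (\<lambda>x. x \<bullet> (M *v x))"
    have ax: "axis i 1 \<bullet> (M *v axis j 1) = M $ i $ j" for i j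
      by (simp add: inner_axis' matrix_vector_mul_component inner_axis)
    define a where "a = (axis i 1 :: real^'n)"
    define b where "b = (axis j 1 :: real^'n)"
    \<comment> \<open>Polarization; by the parallelogram law the two squared norms add up to
      4.\<close>
    have "4 * M $ i $ j = q (a + b) - q (a - b)"
      using ax symmetric_matD[OF sym, of i j]
      by (simp add: q_def a_def b_def matrix_vector_right_distrib matrix_vector_mult_diff_distrib inner_add_left inner_add_right inner_diff_left inner_diff_right)
    moreover have "\<bar>q (a + b)\<bar> \<le> m * ((a + b) \<bullet> (a + b))" "\<bar>q (a - b)\<bar> \<le> m * ((a - b) \<bullet> (a - b))"
      unfolding q_def using le by blast+
    moreover have "a \<bullet> a = 1" "b \<bullet> b = 1" by (simp_all add: a_def b_def inner_axis_axis)
    then have "(a + b) \<bullet> (a + b) + (a - b) \<bullet> (a - b) = 4"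
      by (simp add: inner_add_left inner_add_right inner_diff_left inner_diff_right)
    then have "m * ((a + b) \<bullet> (a + b)) + m * ((a - b) \<bullet> (a - b)) = m * 4"
      by (metis distrib_left)
    ultimately show ?thesis by linarith
  qed
  have "norm M \<le> (\<Sum>i\<in>UNIV. norm (M $ i))" unfolding norm_vec_def by (rule L2_set_le_sum) simp
  also have "\<dots> \<le> (\<Sum>i\<in>(UNIV::'n set). real CARD('n) * m)"
  proof (rule sum_mono)
    fix i :: 'n
    have "norm (M $ i) \<le> (\<Sum>j\<in>UNIV. \<bar>M $ i $ j\<bar>)" by (rule norm_le_l1_cart)
    also have "\<dots> \<le> (\<Sum>j\<in>(UNIV::'n set). m)" by (intro sum_mono entry)
    finally show "norm (M $ i) \<le> real CARD('n) * m" by simp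
  qed
  also have "\<dots> = (real CARD('n))\<^sup>2 * m" by (simp add: power2_eq_square)
  finally show ?thesis .
qed

section \<open>Bounds for the minimal Pucci operator\<close>

lemma trace_mult_mat: "trace (A ** mat c) = c * trace A" for A :: "real^'n^'n"
proof -
  have "A $ i $ j * mat c $ j $ i = (if i = j then c * A $ i $ i else 0)" for i j
    by (auto simp: mat_def)
  then show ?thesis unfolding trace_mult by (simp add: sum_distrib_left trace_def)
qed

text \<open>Both A - \<gamma> I and \<mu> I - N are positive semidefinite, so their product has
  nonnegative trace; the term \<mu> trace A that appears in it is at most n \<Gamma> \<mu>.\<close>

lemma pucci_element_bound:
  fixes N :: "real^'n^'n"
  assumes A: "A \<in> pucci_set \<gamma> \<Gamma>" and \<mu>: "\<mu> \<ge> 0" and \<gamma>: "\<gamma> \<ge> 0"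
    and N: "symmetric_mat N" "\<And>x. x \<bullet> (N *v x) \<le> \<mu> * (x \<bullet> x)"
  shows "- \<gamma> * trace N - real CARD('n) * \<Gamma> * \<mu> \<le> - trace (A ** N)"
proof -
  define P where "P = mat \<mu> - N"
  have "psd P"
    using N by (auto simp: psd_def P_def matrix_vector_mult_diff_rdistrib mat_mult_vec inner_diff_right intro: symmetric_mat_diff)
  moreover have "0 \<le> x \<bullet> ((A - mat \<gamma>) *v x)" for x
    using pucci_set_bounds(1)[OF A, of x] by (simp add: matrix_vector_mult_diff_rdistrib mat_mult_vec inner_diff_right)
  ultimately have "0 \<le> trace ((A - mat \<gamma>) ** P)" by (intro trace_mult_psd)
  also have "\<dots> = \<mu> * trace A - trace (A ** N) - \<gamma> * (\<mu> * real CARD('n) - trace N)"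
  proof -
    have 1: "trace ((A - mat \<gamma>) ** P) = trace (A ** P) - trace (mat \<gamma> ** P)"
      by (simp add: trace_mult left_diff_distrib sum_subtractf)
    have 2: "trace (A ** P) = trace (A ** mat \<mu>) - trace (A ** N)" for A
      by (simp add: P_def trace_mult right_diff_distrib sum_subtractf)
    have 3: "trace (mat \<gamma> ** N) = \<gamma> * trace N"
      using trace_mul_sym[of "mat \<gamma>" N] by (simp add: trace_mult_mat)
    have 4: "trace (mat \<gamma> :: real^'n^'n) = \<gamma> * real CARD('n)" by (simp add: trace_def mat_def)
    have "trace (A ** P) = \<mu> * trace A - trace (A ** N)" using 2[of A] trace_mult_mat[of A \<mu>] by simp
    moreover have "trace (mat \<gamma> ** P) = \<mu> * (\<gamma> * real CARD('n)) - \<gamma> * trace N"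
      using 2[of "mat \<gamma>"] trace_mult_mat[of "mat \<gamma> :: real^'n^'n" \<mu>] 3 4 by simp
    ultimately show ?thesis using 1 by (simp add: algebra_simps)
  qed
  finally have *: "- \<gamma> * trace N - \<mu> * trace A + \<gamma> * (\<mu> * real CARD('n)) \<le> - trace (A ** N)" by (simp add: algebra_simps)
  have "trace A \<le> real CARD('n) * \<Gamma>"
  proof -
    have "A $ i $ i \<le> \<Gamma>" for i
      using pucci_set_bounds(2)[OF A, of "axis i 1"] by (simp add: inner_axis' matrix_vector_mul_component inner_axis)
    then have "trace A \<le> (\<Sum>i\<in>(UNIV::'n set). \<Gamma>)" unfolding trace_def by (intro sum_mono)
    then show ?thesis by simp
  qed
  then have "\<mu> * trace A \<le> real CARD('n) * \<Gamma> * \<mu>" using mult_left_mono[OF _ \<mu>] by (metis mult.commute)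
  moreover have "\<gamma> * (\<mu> * real CARD('n)) \<ge> 0" using \<mu> \<gamma> by simp
  ultimately show ?thesis using * by linarith
qed

lemma pucci_set_nonempty:
  assumes "\<gamma> \<le> \<Gamma>"
  shows "mat \<gamma> \<in> pucci_set \<gamma> \<Gamma>"
  using assms by (auto simp: pucci_set_def mat_mult_vec)

lemma pucci_minus_greatest:
  fixes M :: "real^'n^'n"
  assumes "\<gamma> \<le> \<Gamma>" "\<And>A. A \<in> pucci_set \<gamma> \<Gamma> \<Longrightarrow> c \<le> - trace (A ** M)"
  shows "c \<le> pucci_minus \<gamma> \<Gamma> M"
  unfolding pucci_minus_def using pucci_set_nonempty[OF assms(1)] assms(2) by (intro cINF_greatest) auto

lemma pucci_minus_lower:
  fixes M :: "real^'n^'n"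
  assumes "0 \<le> \<gamma>" "symmetric_mat M" "A \<in> pucci_set \<gamma> \<Gamma>"
  shows "pucci_minus \<gamma> \<Gamma> M \<le> - trace (A ** M)"
proof -
  have "bdd_below ((\<lambda>A. - trace (A ** M)) ` pucci_set \<gamma> \<Gamma>)"
    using pucci_element_bound[OF _ norm_ge_zero[of M] assms(1,2)] abs_le_D1[OF quadratic_form_le_norm[of _ M]]
    by (intro bdd_belowI2) blast
  then show ?thesis unfolding pucci_minus_def using assms(3) by (rule cINF_lower)
qed

lemma pucci_minus_ge:
  fixes N :: "real^'n^'n"
  assumes "0 \<le> \<gamma>" "\<gamma> \<le> \<Gamma>" "\<mu> \<ge> 0" "symmetric_mat N" "\<And>x. x \<bullet> (N *v x) \<le> \<mu> * (x \<bullet> x)"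
  shows "- \<gamma> * trace N - real CARD('n) * \<Gamma> * \<mu> \<le> pucci_minus \<gamma> \<Gamma> N"
  using assms by (intro pucci_minus_greatest pucci_element_bound) auto

lemma pucci_minus_superadd:
  fixes M N :: "real^'n^'n"
  assumes "0 \<le> \<gamma>" "\<gamma> \<le> \<Gamma>" "symmetric_mat M" "symmetric_mat N"
  shows "pucci_minus \<gamma> \<Gamma> M + pucci_minus \<gamma> \<Gamma> N \<le> pucci_minus \<gamma> \<Gamma> (M + N)"
proof (rule pucci_minus_greatest[OF assms(2)])
  fix A :: "real^'n^'n" assume "A \<in> pucci_set \<gamma> \<Gamma>"
  then show "pucci_minus \<gamma> \<Gamma> M + pucci_minus \<gamma> \<Gamma> N \<le> - trace (A ** (M + N))"
    using pucci_minus_lower[OF assms(1,3)] pucci_minus_lower[OF assms(1,4)]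
    by (fastforce simp: matrix_add_ldistrib trace_add)
qed

text \<open>The projection I - e e^T is positive semidefinite, so its product with \<open>N\<close>
  has nonnegative trace.\<close>

lemma psd_trace_ge:
  fixes N :: "real^'n^'n"
  assumes N: "psd N" and e: "norm e = 1"
  shows "e \<bullet> (N *v e) \<le> trace N"
proof -
  define A where "A = (\<chi> i j. (if i = j then 1 else 0) - e $ i * e $ j)"
  have Ax: "A *v x = x - (e \<bullet> x) *\<^sub>R e" for x
  proof -
    have "(A *v x) $ i = x $ i - (\<Sum>j\<in>UNIV. e $ j * x $ j) * e $ i" for i
    proof -
      have "(A *v x) $ i = (\<Sum>j\<in>UNIV. (if i = j then x $ j else 0) - e $ j * x $ j * e $ i)"
        unfolding matrix_vector_mult_def A_def by (auto intro!: sum.cong simp: algebra_simps)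
      then show ?thesis by (simp add: sum_subtractf sum_distrib_right)
    qed
    then show ?thesis by (simp add: vec_eq_iff inner_vec_def)
  qed
  have "0 \<le> x \<bullet> (A *v x)" for x
    using Cauchy_Schwarz_ineq[of e x] e by (simp add: Ax inner_diff_right inner_commute power2_eq_square dot_square_norm)
  from trace_mult_psd[OF this N] have "0 \<le> trace (A ** N)" .
  also have "trace (A ** N) = trace N - e \<bullet> (N *v e)"
  proof -
    have "A $ i $ j * N $ j $ i = (if i = j then N $ j $ i else 0) - e $ i * e $ j * N $ j $ i" for i j
      by (simp add: A_def left_diff_distrib)
    then have "trace (A ** N) = (\<Sum>i\<in>UNIV. \<Sum>j\<in>UNIV. (if i = j then N $ j $ i else 0)) - (\<Sum>i\<in>UNIV. \<Sum>j\<in>UNIV. e $ i * e $ j * N $ j $ i)"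
      unfolding trace_mult by (simp only: sum_subtractf)
    also have "(\<Sum>i\<in>UNIV. \<Sum>j\<in>UNIV. (if i = j then N $ j $ i else 0)) = trace N" by (simp add: trace_def)
    also have "(\<Sum>i\<in>UNIV. \<Sum>j\<in>UNIV. e $ i * e $ j * N $ j $ i) = (\<Sum>j\<in>UNIV. \<Sum>i\<in>UNIV. e $ i * e $ j * N $ j $ i)" by (rule sum.swap)
    also have "\<dots> = e \<bullet> (N *v e)"
      by (simp add: inner_vec_def matrix_vector_mult_def sum_distrib_left mult_ac)
    finally show ?thesis .
  qed
  finally show ?thesis by simp
qed

section \<open>Viscosity solutions\<close>

text \<open>Reduces to the normalized version by moving a and b to the origin and subtracting the
  common slope p. Half of \<kappa> is spent on enlarging X and diminishing Y, which absorbs the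
  small errors of the expansions: u is touched from above and v from below by exact
  paraboloids.\<close>

theorem theorem_on_sums:
  fixes u v :: "real^'n \<Rightarrow> real" and Z :: "real^'n^'n"
  assumes Z: "symmetric_mat Z" "\<And>x. norm (Z *v x) \<le> \<zeta> * norm x" and \<zeta>: "\<zeta> \<ge> 0"
    and cont: "continuous_on (cball a \<rho>) u" "continuous_on (cball b \<rho>) v" and \<rho>: "\<rho> > 0"
    and max: "\<And>x y. x \<in> cball a \<rho> \<Longrightarrow> y \<in> cball b \<rho> \<Longrightarrow>
       u x - v y \<le> u a - v b + p \<bullet> ((x - a) - (y - b)) + 1/2 * (((x - a) - (y - b)) \<bullet> (Z *v ((x - a) - (y - b))))"
    and \<theta>: "\<theta> > 0" and \<kappa>: "\<kappa> > 0" and \<epsilon>: "\<epsilon> > 0"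
  obtains x y p' q' X Y r where "dist x a < \<epsilon>" "dist y b < \<epsilon>" "dist p' p < \<epsilon>" "dist q' p < \<epsilon>"
    "symmetric_mat X" "symmetric_mat Y" "r > 0"
    "\<And>h. norm h < r \<Longrightarrow> u (x + h) \<le> u x + p' \<bullet> h + 1/2 * (h \<bullet> (X *v h))"
    "\<And>h. norm h < r \<Longrightarrow> v (y + h) \<ge> v y + q' \<bullet> h + 1/2 * (h \<bullet> (Y *v h))"
    "\<And>\<xi> \<eta>. \<xi> \<bullet> (X *v \<xi>) - \<eta> \<bullet> (Y *v \<eta>) \<le> (\<xi> - \<eta>) \<bullet> (Z *v (\<xi> - \<eta>)) + 2 * \<theta> * ((Z *v (\<xi> - \<eta>)) \<bullet> (Z *v (\<xi> - \<eta>))) + \<kappa> * (\<xi> \<bullet> \<xi> + \<eta> \<bullet> \<eta>)"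
    "\<And>\<xi>. \<xi> \<bullet> (X *v \<xi>) \<ge> - (1/\<theta> + 2 * \<zeta>) * (\<xi> \<bullet> \<xi>)"
    "\<And>\<eta>. \<eta> \<bullet> (Y *v \<eta>) \<le> (1/\<theta> + 2 * \<zeta>) * (\<eta> \<bullet> \<eta>)"
proof -
  define A where "A = (\<lambda>\<xi>. u (a + \<xi>) - u a - p \<bullet> \<xi>)"
  define B where "B = (\<lambda>\<eta>. v b - v (b + \<eta>) + p \<bullet> \<eta>)"
  have cA: "continuous_on (cball 0 \<rho>) A"
    unfolding A_def by (intro continuous_intros continuous_on_compose2[OF cont(1)]) (auto simp: dist_norm)
  have cB: "continuous_on (cball 0 \<rho>) B"
    unfolding B_def by (intro continuous_intros continuous_on_compose2[OF cont(2)]) (auto simp: dist_norm)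
  have lin: "linear ((*v) Z)" by (rule matrix_vector_mul_linear)
  have k2: "\<kappa>/2 > 0" "\<kappa>/4 > 0" using \<kappa> by auto
  have m: "A \<xi> + B \<eta> \<le> 1/2 * ((\<xi> - \<eta>) \<bullet> (Z *v (\<xi> - \<eta>)))" if "\<xi> \<in> cball 0 \<rho>" "\<eta> \<in> cball 0 \<rho>" for \<xi> \<eta>
    using max[of "a + \<xi>" "b + \<eta>"] that by (simp add: A_def B_def dist_norm inner_diff_right)
  obtain x y p' q X Y where n: "norm x < \<epsilon>" "norm y < \<epsilon>" "norm p' < \<epsilon>" "norm q < \<epsilon>"
    and X: "linear X" "\<And>x y. X x \<bullet> y = x \<bullet> X y" and Y: "linear Y" "\<And>x y. Y x \<bullet> y = x \<bullet> Y y"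
    and jA: "\<And>e. e > 0 \<Longrightarrow> \<exists>\<delta>>0. \<forall>h. norm h < \<delta> \<longrightarrow> A (x + h) \<le> A x + p' \<bullet> h + 1/2 * (h \<bullet> X h) + e * (h \<bullet> h)"
    and jB: "\<And>e. e > 0 \<Longrightarrow> \<exists>\<delta>>0. \<forall>h. norm h < \<delta> \<longrightarrow> B (y + h) \<le> B y - q \<bullet> h - 1/2 * (h \<bullet> Y h) + e * (h \<bullet> h)"
    and le: "\<And>\<xi> \<eta>. \<xi> \<bullet> X \<xi> - \<eta> \<bullet> Y \<eta> \<le> (\<xi> - \<eta>) \<bullet> (Z *v (\<xi> - \<eta>)) + 2 * \<theta> * ((Z *v (\<xi> - \<eta>)) \<bullet> (Z *v (\<xi> - \<eta>))) + \<kappa>/2 * (\<xi> \<bullet> \<xi> + \<eta> \<bullet> \<eta>)"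
    and lX: "\<And>\<xi>. \<xi> \<bullet> X \<xi> \<ge> - (1/\<theta> + 2 * \<zeta>) * (\<xi> \<bullet> \<xi>)"
    and uY: "\<And>\<eta>. \<eta> \<bullet> Y \<eta> \<le> (1/\<theta> + 2 * \<zeta>) * (\<eta> \<bullet> \<eta>)"
    by (rule theorem_on_sums_at_zero[OF lin symmetric_mat_inner[OF Z(1)] Z(2) \<zeta> cA cB \<rho> _ _ m \<theta> k2(1) \<epsilon>]) (auto simp: A_def B_def)
  define MX where "MX = matrix X + mat (\<kappa>/2)"
  define MY where "MY = matrix Y - mat (\<kappa>/2)"
  have MX: "MX *v h = X h + (\<kappa>/2) *\<^sub>R h" for h
    by (simp add: MX_def matrix_vector_mult_add_rdistrib mat_mult_vec matrix_works linear_matrix_vector_mul_eq X(1))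
  have MY: "MY *v h = Y h - (\<kappa>/2) *\<^sub>R h" for h
    by (simp add: MY_def matrix_vector_mult_diff_rdistrib mat_mult_vec matrix_works linear_matrix_vector_mul_eq Y(1))
  obtain r1 where r1: "r1 > 0" "\<And>h. norm h < r1 \<Longrightarrow> A (x + h) \<le> A x + p' \<bullet> h + 1/2 * (h \<bullet> X h) + \<kappa>/4 * (h \<bullet> h)"
    using jA[OF k2(2)] by blast
  obtain r2 where r2: "r2 > 0" "\<And>h. norm h < r2 \<Longrightarrow> B (y + h) \<le> B y - q \<bullet> h - 1/2 * (h \<bullet> Y h) + \<kappa>/4 * (h \<bullet> h)"
    using jB[OF k2(2)] by blast
  show ?thesis
  proof (rule that[of "a + x" "b + y" "p + p'" "p + q" MX MY "min r1 r2"])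
    show "dist (a + x) a < \<epsilon>" "dist (b + y) b < \<epsilon>" "dist (p + p') p < \<epsilon>" "dist (p + q) p < \<epsilon>"
      using n by (simp_all add: dist_norm)
    show "symmetric_mat MX" "symmetric_mat MY"
      unfolding MX_def MY_def by (intro symmetric_mat_add symmetric_mat_diff symmetric_mat_matrix X Y symmetric_mat_mat)+
    show "min r1 r2 > 0" using r1(1) r2(1) by simp
    show "u (a + x + h) \<le> u (a + x) + (p + p') \<bullet> h + 1/2 * (h \<bullet> (MX *v h))" if "norm h < min r1 r2" for h
      using r1(2)[of h] that by (simp add: A_def MX inner_add_left inner_add_right add.assoc add_divide_distrib)
    show "v (b + y + h) \<ge> v (b + y) + (p + q) \<bullet> h + 1/2 * (h \<bullet> (MY *v h))" if "norm h < min r1 r2" for h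
      using r2(2)[of h] that by (simp add: B_def MY inner_add_left inner_add_right inner_diff_right add.assoc diff_divide_distrib add_divide_distrib)
    show "\<xi> \<bullet> (MX *v \<xi>) - \<eta> \<bullet> (MY *v \<eta>) \<le> (\<xi> - \<eta>) \<bullet> (Z *v (\<xi> - \<eta>)) + 2 * \<theta> * ((Z *v (\<xi> - \<eta>)) \<bullet> (Z *v (\<xi> - \<eta>))) + \<kappa> * (\<xi> \<bullet> \<xi> + \<eta> \<bullet> \<eta>)" for \<xi> \<eta>
      using le[of \<xi> \<eta>] by (simp add: MX MY inner_add_right inner_diff_right algebra_simps) (simp add: field_simps)?
    show "\<xi> \<bullet> (MX *v \<xi>) \<ge> - (1/\<theta> + 2 * \<zeta>) * (\<xi> \<bullet> \<xi>)" for \<xi>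
    proof -
      have "\<xi> \<bullet> (MX *v \<xi>) = \<xi> \<bullet> X \<xi> + \<kappa>/2 * (\<xi> \<bullet> \<xi>)" by (simp add: MX inner_add_right)
      moreover have "\<kappa>/2 * (\<xi> \<bullet> \<xi>) \<ge> 0" using \<kappa> by simp
      ultimately show ?thesis using lX[of \<xi>] by linarith
    qed
    show "\<eta> \<bullet> (MY *v \<eta>) \<le> (1/\<theta> + 2 * \<zeta>) * (\<eta> \<bullet> \<eta>)" for \<eta>
    proof -
      have "\<eta> \<bullet> (MY *v \<eta>) = \<eta> \<bullet> Y \<eta> - \<kappa>/2 * (\<eta> \<bullet> \<eta>)" by (simp add: MY inner_diff_right)
      moreover have "\<kappa>/2 * (\<eta> \<bullet> \<eta>) \<ge> 0" using \<kappa> by simp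
      ultimately show ?thesis using uY[of \<eta>] by linarith
    qed
  qed
qed

section \<open>Test functions and touching paraboloids\<close>

lemma C2_with_add:
  assumes "C2_with f Df D2f S" "C2_with g Dg D2g S"
  shows "C2_with (\<lambda>x. f x + g x) (\<lambda>x. Df x + Dg x) (\<lambda>x. D2f x + D2g x) S"
  using assms unfolding C2_with_def
  by (auto intro!: continuous_intros derivative_eq_intros simp: inner_add_left matrix_vector_mult_add_rdistrib)

lemma C2_with_scale:
  assumes "C2_with f Df D2f S"
  shows "C2_with (\<lambda>x. c * f x) (\<lambda>x. c *\<^sub>R Df x) (\<lambda>x. c *\<^sub>R D2f x) S"
  using assms unfolding C2_with_def
  by (auto intro!: continuous_intros derivative_eq_intros simp: scaleR_matrix_vector_assoc)

lemma C2_with_neg: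
  assumes "C2_with f Df D2f S"
  shows "C2_with (\<lambda>x. - f x) (\<lambda>x. - Df x) (\<lambda>x. - D2f x) S"
  using C2_with_scale[OF assms, of "-1"] by simp

lemma C2_with_const: "C2_with (\<lambda>x. c) (\<lambda>x. 0) (\<lambda>x. 0) S"
  unfolding C2_with_def by (auto intro!: derivative_eq_intros)

lemma C2_with_quadratic:
  fixes X :: "real^'n^'n"
  assumes "symmetric_mat X"
  shows "C2_with (\<lambda>y. p \<bullet> (y - a) + 1/2 * ((y - a) \<bullet> (X *v (y - a)))) (\<lambda>y. p + X *v (y - a)) (\<lambda>y. X) S"
  unfolding C2_with_def
proof (intro conjI ballI continuous_on_const)
  have d: "((\<lambda>y. X *v (y - a)) has_derivative (\<lambda>h. X *v h)) (at x)" for x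
    by (auto intro!: derivative_eq_intros bounded_linear.has_derivative[OF matrix_vector_mul_bounded_linear])
  show "((\<lambda>y. p + X *v (y - a)) has_derivative (\<lambda>h. X *v h)) (at x)" for x
    by (auto intro!: derivative_eq_intros d)
  show "((\<lambda>y. p \<bullet> (y - a) + 1/2 * ((y - a) \<bullet> (X *v (y - a)))) has_derivative (\<lambda>h. (p + X *v (x - a)) \<bullet> h)) (at x)" for x
  proof -
    have "((\<lambda>y. p \<bullet> (y - a) + 1/2 * ((y - a) \<bullet> (X *v (y - a)))) has_derivative
       (\<lambda>h. p \<bullet> h + 1/2 * ((x - a) \<bullet> (X *v h) + h \<bullet> (X *v (x - a))))) (at x)"
      by (auto intro!: derivative_eq_intros d)
    moreover have "p \<bullet> h + 1/2 * ((x - a) \<bullet> (X *v h) + h \<bullet> (X *v (x - a))) = (p + X *v (x - a)) \<bullet> h" for h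
      using symmetric_mat_inner[OF assms, of "x - a" h]
      by (simp add: inner_add_right inner_commute[of _ h] inner_commute[of "X *v h"])
    ultimately show ?thesis by simp
  qed
qed

text \<open>A smooth \<psi> is carried along because later the doubled maximum concerns u - \<psi>,
  whereas the equation is one for u.\<close>

lemma visc_sub_jet:
  fixes u :: "real^'n \<Rightarrow> real"
  assumes sub: "visc_sub F f u \<Omega>" and x: "x \<in> \<Omega>" and \<psi>: "C2_with \<psi> D\<psi> D2\<psi> \<Omega>" and X: "symmetric_mat X" and r: "r > 0"
    and jet: "\<And>h. norm h < r \<Longrightarrow> u (x + h) - \<psi> (x + h) \<le> u x - \<psi> x + p \<bullet> h + 1/2 * (h \<bullet> (X *v h))"
  shows "F (D2\<psi> x + X) (D\<psi> x + p) (u x) x \<le> f x"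
proof -
  define \<phi> where "\<phi> = (\<lambda>y. \<psi> y + (p \<bullet> (y - x) + 1/2 * ((y - x) \<bullet> (X *v (y - x)))))"
  have C2: "C2_with \<phi> (\<lambda>y. D\<psi> y + (p + X *v (y - x))) (\<lambda>y. D2\<psi> y + X) \<Omega>"
    unfolding \<phi>_def by (intro C2_with_add \<psi> C2_with_quadratic X)
  have "u y - \<phi> y \<le> u x - \<phi> x" if "y \<in> ball x r" for y
    using jet[of "y - x"] that by (simp add: \<phi>_def dist_norm norm_minus_commute)
  then have "\<exists>e>0. \<forall>y\<in>ball x e \<inter> \<Omega>. u y - \<phi> y \<le> u x - \<phi> x" using r by blast
  with sub C2 x have "F (D2\<psi> x + X) (D\<psi> x + (p + X *v (x - x))) (u x) x \<le> f x"
    unfolding visc_sub_def by blast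
  then show ?thesis by simp
qed

text \<open>The operator satisfied by -u; it exchanges sub- and supersolutions, so facts about one
  kind are read off from the other.\<close>

definition flip_op :: "(real^'n^'n \<Rightarrow> real^'n \<Rightarrow> real \<Rightarrow> real^'n \<Rightarrow> real) \<Rightarrow> real^'n^'n \<Rightarrow> real^'n \<Rightarrow> real \<Rightarrow> real^'n \<Rightarrow> real"
  where "flip_op F M p z x = - F (- M) (- p) (- z) x"

lemma visc_super_imp_sub_flip:
  assumes "visc_super F f v \<Omega>"
  shows "visc_sub (flip_op F) (\<lambda>x. - f x) (\<lambda>x. - v x) \<Omega>"
  unfolding visc_sub_def
proof (intro allI impI, elim conjE exE)
  fix \<phi> D\<phi> D2\<phi> x0 e
  assume C2: "C2_with \<phi> D\<phi> D2\<phi> \<Omega>" and x0: "x0 \<in> \<Omega>" and e: "0 < e" "\<forall>y\<in>ball x0 e \<inter> \<Omega>. - v y - \<phi> y \<le> - v x0 - \<phi> x0"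
  have "\<exists>e>0. \<forall>y\<in>ball x0 e \<inter> \<Omega>. v y - (- \<phi> y) \<ge> v x0 - (- \<phi> x0)"
    using e by (intro exI[of _ e]) force
  then have "F (- D2\<phi> x0) (- D\<phi> x0) (v x0) x0 \<ge> f x0"
    using assms C2_with_neg[OF C2] x0 unfolding visc_super_def by blast
  then show "flip_op F (D2\<phi> x0) (D\<phi> x0) (- v x0) x0 \<le> - f x0" by (simp add: flip_op_def)
qed

lemma visc_sub_imp_super_flip:
  assumes "visc_sub F f u \<Omega>"
  shows "visc_super (flip_op F) (\<lambda>x. - f x) (\<lambda>x. - u x) \<Omega>"
  unfolding visc_super_def
proof (intro allI impI, elim conjE exE)
  fix \<phi> D\<phi> D2\<phi> x0 e
  assume C2: "C2_with \<phi> D\<phi> D2\<phi> \<Omega>" and x0: "x0 \<in> \<Omega>" and e: "0 < e" "\<forall>y\<in>ball x0 e \<inter> \<Omega>. - u y - \<phi> y \<ge> - u x0 - \<phi> x0"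
  have "\<exists>e>0. \<forall>y\<in>ball x0 e \<inter> \<Omega>. u y - (- \<phi> y) \<le> u x0 - (- \<phi> x0)"
    using e by (intro exI[of _ e]) force
  then have "F (- D2\<phi> x0) (- D\<phi> x0) (u x0) x0 \<le> f x0"
    using assms C2_with_neg[OF C2] x0 unfolding visc_sub_def by blast
  then show "flip_op F (D2\<phi> x0) (D\<phi> x0) (- u x0) x0 \<ge> - f x0" by (simp add: flip_op_def)
qed

lemma visc_super_jet:
  fixes v :: "real^'n \<Rightarrow> real"
  assumes super: "visc_super F f v \<Omega>" and x: "x \<in> \<Omega>" and X: "symmetric_mat X" and r: "r > 0"
    and jet: "\<And>h. norm h < r \<Longrightarrow> v (x + h) \<ge> v x + p \<bullet> h + 1/2 * (h \<bullet> (X *v h))"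
  shows "F X p (v x) x \<ge> f x"
proof -
  have "flip_op F (0 + - X) (0 + - p) (- v x) x \<le> - f x"
    by (rule visc_sub_jet[OF visc_super_imp_sub_flip[OF super] x C2_with_const[of 0] symmetric_mat_minus[OF X] r])
       (use jet in \<open>force simp: matrix_vector_mult_minus\<close>)
  then show ?thesis by (simp add: flip_op_def)
qed

lemma trace_le_norm:
  fixes E :: "real^'n^'n"
  shows "trace E \<le> real CARD('n) * norm E"
proof -
  have "E $ i $ i \<le> norm E" for i
  proof -
    have "norm (E $ i) \<le> norm E" by (rule Finite_Cartesian_Product.norm_nth_le)
    then show ?thesis using component_le_norm_cart[of "E $ i" i] by linarith
  qed
  then have "trace E \<le> (\<Sum>i\<in>(UNIV::'n set). norm E)" unfolding trace_def by (intro sum_mono)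
  then show ?thesis by simp
qed

lemma pucci_minus_ge_norm:
  fixes E :: "real^'n^'n"
  assumes "0 \<le> \<gamma>" "\<gamma> \<le> \<Gamma>" "symmetric_mat E"
  shows "- ((\<gamma> + \<Gamma>) * real CARD('n) * norm E) \<le> pucci_minus \<gamma> \<Gamma> E"
proof -
  have "- \<gamma> * trace E - real CARD('n) * \<Gamma> * norm E \<le> pucci_minus \<gamma> \<Gamma> E"
    using abs_le_D1[OF quadratic_form_le_norm[of _ E]] assms by (intro pucci_minus_ge) auto
  moreover have "\<gamma> * trace E \<le> \<gamma> * (real CARD('n) * norm E)"
    using trace_le_norm assms(1) by (intro mult_left_mono)
  ultimately show ?thesis by (simp add: algebra_simps)
qed

text \<open>The modulus is recorded for arguments bounded by 1, and homogeneity extends it to all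
  arguments. As a locale, the hypotheses can be instantiated a second time, for the flipped operator
  with the same constants.\<close>

locale elliptic_operator =
  fixes F :: "real^'n^'n \<Rightarrow> real^'n \<Rightarrow> real \<Rightarrow> real^'n \<Rightarrow> real" and \<Omega> :: "(real^'n) set"
    and \<gamma> \<Gamma> \<delta>\<^sub>0 \<delta>\<^sub>1 \<nu> :: real and \<omega> :: "real \<Rightarrow> real"
  assumes \<gamma>_pos: "0 < \<gamma>" and \<gamma>_le_\<Gamma>: "\<gamma> \<le> \<Gamma>" and \<delta>\<^sub>0_nonneg: "0 \<le> \<delta>\<^sub>0" and \<delta>\<^sub>1_nonneg: "0 \<le> \<delta>\<^sub>1"
    and \<nu>_gt: "1/2 < \<nu>" and \<nu>_le: "\<nu> \<le> 1"
    and \<omega>_mono: "mono_on {0..} \<omega>" and \<omega>_cont: "continuous_on {0..} \<omega>" and \<omega>_0: "\<omega> 0 = 0" and \<omega>_nonneg: "\<And>s. 0 \<le> s \<Longrightarrow> 0 \<le> \<omega> s"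
    and elliptic: "\<And>M N p q z w x. symmetric_mat M \<Longrightarrow> symmetric_mat N \<Longrightarrow> x \<in> \<Omega> \<Longrightarrow>
       pucci_minus \<gamma> \<Gamma> (M - N) - \<delta>\<^sub>1 * norm (p - q) - \<delta>\<^sub>0 * \<bar>z - w\<bar> \<le> F M p z x - F N q w x"
    and homogeneous: "\<And>t M p z x. 0 \<le> t \<Longrightarrow> symmetric_mat M \<Longrightarrow> x \<in> \<Omega> \<Longrightarrow>
       F (t *\<^sub>R M) (t *\<^sub>R p) (t * z) x = t * F M p z x"
    and modulus: "\<And>M p z x y. symmetric_mat M \<Longrightarrow> norm p \<le> 1 \<Longrightarrow> \<bar>z\<bar> \<le> 1 \<Longrightarrow> x \<in> \<Omega> \<Longrightarrow> y \<in> \<Omega> \<Longrightarrow>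
       \<bar>F M p z x - F M p z y\<bar> \<le> \<omega> (dist x y powr \<nu> * (norm M + 1))"
begin

text \<open>Homogeneity turns the modulus into a bound that is affine in the matrix.\<close>

lemma space_dependence:
  assumes s: "s > 0" and M: "symmetric_mat M" and xy: "x \<in> \<Omega>" "y \<in> \<Omega>" and d: "dist x y powr \<nu> \<le> s"
  shows "\<bar>F M p z x - F M p z y\<bar> \<le> (1 + norm p + \<bar>z\<bar> + dist x y powr \<nu> * norm M / s) * \<omega> (2 * s)"
proof -
  define a where "a = dist x y powr \<nu>"
  \<comment> \<open>Dividing by c makes p and z at most 1 and |x - y|^\<nu> times the matrix norm at
    most s, so the argument of \<omega> is at most 2 s.\<close>
  define c where "c = 1 + norm p + \<bar>z\<bar> + a * norm M / s"
  have a: "a \<ge> 0" "a \<le> s" using d by (auto simp: a_def)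
  have frac: "a * norm M / s \<ge> 0" using a s by simp
  have c: "c \<ge> 1" "c \<ge> norm p" "c \<ge> \<bar>z\<bar>" "c \<ge> a * norm M / s"
    using frac norm_ge_zero[of p] by (auto simp: c_def)
  then have c0: "c > 0" by linarith
  have M': "symmetric_mat ((1/c) *\<^sub>R M)" by (rule symmetric_mat_scaleR[OF M])
  have scale: "F M p z w = c * F ((1/c) *\<^sub>R M) ((1/c) *\<^sub>R p) (z / c) w" if "w \<in> \<Omega>" for w
    using homogeneous[of c "(1/c) *\<^sub>R M" w "(1/c) *\<^sub>R p" "z / c"] c0 M' that by simp
  have "\<bar>F ((1/c) *\<^sub>R M) ((1/c) *\<^sub>R p) (z / c) x - F ((1/c) *\<^sub>R M) ((1/c) *\<^sub>R p) (z / c) y\<bar>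
      \<le> \<omega> (a * (norm ((1/c) *\<^sub>R M) + 1))"
    unfolding a_def using c c0 by (intro modulus M' xy) (auto simp: divide_le_eq)
  also have "\<dots> \<le> \<omega> (2 * s)"
  proof (rule mono_onD[OF \<omega>_mono])
    have "a * norm M \<le> s * c" using c(4) s by (simp add: divide_le_eq mult.commute)
    then have "a * norm M / c \<le> s" using c0 by (simp add: divide_le_eq mult.commute)
    then show "a * (norm ((1/c) *\<^sub>R M) + 1) \<le> 2 * s" using a c0 by (simp add: distrib_left)
  qed (use a s in auto)
  finally have "c * \<bar>F ((1/c) *\<^sub>R M) ((1/c) *\<^sub>R p) (z / c) x - F ((1/c) *\<^sub>R M) ((1/c) *\<^sub>R p) (z / c) y\<bar> \<le> c * \<omega> (2 * s)"
    using c0 by (intro mult_left_mono) auto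
  moreover have "\<bar>F M p z x - F M p z y\<bar> = c * \<bar>F ((1/c) *\<^sub>R M) ((1/c) *\<^sub>R p) (z / c) x - F ((1/c) *\<^sub>R M) ((1/c) *\<^sub>R p) (z / c) y\<bar>"
    unfolding scale[OF xy(1)] scale[OF xy(2)] right_diff_distrib[symmetric] abs_mult using c0 by simp
  ultimately show ?thesis by (simp add: c_def a_def)
qed

end

lemma LIMSEQ_of_dist_less:
  assumes "\<And>k. dist (x k) a < 1 / real (Suc k)"
  shows "x \<longlonglongrightarrow> a"
proof -
  have "(\<lambda>k. dist (x k) a) \<longlonglongrightarrow> 0"
    by (rule tendsto_sandwich[OF _ _ tendsto_const LIMSEQ_inverse_real_of_nat])
       (use assms in \<open>auto simp: inverse_eq_divide less_imp_le simp del: of_nat_Suc\<close>)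
  then show ?thesis by (simp add: tendsto_dist_iff[of x])
qed

context elliptic_operator
begin

text \<open>The theorem on sums yields points near a and b, not a and b themselves. Instead of
  passing to a limit of the matrices, one stops at a late stage of the approximation: the bound on Y
  is uniform along it, and all other errors fall below \<eta>.\<close>

lemma inequality_at_maximum:
  assumes \<Omega>: "open \<Omega>" and sub: "visc_sub F f u \<Omega>" and super: "visc_super F g v \<Omega>"
    and cont: "continuous_on \<Omega> u" "continuous_on \<Omega> v" "continuous_on \<Omega> f" "continuous_on \<Omega> g"
    and \<psi>: "C2_with \<psi> D\<psi> D2\<psi> \<Omega>" "\<And>x. x \<in> \<Omega> \<Longrightarrow> symmetric_mat (D2\<psi> x)"
    and balls: "cball a \<rho> \<subseteq> \<Omega>" "cball b \<rho> \<subseteq> \<Omega>" and \<rho>: "\<rho> > 0"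
    and Z: "symmetric_mat Z" "\<And>x. norm (Z *v x) \<le> \<zeta> * norm x" and \<zeta>: "\<zeta> \<ge> 0"
    and max: "\<And>x y. x \<in> cball a \<rho> \<Longrightarrow> y \<in> cball b \<rho> \<Longrightarrow>
       u x - \<psi> x - v y \<le> u a - \<psi> a - v b + p \<bullet> ((x - a) - (y - b)) + 1/2 * (((x - a) - (y - b)) \<bullet> (Z *v ((x - a) - (y - b))))"
    and s: "s > 0" "dist a b powr \<nu> < s" and \<theta>: "\<theta> > 0" and \<eta>: "\<eta> > 0"
  obtains X Y where "symmetric_mat X" "symmetric_mat Y"
    "\<And>\<xi> \<upsilon>. \<xi> \<bullet> (X *v \<xi>) - \<upsilon> \<bullet> (Y *v \<upsilon>) \<le> (\<xi> - \<upsilon>) \<bullet> (Z *v (\<xi> - \<upsilon>)) + 2 * \<theta> * ((Z *v (\<xi> - \<upsilon>)) \<bullet> (Z *v (\<xi> - \<upsilon>))) + \<eta> * (\<xi> \<bullet> \<xi> + \<upsilon> \<bullet> \<upsilon>)"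
    "norm Y \<le> (real CARD('n))\<^sup>2 * max (1/\<theta> + 2 * \<zeta>) (\<zeta> + 2 * \<theta> * \<zeta>\<^sup>2 + \<eta>)"
    "pucci_minus \<gamma> \<Gamma> (X - Y + D2\<psi> a) - \<delta>\<^sub>1 * norm (D\<psi> a) - \<delta>\<^sub>0 * \<bar>u a - v b\<bar>
       - (1 + norm p + \<bar>v b\<bar> + dist a b powr \<nu> * norm Y / s) * \<omega> (2 * s) \<le> f a - g b + \<eta>"
proof -
  have ab: "a \<in> \<Omega>" "b \<in> \<Omega>" using balls \<rho> by auto
  define form where "form = (\<lambda>X Y::real^'n^'n. \<forall>\<xi> \<upsilon>. \<xi> \<bullet> (X *v \<xi>) - \<upsilon> \<bullet> (Y *v \<upsilon>) \<le> (\<xi> - \<upsilon>) \<bullet> (Z *v (\<xi> - \<upsilon>)) + 2 * \<theta> * ((Z *v (\<xi> - \<upsilon>)) \<bullet> (Z *v (\<xi> - \<upsilon>))) + \<eta> * (\<xi> \<bullet> \<xi> + \<upsilon> \<bullet> \<upsilon>))"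
  define upp where "upp = (\<lambda>Y::real^'n^'n. \<forall>\<xi>. \<xi> \<bullet> (Y *v \<xi>) \<le> (1/\<theta> + 2 * \<zeta>) * (\<xi> \<bullet> \<xi>))"
  \<comment> \<open>The two viscosity inequalities at x and y, joined by ellipticity at x and by the
    dependence of F on space between x and y.\<close>
  define raw where "raw = (\<lambda>x y p' q' X Y. dist x y powr \<nu> \<le> s \<longrightarrow>
      pucci_minus \<gamma> \<Gamma> (D2\<psi> x + X - Y) - \<delta>\<^sub>1 * norm (D\<psi> x + p' - q') - \<delta>\<^sub>0 * \<bar>u x - v y\<bar>
       - (1 + norm q' + \<bar>v y\<bar> + dist x y powr \<nu> * norm Y / s) * \<omega> (2 * s) \<le> f x - g y)"
  define Q where "Q = (\<lambda>k x y p' q' X Y. dist x a < 1 / real (Suc k) \<and> dist y b < 1 / real (Suc k) \<and>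
      dist p' p < 1 / real (Suc k) \<and> dist q' p < 1 / real (Suc k) \<and> x \<in> \<Omega> \<and> y \<in> \<Omega> \<and>
      symmetric_mat X \<and> symmetric_mat Y \<and> form X Y \<and> upp Y \<and> raw x y p' q' X Y)"
  have "\<forall>k. \<exists>x y p' q' X Y. Q k x y p' q' X Y"
  proof
    fix k :: nat
    define \<epsilon> where "\<epsilon> = min (1 / real (Suc k)) \<rho>"
    have \<epsilon>: "\<epsilon> > 0" using \<rho> by (simp add: \<epsilon>_def)
    have contu\<psi>: "continuous_on (cball a \<rho>) (\<lambda>x. u x - \<psi> x)"
    proof (intro continuous_on_diff continuous_on_subset[OF cont(1) balls(1)])
      show "continuous_on (cball a \<rho>) \<psi>"
        using \<psi>(1) balls(1) unfolding C2_with_def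
        by (meson has_derivative_continuous continuous_at_imp_continuous_on subsetD)
    qed
    obtain x y p' q' X Y r where d: "dist x a < \<epsilon>" "dist y b < \<epsilon>" "dist p' p < \<epsilon>" "dist q' p < \<epsilon>"
      and sym: "symmetric_mat X" "symmetric_mat Y" and r: "r > 0"
      and jx: "\<And>h. norm h < r \<Longrightarrow> u (x + h) - \<psi> (x + h) \<le> u x - \<psi> x + p' \<bullet> h + 1/2 * (h \<bullet> (X *v h))"
      and jy: "\<And>h. norm h < r \<Longrightarrow> v (y + h) \<ge> v y + q' \<bullet> h + 1/2 * (h \<bullet> (Y *v h))"
      and fm: "\<And>\<xi> \<upsilon>. \<xi> \<bullet> (X *v \<xi>) - \<upsilon> \<bullet> (Y *v \<upsilon>) \<le> (\<xi> - \<upsilon>) \<bullet> (Z *v (\<xi> - \<upsilon>)) + 2 * \<theta> * ((Z *v (\<xi> - \<upsilon>)) \<bullet> (Z *v (\<xi> - \<upsilon>))) + \<eta> * (\<xi> \<bullet> \<xi> + \<upsilon> \<bullet> \<upsilon>)"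
      and low: "\<And>\<xi>. \<xi> \<bullet> (X *v \<xi>) \<ge> - (1/\<theta> + 2 * \<zeta>) * (\<xi> \<bullet> \<xi>)"
      and up: "\<And>\<xi>. \<xi> \<bullet> (Y *v \<xi>) \<le> (1/\<theta> + 2 * \<zeta>) * (\<xi> \<bullet> \<xi>)"
      by (rule theorem_on_sums[OF Z \<zeta> contu\<psi> continuous_on_subset[OF cont(2) balls(2)] \<rho> max \<theta> \<eta> \<epsilon>]) blast+
    have x: "x \<in> \<Omega>" and y: "y \<in> \<Omega>"
      using d(1,2) balls by (auto simp: \<epsilon>_def dist_commute subset_iff)
    have "raw x y p' q' X Y"
      unfolding raw_def
    proof
      assume ds: "dist x y powr \<nu> \<le> s"
      have 1: "F (D2\<psi> x + X) (D\<psi> x + p') (u x) x \<le> f x"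
        by (rule visc_sub_jet[OF sub x \<psi>(1) sym(1) r jx])
      have 2: "F Y q' (v y) y \<ge> g y" by (rule visc_super_jet[OF super y sym(2) r jy])
      have 3: "\<bar>F Y q' (v y) x - F Y q' (v y) y\<bar> \<le> (1 + norm q' + \<bar>v y\<bar> + dist x y powr \<nu> * norm Y / s) * \<omega> (2 * s)"
        by (rule space_dependence[OF s(1) sym(2) x y ds])
      have 4: "pucci_minus \<gamma> \<Gamma> ((D2\<psi> x + X) - Y) - \<delta>\<^sub>1 * norm ((D\<psi> x + p') - q') - \<delta>\<^sub>0 * \<bar>u x - v y\<bar>
          \<le> F (D2\<psi> x + X) (D\<psi> x + p') (u x) x - F Y q' (v y) x"
        by (intro elliptic symmetric_mat_add \<psi>(2) x sym)
      show "pucci_minus \<gamma> \<Gamma> (D2\<psi> x + X - Y) - \<delta>\<^sub>1 * norm (D\<psi> x + p' - q') - \<delta>\<^sub>0 * \<bar>u x - v y\<bar>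
       - (1 + norm q' + \<bar>v y\<bar> + dist x y powr \<nu> * norm Y / s) * \<omega> (2 * s) \<le> f x - g y"
        using 1 2 3 4 by linarith
    qed
    moreover have "dist x a < 1 / real (Suc k)" "dist y b < 1 / real (Suc k)" "dist p' p < 1 / real (Suc k)" "dist q' p < 1 / real (Suc k)"
      using d unfolding \<epsilon>_def by linarith+
    ultimately have "Q k x y p' q' X Y"
      unfolding Q_def form_def upp_def using x y sym fm up by blast
    then show "\<exists>x y p' q' X Y. Q k x y p' q' X Y" by blast
  qed
  then obtain x y p' q' X Y where Q: "\<And>k. Q k (x k) (y k) (p' k) (q' k) (X k) (Y k)" by metis
  have lim: "x \<longlonglongrightarrow> a" "y \<longlonglongrightarrow> b" "p' \<longlonglongrightarrow> p" "q' \<longlonglongrightarrow> p"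
    using Q unfolding Q_def by (blast intro: LIMSEQ_of_dist_less)+
  have dom: "x k \<in> \<Omega>" "y k \<in> \<Omega>" and sym: "symmetric_mat (X k)" "symmetric_mat (Y k)"
    and fm: "form (X k) (Y k)" and up: "upp (Y k)" and rw: "raw (x k) (y k) (p' k) (q' k) (X k) (Y k)" for k
    using Q[of k] unfolding Q_def by blast+
  define BY where "BY = (real CARD('n))\<^sup>2 * max (1/\<theta> + 2 * \<zeta>) (\<zeta> + 2 * \<theta> * \<zeta>\<^sup>2 + \<eta>)"
  have BY: "norm (Y k) \<le> BY" for k
    unfolding BY_def
  proof (rule norm_mat_le_form[OF sym(2)])
    fix \<xi> :: "real^'n"
    have up': "\<xi> \<bullet> (Y k *v \<xi>) \<le> (1/\<theta> + 2 * \<zeta>) * (\<xi> \<bullet> \<xi>)" using up unfolding upp_def by blast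
    have zz: "norm (Z *v \<xi>) * norm (Z *v \<xi>) \<le> \<zeta>\<^sup>2 * (\<xi> \<bullet> \<xi>)"
      using mult_mono[OF Z(2)[of \<xi>] Z(2)[of \<xi>]] \<zeta> by (simp add: power2_eq_square dot_square_norm mult_ac)
    have z1: "\<xi> \<bullet> (Z *v \<xi>) \<le> \<zeta> * (\<xi> \<bullet> \<xi>)"
      using norm_cauchy_schwarz[of \<xi> "Z *v \<xi>"] mult_left_mono[OF Z(2)[of \<xi>] norm_ge_zero[of \<xi>]]
      by (simp add: power2_eq_square dot_square_norm mult_ac)
    have "Y k *v (- \<xi>) = - (Y k *v \<xi>)"
      using matrix_vector_mult_scaleR[of "Y k" "-1" \<xi>] by simp
    \<comment> \<open>The form inequality with first vector 0 and second vector -\<xi> bounds Y from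
      below.\<close>
    then have "- (\<xi> \<bullet> (Y k *v \<xi>)) \<le> \<xi> \<bullet> (Z *v \<xi>) + 2 * \<theta> * ((Z *v \<xi>) \<bullet> (Z *v \<xi>)) + \<eta> * (\<xi> \<bullet> \<xi>)"
      using fm[of k, unfolded form_def, rule_format, of 0 "- \<xi>"] by simp
    also have "2 * \<theta> * ((Z *v \<xi>) \<bullet> (Z *v \<xi>)) \<le> 2 * \<theta> * (\<zeta>\<^sup>2 * (\<xi> \<bullet> \<xi>))"
      using zz \<theta> by (intro mult_left_mono) (auto simp: dot_square_norm power2_eq_square)
    also have "\<xi> \<bullet> (Z *v \<xi>) \<le> \<zeta> * (\<xi> \<bullet> \<xi>)" by (rule z1)
    finally have low': "- (\<xi> \<bullet> (Y k *v \<xi>)) \<le> (\<zeta> + 2 * \<theta> * \<zeta>\<^sup>2 + \<eta>) * (\<xi> \<bullet> \<xi>)" by (simp add: algebra_simps)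
    have "(1/\<theta> + 2 * \<zeta>) * (\<xi> \<bullet> \<xi>) \<le> max (1/\<theta> + 2 * \<zeta>) (\<zeta> + 2 * \<theta> * \<zeta>\<^sup>2 + \<eta>) * (\<xi> \<bullet> \<xi>)"
         "(\<zeta> + 2 * \<theta> * \<zeta>\<^sup>2 + \<eta>) * (\<xi> \<bullet> \<xi>) \<le> max (1/\<theta> + 2 * \<zeta>) (\<zeta> + 2 * \<theta> * \<zeta>\<^sup>2 + \<eta>) * (\<xi> \<bullet> \<xi>)"
      by (intro mult_right_mono; simp)+
    then show "\<bar>\<xi> \<bullet> (Y k *v \<xi>)\<bar> \<le> max (1/\<theta> + 2 * \<zeta>) (\<zeta> + 2 * \<theta> * \<zeta>\<^sup>2 + \<eta>) * (\<xi> \<bullet> \<xi>)"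
      using up' low' by linarith
  qed
  have clim: "(\<lambda>k. h (t k)) \<longlonglongrightarrow> h c" if "continuous_on \<Omega> h" "t \<longlonglongrightarrow> c" "c \<in> \<Omega>" for h :: "real^'n \<Rightarrow> 'z::topological_space" and t c
    using that \<Omega> continuous_on_eq_continuous_at isCont_tendsto_compose by blast
  have D\<psi>c: "continuous_on \<Omega> D\<psi>"
    using \<psi>(1) unfolding C2_with_def by (meson has_derivative_continuous continuous_at_imp_continuous_on)
  have D2\<psi>c: "continuous_on \<Omega> D2\<psi>" using \<psi>(1) unfolding C2_with_def by blast
  have dlim: "(\<lambda>k. dist (x k) (y k) powr \<nu>) \<longlonglongrightarrow> dist a b powr \<nu>"
    using \<nu>_gt by (intro tendsto_powr' tendsto_dist lim tendsto_const) auto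
  \<comment> \<open>Everything that changes when x k, y k and the slopes are replaced by their
    limits. It tends to 0 because |Y k| enters through its bound \<open>BY\<close> only.\<close>
  define rr where "rr = (\<lambda>k. (f (x k) - f a) - (g (y k) - g b) + (\<gamma> + \<Gamma>) * real CARD('n) * norm (D2\<psi> (x k) - D2\<psi> a)
     + \<delta>\<^sub>1 * (norm (D\<psi> (x k) + p' k - q' k) - norm (D\<psi> a)) + \<delta>\<^sub>0 * (\<bar>u (x k) - v (y k)\<bar> - \<bar>u a - v b\<bar>)
     + \<omega> (2 * s) * (norm (q' k) - norm p + (\<bar>v (y k)\<bar> - \<bar>v b\<bar>) + BY / s * \<bar>dist (x k) (y k) powr \<nu> - dist a b powr \<nu>\<bar>))"
  have "rr \<longlonglongrightarrow> (f a - f a) - (g b - g b) + (\<gamma> + \<Gamma>) * real CARD('n) * norm (D2\<psi> a - D2\<psi> a)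
     + \<delta>\<^sub>1 * (norm (D\<psi> a + p - p) - norm (D\<psi> a)) + \<delta>\<^sub>0 * (\<bar>u a - v b\<bar> - \<bar>u a - v b\<bar>)
     + \<omega> (2 * s) * (norm p - norm p + (\<bar>v b\<bar> - \<bar>v b\<bar>) + BY / s * \<bar>dist a b powr \<nu> - dist a b powr \<nu>\<bar>)"
    unfolding rr_def by (intro tendsto_intros clim[OF cont(1)] clim[OF cont(2)] clim[OF cont(3)] clim[OF cont(4)] clim[OF D\<psi>c] clim[OF D2\<psi>c] lim ab dlim)
  then have "rr \<longlonglongrightarrow> 0" by simp
  then have "\<forall>\<^sub>F k in sequentially. rr k < \<eta>" using \<eta> by (rule order_tendstoD(2))
  moreover have "\<forall>\<^sub>F k in sequentially. dist (x k) (y k) powr \<nu> < s" using dlim s(2) by (rule order_tendstoD(2))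
  ultimately have "\<forall>\<^sub>F k in sequentially. rr k < \<eta> \<and> dist (x k) (y k) powr \<nu> < s" by eventually_elim simp
  then obtain k where k: "rr k < \<eta>" "dist (x k) (y k) powr \<nu> < s"
    using eventually_happens sequentially_bot by blast
  have symE: "symmetric_mat (X k - Y k + D2\<psi> a)" "symmetric_mat (D2\<psi> (x k) - D2\<psi> a)"
    by (intro symmetric_mat_add symmetric_mat_diff \<psi>(2) ab dom sym)+
  have "pucci_minus \<gamma> \<Gamma> (X k - Y k + D2\<psi> a) + pucci_minus \<gamma> \<Gamma> (D2\<psi> (x k) - D2\<psi> a) \<le> pucci_minus \<gamma> \<Gamma> ((X k - Y k + D2\<psi> a) + (D2\<psi> (x k) - D2\<psi> a))"
    using \<gamma>_pos \<gamma>_le_\<Gamma> symE by (intro pucci_minus_superadd) auto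
  also have "(X k - Y k + D2\<psi> a) + (D2\<psi> (x k) - D2\<psi> a) = D2\<psi> (x k) + X k - Y k" by (simp add: algebra_simps)
  finally have 1: "pucci_minus \<gamma> \<Gamma> (X k - Y k + D2\<psi> a) - (\<gamma> + \<Gamma>) * real CARD('n) * norm (D2\<psi> (x k) - D2\<psi> a) \<le> pucci_minus \<gamma> \<Gamma> (D2\<psi> (x k) + X k - Y k)"
    using pucci_minus_ge_norm[OF _ \<gamma>_le_\<Gamma> symE(2)] \<gamma>_pos by linarith
  have 2: "pucci_minus \<gamma> \<Gamma> (D2\<psi> (x k) + X k - Y k) - \<delta>\<^sub>1 * norm (D\<psi> (x k) + p' k - q' k) - \<delta>\<^sub>0 * \<bar>u (x k) - v (y k)\<bar>
       - (1 + norm (q' k) + \<bar>v (y k)\<bar> + dist (x k) (y k) powr \<nu> * norm (Y k) / s) * \<omega> (2 * s) \<le> f (x k) - g (y k)"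
    using rw[of k] k(2) unfolding raw_def by simp
  have 3: "(1 + norm (q' k) + \<bar>v (y k)\<bar> + dist (x k) (y k) powr \<nu> * norm (Y k) / s) * \<omega> (2 * s)
     \<le> (1 + norm p + \<bar>v b\<bar> + dist a b powr \<nu> * norm (Y k) / s) * \<omega> (2 * s)
       + \<omega> (2 * s) * (norm (q' k) - norm p + (\<bar>v (y k)\<bar> - \<bar>v b\<bar>) + BY / s * \<bar>dist (x k) (y k) powr \<nu> - dist a b powr \<nu>\<bar>)"
  proof -
    define D where "D = dist (x k) (y k) powr \<nu> - dist a b powr \<nu>"
    have "D * norm (Y k) \<le> \<bar>D\<bar> * BY"
      using mult_mono[OF abs_ge_self[of D] BY[of k]] by simp
    then have "D * norm (Y k) / s \<le> BY / s * \<bar>D\<bar>" using s(1) by (simp add: divide_right_mono mult.commute)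
    then have "dist (x k) (y k) powr \<nu> * norm (Y k) / s \<le> dist a b powr \<nu> * norm (Y k) / s + BY / s * \<bar>D\<bar>"
      by (simp add: D_def left_diff_distrib diff_divide_distrib)
    then have "(1 + norm (q' k) + \<bar>v (y k)\<bar> + dist (x k) (y k) powr \<nu> * norm (Y k) / s) * \<omega> (2 * s)
      \<le> ((1 + norm p + \<bar>v b\<bar> + dist a b powr \<nu> * norm (Y k) / s) + (norm (q' k) - norm p + (\<bar>v (y k)\<bar> - \<bar>v b\<bar>) + BY / s * \<bar>D\<bar>)) * \<omega> (2 * s)"
      using \<omega>_nonneg[of "2 * s"] s(1) by (intro mult_right_mono) auto
    then show ?thesis unfolding D_def by (simp only: distrib_right mult.commute[of "\<omega> (2 * s)"])
  qed
  have "pucci_minus \<gamma> \<Gamma> (X k - Y k + D2\<psi> a) - \<delta>\<^sub>1 * norm (D\<psi> a) - \<delta>\<^sub>0 * \<bar>u a - v b\<bar>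
       - (1 + norm p + \<bar>v b\<bar> + dist a b powr \<nu> * norm (Y k) / s) * \<omega> (2 * s) \<le> f a - g b + rr k"
    using 1 2 3 unfolding rr_def right_diff_distrib[of \<delta>\<^sub>1] right_diff_distrib[of \<delta>\<^sub>0] by linarith
  then have "pucci_minus \<gamma> \<Gamma> (X k - Y k + D2\<psi> a) - \<delta>\<^sub>1 * norm (D\<psi> a) - \<delta>\<^sub>0 * \<bar>u a - v b\<bar>
       - (1 + norm p + \<bar>v b\<bar> + dist a b powr \<nu> * norm (Y k) / s) * \<omega> (2 * s) \<le> f a - g b + \<eta>"
    using k(1) by linarith
  then show ?thesis
    using that[of "X k" "Y k"] sym fm[of k] BY[of k] unfolding form_def BY_def by blast
qed

end

section \<open>The inequality satisfied by a difference\<close>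

lemma taylor_second_order_upper:
  fixes h :: "real \<Rightarrow> real"
  assumes r: "r > 0" and h: "\<And>k. \<bar>k\<bar> < r \<Longrightarrow> (h has_real_derivative h' (c + k)) (at (c + k))"
    and h': "(h' has_real_derivative b) (at c)" and \<tau>: "\<tau> > 0"
  obtains \<delta> where "\<delta> > 0" "\<And>k. \<bar>k\<bar> < \<delta> \<Longrightarrow> h (c + k) \<le> h c + h' c * k + 1/2 * b * k\<^sup>2 + \<tau> * k\<^sup>2"
proof -
  have hd: "(h' has_derivative (\<lambda>k. b * k)) (at c)" using h' by (simp add: has_field_derivative_def)
  obtain \<delta>1 where \<delta>1: "\<delta>1 > 0" "\<And>y. norm (y - c) < \<delta>1 \<Longrightarrow> norm (h' y - h' c - b * (y - c)) \<le> \<tau> * norm (y - c)"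
    using hd \<tau> unfolding has_derivative_at_alt by blast
  define \<delta> where "\<delta> = min r \<delta>1"
  have "h (c + k) \<le> h c + h' c * k + 1/2 * b * k\<^sup>2 + \<tau> * k\<^sup>2" if k: "\<bar>k\<bar> < \<delta>" for k
  proof -
    \<comment> \<open>The function minus its quadratic model along the segment. The mean value
      theorem reduces the estimate to the differentiability of h' at c.\<close>
    define G where "G = (\<lambda>t. h (c + t * k) - h' c * (t * k) - 1/2 * b * (t * k)\<^sup>2)"
    have small: "\<bar>t * k\<bar> \<le> \<bar>k\<bar>" if "0 \<le> t" "t \<le> 1" for t
      using that by (simp add: abs_mult mult_left_le_one_le)
    have d: "(G has_real_derivative (h' (c + t * k) - h' c - b * (t * k)) * k) (at t)" if "0 \<le> t" "t \<le> 1" for t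
    proof -
      have "(h has_real_derivative h' (c + t * k)) (at (c + t * k))"
        using small[OF that] k by (intro h) (auto simp: \<delta>_def)
      then show ?thesis unfolding G_def
        by (auto intro!: derivative_eq_intros DERIV_chain2[where f = h and g = "\<lambda>t. c + t * k"] simp: power2_eq_square algebra_simps)
    qed
    obtain \<xi> where \<xi>: "0 < \<xi>" "\<xi> < 1" "G 1 - G 0 = (1 - 0) * ((h' (c + \<xi> * k) - h' c - b * (\<xi> * k)) * k)"
      using MVT2[of 0 1 G "\<lambda>t. (h' (c + t * k) - h' c - b * (t * k)) * k"] d by auto
    have "\<bar>h' (c + \<xi> * k) - h' c - b * (\<xi> * k)\<bar> \<le> \<tau> * \<bar>\<xi> * k\<bar>"
      using \<delta>1(2)[of "c + \<xi> * k"] small[of \<xi>] \<xi> k by (simp add: \<delta>_def)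
    also have "\<dots> \<le> \<tau> * \<bar>k\<bar>" using small[of \<xi>] \<xi> \<tau> by (intro mult_left_mono) auto
    finally have "\<bar>G 1 - G 0\<bar> \<le> (\<tau> * \<bar>k\<bar>) * \<bar>k\<bar>"
      unfolding \<xi>(3) by (simp only: abs_mult) (simp add: mult_right_mono)
    then have "G 1 - G 0 \<le> \<tau> * k\<^sup>2" by (simp add: power2_eq_square mult.assoc)
    then show ?thesis by (simp add: G_def)
  qed
  moreover have "\<delta> > 0" using r \<delta>1(1) by (simp add: \<delta>_def)
  ultimately show ?thesis using that by blast
qed

text \<open>The penalty \<open>t - t sqrt t\<close> of Ishii and Lions: as a function of \<open>|x - y|\<close> it is steep near \<open>0\<close>
  and strictly concave in the direction \<open>x - y\<close>. It is expanded as a function of \<open>|x - y|\<^sup>2\<close>.\<close>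

lemma concave_penalty_expansion:
  fixes D :: "'a::real_inner"
  assumes D: "D \<noteq> 0" and L: "L > 0"
  defines "d \<equiv> norm D"
  obtains \<rho> where "\<rho> > 0"
    "\<And>e. norm e \<le> \<rho> \<Longrightarrow> L * (norm (D + e) - norm (D + e) * sqrt (norm (D + e)))
       \<le> L * (d - d * sqrt d) + (L * (1 - 3/2 * sqrt d) / d) * (D \<bullet> e)
         + 1/2 * ((L * (1 - 3/2 * sqrt d) / d + 1) * (e \<bullet> e) - L * (1 - 3/4 * sqrt d) / d^3 * (D \<bullet> e)\<^sup>2)"
proof -
  have d: "d > 0" using D by (simp add: d_def)
  define w where "w = sqrt d"
  have w: "w > 0" "w\<^sup>2 = d" using d by (auto simp: w_def)
  \<comment> \<open>The penalty as a function of q = |x - y|^2, smooth for q > 0; \<open>b\<close>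
    below is its second derivative at d^2.\<close>
  define h where "h = (\<lambda>q. L * (q powr (1/2) - q powr (3/4)))"
  define h' where "h' = (\<lambda>q. L * (1/2 * q powr (-1/2) - 3/4 * q powr (-1/4)))"
  define b where "b = L * (-1/4 * (d\<^sup>2) powr (-3/2) + 3/16 * (d\<^sup>2) powr (-5/4))"
  have pw: "(d\<^sup>2) powr a = w powr (4 * a)" for a
  proof -
    have sq: "d\<^sup>2 = w powr 4" using w powr_realpow[of w 4] by (simp add: power_mult[symmetric] flip: w(2))
    show ?thesis by (simp only: sq powr_powr)
  qed
  have hval: "h (t\<^sup>2) = L * (t - t * sqrt t)" if "t \<ge> 0" for t
  proof (cases "t = 0")
    case False
    then have t: "t > 0" using that by simp
    have sq: "t\<^sup>2 = t powr 2" using t powr_realpow[of t 2] by simp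
    have "(t\<^sup>2) powr a = t powr (2 * a)" for a by (simp only: sq powr_powr)
    from this[of "1/2"] this[of "3/4"] have "(t\<^sup>2) powr (1/2) = t" "(t\<^sup>2) powr (3/4) = t powr (3/2)"
      using t by simp_all
    moreover have "t powr (3/2) = t * sqrt t" using powr_add[of t 1 "1/2"] t by (simp add: powr_half_sqrt)
    ultimately show ?thesis by (simp add: h_def)
  qed (simp add: h_def)
  have hder: "(h has_real_derivative h' q) (at q)" if "q > 0" for q
    unfolding h_def h'_def using that by (auto intro!: derivative_eq_intros)
  have h'der: "(h' has_real_derivative b) (at (d\<^sup>2))"
    unfolding h'_def b_def using d by (auto intro!: derivative_eq_intros simp: algebra_simps)
  have h'd: "h' (d\<^sup>2) = L * (1 - 3/2 * sqrt d) / (2 * d)"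
  proof -
    have "w powr (-2) = 1 / d" "w powr (-1) = 1 / w"
      using w powr_realpow[of w 2] by (simp_all add: powr_minus_divide powr_realpow)
    then show ?thesis using w d by (simp add: h'_def pw w_def[symmetric]) (simp add: w(2)[symmetric] field_simps power2_eq_square)
  qed
  have bd: "4 * b = - (L * (1 - 3/4 * sqrt d) / d^3)"
  proof -
    have "w powr (-6) = 1 / w^6" "w powr (-5) = 1 / w^5"
      using w powr_realpow[of w 6] powr_realpow[of w 5] by (simp_all add: powr_minus_divide powr_realpow)
    moreover have "d^3 = w^6" using w(2)[symmetric] by (simp add: power_mult[symmetric])
    moreover have "w ^ 6 = w * w ^ 5" by (simp add: numeral_eq_Suc)
    ultimately show ?thesis using w by (simp add: b_def pw w_def[symmetric]) (simp add: field_simps)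
  qed
  \<comment> \<open>The Taylor remainder and the mixed terms of k^2 cost |e|^2/4 each; together they
    make up the summand 1 in the coefficient of |e|^2.\<close>
  define \<tau> where "\<tau> = 1 / (4 * (2 * d + 1)\<^sup>2)"
  have \<tau>: "\<tau> > 0" using d by (simp add: \<tau>_def)
  obtain \<delta> where \<delta>: "\<delta> > 0" "\<And>k. \<bar>k\<bar> < \<delta> \<Longrightarrow> h (d\<^sup>2 + k) \<le> h (d\<^sup>2) + h' (d\<^sup>2) * k + 1/2 * b * k\<^sup>2 + \<tau> * k\<^sup>2"
  proof (rule taylor_second_order_upper[where h = h and h' = h' and c = "d\<^sup>2" and b = b and r = "d\<^sup>2" and \<tau> = \<tau>])
    show "(h has_real_derivative h' (d\<^sup>2 + k)) (at (d\<^sup>2 + k))" if "\<bar>k\<bar> < d\<^sup>2" for k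
      using that by (intro hder) linarith
  qed (use d h'der \<tau> in auto)
  \<comment> \<open>One entry for each need: |e|^2 \<le> |e|, then |k| < \<delta>, then the
    smallness of the mixed terms of k^2.\<close>
  define \<rho> where "\<rho> = min 1 (min (\<delta> / (2 * (2 * d + 1))) (1 / (2 * (\<bar>b\<bar> + 1) * (4 * d + 1))))"
  have \<rho>: "\<rho> > 0" using \<delta>(1) d by (simp add: \<rho>_def add_nonneg_pos)
  show ?thesis
  proof (rule that[OF \<rho>])
    fix e :: 'a assume e: "norm e \<le> \<rho>"
    define k where "k = 2 * (D \<bullet> e) + e \<bullet> e"
    have e1: "norm e \<le> 1" using e by (simp add: \<rho>_def)
    have De: "\<bar>D \<bullet> e\<bar> \<le> d * norm e" unfolding d_def by (rule Cauchy_Schwarz_ineq2)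
    have ee: "e \<bullet> e = norm e * norm e" by (simp add: dot_square_norm power2_eq_square)
    have ee1: "e \<bullet> e \<le> norm e" using e1 by (simp add: ee mult_left_le)
    have kb: "\<bar>k\<bar> \<le> (2 * d + 1) * norm e"
    proof -
      have "(2 * d + 1) * norm e = 2 * (d * norm e) + norm e" by (simp add: algebra_simps)
      then show ?thesis using De ee1 inner_ge_zero[of e] unfolding k_def by linarith
    qed
    have "\<bar>k\<bar> < \<delta>"
    proof -
      have "(2 * d + 1) * norm e \<le> (2 * d + 1) * (\<delta> / (2 * (2 * d + 1)))"
        using e d by (intro mult_left_mono) (auto simp: \<rho>_def)
      also have "\<dots> = \<delta> / 2" using d by (simp add: field_simps)
      finally show ?thesis using kb \<delta>(1) by linarith
    qed
    have nk: "(norm (D + e))\<^sup>2 = d\<^sup>2 + k"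
      by (simp add: k_def d_def power2_norm_eq_inner inner_add_left inner_add_right inner_commute)
    have "L * (norm (D + e) - norm (D + e) * sqrt (norm (D + e))) = h (d\<^sup>2 + k)"
      using hval[of "norm (D + e)"] by (simp add: nk)
    also have "\<dots> \<le> h (d\<^sup>2) + h' (d\<^sup>2) * k + 1/2 * b * k\<^sup>2 + \<tau> * k\<^sup>2" by (rule \<delta>(2)) fact
    also have "h (d\<^sup>2) = L * (d - d * sqrt d)" using d by (intro hval) simp
    also have "\<tau> * k\<^sup>2 \<le> 1/4 * (e \<bullet> e)"
    proof -
      have "k\<^sup>2 \<le> ((2 * d + 1) * norm e)\<^sup>2" using power_mono[OF kb, of 2] by simp
      then have "\<tau> * k\<^sup>2 \<le> \<tau> * ((2 * d + 1) * norm e)\<^sup>2" using \<tau> by (intro mult_left_mono) auto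
      also have "\<dots> = 1/4 * (e \<bullet> e)" using d by (simp add: \<tau>_def power_mult_distrib dot_square_norm)
      finally show ?thesis .
    qed
    also have "1/2 * b * k\<^sup>2 \<le> 2 * b * (D \<bullet> e)\<^sup>2 + 1/4 * (e \<bullet> e)"
    proof -
      have "1/2 * b * k\<^sup>2 = 2 * b * (D \<bullet> e)\<^sup>2 + (1/2 * b * (4 * (D \<bullet> e) + e \<bullet> e)) * (e \<bullet> e)"
        by (simp add: k_def power2_eq_square algebra_simps)
      moreover have "1/2 * b * (4 * (D \<bullet> e) + e \<bullet> e) \<le> 1/4"
      proof -
        have "\<bar>4 * (D \<bullet> e) + e \<bullet> e\<bar> \<le> (4 * d + 1) * norm e"
        proof -
          have "(4 * d + 1) * norm e = 4 * (d * norm e) + norm e" by (simp add: algebra_simps)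
          then show ?thesis using De ee1 inner_ge_zero[of e] by linarith
        qed
        also have "\<dots> \<le> (4 * d + 1) * (1 / (2 * (\<bar>b\<bar> + 1) * (4 * d + 1)))"
          using e d by (intro mult_left_mono) (auto simp: \<rho>_def)
        also have "\<dots> = 1 / (2 * (\<bar>b\<bar> + 1))"
        proof -
          have "c * (1 / (a * c)) = 1 / a" if "c > 0" for a c :: real using that by simp
          then show ?thesis using d by simp
        qed
        finally have "\<bar>b\<bar> * \<bar>4 * (D \<bullet> e) + e \<bullet> e\<bar> \<le> \<bar>b\<bar> * (1 / (2 * (\<bar>b\<bar> + 1)))"
          by (intro mult_left_mono) auto
        also have "\<dots> \<le> 1/2" by (simp add: field_simps)
        finally have "\<bar>b * (4 * (D \<bullet> e) + e \<bullet> e)\<bar> \<le> 1/2" by (simp add: abs_mult)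
        then show ?thesis using abs_le_D1 by fastforce
      qed
      then have "(1/2 * b * (4 * (D \<bullet> e) + e \<bullet> e)) * (e \<bullet> e) \<le> 1/4 * (e \<bullet> e)"
        by (intro mult_right_mono) auto
      ultimately show ?thesis by linarith
    qed
    also have "L * (d - d * sqrt d) + h' (d\<^sup>2) * k + (2 * b * (D \<bullet> e)\<^sup>2 + 1/4 * (e \<bullet> e)) + 1/4 * (e \<bullet> e)
      = L * (d - d * sqrt d) + (2 * h' (d\<^sup>2)) * (D \<bullet> e) + 1/2 * ((2 * h' (d\<^sup>2) + 1) * (e \<bullet> e) + (4 * b) * (D \<bullet> e)\<^sup>2)"
      by (simp add: k_def algebra_simps)
    finally show "L * (norm (D + e) - norm (D + e) * sqrt (norm (D + e)))
       \<le> L * (d - d * sqrt d) + (L * (1 - 3/2 * sqrt d) / d) * (D \<bullet> e)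
         + 1/2 * ((L * (1 - 3/2 * sqrt d) / d + 1) * (e \<bullet> e) - L * (1 - 3/4 * sqrt d) / d^3 * (D \<bullet> e)\<^sup>2)"
      by (simp add: h'd bd)
  qed
qed

text \<open>A direction in which \<open>N\<close> is very negative makes the minimal operator large:
  since \<mu> I - N is positive semidefinite, the remaining directions contribute at most a multiple
  of \<mu> to the trace of \<open>N\<close>.\<close>

lemma pucci_minus_direction:
  fixes N :: "real^'n^'n"
  assumes "0 \<le> \<gamma>" "\<gamma> \<le> \<Gamma>" "0 \<le> \<mu>" and N: "symmetric_mat N" "\<And>\<xi>. \<xi> \<bullet> (N *v \<xi>) \<le> \<mu> * (\<xi> \<bullet> \<xi>)" and e: "norm e = 1"
  shows "- \<gamma> * (e \<bullet> (N *v e)) - \<mu> * real CARD('n) * (\<gamma> + \<Gamma>) \<le> pucci_minus \<gamma> \<Gamma> N"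
proof -
  have "psd (mat \<mu> - N)"
    using N by (auto simp: psd_def matrix_vector_mult_diff_rdistrib mat_mult_vec inner_diff_right intro: symmetric_mat_diff)
  from psd_trace_ge[OF this e] have "\<mu> - e \<bullet> (N *v e) \<le> real CARD('n) * \<mu> - trace N"
    using e by (simp add: matrix_vector_mult_diff_rdistrib mat_mult_vec inner_diff_right dot_square_norm trace_sub) (simp add: trace_def mat_def)
  then have "trace N \<le> real CARD('n) * \<mu> + e \<bullet> (N *v e)" using assms(3) by linarith
  then have "\<gamma> * trace N \<le> \<gamma> * (real CARD('n) * \<mu> + e \<bullet> (N *v e))" using assms(1) by (rule mult_left_mono)
  moreover have "- \<gamma> * trace N - real CARD('n) * \<Gamma> * \<mu> \<le> pucci_minus \<gamma> \<Gamma> N"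
    by (rule pucci_minus_ge[OF assms(1-3) N])
  ultimately show ?thesis by (simp add: algebra_simps)
qed

lemma continuous_on_compact_bound:
  fixes h :: "'a::topological_space \<Rightarrow> 'b::real_normed_vector"
  assumes "continuous_on B h" "compact B"
  obtains C where "C > 0" "\<And>x. x \<in> B \<Longrightarrow> norm (h x) \<le> C"
  using compact_imp_bounded[OF compact_continuous_image[OF assms]] unfolding bounded_pos by auto

text \<open>The setting of the doubling of variables. The quadratic gap \<kappa> keeps maximum
  points of the doubled functions near x0.\<close>

locale strict_maximum = elliptic_operator F \<Omega> \<gamma> \<Gamma> \<delta>\<^sub>0 \<delta>\<^sub>1 \<nu> \<omega>
  for F :: "real^'n^'n \<Rightarrow> real^'n \<Rightarrow> real \<Rightarrow> real^'n \<Rightarrow> real" and \<Omega> \<gamma> \<Gamma> \<delta>\<^sub>0 \<delta>\<^sub>1 \<nu> \<omega> +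
  fixes f g u v \<psi> :: "real^'n \<Rightarrow> real" and D\<psi> D2\<psi> and x0 :: "real^'n" and r \<kappa> :: real
  assumes open_\<Omega>: "open \<Omega>" and sub: "visc_sub F f u \<Omega>" and super: "visc_super F g v \<Omega>"
    and cont_u: "continuous_on \<Omega> u" and cont_v: "continuous_on \<Omega> v"
    and cont_f: "continuous_on \<Omega> f" and cont_g: "continuous_on \<Omega> g"
    and \<psi>_C2: "C2_with \<psi> D\<psi> D2\<psi> \<Omega>" and \<psi>_sym: "\<And>x. x \<in> \<Omega> \<Longrightarrow> symmetric_mat (D2\<psi> x)"
    and r_pos: "r > 0" and ball_sub: "cball x0 r \<subseteq> \<Omega>" and \<kappa>_pos: "\<kappa> > 0"
    and strict: "\<And>y. y \<in> cball x0 r \<Longrightarrow> u y - \<psi> y - v y \<le> u x0 - \<psi> x0 - v x0 - \<kappa> * (dist y x0)\<^sup>2"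
begin

definition "m = u x0 - \<psi> x0 - v x0"

lemma cont_\<psi>: "continuous_on \<Omega> \<psi>" and cont_D\<psi>: "continuous_on \<Omega> D\<psi>" and cont_D2\<psi>: "continuous_on \<Omega> D2\<psi>"
  using \<psi>_C2 unfolding C2_with_def by (meson has_derivative_continuous continuous_at_imp_continuous_on)+

text \<open>Uniform continuity of v allows y to be replaced by x in u x - \<psi> x - v y at a small
  cost; then the quadratic gap applies to x.\<close>

lemma localize:
  assumes "\<tau> > 0"
  obtains d where "d > 0" "\<And>x y. \<lbrakk>x \<in> cball x0 r; y \<in> cball x0 r; dist x y < d; u x - \<psi> x - v y \<ge> m\<rbrakk> \<Longrightarrow> dist x x0 < \<tau> \<and> dist y x0 < \<tau>"
proof -
  have "uniformly_continuous_on (cball x0 r) v"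
    by (intro compact_uniformly_continuous continuous_on_subset[OF cont_v ball_sub]) auto
  moreover have "\<kappa> * (\<tau>/2)\<^sup>2 > 0" using \<kappa>_pos assms by simp
  ultimately obtain d where d: "d > 0" "\<And>x y. x \<in> cball x0 r \<Longrightarrow> y \<in> cball x0 r \<Longrightarrow> dist y x < d \<Longrightarrow> dist (v y) (v x) < \<kappa> * (\<tau>/2)\<^sup>2"
    unfolding uniformly_continuous_on_def by metis
  show ?thesis
  proof (rule that[of "min d (\<tau>/2)"])
    show "min d (\<tau>/2) > 0" using d assms by simp
    fix x y assume xy: "x \<in> cball x0 r" "y \<in> cball x0 r" "dist x y < min d (\<tau>/2)" "u x - \<psi> x - v y \<ge> m"
    have "dist (v x) (v y) < \<kappa> * (\<tau>/2)\<^sup>2" using d(2)[OF xy(2,1)] xy(3) by simp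
    then have "v x - v y < \<kappa> * (\<tau>/2)\<^sup>2" unfolding dist_real_def by linarith
    then have "\<kappa> * (dist x x0)\<^sup>2 < \<kappa> * (\<tau>/2)\<^sup>2" using strict[OF xy(1)] xy(4) unfolding m_def by linarith
    then have "(dist x x0)\<^sup>2 < (\<tau>/2)\<^sup>2" using \<kappa>_pos by simp
    then have "dist x x0 < \<tau>/2" using assms power2_less_imp_less[of "dist x x0" "\<tau>/2"] by simp
    moreover have "dist y x0 \<le> dist x y + dist x x0" by (metis dist_commute dist_triangle)
    ultimately show "dist x x0 < \<tau> \<and> dist y x0 < \<tau>" using xy(3) assms by auto
  qed
qed

lemma cball_quarter: "dist x x0 < r/2 \<Longrightarrow> cball x (r/4) \<subseteq> cball x0 r"
proof
  fix y assume "dist x x0 < r/2" "y \<in> cball x (r/4)"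
  then have "dist x0 x < r/2" "dist x y \<le> r/4" by (simp_all add: dist_commute)
  then have "dist x0 y < r/2 + r/4" using dist_triangle[of x0 y x] by linarith
  then show "y \<in> cball x0 r" using r_pos by simp
qed

text \<open>Suppose that the doubled function with penalty L (t - t sqrt t) exceeds \<open>m\<close>
  at a pair of distance d. The form inequality, tested on e and -e with e along a - b, makes X - Y
  as negative as -L / sqrt d in that direction, while all other terms are at most a constant plus
  multiples of L and L d^(\<nu> - 1). After division by L / sqrt d there remain sqrt d and d^(\<nu>
  - 1/2), which are small uniformly in L.\<close>

lemma one_sided_lipschitz:
  obtains L r1 where "L > 0" "r1 > 0"
    "\<And>x y. \<lbrakk>x \<in> cball x0 r; y \<in> cball x0 r; dist x y \<le> r1\<rbrakk> \<Longrightarrow> u x - \<psi> x - v y - m \<le> L * dist x y"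
proof -
  define B where "B = cball x0 r"
  have cB: "compact B" by (simp add: B_def)
  have B\<Omega>: "B \<subseteq> \<Omega>" using ball_sub by (simp add: B_def)
  obtain Cu where Cu: "Cu > 0" "\<And>x. x \<in> B \<Longrightarrow> norm (u x) \<le> Cu" using continuous_on_compact_bound[OF continuous_on_subset[OF cont_u B\<Omega>] cB] by metis
  obtain Cv where Cv: "Cv > 0" "\<And>x. x \<in> B \<Longrightarrow> norm (v x) \<le> Cv" using continuous_on_compact_bound[OF continuous_on_subset[OF cont_v B\<Omega>] cB] by metis
  obtain Cf where Cf: "Cf > 0" "\<And>x. x \<in> B \<Longrightarrow> norm (f x) \<le> Cf" using continuous_on_compact_bound[OF continuous_on_subset[OF cont_f B\<Omega>] cB] by metis
  obtain Cg where Cg: "Cg > 0" "\<And>x. x \<in> B \<Longrightarrow> norm (g x) \<le> Cg" using continuous_on_compact_bound[OF continuous_on_subset[OF cont_g B\<Omega>] cB] by metis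
  obtain C\<psi> where C\<psi>: "C\<psi> > 0" "\<And>x. x \<in> B \<Longrightarrow> norm (\<psi> x) \<le> C\<psi>" using continuous_on_compact_bound[OF continuous_on_subset[OF cont_\<psi> B\<Omega>] cB] by metis
  obtain CD where CD: "CD > 0" "\<And>x. x \<in> B \<Longrightarrow> norm (D\<psi> x) \<le> CD" using continuous_on_compact_bound[OF continuous_on_subset[OF cont_D\<psi> B\<Omega>] cB] by metis
  obtain CH where CH: "CH > 0" "\<And>x. x \<in> B \<Longrightarrow> norm (D2\<psi> x) \<le> CH" using continuous_on_compact_bound[OF continuous_on_subset[OF cont_D2\<psi> B\<Omega>] cB] by metis
  define n where "n = real CARD('n)"
  have n1: "n \<ge> 1" by (simp add: n_def Suc_leI)
  define w2 where "w2 = \<omega> (2 * 1)"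
  have w2: "w2 \<ge> 0" unfolding w2_def by (rule \<omega>_nonneg) simp
  \<comment> \<open>All contributions that depend neither on L nor on d. Hence d1 and r1 can be
    fixed before L, and L chosen in terms of r1.\<close>
  define M1 where "M1 = (\<gamma> + \<Gamma>) * n * CH + \<delta>\<^sub>1 * CD + \<delta>\<^sub>0 * (Cu + Cv) + (1 + Cv) * w2 + Cf + Cg + 1 + 2 * \<gamma> + 2 * n * (\<gamma> + \<Gamma>)"
  have M1: "M1 \<ge> 0"
    unfolding M1_def using \<gamma>_pos \<gamma>_le_\<Gamma> n1 CH(1) CD(1) Cu(1) Cv(1) Cf(1) Cg(1) w2 \<delta>\<^sub>0_nonneg \<delta>\<^sub>1_nonneg
    by (intro add_nonneg_nonneg mult_nonneg_nonneg) auto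
  obtain d1 where d1: "d1 > 0" "\<And>d. 0 < d \<Longrightarrow> d < d1 \<Longrightarrow> M1 * sqrt d + w2 * (sqrt d + 10 * n\<^sup>2 * d powr (\<nu> - 1/2)) < \<gamma>"
  proof -
    have "((\<lambda>d. M1 * sqrt d + w2 * (sqrt d + 10 * n\<^sup>2 * d powr (\<nu> - 1/2))) \<longlongrightarrow> M1 * sqrt 0 + w2 * (sqrt 0 + 10 * n\<^sup>2 * 0 powr (\<nu> - 1/2))) (at_right 0)"
      using \<nu>_gt by (intro tendsto_intros tendsto_powr' tendsto_ident_at) (auto simp: eventually_at_filter)
    then have "((\<lambda>d. M1 * sqrt d + w2 * (sqrt d + 10 * n\<^sup>2 * d powr (\<nu> - 1/2))) \<longlongrightarrow> 0) (at_right 0)" by simp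
    then have "\<forall>\<^sub>F d in at_right 0. M1 * sqrt d + w2 * (sqrt d + 10 * n\<^sup>2 * d powr (\<nu> - 1/2)) < \<gamma>"
      using \<gamma>_pos by (rule order_tendstoD(2))
    then show ?thesis using that unfolding eventually_at_right_field by blast
  qed
  have "r/2 > 0" using r_pos by simp
  from localize[OF this] obtain d2 where d2: "d2 > 0"
    "\<And>x y. \<lbrakk>x \<in> cball x0 r; y \<in> cball x0 r; dist x y < d2; u x - \<psi> x - v y \<ge> m\<rbrakk> \<Longrightarrow> dist x x0 < r/2 \<and> dist y x0 < r/2" by metis
  define r1 where "r1 = min (min d1 d2) (1/9) / 2"
  have r1: "r1 > 0" "r1 < d1" "r1 < d2" "r1 < 1/9" using d1(1) d2(1) by (auto simp: r1_def)
  define W where "W = 2 * (Cu + C\<psi> + Cv)"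
  have x0B: "x0 \<in> B" using r_pos by (simp add: B_def)
  have W: "u x - \<psi> x - v y - m \<le> W" if "x \<in> B" "y \<in> B" for x y
  proof -
    have "u x \<le> Cu" "- \<psi> x \<le> C\<psi>" "- v y \<le> Cv" "- u x0 \<le> Cu" "\<psi> x0 \<le> C\<psi>" "v x0 \<le> Cv"
      using Cu(2)[OF that(1)] C\<psi>(2)[OF that(1)] Cv(2)[OF that(2)] Cu(2)[OF x0B] C\<psi>(2)[OF x0B] Cv(2)[OF x0B]
      by (auto simp: abs_le_iff)
    then show ?thesis unfolding W_def m_def by argo
  qed
  \<comment> \<open>The second entry lifts the penalty at distance r1 above the bound
    \<open>W\<close>, so that the maximum is not attained there. With L \<ge> 4 the summand 1 in the
    Hessian of the penalty is absorbed by L/d.\<close>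
  define L where "L = max 4 (2 * W / r1 + 1)"
  have L: "L \<ge> 4" "L * r1 / 2 > W"
  proof -
    have "(2 * W / r1 + 1) * r1 = 2 * W + r1" using r1(1) by (simp add: field_simps)
    moreover have "(2 * W / r1 + 1) * r1 \<le> L * r1" using r1(1) by (intro mult_right_mono) (auto simp: L_def)
    ultimately show "L * r1 / 2 > W" using r1(1) by linarith
  qed (simp add: L_def)
  have L0: "L > 0" using L by simp
  define \<phi> where "\<phi> = (\<lambda>t. L * (t - t * sqrt t))"
  have \<phi>low: "\<phi> t \<ge> L * t / 2" if "0 \<le> t" "t \<le> 1/9" for t
  proof -
    have "sqrt t \<le> sqrt (1/9)" using that by simp
    also have "\<dots> = 1/3" by (simp add: real_sqrt_divide)
    finally have "t * sqrt t \<le> t * (1/2)" using that by (intro mult_left_mono) auto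
    then have "L * (t / 2) \<le> L * (t - t * sqrt t)" using L0 by (intro mult_left_mono) auto
    then show ?thesis by (simp add: \<phi>_def)
  qed
  have main: "u x - \<psi> x - v y - \<phi> (dist x y) \<le> m" if xy: "x \<in> B" "y \<in> B" "dist x y \<le> r1" for x y
  proof (rule ccontr)
    assume gt: "\<not> u x - \<psi> x - v y - \<phi> (dist x y) \<le> m"
    define T where "T = (B \<times> B) \<inter> {z. dist (fst z) (snd z) \<le> r1}"
    have "compact T"
      unfolding T_def by (intro compact_Int_closed compact_Times cB closed_Collect_le continuous_intros)
    moreover have "(x, y) \<in> T" using xy by (simp add: T_def)
    moreover have "continuous_on T (\<lambda>z. u (fst z) - \<psi> (fst z) - v (snd z) - \<phi> (dist (fst z) (snd z)))"
      unfolding \<phi>_def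
      by (intro continuous_intros continuous_on_compose2[OF cont_u] continuous_on_compose2[OF cont_v] continuous_on_compose2[OF cont_\<psi>])
         (use B\<Omega> in \<open>auto simp: T_def\<close>)
    ultimately obtain z where z: "z \<in> T" "\<And>z'. z' \<in> T \<Longrightarrow> u (fst z') - \<psi> (fst z') - v (snd z') - \<phi> (dist (fst z') (snd z')) \<le> u (fst z) - \<psi> (fst z) - v (snd z) - \<phi> (dist (fst z) (snd z))"
      using continuous_attains_sup[of T] by blast
    define a where "a = fst z"
    define b where "b = snd z"
    define d where "d = dist a b"
    have ab: "a \<in> B" "b \<in> B" "d \<le> r1" using z(1) by (auto simp: T_def a_def b_def d_def)
    have mx: "u x - \<psi> x - v y - \<phi> (dist x y) \<le> u a - \<psi> a - v b - \<phi> d" if "x \<in> B" "y \<in> B" "dist x y \<le> r1" for x y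
      using z(2)[of "(x, y)"] that by (simp add: T_def a_def b_def d_def)
    have big: "u a - \<psi> a - v b - \<phi> d > m" using mx[OF xy] gt by linarith
    have d0: "d > 0"
    proof (rule ccontr)
      assume "\<not> d > 0"
      then have "a = b" by (simp add: d_def)
      then have "u a - \<psi> a - v b - \<phi> d \<le> m - \<kappa> * (dist a x0)\<^sup>2" using strict[of a] ab(1) by (simp add: \<phi>_def d_def B_def m_def)
      also have "\<dots> \<le> m" using \<kappa>_pos by simp
      finally show False using big by simp
    qed
    have dr: "d < r1"
    proof (rule ccontr)
      assume "\<not> d < r1"
      then have "d = r1" using ab(3) by simp
      then have "\<phi> d > W" using \<phi>low[of r1] r1 L(2) by auto
      then show False using big W[OF ab(1,2)] by linarith
    qed
    have d19: "d < 1/9" "d < 1" using dr r1 by linarith+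
    have "u a - \<psi> a - v b \<ge> m" 
    proof -
      have "0 \<le> L * d / 2" using d0 L0 by simp
      then show ?thesis using big \<phi>low[of d] d0 d19 by linarith
    qed
    then have "dist a x0 < r/2" "dist b x0 < r/2" using d2(2)[of a b] ab dr r1 by (auto simp: B_def d_def)
    then have balls: "cball a (r/4) \<subseteq> B" "cball b (r/4) \<subseteq> B" using cball_quarter by (auto simp: B_def)
    define D where "D = a - b"
    have nD: "norm D = d" and D0: "D \<noteq> 0" using d0 by (auto simp: D_def d_def dist_norm)
    obtain \<rho>1 where \<rho>1: "\<rho>1 > 0"
      "\<And>e. norm e \<le> \<rho>1 \<Longrightarrow> \<phi> (norm (D + e)) \<le> \<phi> d + (L * (1 - 3/2 * sqrt d) / d) * (D \<bullet> e)
         + 1/2 * ((L * (1 - 3/2 * sqrt d) / d + 1) * (e \<bullet> e) - L * (1 - 3/4 * sqrt d) / d^3 * (D \<bullet> e)\<^sup>2)"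
      using concave_penalty_expansion[OF D0 L0, unfolded nD] unfolding \<phi>_def by metis
    define \<rho> where "\<rho> = min (r/4) (min ((r1 - d)/2) (\<rho>1/2))"
    have "\<rho> \<le> r/4" "\<rho> \<le> (r1 - d)/2" "\<rho> \<le> \<rho>1/2" 
      unfolding \<rho>_def by (intro min.cobounded1 min.coboundedI2 order_refl)+
    moreover have "\<rho> > 0" using r_pos dr \<rho>1(1) by (auto simp: \<rho>_def)
    ultimately have \<rho>: "\<rho> > 0" "\<rho> \<le> r/4" "2 * \<rho> \<le> r1 - d" "2 * \<rho> \<le> \<rho>1" by auto
    define \<alpha> where "\<alpha> = L * (1 - 3/2 * sqrt d) / d + 1"
    define \<beta> where "\<beta> = L * (1 - 3/4 * sqrt d) / d^3"
    define p where "p = (L * (1 - 3/2 * sqrt d) / d) *\<^sub>R D"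
    \<comment> \<open>The Hessian of the quadratic model of the penalty at \<open>D\<close>: of
      order L/d across \<open>D\<close>, but equal to -\<sigma>, of order -L / sqrt d, along
      \<open>D\<close>.\<close>
    define Z where "Z = mat \<alpha> - (\<chi> i j. \<beta> * D $ i * D $ j)"
    have Zv: "Z *v \<xi> = \<alpha> *\<^sub>R \<xi> - (\<beta> * (D \<bullet> \<xi>)) *\<^sub>R D" for \<xi>
    proof -
      have "(\<chi> i j. \<beta> * D $ i * D $ j) *v \<xi> = (\<beta> * (D \<bullet> \<xi>)) *\<^sub>R D"
        by (simp add: vec_eq_iff matrix_vector_mult_def inner_vec_def sum_distrib_left sum_distrib_right mult_ac)
      then show ?thesis by (simp add: Z_def matrix_vector_mult_diff_rdistrib mat_mult_vec)
    qed
    have Zsym: "symmetric_mat Z"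
      unfolding Z_def by (intro symmetric_mat_diff symmetric_mat_mat) (simp add: symmetric_matI)
    have sq: "sqrt d < 1/3" "sqrt d > 0"
    proof -
      have "sqrt d < sqrt (1/9)" using d19(1) by simp
      also have "\<dots> = 1/3" by (simp add: real_sqrt_divide)
      finally show "sqrt d < 1/3" .
    qed (use d0 in simp)
    have sqsq: "sqrt d * sqrt d = d" using d0 by simp
    have Ld: "L / d \<ge> 4" using L(1) d0 d19(2) by (simp add: le_divide_eq)
    have \<alpha>: "0 \<le> \<alpha>" "\<alpha> \<le> 2 * (L / d)"
    proof -
      show "0 \<le> \<alpha>" using sq L0 d0 by (simp add: \<alpha>_def)
      have "L * (1 - 3/2 * sqrt d) / d \<le> L * 1 / d"
        using sq L0 d0 by (intro divide_right_mono mult_left_mono) auto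
      then show "\<alpha> \<le> 2 * (L / d)" unfolding \<alpha>_def using Ld by linarith
    qed
    have \<beta>d: "\<beta> * d\<^sup>2 = L * (1 - 3/4 * sqrt d) / d" using d0 by (simp add: \<beta>_def power2_eq_square power3_eq_cube)
    have \<beta>: "0 \<le> \<beta>" "\<beta> * d\<^sup>2 \<le> L / d"
    proof -
      show "0 \<le> \<beta>" using sq L0 d0 by (simp add: \<beta>_def)
      have "L * (1 - 3/4 * sqrt d) / d \<le> L * 1 / d"
        using sq L0 d0 by (intro divide_right_mono mult_left_mono) auto
      then show "\<beta> * d\<^sup>2 \<le> L / d" unfolding \<beta>d by simp
    qed
    have Zn: "norm (Z *v \<xi>) \<le> 3 * L / d * norm \<xi>" for \<xi>
    proof -
      have "norm (Z *v \<xi>) \<le> \<alpha> * norm \<xi> + \<beta> * \<bar>D \<bullet> \<xi>\<bar> * d"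
        using norm_triangle_ineq4[of "\<alpha> *\<^sub>R \<xi>" "(\<beta> * (D \<bullet> \<xi>)) *\<^sub>R D"] \<alpha> \<beta> by (simp add: Zv nD abs_mult)
      also have "\<beta> * \<bar>D \<bullet> \<xi>\<bar> * d \<le> \<beta> * (d * norm \<xi>) * d"
        using Cauchy_Schwarz_ineq2[of D \<xi>] \<beta>(1) d0 by (intro mult_right_mono mult_left_mono) (auto simp: nD)
      also have "\<beta> * (d * norm \<xi>) * d = \<beta> * d\<^sup>2 * norm \<xi>" by (simp add: power2_eq_square)
      also have "\<alpha> * norm \<xi> + \<beta> * d\<^sup>2 * norm \<xi> \<le> 2 * (L / d) * norm \<xi> + L / d * norm \<xi>"
        using \<alpha>(2) \<beta>(2) by (intro add_mono mult_right_mono) auto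
      finally show ?thesis by (simp add: algebra_simps)
    qed
    have max: "u x - \<psi> x - v y \<le> u a - \<psi> a - v b + p \<bullet> ((x - a) - (y - b)) + 1/2 * (((x - a) - (y - b)) \<bullet> (Z *v ((x - a) - (y - b))))"
      if "x \<in> cball a \<rho>" "y \<in> cball b \<rho>" for x y
    proof -
      define e where "e = (x - a) - (y - b)"
      have "norm e \<le> 2 * \<rho>"
        using that norm_triangle_ineq4[of "x - a" "y - b"] by (simp add: e_def dist_norm norm_minus_commute)
      moreover have De: "x - y = D + e" by (simp add: D_def e_def)
      ultimately have "dist x y \<le> r1" using norm_triangle_ineq[of D e] \<rho>(3) by (simp add: dist_norm nD)
      moreover have "x \<in> B" "y \<in> B" using that balls \<rho>(2) by (auto simp: subset_iff)
      ultimately have "u x - \<psi> x - v y - \<phi> (dist x y) \<le> u a - \<psi> a - v b - \<phi> d" by (intro mx)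
      moreover have "\<phi> (dist x y) \<le> \<phi> d + p \<bullet> e + 1/2 * (e \<bullet> (Z *v e))"
      proof -
        have pe: "p \<bullet> e = (L * (1 - 3/2 * sqrt d) / d) * (D \<bullet> e)" by (simp add: p_def)
        have Zee: "e \<bullet> (Z *v e) = (L * (1 - 3/2 * sqrt d) / d + 1) * (e \<bullet> e) - L * (1 - 3/4 * sqrt d) / d^3 * (D \<bullet> e)\<^sup>2"
          by (simp add: Zv inner_diff_right \<alpha>_def \<beta>_def power2_eq_square inner_commute)
        show ?thesis
          unfolding pe Zee using \<rho>1(2)[of e] \<open>norm e \<le> 2 * \<rho>\<close> \<rho>(4) by (simp add: dist_norm De)
      qed
      ultimately show ?thesis unfolding e_def[symmetric] by argo
    qed
    have sub_balls: "cball a \<rho> \<subseteq> \<Omega>" "cball b \<rho> \<subseteq> \<Omega>"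
      using balls B\<Omega> subset_cball[OF \<rho>(2)] by blast+
    have dpow: "dist a b powr \<nu> < 1"
    proof -
      have "d powr \<nu> < 1 powr \<nu>" using d0 d19 \<nu>_gt by (intro powr_less_mono2) auto
      then show ?thesis by (simp add: d_def)
    qed
    \<comment> \<open>A multiple of d/L, so that 1/\<theta> and \<theta> |Z|^2 are both of order
      L/d.\<close>
    have \<theta>: "d / (4 * L) > 0" using d0 L0 by simp
    have \<zeta>: "3 * L / d \<ge> 0" using d0 L0 by simp
    obtain X Y where XY: "symmetric_mat X" "symmetric_mat Y"
      and form: "\<And>\<xi> \<upsilon>. \<xi> \<bullet> (X *v \<xi>) - \<upsilon> \<bullet> (Y *v \<upsilon>) \<le> (\<xi> - \<upsilon>) \<bullet> (Z *v (\<xi> - \<upsilon>)) + 2 * (d / (4 * L)) * ((Z *v (\<xi> - \<upsilon>)) \<bullet> (Z *v (\<xi> - \<upsilon>))) + 1 * (\<xi> \<bullet> \<xi> + \<upsilon> \<bullet> \<upsilon>)"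
      and nY: "norm Y \<le> (real CARD('n))\<^sup>2 * max (1/(d / (4 * L)) + 2 * (3 * L / d)) (3 * L / d + 2 * (d / (4 * L)) * (3 * L / d)\<^sup>2 + 1)"
      and ineq: "pucci_minus \<gamma> \<Gamma> (X - Y + D2\<psi> a) - \<delta>\<^sub>1 * norm (D\<psi> a) - \<delta>\<^sub>0 * \<bar>u a - v b\<bar>
       - (1 + norm p + \<bar>v b\<bar> + dist a b powr \<nu> * norm Y / 1) * \<omega> (2 * 1) \<le> f a - g b + 1"
      by (rule inequality_at_maximum[OF open_\<Omega> sub super cont_u cont_v cont_f cont_g \<psi>_C2 \<psi>_sym sub_balls \<rho>(1) Zsym Zn \<zeta> max _ dpow \<theta>, where \<eta> = 1]) auto
    have nY': "norm Y \<le> 10 * n\<^sup>2 * (L / d)"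
    proof -
      have "1/(d / (4 * L)) + 2 * (3 * L / d) = 10 * (L / d)" using d0 L0 by (simp add: field_simps)
      moreover have "3 * L / d + 2 * (d / (4 * L)) * (3 * L / d)\<^sup>2 + 1 = 15/2 * (L / d) + 1"
        using d0 L0 by (simp add: field_simps power2_eq_square)
      ultimately have "max (1/(d / (4 * L)) + 2 * (3 * L / d)) (3 * L / d + 2 * (d / (4 * L)) * (3 * L / d)\<^sup>2 + 1) \<le> 10 * (L / d)"
        using Ld by simp
      then have "n\<^sup>2 * max (1/(d / (4 * L)) + 2 * (3 * L / d)) (3 * L / d + 2 * (d / (4 * L)) * (3 * L / d)\<^sup>2 + 1) \<le> n\<^sup>2 * (10 * (L / d))"
        by (intro mult_left_mono) auto
      then show ?thesis using nY by (simp add: n_def mult_ac)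
    qed
    define \<sigma> where "\<sigma> = 3/4 * (L / sqrt d) - 1"
    have Lsq: "L / sqrt d \<ge> 12" using L(1) sq by (simp add: le_divide_eq)
    have \<sigma>: "\<alpha> - \<beta> * d\<^sup>2 = - \<sigma>" "\<sigma> \<ge> 0" "2 * \<sigma> \<ge> L / sqrt d"
    proof -
      have "\<alpha> - \<beta> * d\<^sup>2 = 1 - 3/4 * (L * sqrt d / d)"
        unfolding \<alpha>_def \<beta>d using d0 by (simp add: field_simps)
      also have "L * sqrt d / d = L / sqrt d" using sq sqsq by (simp add: field_simps)
      finally show "\<alpha> - \<beta> * d\<^sup>2 = - \<sigma>" by (simp add: \<sigma>_def)
    qed (use Lsq in \<open>auto simp: \<sigma>_def\<close>)
    define e where "e = (1/d) *\<^sub>R D"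
    have e1: "norm e = 1" using d0 by (simp add: e_def nD)
    have ee: "e \<bullet> e = 1" using e1 by (simp add: dot_square_norm)
    have Ze: "Z *v e = - \<sigma> *\<^sub>R e"
    proof -
      have "Z *v e = (\<alpha> - \<beta> * d\<^sup>2) *\<^sub>R e"
        using d0 by (simp add: Zv e_def dot_square_norm nD algebra_simps power2_eq_square)
      then show ?thesis by (simp add: \<sigma>(1))
    qed
    \<comment> \<open>The vectors e and -e differ by 2 e, on which Z acts as -\<sigma>. The term
      with \<theta> = d/(4 L) gives back at most 2 \<sigma> of the gain 4 \<sigma>.\<close>
    have dir: "e \<bullet> ((X - Y) *v e) \<le> 2 - L / sqrt d"
    proof -
      have E2: "e - - e = 2 *\<^sub>R e" by (simp only: diff_minus_eq_add scaleR_2)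
      have Zee: "Z *v (2 *\<^sub>R e) = (- 2 * \<sigma>) *\<^sub>R e" by (simp add: matrix_vector_mult_scaleR Ze)
      have Ym: "Y *v (- e) = - (Y *v e)" using matrix_vector_mult_scaleR[of Y "-1" e] by simp
      have "e \<bullet> (X *v e) - e \<bullet> (Y *v e) \<le> - 4 * \<sigma> + 2 * (d / (4 * L)) * (4 * \<sigma>\<^sup>2) + 2"
        using form[of e "- e"] unfolding E2 Zee Ym by (simp add: ee power2_eq_square)
      also have "2 * (d / (4 * L)) * (4 * \<sigma>\<^sup>2) = 2 * \<sigma> * (d * \<sigma> / L)" using L0 by (simp add: power2_eq_square)
      also have "d * \<sigma> / L \<le> 1"
      proof -
        have "d * \<sigma> \<le> d * (3/4 * (L / sqrt d))" using d0 by (intro mult_left_mono) (auto simp: \<sigma>_def)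
        also have "\<dots> = 3/4 * L * sqrt d" using sq sqsq by (simp add: field_simps)
        also have "\<dots> \<le> L * 1" using sq L0 by (simp add: mult.commute)
        finally show ?thesis using L0 by (simp add: divide_le_eq)
      qed
      then have "2 * \<sigma> * (d * \<sigma> / L) \<le> 2 * \<sigma> * 1" using \<sigma>(2) by (intro mult_left_mono) auto
      finally have "e \<bullet> (X *v e) - e \<bullet> (Y *v e) \<le> - 2 * \<sigma> + 2" by simp
      then show ?thesis using \<sigma>(3) by (simp add: matrix_vector_mult_diff_rdistrib inner_diff_right)
    qed
    have XYle: "\<xi> \<bullet> ((X - Y) *v \<xi>) \<le> 2 * (\<xi> \<bullet> \<xi>)" for \<xi>
      using form[of \<xi> \<xi>] by (simp add: matrix_vector_mult_diff_rdistrib inner_diff_right)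
    have P1: "\<gamma> * (L / sqrt d - 2) - 2 * n * (\<gamma> + \<Gamma>) \<le> pucci_minus \<gamma> \<Gamma> (X - Y)"
    proof -
      have "- \<gamma> * (e \<bullet> ((X - Y) *v e)) - 2 * real CARD('n) * (\<gamma> + \<Gamma>) \<le> pucci_minus \<gamma> \<Gamma> (X - Y)"
        using \<gamma>_pos \<gamma>_le_\<Gamma> by (intro pucci_minus_direction XYle e1 symmetric_mat_diff XY) auto
      moreover have "\<gamma> * (e \<bullet> ((X - Y) *v e)) \<le> \<gamma> * (2 - L / sqrt d)" using dir \<gamma>_pos by (intro mult_left_mono) auto
      moreover have "\<gamma> * (2 - L / sqrt d) = - (\<gamma> * (L / sqrt d - 2))" by (simp add: algebra_simps)
      ultimately show ?thesis unfolding n_def by linarith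
    qed
    have a\<Omega>: "a \<in> \<Omega>" using ab(1) B\<Omega> by blast
    have P2: "pucci_minus \<gamma> \<Gamma> (X - Y) + pucci_minus \<gamma> \<Gamma> (D2\<psi> a) \<le> pucci_minus \<gamma> \<Gamma> (X - Y + D2\<psi> a)"
      using \<gamma>_pos \<gamma>_le_\<Gamma> by (intro pucci_minus_superadd symmetric_mat_diff XY \<psi>_sym a\<Omega>) auto
    have P3: "- ((\<gamma> + \<Gamma>) * n * CH) \<le> pucci_minus \<gamma> \<Gamma> (D2\<psi> a)"
    proof -
      have "(\<gamma> + \<Gamma>) * n * norm (D2\<psi> a) \<le> (\<gamma> + \<Gamma>) * n * CH"
        using CH(2)[OF ab(1)] \<gamma>_pos \<gamma>_le_\<Gamma> n1 by (intro mult_left_mono) auto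
      moreover have "- ((\<gamma> + \<Gamma>) * n * norm (D2\<psi> a)) \<le> pucci_minus \<gamma> \<Gamma> (D2\<psi> a)"
        unfolding n_def using \<gamma>_pos \<gamma>_le_\<Gamma> by (intro pucci_minus_ge_norm \<psi>_sym a\<Omega>) auto
      ultimately show ?thesis by linarith
    qed
    have b1: "\<delta>\<^sub>1 * norm (D\<psi> a) \<le> \<delta>\<^sub>1 * CD" using CD(2)[OF ab(1)] \<delta>\<^sub>1_nonneg by (rule mult_left_mono)
    have b2: "\<delta>\<^sub>0 * \<bar>u a - v b\<bar> \<le> \<delta>\<^sub>0 * (Cu + Cv)"
    proof (rule mult_left_mono[OF _ \<delta>\<^sub>0_nonneg])
      show "\<bar>u a - v b\<bar> \<le> Cu + Cv" using Cu(2)[OF ab(1)] Cv(2)[OF ab(2)] unfolding real_norm_def by linarith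
    qed
    have np: "norm p \<le> L"
    proof -
      have "norm p = L * (1 - 3/2 * sqrt d)" using d0 L0 sq by (simp add: p_def nD abs_mult)
      also have "\<dots> \<le> L * 1" using sq L0 by (intro mult_left_mono) auto
      finally show ?thesis by simp
    qed
    have b3: "(1 + norm p + \<bar>v b\<bar> + dist a b powr \<nu> * norm Y / 1) * \<omega> (2 * 1) \<le> (1 + Cv) * w2 + w2 * (L + d powr \<nu> * (10 * n\<^sup>2 * (L / d)))"
    proof -
      have "d powr \<nu> * norm Y \<le> d powr \<nu> * (10 * n\<^sup>2 * (L / d))" using nY' by (intro mult_left_mono) auto
      then have "(1 + norm p + \<bar>v b\<bar> + dist a b powr \<nu> * norm Y / 1) * w2 \<le> ((1 + Cv) + (L + d powr \<nu> * (10 * n\<^sup>2 * (L / d)))) * w2"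
        using np Cv(2)[OF ab(2)] w2 by (intro mult_right_mono) (auto simp: d_def)
      then show ?thesis unfolding w2_def by (simp only: distrib_right mult.commute[of "\<omega> (2 * 1)"])
    qed
    have fa: "f a \<le> Cf" "- Cg \<le> g b" using Cf(2)[OF ab(1)] Cg(2)[OF ab(2)] unfolding real_norm_def by linarith+
    have "\<gamma> * (L / sqrt d) \<le> M1 + w2 * (L + d powr \<nu> * (10 * n\<^sup>2 * (L / d)))"
      using ineq P1 P2 P3 b1 b2 b3 fa unfolding M1_def by (simp only: right_diff_distrib)
    then have "\<gamma> * (L / sqrt d) * (sqrt d / L) \<le> (M1 + w2 * (L + d powr \<nu> * (10 * n\<^sup>2 * (L / d)))) * (sqrt d / L)"
      using d0 L0 by (intro mult_right_mono) auto
    also have "\<gamma> * (L / sqrt d) * (sqrt d / L) = \<gamma>" using L0 sq by simp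
    also have "(M1 + w2 * (L + d powr \<nu> * (10 * n\<^sup>2 * (L / d)))) * (sqrt d / L)
       = M1 * sqrt d / L + w2 * (sqrt d + 10 * n\<^sup>2 * d powr (\<nu> - 1/2))"
    proof -
      have "d powr (\<nu> - 1/2) = d powr \<nu> / sqrt d" using d0 by (simp add: powr_diff powr_half_sqrt)
      moreover have "d powr \<nu> / d * sqrt d = d powr \<nu> / sqrt d" using sq sqsq by (simp add: field_simps)
      moreover have "d powr \<nu> * (10 * n\<^sup>2 * (L / d)) * (sqrt d / L) = 10 * n\<^sup>2 * (d powr \<nu> / d * sqrt d)"
        using L0 by simp
      ultimately have As: "d powr \<nu> * (10 * n\<^sup>2 * (L / d)) * (sqrt d / L) = 10 * n\<^sup>2 * d powr (\<nu> - 1/2)"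
        by simp
      have Ls: "L * (sqrt d / L) = sqrt d" using L0 by simp
      have "(M1 + w2 * (L + A)) * q = M1 * q + w2 * (L * q + A * q)" for A q by (simp add: algebra_simps)
      from this[of "d powr \<nu> * (10 * n\<^sup>2 * (L / d))" "sqrt d / L"] show ?thesis unfolding As Ls by simp
    qed
    also have "M1 * sqrt d / L \<le> M1 * sqrt d"
      using M1 sq L(1) mult_left_mono[of 1 L "M1 * sqrt d"] by (simp add: divide_le_eq)
    finally show False using d1(2)[of d] d0 dr r1(2) by linarith
  qed
  show ?thesis
  proof (rule that[OF L0 r1(1)])
    fix x y assume xy: "x \<in> cball x0 r" "y \<in> cball x0 r" "dist x y \<le> r1"
    have "\<phi> (dist x y) \<le> L * dist x y" unfolding \<phi>_def using L0 by (intro mult_left_mono) auto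
    then show "u x - \<psi> x - v y - m \<le> L * dist x y" using main[of x y] xy by (simp add: B_def)
  qed
qed

end

section \<open>Doubling with the quadratic penalty\<close>

lemma psd_form_le_trace:
  fixes N :: "real^'n^'n"
  assumes "psd N"
  shows "\<xi> \<bullet> (N *v \<xi>) \<le> trace N * (\<xi> \<bullet> \<xi>)"
proof (cases "\<xi> = 0")
  case False
  have "(\<xi> /\<^sub>R norm \<xi>) \<bullet> (N *v (\<xi> /\<^sub>R norm \<xi>)) \<le> trace N"
    using False by (intro psd_trace_ge[OF assms]) simp
  then have "(\<xi> \<bullet> (N *v \<xi>)) / (norm \<xi>)\<^sup>2 \<le> trace N"
    by (simp add: matrix_vector_mult_scaleR power2_eq_square divide_inverse mult_ac)
  then show ?thesis using False by (simp add: divide_le_eq dot_square_norm)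
qed simp

text \<open>The smaller \<open>Y - X\<close>, the smaller \<open>Y\<close>: compare the form at \<open>\<xi>\<close> and at \<open>(1 \<plusminus> t) \<xi>\<close>.\<close>

lemma doubling_matrix_bound:
  fixes X Y :: "real^'n^'n"
  assumes sym: "symmetric_mat X" "symmetric_mat Y"
    and form: "\<And>\<xi> \<upsilon>. \<xi> \<bullet> (X *v \<xi>) - \<upsilon> \<bullet> (Y *v \<upsilon>) \<le> c * ((\<xi> - \<upsilon>) \<bullet> (\<xi> - \<upsilon>)) + \<eta> * (\<xi> \<bullet> \<xi> + \<upsilon> \<bullet> \<upsilon>)"
    and \<eta>: "\<eta> \<ge> 0" and t: "0 < t" "t \<le> 1"
  defines "\<tau> \<equiv> trace (Y - X + mat (2 * \<eta>))"
  shows "norm Y \<le> (real CARD('n))\<^sup>2 * ((\<tau> + c * t\<^sup>2 + 3 * \<eta>) / t)"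
proof (rule norm_mat_le_form[OF sym(2)])
  fix \<xi> :: "real^'n"
  define y where "y = \<xi> \<bullet> (Y *v \<xi>)"
  define x where "x = \<xi> \<bullet> (X *v \<xi>)"
  define q where "q = \<xi> \<bullet> \<xi>"
  have q: "q \<ge> 0" by (simp add: q_def)
  define N where "N = Y - X + mat (2 * \<eta>)"
  have Nv: "\<upsilon> \<bullet> (N *v \<upsilon>) = \<upsilon> \<bullet> (Y *v \<upsilon>) - \<upsilon> \<bullet> (X *v \<upsilon>) + 2 * \<eta> * (\<upsilon> \<bullet> \<upsilon>)" for \<upsilon>
    by (simp add: N_def matrix_vector_mult_add_rdistrib matrix_vector_mult_diff_rdistrib mat_mult_vec inner_add_right inner_diff_right)
  have "psd N"
    unfolding psd_def
  proof (intro conjI allI)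
    show "symmetric_mat N" unfolding N_def by (intro symmetric_mat_add symmetric_mat_diff sym symmetric_mat_mat)
    show "0 \<le> \<upsilon> \<bullet> (N *v \<upsilon>)" for \<upsilon> using form[of \<upsilon> \<upsilon>] by (simp add: Nv)
  qed
  from psd_form_le_trace[OF this, of \<xi>] have xy: "y - x + 2 * \<eta> * q \<le> \<tau> * q"
    unfolding Nv \<tau>_def N_def[symmetric] y_def x_def q_def by linarith
  have scaled: "x - k\<^sup>2 * y \<le> c * ((1 - k)\<^sup>2 * q) + \<eta> * ((1 + k\<^sup>2) * q)" for k
  proof -
    have "\<xi> - k *\<^sub>R \<xi> = (1 - k) *\<^sub>R \<xi>" by (simp add: scaleR_left_diff_distrib)
    then show ?thesis using form[of \<xi> "k *\<^sub>R \<xi>"]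
      by (simp add: x_def y_def q_def matrix_vector_mult_scaleR power2_eq_square algebra_simps)
  qed
  \<comment> \<open>The sign of y decides between 1 - t and 1 + t. Either way y gets a coefficient
    of size at least t, while the two vectors differ by t \<xi> only and the penalty costs c
    t^2.\<close>
  have "t * \<bar>y\<bar> \<le> (\<tau> + c * t\<^sup>2 + 3 * \<eta>) * q"
  proof (cases "y \<ge> 0")
    case True
    have "x - (1 - t)\<^sup>2 * y \<le> c * (t\<^sup>2 * q) + \<eta> * ((1 + (1 - t)\<^sup>2) * q)" using scaled[of "1 - t"] by simp
    moreover have "\<eta> * ((1 + (1 - t)\<^sup>2) * q) \<le> \<eta> * (2 * q)"
      using t q \<eta> by (intro mult_left_mono mult_right_mono) (auto simp: power2_eq_square mult_le_one)
    moreover have "(1 - (1 - t)\<^sup>2) * y \<ge> t * y"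
    proof (rule mult_right_mono[OF _ True])
      have "t * t \<le> t" using t by (simp add: mult_left_le)
      then show "t \<le> 1 - (1 - t)\<^sup>2" by (simp add: power2_eq_square algebra_simps)
    qed
    moreover have "0 \<le> \<eta> * q" using \<eta> q by simp
    ultimately show ?thesis using xy True by (simp add: algebra_simps)
  next
    case False
    have "x - (1 + t)\<^sup>2 * y \<le> c * (t\<^sup>2 * q) + \<eta> * ((1 + (1 + t)\<^sup>2) * q)" using scaled[of "1 + t"] by simp
    moreover have "\<eta> * ((1 + (1 + t)\<^sup>2) * q) \<le> \<eta> * (5 * q)"
    proof (intro mult_left_mono mult_right_mono)
      have "(1 + t)\<^sup>2 \<le> 2\<^sup>2" using t by (intro power_mono) auto
      then show "1 + (1 + t)\<^sup>2 \<le> 5" by simp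
    qed (use q \<eta> in auto)
    moreover have "((1 + t)\<^sup>2 - 1) * (- y) \<ge> t * (- y)"
      using False t by (intro mult_right_mono) (auto simp: power2_eq_square algebra_simps)
    ultimately show ?thesis using xy False by (simp add: algebra_simps)
  qed
  then show "\<bar>\<xi> \<bullet> (Y *v \<xi>)\<bar> \<le> (\<tau> + c * t\<^sup>2 + 3 * \<eta>) / t * (\<xi> \<bullet> \<xi>)"
    using t by (simp add: y_def[symmetric] q_def[symmetric] field_simps)
qed

context strict_maximum
begin

text \<open>The space error is bounded by \<gamma> times the trace of Y - X, up to small terms, and
  this is exactly what ellipticity gains. So neither X nor Y survives in the conclusion.\<close>

lemma approximate_inequality:
  assumes \<tau>: "\<tau> > 0" and s: "s > 0" and L: "L > 0" and r1: "r1 > 0"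
    and lip: "\<And>x y. \<lbrakk>x \<in> cball x0 r; y \<in> cball x0 r; dist x y \<le> r1\<rbrakk> \<Longrightarrow> u x - \<psi> x - v y - m \<le> L * dist x y"
  obtains a b where "dist a x0 < \<tau>" "dist b x0 < \<tau>" "a \<in> \<Omega>" "b \<in> \<Omega>"
    "pucci_minus \<gamma> \<Gamma> (D2\<psi> a) - \<delta>\<^sub>1 * norm (D\<psi> a) - \<delta>\<^sub>0 * \<bar>u a - v b\<bar> - (1 + 2 * L + \<bar>v b\<bar>) * \<omega> (2 * s) \<le> f a - g b + \<tau>"
proof -
  define B where "B = cball x0 r"
  have cB: "compact B" by (simp add: B_def)
  have B\<Omega>: "B \<subseteq> \<Omega>" using ball_sub by (simp add: B_def)
  have x0B: "x0 \<in> B" using r_pos by (simp add: B_def)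
  have "min \<tau> (r/2) > 0" using \<tau> r_pos by simp
  from localize[OF this] obtain d1 where d1: "d1 > 0"
    "\<And>x y. \<lbrakk>x \<in> cball x0 r; y \<in> cball x0 r; dist x y < d1; u x - \<psi> x - v y \<ge> m\<rbrakk> \<Longrightarrow> dist x x0 < min \<tau> (r/2) \<and> dist y x0 < min \<tau> (r/2)" by metis
  define n where "n = real CARD('n)"
  have n1: "n \<ge> 1" by (simp add: n_def Suc_leI)
  define w where "w = \<omega> (2 * s)"
  have w: "w \<ge> 0" unfolding w_def by (rule \<omega>_nonneg) (use s in simp)
  define c where "c = (2 * L) powr \<nu>"
  \<comment> \<open>Large enough for the space error to be at most \<gamma> Q, where
    \<open>Q\<close> is the numerator in the bound of |Y|. The trace part of \<gamma> Q is what
    ellipticity supplies on the other side.\<close>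
  define G where "G = c * n\<^sup>2 * w / (s * \<gamma>) + 1"
  have G: "G \<ge> 1" using w s \<gamma>_pos by (simp add: G_def c_def)
  have cBB: "compact (B \<times> B)" by (intro compact_Times cB)
  have contd: "continuous_on (B \<times> B) (\<lambda>z. u (fst z) - \<psi> (fst z) - v (snd z) - m)"
    by (intro continuous_intros continuous_on_compose2[OF cont_u] continuous_on_compose2[OF cont_v] continuous_on_compose2[OF cont_\<psi>])
       (use B\<Omega> in auto)
  obtain W where W: "W > 0" "\<And>z. z \<in> B \<times> B \<Longrightarrow> norm (u (fst z) - \<psi> (fst z) - v (snd z) - m) \<le> W"
    using continuous_on_compact_bound[OF contd cBB] by metis
  define dd where "dd = min d1 r1"
  have dd: "dd > 0" using d1(1) r1 by (simp add: dd_def)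
  \<comment> \<open>What is left when the two terms \<gamma> T have cancelled; the exponent 2 \<nu>
    - 1 is positive.\<close>
  define err where "err = (\<lambda>\<epsilon>. 2 * \<epsilon> * n * (\<gamma> + \<Gamma>) + 3 * \<gamma> * G\<^sup>2 * \<epsilon> powr (2 * \<nu> - 1) + 3 * \<gamma> * \<epsilon> + \<epsilon>)"
  have "\<forall>\<^sub>F \<epsilon> in at_right 0. 2 * \<epsilon> * W < dd\<^sup>2 \<and> (2 * L * \<epsilon>) powr \<nu> < s \<and> G * \<epsilon> powr \<nu> < 1 \<and> err \<epsilon> < \<tau> \<and> (0::real) < \<epsilon>"
  proof (intro eventually_conj)
    have pw: "((\<lambda>\<epsilon>. \<epsilon> powr a) \<longlongrightarrow> 0) (at_right (0::real))" if "a > 0" for a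
    proof -
      have "((\<lambda>\<epsilon>. \<epsilon> powr a) \<longlongrightarrow> 0 powr a) (at_right (0::real))"
        using that by (intro tendsto_powr' tendsto_ident_at tendsto_const) (auto simp: eventually_at_filter)
      then show ?thesis by simp
    qed
    have "((\<lambda>\<epsilon>. 2 * \<epsilon> * W) \<longlongrightarrow> 2 * 0 * W) (at_right 0)" by (intro tendsto_intros)
    then show "\<forall>\<^sub>F \<epsilon> in at_right 0. 2 * \<epsilon> * W < dd\<^sup>2" using dd by (intro order_tendstoD(2)) auto
    have "((\<lambda>\<epsilon>. (2 * L * \<epsilon>) powr \<nu>) \<longlongrightarrow> (2 * L * 0) powr \<nu>) (at_right 0)"
      using \<nu>_gt L by (intro tendsto_powr' tendsto_intros) (auto simp: eventually_at_filter)
    then show "\<forall>\<^sub>F \<epsilon> in at_right 0. (2 * L * \<epsilon>) powr \<nu> < s" using s by (intro order_tendstoD(2)) auto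
    have "((\<lambda>\<epsilon>. G * \<epsilon> powr \<nu>) \<longlongrightarrow> G * 0) (at_right 0)" using \<nu>_gt by (intro tendsto_intros pw) auto
    then show "\<forall>\<^sub>F \<epsilon> in at_right 0. G * \<epsilon> powr \<nu> < 1" by (intro order_tendstoD(2)) auto
    have "(err \<longlongrightarrow> 2 * 0 * n * (\<gamma> + \<Gamma>) + 3 * \<gamma> * G\<^sup>2 * 0 + 3 * \<gamma> * 0 + 0) (at_right 0)"
      unfolding err_def using \<nu>_gt by (intro tendsto_intros pw) auto
    then show "\<forall>\<^sub>F \<epsilon> in at_right 0. err \<epsilon> < \<tau>" using \<tau> by (intro order_tendstoD(2)) auto
    show "\<forall>\<^sub>F \<epsilon> in at_right 0. (0::real) < \<epsilon>" by (simp add: eventually_at_filter)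
  qed
  then obtain \<epsilon> where e: "2 * \<epsilon> * W < dd\<^sup>2" "(2 * L * \<epsilon>) powr \<nu> < s" "G * \<epsilon> powr \<nu> < 1" "err \<epsilon> < \<tau>" "\<epsilon> > 0"
    using eventually_happens trivial_limit_at_right_real by blast
  define \<Phi> where "\<Phi> = (\<lambda>z. u (fst z) - \<psi> (fst z) - v (snd z) - 1/(2*\<epsilon>) * ((fst z - snd z) \<bullet> (fst z - snd z)))"
  have "continuous_on (B \<times> B) \<Phi>"
    unfolding \<Phi>_def
    by (intro continuous_intros continuous_on_compose2[OF cont_u] continuous_on_compose2[OF cont_v] continuous_on_compose2[OF cont_\<psi>])
       (use B\<Omega> in auto)
  then obtain z where z: "z \<in> B \<times> B" "\<And>z'. z' \<in> B \<times> B \<Longrightarrow> \<Phi> z' \<le> \<Phi> z"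
    using continuous_attains_sup[OF cBB] x0B by blast
  define a where "a = fst z"
  define b where "b = snd z"
  define d where "d = dist a b"
  have ab: "a \<in> B" "b \<in> B" using z(1) by (auto simp: a_def b_def)
  have dsq: "(a - b) \<bullet> (a - b) = d\<^sup>2" by (simp add: d_def dist_norm dot_square_norm)
  have mx: "u x - \<psi> x - v y - 1/(2*\<epsilon>) * ((x - y) \<bullet> (x - y)) \<le> u a - \<psi> a - v b - 1/(2*\<epsilon>) * ((a - b) \<bullet> (a - b))"
    if "x \<in> B" "y \<in> B" for x y
    using z(2)[of "(x, y)"] that by (simp add: \<Phi>_def a_def b_def)
  have big: "u a - \<psi> a - v b - 1/(2*\<epsilon>) * d\<^sup>2 \<ge> m" using mx[OF x0B x0B] by (simp add: m_def dsq)
  have d0: "d \<ge> 0" by (simp add: d_def)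
  have pen: "1/(2*\<epsilon>) * d\<^sup>2 \<ge> 0" using e(5) by simp
  have ge_m: "u a - \<psi> a - v b \<ge> m" using big pen by linarith
  have "d < dd"
  proof -
    have "u a - \<psi> a - v b - m \<le> W" using W(2)[of "(a, b)"] ab by simp
    then have "1/(2*\<epsilon>) * d\<^sup>2 \<le> W" using big by linarith
    then have "d\<^sup>2 \<le> 2 * \<epsilon> * W" using e(5) by (simp add: field_simps)
    then have "d\<^sup>2 < dd\<^sup>2" using e(1) by linarith
    then show ?thesis using dd power2_less_imp_less[of d dd] by simp
  qed
  then have dr: "d < d1" "d \<le> r1" by (auto simp: dd_def)
  have near: "dist a x0 < min \<tau> (r/2)" "dist b x0 < min \<tau> (r/2)"
    using d1(2)[of a b] ab dr ge_m by (auto simp: B_def d_def)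
  then have balls: "cball a (r/4) \<subseteq> B" "cball b (r/4) \<subseteq> B" using cball_quarter by (auto simp: B_def)
  \<comment> \<open>Comparison with the pair (x0, x0) bounds the penalty d^2/(2 \<epsilon>) by L d.
    Without the one-sided Lipschitz bound only d^2 = O(\<epsilon>) would follow.\<close>
  have dL: "d \<le> 2 * L * \<epsilon>"
  proof (cases "d = 0")
    case False
    have "1/(2*\<epsilon>) * d\<^sup>2 \<le> L * d" using lip[of a b] ab dr(2) big by (simp add: B_def d_def)
    then have "d * d \<le> (2 * L * \<epsilon>) * d" using e(5) by (simp add: field_simps power2_eq_square)
    then show ?thesis using False d0 by simp
  qed (use L e in simp)
  define p where "p = (1/\<epsilon>) *\<^sub>R (a - b)"
  have np: "norm p \<le> 2 * L"
    using dL e(5) by (simp add: p_def d_def dist_norm divide_le_eq)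
  define Z where "Z = (mat (1/\<epsilon>) :: real^'n^'n)"
  have Zv: "Z *v \<xi> = (1/\<epsilon>) *\<^sub>R \<xi>" for \<xi> by (simp add: Z_def mat_mult_vec)
  have Zn: "norm (Z *v \<xi>) \<le> 1/\<epsilon> * norm \<xi>" for \<xi> using e(5) by (simp add: Zv)
  have Zsym: "symmetric_mat Z" by (simp add: Z_def)
  have max: "u x - \<psi> x - v y \<le> u a - \<psi> a - v b + p \<bullet> ((x - a) - (y - b)) + 1/2 * (((x - a) - (y - b)) \<bullet> (Z *v ((x - a) - (y - b))))"
    if "x \<in> cball a (r/4)" "y \<in> cball b (r/4)" for x y
  proof -
    define h where "h = (x - a) - (y - b)"
    have xy: "x - y = (a - b) + h" by (simp add: h_def)
    have exp: "(x - y) \<bullet> (x - y) = (a - b) \<bullet> (a - b) + 2 * ((a - b) \<bullet> h) + h \<bullet> h"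
      unfolding xy by (simp only: inner_add_left inner_add_right) (simp add: inner_commute)
    have "1/(2*\<epsilon>) * (k1 + 2 * k2 + k3) = 1/(2*\<epsilon>) * k1 + 1/\<epsilon> * k2 + 1/(2*\<epsilon>) * k3" for k1 k2 k3
      using e(5) by (simp add: field_simps)
    then have "1/(2*\<epsilon>) * ((x - y) \<bullet> (x - y)) = 1/(2*\<epsilon>) * ((a - b) \<bullet> (a - b)) + 1/\<epsilon> * ((a - b) \<bullet> h) + 1/(2*\<epsilon>) * (h \<bullet> h)"
      unfolding exp .
    moreover have "u x - \<psi> x - v y - 1/(2*\<epsilon>) * ((x - y) \<bullet> (x - y)) \<le> u a - \<psi> a - v b - 1/(2*\<epsilon>) * ((a - b) \<bullet> (a - b))"
      using that balls by (intro mx) auto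
    ultimately have "u x - \<psi> x - v y \<le> u a - \<psi> a - v b + 1/\<epsilon> * ((a - b) \<bullet> h) + 1/(2*\<epsilon>) * (h \<bullet> h)"
      by linarith
    then show ?thesis unfolding h_def[symmetric] by (simp add: p_def Zv)
  qed
  have sub_balls: "cball a (r/4) \<subseteq> \<Omega>" "cball b (r/4) \<subseteq> \<Omega>" using balls B\<Omega> by blast+
  have r4: "r/4 > 0" using r_pos by simp
  have \<zeta>: "1/\<epsilon> \<ge> 0" using e(5) by simp
  have dpow: "d powr \<nu> \<le> c * \<epsilon> powr \<nu>" "dist a b powr \<nu> < s"
  proof -
    have "d powr \<nu> \<le> (2 * L * \<epsilon>) powr \<nu>" using dL d0 \<nu>_gt by (intro powr_mono2) auto
    then show "d powr \<nu> \<le> c * \<epsilon> powr \<nu>" "dist a b powr \<nu> < s"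
      using e(2,5) L by (auto simp: c_def d_def powr_mult)
  qed
  obtain X Y where XY: "symmetric_mat X" "symmetric_mat Y"
    and form: "\<And>\<xi> \<upsilon>. \<xi> \<bullet> (X *v \<xi>) - \<upsilon> \<bullet> (Y *v \<upsilon>) \<le> (\<xi> - \<upsilon>) \<bullet> (Z *v (\<xi> - \<upsilon>)) + 2 * \<epsilon> * ((Z *v (\<xi> - \<upsilon>)) \<bullet> (Z *v (\<xi> - \<upsilon>))) + \<epsilon> * (\<xi> \<bullet> \<xi> + \<upsilon> \<bullet> \<upsilon>)"
    and ineq: "pucci_minus \<gamma> \<Gamma> (X - Y + D2\<psi> a) - \<delta>\<^sub>1 * norm (D\<psi> a) - \<delta>\<^sub>0 * \<bar>u a - v b\<bar>
       - (1 + norm p + \<bar>v b\<bar> + dist a b powr \<nu> * norm Y / s) * \<omega> (2 * s) \<le> f a - g b + \<epsilon>"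
    by (rule inequality_at_maximum[OF open_\<Omega> sub super cont_u cont_v cont_f cont_g \<psi>_C2 \<psi>_sym sub_balls r4 Zsym Zn \<zeta> max s dpow(2) e(5), where \<eta> = \<epsilon>])
       (use e(5) in auto)
  have form': "\<xi> \<bullet> (X *v \<xi>) - \<upsilon> \<bullet> (Y *v \<upsilon>) \<le> 3/\<epsilon> * ((\<xi> - \<upsilon>) \<bullet> (\<xi> - \<upsilon>)) + \<epsilon> * (\<xi> \<bullet> \<xi> + \<upsilon> \<bullet> \<upsilon>)" for \<xi> \<upsilon>
  proof -
    have "(\<xi> - \<upsilon>) \<bullet> (Z *v (\<xi> - \<upsilon>)) + 2 * \<epsilon> * ((Z *v (\<xi> - \<upsilon>)) \<bullet> (Z *v (\<xi> - \<upsilon>))) = 3/\<epsilon> * ((\<xi> - \<upsilon>) \<bullet> (\<xi> - \<upsilon>))"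
      unfolding Zv inner_scaleR_left inner_scaleR_right using e(5) by (simp del: scaleR_right_diff_distrib inner_diff_left inner_diff_right)
    then show ?thesis using form[of \<xi> \<upsilon>] by linarith
  qed
  define T where "T = trace (Y - X + mat (2 * \<epsilon>))"
  \<comment> \<open>Of order \<epsilon>^\<nu>: then d^\<nu>/t stays bounded while t^2/\<epsilon>
    tends to 0.\<close>
  define t where "t = G * \<epsilon> powr \<nu>"
  have t: "0 < t" "t \<le> 1" using G e(3,5) by (auto simp: t_def)
  define Q where "Q = T + 3/\<epsilon> * t\<^sup>2 + 3 * \<epsilon>"
  have nY: "norm Y \<le> n\<^sup>2 * (Q / t)"
    unfolding n_def Q_def T_def using e(5) by (intro doubling_matrix_bound[OF XY form'] t) auto
  have Q0: "Q \<ge> 0"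
  proof -
    have "0 \<le> n\<^sup>2 * (Q / t)" using nY norm_ge_zero[of Y] by linarith
    moreover have "n\<^sup>2 > 0" using n1 by simp
    ultimately show ?thesis using t(1) by (simp add: zero_le_mult_iff zero_le_divide_iff)
  qed
  have P1: "\<gamma> * T - 2 * \<epsilon> * n * (\<gamma> + \<Gamma>) \<le> pucci_minus \<gamma> \<Gamma> (X - Y)"
  proof -
    have "\<xi> \<bullet> ((X - Y) *v \<xi>) \<le> 2 * \<epsilon> * (\<xi> \<bullet> \<xi>)" for \<xi>
      using form'[of \<xi> \<xi>] by (simp add: matrix_vector_mult_diff_rdistrib inner_diff_right)
    then have "- \<gamma> * trace (X - Y) - real CARD('n) * \<Gamma> * (2 * \<epsilon>) \<le> pucci_minus \<gamma> \<Gamma> (X - Y)"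
      using \<gamma>_pos \<gamma>_le_\<Gamma> e(5) by (intro pucci_minus_ge symmetric_mat_diff XY) auto
    moreover have "trace (X - Y) = 2 * \<epsilon> * n - T"
      by (simp add: T_def n_def trace_add trace_sub) (simp add: trace_def mat_def)
    ultimately show ?thesis unfolding n_def by (simp add: algebra_simps)
  qed
  have a\<Omega>: "a \<in> \<Omega>" "b \<in> \<Omega>" using ab B\<Omega> by blast+
  have P2: "pucci_minus \<gamma> \<Gamma> (X - Y) + pucci_minus \<gamma> \<Gamma> (D2\<psi> a) \<le> pucci_minus \<gamma> \<Gamma> (X - Y + D2\<psi> a)"
    using \<gamma>_pos \<gamma>_le_\<Gamma> by (intro pucci_minus_superadd symmetric_mat_diff XY \<psi>_sym a\<Omega>) auto
  have b1: "dist a b powr \<nu> * norm Y / s * w \<le> \<gamma> * Q"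
  proof -
    have "d powr \<nu> * norm Y \<le> (c * \<epsilon> powr \<nu>) * (n\<^sup>2 * (Q / t))"
      using dpow(1) nY by (intro mult_mono) (auto simp: c_def)
    then have "d powr \<nu> * norm Y / s * w \<le> (c * \<epsilon> powr \<nu>) * (n\<^sup>2 * (Q / t)) / s * w"
      using s w by (intro mult_right_mono divide_right_mono) auto
    also have "\<dots> = (c * n\<^sup>2 * w / s) / G * Q"
      using e(5) s G by (simp add: t_def field_simps)
    also have "\<dots> \<le> \<gamma> * Q"
    proof (rule mult_right_mono[OF _ Q0])
      have "c * n\<^sup>2 * w / s = \<gamma> * (G - 1)" using s \<gamma>_pos by (simp add: G_def field_simps)
      also have "\<dots> \<le> \<gamma> * G" using \<gamma>_pos by simp
      finally show "c * n\<^sup>2 * w / s / G \<le> \<gamma>" using G by (subst pos_divide_le_eq) auto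
    qed
    finally show ?thesis by (simp add: d_def)
  qed
  have b2: "(1 + norm p + \<bar>v b\<bar> + dist a b powr \<nu> * norm Y / s) * w \<le> (1 + 2 * L + \<bar>v b\<bar>) * w + \<gamma> * Q"
  proof -
    have "(1 + norm p + \<bar>v b\<bar> + dist a b powr \<nu> * norm Y / s) * w = (1 + norm p + \<bar>v b\<bar>) * w + dist a b powr \<nu> * norm Y / s * w"
      by (simp only: distrib_right)
    also have "(1 + norm p + \<bar>v b\<bar>) * w \<le> (1 + 2 * L + \<bar>v b\<bar>) * w" using np w by (intro mult_right_mono) auto
    finally show ?thesis using b1 by linarith
  qed
  have Qeq: "\<gamma> * Q = \<gamma> * T + 3 * \<gamma> * G\<^sup>2 * \<epsilon> powr (2 * \<nu> - 1) + 3 * \<gamma> * \<epsilon>"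
  proof -
    define q where "q = \<epsilon> powr \<nu>"
    have "\<epsilon> powr (2 * \<nu> - 1) = \<epsilon> powr (\<nu> + \<nu>) / \<epsilon> powr 1"
      unfolding powr_diff[symmetric] by (rule arg_cong2[where f = "(powr)"]) auto
    also have "\<dots> = q * q / \<epsilon>" unfolding powr_add q_def using e(5) by simp
    finally have pw: "\<epsilon> powr (2 * \<nu> - 1) = q * q / \<epsilon>" .
    show ?thesis
      unfolding Q_def t_def pw q_def[symmetric] power2_eq_square using e(5) by (simp add: distrib_left mult_ac)
  qed
  have "pucci_minus \<gamma> \<Gamma> (D2\<psi> a) - \<delta>\<^sub>1 * norm (D\<psi> a) - \<delta>\<^sub>0 * \<bar>u a - v b\<bar> - (1 + 2 * L + \<bar>v b\<bar>) * w \<le> f a - g b + err \<epsilon>"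
    using ineq P1 P2 b2 unfolding Qeq err_def w_def[symmetric] by argo
  then have "pucci_minus \<gamma> \<Gamma> (D2\<psi> a) - \<delta>\<^sub>1 * norm (D\<psi> a) - \<delta>\<^sub>0 * \<bar>u a - v b\<bar> - (1 + 2 * L + \<bar>v b\<bar>) * \<omega> (2 * s) \<le> f a - g b + \<tau>"
    using e(4) unfolding w_def by linarith
  then show ?thesis using that[of a b] near a\<Omega> by simp
qed

text \<open>Two limits in this order: first the points tend to x0 with s fixed; then s tends to 0
  and removes \<omega> (2 s), whose factor is under control because L does not depend on s.\<close>

lemma inequality_at_strict_maximum:
  "pucci_minus \<gamma> \<Gamma> (D2\<psi> x0) - \<delta>\<^sub>1 * norm (D\<psi> x0) - \<delta>\<^sub>0 * \<bar>u x0 - v x0\<bar> \<le> f x0 - g x0"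
proof -
  have x0: "x0 \<in> \<Omega>" using ball_sub r_pos by auto
  obtain L r1 where Lr: "L > 0" "r1 > 0"
    "\<And>x y. \<lbrakk>x \<in> cball x0 r; y \<in> cball x0 r; dist x y \<le> r1\<rbrakk> \<Longrightarrow> u x - \<psi> x - v y - m \<le> L * dist x y"
    using one_sided_lipschitz by metis
  define R where "R = (\<lambda>a b s. f a - g b + \<delta>\<^sub>1 * norm (D\<psi> a) + \<delta>\<^sub>0 * \<bar>u a - v b\<bar> + (1 + 2 * L + \<bar>v b\<bar>) * \<omega> (2 * s) + (\<gamma> + \<Gamma>) * real CARD('n) * norm (D2\<psi> a - D2\<psi> x0))"
  have step: "pucci_minus \<gamma> \<Gamma> (D2\<psi> x0) \<le> R x0 x0 s" if s: "s > 0" for s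
  proof -
    have "\<forall>k. \<exists>a b. dist a x0 < 1 / real (Suc k) \<and> dist b x0 < 1 / real (Suc k) \<and> a \<in> \<Omega> \<and> pucci_minus \<gamma> \<Gamma> (D2\<psi> x0) \<le> R a b s + 1 / real (Suc k)"
    proof
      fix k
      have "1 / real (Suc k) > 0" by simp
      then obtain a b where ab: "dist a x0 < 1 / real (Suc k)" "dist b x0 < 1 / real (Suc k)" "a \<in> \<Omega>" "b \<in> \<Omega>"
        "pucci_minus \<gamma> \<Gamma> (D2\<psi> a) - \<delta>\<^sub>1 * norm (D\<psi> a) - \<delta>\<^sub>0 * \<bar>u a - v b\<bar> - (1 + 2 * L + \<bar>v b\<bar>) * \<omega> (2 * s) \<le> f a - g b + 1 / real (Suc k)"
        using approximate_inequality[OF _ s Lr] by blast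
      have sy: "symmetric_mat (D2\<psi> a - D2\<psi> x0)" by (intro symmetric_mat_diff \<psi>_sym ab x0)
      have "pucci_minus \<gamma> \<Gamma> (D2\<psi> x0) + pucci_minus \<gamma> \<Gamma> (D2\<psi> a - D2\<psi> x0) \<le> pucci_minus \<gamma> \<Gamma> (D2\<psi> x0 + (D2\<psi> a - D2\<psi> x0))"
        using \<gamma>_pos \<gamma>_le_\<Gamma> sy by (intro pucci_minus_superadd \<psi>_sym x0) auto
      moreover have "- ((\<gamma> + \<Gamma>) * real CARD('n) * norm (D2\<psi> a - D2\<psi> x0)) \<le> pucci_minus \<gamma> \<Gamma> (D2\<psi> a - D2\<psi> x0)"
        using \<gamma>_pos \<gamma>_le_\<Gamma> sy by (intro pucci_minus_ge_norm) auto
      ultimately have "pucci_minus \<gamma> \<Gamma> (D2\<psi> x0) \<le> R a b s + 1 / real (Suc k)" using ab(5) unfolding R_def by simp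
      then show "\<exists>a b. dist a x0 < 1 / real (Suc k) \<and> dist b x0 < 1 / real (Suc k) \<and> a \<in> \<Omega> \<and> pucci_minus \<gamma> \<Gamma> (D2\<psi> x0) \<le> R a b s + 1 / real (Suc k)"
        using ab by blast
    qed
    then obtain a b where ab: "\<And>k. dist (a k) x0 < 1 / real (Suc k)" "\<And>k. dist (b k) x0 < 1 / real (Suc k)"
      "\<And>k. pucci_minus \<gamma> \<Gamma> (D2\<psi> x0) \<le> R (a k) (b k) s + 1 / real (Suc k)" by metis
    have lim: "a \<longlonglongrightarrow> x0" "b \<longlonglongrightarrow> x0" using ab(1,2) by (auto intro: LIMSEQ_of_dist_less)
    have clim: "(\<lambda>k. h (t k)) \<longlonglongrightarrow> h x0" if "continuous_on \<Omega> h" "t \<longlonglongrightarrow> x0" for h :: "real^'n \<Rightarrow> 'z::topological_space" and t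
      using that open_\<Omega> x0 continuous_on_eq_continuous_at isCont_tendsto_compose by blast
    have "(\<lambda>k. R (a k) (b k) s + 1 / real (Suc k)) \<longlonglongrightarrow> R x0 x0 s + 0"
      unfolding R_def using LIMSEQ_inverse_real_of_nat
      by (intro tendsto_intros clim[OF cont_u] clim[OF cont_v] clim[OF cont_f] clim[OF cont_g] clim[OF cont_D\<psi>] clim[OF cont_D2\<psi>] lim)
         (simp add: inverse_eq_divide)
    then show ?thesis using ab(3) by (intro LIMSEQ_le_const[of _ "R x0 x0 s"]) auto
  qed
  have "(\<lambda>k. \<omega> (2 * (1 / real (Suc k)))) \<longlonglongrightarrow> \<omega> (2 * 0)"
  proof (rule continuous_on_tendsto_compose[OF \<omega>_cont])
    show "(\<lambda>k. 2 * (1 / real (Suc k))) \<longlonglongrightarrow> 2 * 0"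
      using LIMSEQ_inverse_real_of_nat by (intro tendsto_intros) (simp add: inverse_eq_divide)
  qed auto
  then have "(\<lambda>k. R x0 x0 (1 / real (Suc k))) \<longlonglongrightarrow> f x0 - g x0 + \<delta>\<^sub>1 * norm (D\<psi> x0) + \<delta>\<^sub>0 * \<bar>u x0 - v x0\<bar> + (1 + 2 * L + \<bar>v x0\<bar>) * \<omega> (2 * 0) + (\<gamma> + \<Gamma>) * real CARD('n) * norm (D2\<psi> x0 - D2\<psi> x0)"
    unfolding R_def by (intro tendsto_intros)
  moreover have "pucci_minus \<gamma> \<Gamma> (D2\<psi> x0) \<le> R x0 x0 (1 / real (Suc k))" for k by (rule step) simp
  ultimately have "pucci_minus \<gamma> \<Gamma> (D2\<psi> x0) \<le> f x0 - g x0 + \<delta>\<^sub>1 * norm (D\<psi> x0) + \<delta>\<^sub>0 * \<bar>u x0 - v x0\<bar> + (1 + 2 * L + \<bar>v x0\<bar>) * \<omega> (2 * 0) + (\<gamma> + \<Gamma>) * real CARD('n) * norm (D2\<psi> x0 - D2\<psi> x0)"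
    by (intro LIMSEQ_le_const) auto
  then show ?thesis by (simp add: \<omega>_0)
qed

end

context elliptic_operator
begin

text \<open>Adding \<kappa> |y - x0|^2 to \<psi> makes the maximum strict. This costs 2 n (\<gamma>
  + \<Gamma>) \<kappa>, which vanishes with \<kappa>.\<close>

theorem difference_inequality:
  assumes \<Omega>: "open \<Omega>" and sub: "visc_sub F f u \<Omega>" and super: "visc_super F g v \<Omega>"
    and cont: "continuous_on \<Omega> u" "continuous_on \<Omega> v" "continuous_on \<Omega> f" "continuous_on \<Omega> g"
    and \<psi>: "C2_with \<psi> D\<psi> D2\<psi> \<Omega>" "\<And>x. x \<in> \<Omega> \<Longrightarrow> symmetric_mat (D2\<psi> x)"
    and x0: "x0 \<in> \<Omega>" and e: "e > 0" and max: "\<And>y. y \<in> ball x0 e \<Longrightarrow> y \<in> \<Omega> \<Longrightarrow> u y - v y - \<psi> y \<le> u x0 - v x0 - \<psi> x0"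
  shows "pucci_minus \<gamma> \<Gamma> (D2\<psi> x0) - \<delta>\<^sub>1 * norm (D\<psi> x0) - \<delta>\<^sub>0 * \<bar>u x0 - v x0\<bar> \<le> f x0 - g x0"
proof -
  define n where "n = real CARD('n)"
  have main: "pucci_minus \<gamma> \<Gamma> (D2\<psi> x0) - \<delta>\<^sub>1 * norm (D\<psi> x0) - \<delta>\<^sub>0 * \<bar>u x0 - v x0\<bar> \<le> f x0 - g x0 + 2 * n * (\<gamma> + \<Gamma>) * \<kappa>"
    if \<kappa>: "\<kappa> > 0" for \<kappa>
  proof -
    obtain r0 where r0: "r0 > 0" "cball x0 r0 \<subseteq> \<Omega>" using \<Omega> x0 open_contains_cball by blast
    define r where "r = min r0 (e/2)"
    have r: "r > 0" "cball x0 r \<subseteq> \<Omega>" "cball x0 r \<subseteq> ball x0 e"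
      using r0 e by (auto simp: r_def subset_iff)
    have symk: "symmetric_mat (mat (2 * \<kappa>) :: real^'n^'n)" by simp
    define \<psi>' where "\<psi>' = (\<lambda>y. \<psi> y + (0 \<bullet> (y - x0) + 1/2 * ((y - x0) \<bullet> (mat (2 * \<kappa>) *v (y - x0)))))"
    have \<psi>'_eq: "\<psi>' y = \<psi> y + \<kappa> * (dist y x0)\<^sup>2" for y
      by (simp add: \<psi>'_def mat_mult_vec dist_norm dot_square_norm)
    interpret strict_maximum F \<Omega> \<gamma> \<Gamma> \<delta>\<^sub>0 \<delta>\<^sub>1 \<nu> \<omega> f g u v \<psi>' "\<lambda>y. D\<psi> y + (0 + mat (2 * \<kappa>) *v (y - x0))" "\<lambda>y. D2\<psi> y + mat (2 * \<kappa>)" x0 r \<kappa>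
    proof
      show "C2_with \<psi>' (\<lambda>y. D\<psi> y + (0 + mat (2 * \<kappa>) *v (y - x0))) (\<lambda>y. D2\<psi> y + mat (2 * \<kappa>)) \<Omega>"
        unfolding \<psi>'_def by (intro C2_with_add \<psi>(1) C2_with_quadratic symk)
      show "symmetric_mat (D2\<psi> x + mat (2 * \<kappa>))" if "x \<in> \<Omega>" for x
        by (intro symmetric_mat_add \<psi>(2) that symk)
      show "u y - \<psi>' y - v y \<le> u x0 - \<psi>' x0 - v x0 - \<kappa> * (dist y x0)\<^sup>2" if "y \<in> cball x0 r" for y
      proof -
        have "y \<in> ball x0 e" "y \<in> \<Omega>" using that r by blast+
        from max[OF this] show ?thesis by (simp add: \<psi>'_eq)
      qed
    qed (use assms r \<kappa> in auto)
    have "pucci_minus \<gamma> \<Gamma> (D2\<psi> x0) + pucci_minus \<gamma> \<Gamma> (mat (2 * \<kappa>) :: real^'n^'n) \<le> pucci_minus \<gamma> \<Gamma> (D2\<psi> x0 + mat (2 * \<kappa>))"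
      using \<gamma>_pos \<gamma>_le_\<Gamma> by (intro pucci_minus_superadd \<psi>(2) x0 symk) auto
    moreover have "- \<gamma> * trace (mat (2 * \<kappa>) :: real^'n^'n) - real CARD('n) * \<Gamma> * (2 * \<kappa>) \<le> pucci_minus \<gamma> \<Gamma> (mat (2 * \<kappa>) :: real^'n^'n)"
      using \<gamma>_pos \<gamma>_le_\<Gamma> \<kappa> by (intro pucci_minus_ge symk) (auto simp: mat_mult_vec)
    moreover have "trace (mat (2 * \<kappa>) :: real^'n^'n) = 2 * \<kappa> * n" by (simp add: trace_def mat_def n_def)
    ultimately have "pucci_minus \<gamma> \<Gamma> (D2\<psi> x0) - 2 * n * (\<gamma> + \<Gamma>) * \<kappa> \<le> pucci_minus \<gamma> \<Gamma> (D2\<psi> x0 + mat (2 * \<kappa>))"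
      by (simp add: n_def algebra_simps)
    then show ?thesis using inequality_at_strict_maximum by simp
  qed
  show ?thesis
  proof (rule field_le_epsilon)
    fix \<epsilon> :: real assume "\<epsilon> > 0"
    define K where "K = 2 * n * (\<gamma> + \<Gamma>)"
    have K: "K > 0" using \<gamma>_pos \<gamma>_le_\<Gamma> by (simp add: K_def n_def)
    from main[of "\<epsilon> / K"] show "pucci_minus \<gamma> \<Gamma> (D2\<psi> x0) - \<delta>\<^sub>1 * norm (D\<psi> x0) - \<delta>\<^sub>0 * \<bar>u x0 - v x0\<bar> \<le> f x0 - g x0 + \<epsilon>"
      using K \<open>\<epsilon> > 0\<close> by (simp add: K_def[symmetric])
  qed
qed

end

section \<open>The strong maximum principle\<close>

definition outer :: "real^'n \<Rightarrow> real^'n^'n" where "outer w = (\<chi> i j. w $ i * w $ j)"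

lemma outer_mult_vec: "outer w *v h = (w \<bullet> h) *\<^sub>R w"
  by (simp add: vec_eq_iff outer_def matrix_vector_mult_def inner_vec_def sum_distrib_left sum_distrib_right mult_ac)

lemma symmetric_mat_outer [simp]: "symmetric_mat (outer w)"
  by (rule symmetric_matI) (simp add: outer_def)

lemma trace_outer: "trace (outer w) = w \<bullet> w"
  by (simp add: trace_def outer_def inner_vec_def)

definition gauss :: "real \<Rightarrow> real^'n \<Rightarrow> real^'n \<Rightarrow> real" where
  "gauss A z x = exp (- A * ((x - z) \<bullet> (x - z)))"

definition gauss_hessian :: "real \<Rightarrow> real^'n \<Rightarrow> real^'n \<Rightarrow> real^'n^'n" where
  "gauss_hessian A z x = gauss A z x *\<^sub>R ((4 * A\<^sup>2) *\<^sub>R outer (x - z) - mat (2 * A))"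

lemma gauss_pos: "gauss A z x > 0" by (simp add: gauss_def)

lemma continuous_on_gauss [continuous_intros]:
  "continuous_on S a \<Longrightarrow> continuous_on S b \<Longrightarrow> continuous_on S (\<lambda>x. gauss A (a x) (b x))"
  unfolding gauss_def by (intro continuous_intros)

lemma gauss_le: "A > 0 \<Longrightarrow> 0 \<le> s \<Longrightarrow> s \<le> dist x z \<Longrightarrow> gauss A z x \<le> exp (- A * s\<^sup>2)"
  and gauss_ge: "A > 0 \<Longrightarrow> dist x z \<le> s \<Longrightarrow> exp (- A * s\<^sup>2) \<le> gauss A z x"
  by (auto simp: gauss_def dist_norm dot_square_norm intro!: power_mono)

lemma C2_with_gauss: "C2_with (gauss A z) (\<lambda>x. (- 2 * A * gauss A z x) *\<^sub>R (x - z)) (gauss_hessian A z) S"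
  unfolding C2_with_def
proof (intro conjI ballI)
  have d: "(gauss A z has_derivative (\<lambda>h. (- 2 * A * gauss A z x) * ((x - z) \<bullet> h))) (at x)" for x
    unfolding gauss_def by (auto intro!: derivative_eq_intros simp: inner_commute algebra_simps)
  then show "(gauss A z has_derivative (\<lambda>h. ((- 2 * A * gauss A z x) *\<^sub>R (x - z)) \<bullet> h)) (at x)" for x
    by simp
  show "((\<lambda>x. (- 2 * A * gauss A z x) *\<^sub>R (x - z)) has_derivative (\<lambda>h. gauss_hessian A z x *v h)) (at x)" for x
  proof -
    have "((\<lambda>x. (- 2 * A * gauss A z x) *\<^sub>R (x - z)) has_derivative
       (\<lambda>h. (- 2 * A * gauss A z x) *\<^sub>R h + (- 2 * A * ((- 2 * A * gauss A z x) * ((x - z) \<bullet> h))) *\<^sub>R (x - z))) (at x)"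
      by (auto intro!: derivative_eq_intros d)
    moreover have "gauss_hessian A z x *v h = (- 2 * A * gauss A z x) *\<^sub>R h + (- 2 * A * ((- 2 * A * gauss A z x) * ((x - z) \<bullet> h))) *\<^sub>R (x - z)" for h
    proof -
      have "gauss_hessian A z x *v h = gauss A z x *\<^sub>R ((4 * A\<^sup>2 * ((x - z) \<bullet> h)) *\<^sub>R (x - z) - (2 * A) *\<^sub>R h)"
        unfolding gauss_hessian_def
        by (simp only: scaleR_matrix_vector_assoc[symmetric] matrix_vector_mult_diff_rdistrib mat_mult_vec outer_mult_vec scaleR_scaleR)
      then show ?thesis by (simp add: scaleR_diff_right power2_eq_square mult_ac)
    qed
    ultimately show ?thesis by simp
  qed
  show "continuous_on S (gauss_hessian A z)"
    unfolding gauss_hessian_def outer_def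
    by (intro continuous_intros continuous_on_vec_lambda)
qed

context elliptic_operator
begin

text \<open>On an annulus around z the second-order term 4 A^2 \<gamma> |x - z|^2 outgrows the
  others, which are linear in A. Everything is proportional to c times the Gaussian, so A depends
  neither on c nor on z.\<close>

lemma gauss_barrier_parameter:
  assumes \<rho>: "\<rho> > 0"
  obtains A where "A > 0"
    "\<And>c z (x::real^'n). \<lbrakk>c \<ge> 0; \<rho> \<le> dist x z; dist x z \<le> R\<rbrakk> \<Longrightarrow>
      pucci_minus \<gamma> \<Gamma> (- c *\<^sub>R gauss_hessian A z x) - \<delta>\<^sub>1 * norm (- c *\<^sub>R (- 2 * A * gauss A z x) *\<^sub>R (x - z)) \<ge> c * gauss A z x * (\<delta>\<^sub>0 + 1)"
proof -
  define n where "n = real CARD('n)"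
  \<comment> \<open>The sum of the coefficients of A in the terms to be beaten and of the margin
    \<open>\<delta>\<^sub>0 + 1\<close>, which A \<ge> 1 allows to be counted as linear in
    A.\<close>
  define C where "C = 2 * (n * (\<gamma> + \<Gamma>) + \<delta>\<^sub>1 * \<bar>R\<bar>) + \<delta>\<^sub>0 + 1"
  have C: "C > 0" unfolding C_def n_def using \<gamma>_pos \<gamma>_le_\<Gamma> \<delta>\<^sub>0_nonneg \<delta>\<^sub>1_nonneg by (intro add_nonneg_pos add_nonneg_nonneg mult_nonneg_nonneg) auto
  define A where "A = max 1 (C / (4 * \<gamma> * \<rho>\<^sup>2))"
  have A: "A \<ge> 1" "4 * A * \<gamma> * \<rho>\<^sup>2 \<ge> C"
  proof -
    have "C / (4 * \<gamma> * \<rho>\<^sup>2) \<le> A" by (simp add: A_def)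
    then show "4 * A * \<gamma> * \<rho>\<^sup>2 \<ge> C" using \<gamma>_pos \<rho> by (simp add: divide_le_eq mult_ac)
  qed (simp add: A_def)
  show ?thesis
  proof (rule that[of A])
    show "A > 0" using A by simp
    fix c :: real and z x :: "real^'n"
    assume c: "c \<ge> 0" and d: "\<rho> \<le> dist x z" "dist x z \<le> R"
    define E where "E = gauss A z x"
    define d where "d = dist x z"
    have E: "E > 0" by (simp add: E_def gauss_pos)
    define N where "N = - c *\<^sub>R gauss_hessian A z x"
    have Nsym: "symmetric_mat N"
      unfolding N_def gauss_hessian_def by (intro symmetric_mat_scaleR symmetric_mat_diff symmetric_mat_mat symmetric_mat_outer)
    have Nv: "N *v h = (c * E * 2 * A) *\<^sub>R h - (c * E * 4 * A\<^sup>2 * ((x - z) \<bullet> h)) *\<^sub>R (x - z)" for h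
      unfolding N_def gauss_hessian_def E_def[symmetric]
      by (simp only: scaleR_matrix_vector_assoc[symmetric] matrix_vector_mult_diff_rdistrib mat_mult_vec outer_mult_vec scaleR_scaleR)
         (simp add: algebra_simps)
    have Nle: "h \<bullet> (N *v h) \<le> (c * E * 2 * A) * (h \<bullet> h)" for h
    proof -
      have "0 \<le> c * E * 4 * A\<^sup>2 * ((x - z) \<bullet> h)\<^sup>2" using c E by simp
      then show ?thesis by (simp add: Nv inner_diff_right power2_eq_square inner_commute mult_ac)
    qed
    have trN: "trace N = c * E * (2 * A * n - 4 * A\<^sup>2 * d\<^sup>2)"
    proof -
      have tm: "trace (k *\<^sub>R M) = k * trace M" for k and M :: "real^'n^'n" by (simp add: trace_def sum_distrib_left)
      have "trace (mat (2 * A) :: real^'n^'n) = 2 * A * n" by (simp add: trace_def mat_def n_def)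
      then show ?thesis
        by (simp add: N_def gauss_hessian_def E_def[symmetric] tm trace_sub trace_outer d_def dist_norm dot_square_norm algebra_simps)
    qed
    have mu0: "c * E * 2 * A \<ge> 0" using c E A by simp
    have "- \<gamma> * trace N - real CARD('n) * \<Gamma> * (c * E * 2 * A) \<le> pucci_minus \<gamma> \<Gamma> N"
      using \<gamma>_pos \<gamma>_le_\<Gamma> by (intro pucci_minus_ge Nsym Nle mu0) auto
    then have P: "c * E * (4 * A\<^sup>2 * \<gamma> * d\<^sup>2 - 2 * A * n * (\<gamma> + \<Gamma>)) \<le> pucci_minus \<gamma> \<Gamma> N"
      unfolding trN by (simp add: n_def algebra_simps)
    have G: "norm (- c *\<^sub>R (- 2 * A * gauss A z x) *\<^sub>R (x - z)) = c * E * (2 * A * d)"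
      using c A E by (simp add: E_def[symmetric] d_def dist_norm abs_mult)
    have key: "4 * A\<^sup>2 * \<gamma> * d\<^sup>2 - 2 * A * n * (\<gamma> + \<Gamma>) - \<delta>\<^sub>1 * (2 * A * d) \<ge> \<delta>\<^sub>0 + 1"
    proof -
      have "C \<le> 4 * A * \<gamma> * d\<^sup>2"
      proof -
        have "\<rho>\<^sup>2 \<le> d\<^sup>2" using d \<rho> by (intro power_mono) (auto simp: d_def)
        then have "4 * A * \<gamma> * \<rho>\<^sup>2 \<le> 4 * A * \<gamma> * d\<^sup>2" using A \<gamma>_pos by (intro mult_left_mono) auto
        then show ?thesis using A(2) by linarith
      qed
      then have "A * C \<le> A * (4 * A * \<gamma> * d\<^sup>2)" using A by (intro mult_left_mono) auto
      moreover have "A * C = 2 * A * n * (\<gamma> + \<Gamma>) + \<delta>\<^sub>1 * (2 * A * \<bar>R\<bar>) + A * (\<delta>\<^sub>0 + 1)"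
        by (simp add: C_def algebra_simps)
      moreover have "\<delta>\<^sub>1 * (2 * A * d) \<le> \<delta>\<^sub>1 * (2 * A * \<bar>R\<bar>)"
        using d \<delta>\<^sub>1_nonneg A by (intro mult_left_mono) (auto simp: d_def)
      moreover have "1 * (\<delta>\<^sub>0 + 1) \<le> A * (\<delta>\<^sub>0 + 1)" using A \<delta>\<^sub>0_nonneg by (intro mult_right_mono) auto
      moreover have "A * (4 * A * \<gamma> * d\<^sup>2) = 4 * A\<^sup>2 * \<gamma> * d\<^sup>2" by (simp add: power2_eq_square)
      ultimately show ?thesis by argo
    qed
    have "c * E * (\<delta>\<^sub>0 + 1) \<le> c * E * (4 * A\<^sup>2 * \<gamma> * d\<^sup>2 - 2 * A * n * (\<gamma> + \<Gamma>) - \<delta>\<^sub>1 * (2 * A * d))"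
      using key c E by (intro mult_left_mono) auto
    also have "\<dots> = c * E * (4 * A\<^sup>2 * \<gamma> * d\<^sup>2 - 2 * A * n * (\<gamma> + \<Gamma>)) - \<delta>\<^sub>1 * (c * E * (2 * A * d))"
      by (simp add: algebra_simps)
    finally show "pucci_minus \<gamma> \<Gamma> (- c *\<^sub>R gauss_hessian A z x) - \<delta>\<^sub>1 * norm (- c *\<^sub>R (- 2 * A * gauss A z x) *\<^sub>R (x - z)) \<ge> c * gauss A z x * (\<delta>\<^sub>0 + 1)"
      using P unfolding G N_def[symmetric] unfolding E_def[symmetric] by argo
  qed
qed

lemma C2_with_gauss_barrier:
  "C2_with (\<lambda>x. k + (- c) * gauss A z x) (\<lambda>x. - c *\<^sub>R (- 2 * A * gauss A z x) *\<^sub>R (x - z)) (\<lambda>x. - c *\<^sub>R gauss_hessian A z x) S"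
  using C2_with_add[OF C2_with_const[of k] C2_with_scale[OF C2_with_gauss[of A z], of "- c"]] by simp

lemma symmetric_gauss_hessian: "symmetric_mat (c *\<^sub>R gauss_hessian A z x)"
  unfolding gauss_hessian_def by (intro symmetric_mat_scaleR symmetric_mat_diff symmetric_mat_mat symmetric_mat_outer)

text \<open>The difference inequality with the barrier as test function: \<open>small\<close> says
  that the zero-order term cannot use up the margin in \<open>barrier\<close>.\<close>

lemma no_touching_gauss_barrier:
  assumes \<Omega>: "open \<Omega>" and sub: "visc_sub F f u \<Omega>" and super: "visc_super F g v \<Omega>"
    and cont: "continuous_on \<Omega> u" "continuous_on \<Omega> v" "continuous_on \<Omega> f" "continuous_on \<Omega> g"
    and fg: "f x \<le> g x"
    and barrier: "pucci_minus \<gamma> \<Gamma> (- c *\<^sub>R gauss_hessian A z x) - \<delta>\<^sub>1 * norm (- c *\<^sub>R (- 2 * A * gauss A z x) *\<^sub>R (x - z)) \<ge> c * gauss A z x * (\<delta>\<^sub>0 + 1)"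
    and small: "\<delta>\<^sub>0 * \<bar>u x - v x\<bar> < c * gauss A z x * (\<delta>\<^sub>0 + 1)"
    and x: "x \<in> \<Omega>" and e: "e > 0"
    and max: "\<And>y. y \<in> ball x e \<Longrightarrow> y \<in> \<Omega> \<Longrightarrow> u y - v y + c * gauss A z y \<le> u x - v x + c * gauss A z x"
  shows False
proof -
  have "pucci_minus \<gamma> \<Gamma> (- c *\<^sub>R gauss_hessian A z x) - \<delta>\<^sub>1 * norm (- c *\<^sub>R (- 2 * A * gauss A z x) *\<^sub>R (x - z)) - \<delta>\<^sub>0 * \<bar>u x - v x\<bar> \<le> f x - g x"
    by (rule difference_inequality[OF \<Omega> sub super cont C2_with_gauss_barrier[of 0] symmetric_gauss_hessian x e]) (use max in auto)
  then show False using barrier small fg by linarith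
qed

theorem strong_maximum_principle:
  assumes \<Omega>: "open \<Omega>" "connected \<Omega>" and sub: "visc_sub F f u \<Omega>" and super: "visc_super F g v \<Omega>"
    and cont: "continuous_on \<Omega> u" "continuous_on \<Omega> v" "continuous_on \<Omega> f" "continuous_on \<Omega> g"
    and fg: "\<And>x. x \<in> \<Omega> \<Longrightarrow> f x \<le> g x" and le: "\<And>x. x \<in> \<Omega> \<Longrightarrow> u x \<le> v x"
    and x1: "x1 \<in> \<Omega>" "u x1 = v x1" and x: "x \<in> \<Omega>"
  shows "u x = v x"
proof -
  define w where "w = (\<lambda>x. u x - v x)"
  have contw: "continuous_on \<Omega> w" unfolding w_def by (intro continuous_intros cont)
  have w0: "w x \<le> 0" if "x \<in> \<Omega>" for x using le[OF that] by (simp add: w_def)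
  define T where "T = {x \<in> \<Omega>. w x = 0}"
  have closedT: "closedin (top_of_set \<Omega>) T"
    unfolding T_def using continuous_closedin_preimage_constant[OF contw, of 0] by simp
  have "openin (top_of_set \<Omega>) T"
  proof -
    have "\<exists>e>0. ball x0 e \<subseteq> T" if "x0 \<in> T" for x0
    proof -
      have x0: "x0 \<in> \<Omega>" "w x0 = 0" using that by (auto simp: T_def)
      obtain \<rho>' where \<rho>': "\<rho>' > 0" "cball x0 \<rho>' \<subseteq> \<Omega>" using \<Omega>(1) x0(1) open_contains_cball by blast
      \<comment> \<open>Half the radius leaves room: a point y within \<rho> of x0 is closer than
        \<rho> to T, so the ball around y up to its nearest point of T stays in the ball of radius 2
        \<rho>.\<close>
      define \<rho> where "\<rho> = \<rho>' / 2"
      have \<rho>: "\<rho> > 0" "cball x0 (2 * \<rho>) \<subseteq> \<Omega>" using \<rho>' by (auto simp: \<rho>_def)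
      have "ball x0 \<rho> \<subseteq> T"
      proof (rule ccontr)
        assume "\<not> ball x0 \<rho> \<subseteq> T"
        then obtain y where "y \<in> ball x0 \<rho>" "y \<notin> T" by blast
        then have y: "dist x0 y < \<rho>" "y \<notin> T" by simp_all
        have sb: "y' \<in> cball x0 (2 * \<rho>)" if "dist y y' \<le> \<rho>" for y'
          using dist_triangle[of x0 y' y] y(1) that by simp
        define S where "S = T \<inter> cball x0 (2 * \<rho>)"
        have "compact S"
        proof -
          have "S = {x \<in> cball x0 (2 * \<rho>). w x = 0}" using \<rho>(2) by (auto simp: S_def T_def)
          moreover have "closed {x \<in> cball x0 (2 * \<rho>). w x = 0}"
            by (intro continuous_closed_preimage_constant continuous_on_subset[OF contw \<rho>(2)]) auto
          ultimately show ?thesis by (metis S_def bounded_Int bounded_cball compact_eq_bounded_closed)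
        qed
        moreover have "x0 \<in> S" using that \<rho>(1) by (simp add: S_def)
        ultimately obtain xh where xh: "xh \<in> S" "\<And>x. x \<in> S \<Longrightarrow> dist y xh \<le> dist y x"
          using distance_attains_inf[of S y] compact_imp_closed by blast
        define R where "R = dist y xh"
        have xhT: "xh \<in> \<Omega>" "w xh = 0" using xh(1) by (auto simp: S_def T_def)
        have R: "R > 0" "R < \<rho>"
        proof -
          show "R > 0" using xh(1) y(2) by (auto simp: R_def S_def)
          show "R < \<rho>" using xh(2)[OF \<open>x0 \<in> S\<close>] y(1) by (simp add: R_def dist_commute)
        qed
        have neg: "w q < 0" if "dist y q < R" for q
        proof -
          have q: "q \<in> cball x0 (2 * \<rho>)" using that R by (intro sb) simp
          then have "q \<in> \<Omega>" using \<rho>(2) by blast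
          moreover have "q \<notin> S" using xh(2)[of q] that by (auto simp: R_def)
          ultimately show ?thesis using q w0[of q] by (auto simp: S_def T_def less_le)
        qed
        \<comment> \<open>The ball of half the radius, internally tangent at xh: its closure meets
          the larger sphere in xh only, so w < 0 on it except at xh.\<close>
        define z where "z = midpoint y xh"
        define R' where "R' = R / 2"
        have R': "R' > 0" using R by (simp add: R'_def)
        have zx: "dist z xh = R'" "dist y z = R'"
          by (simp_all add: z_def R'_def R_def dist_midpoint)
        have neg': "w q < 0" if "dist z q \<le> R'" "q \<noteq> xh" for q
        proof (rule neg, rule ccontr)
          assume "\<not> dist y q < R"
          moreover have "dist y q \<le> dist y z + dist z q" by (rule dist_triangle)
          ultimately have eq: "dist y q = R" "dist z q = R'" using that zx by (auto simp: R'_def)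
          \<comment> \<open>Equality in the triangle inequality makes q - z and z - y parallel;
            having equal length, they coincide.\<close>
          have "norm ((z - y) + (q - z)) = norm (z - y) + norm (q - z)"
            using eq zx(2) by (simp add: dist_norm norm_minus_commute R'_def)
          then have "norm (z - y) *\<^sub>R (q - z) = norm (q - z) *\<^sub>R (z - y)" by (simp only: norm_triangle_eq)
          then have "q - z = z - y" using eq zx(2) R' by (simp add: dist_norm norm_minus_commute)
          moreover have "z + z = y + xh" by (simp add: z_def midpoint_def flip: scaleR_2)
          then have "xh - z = z - y" by (simp add: algebra_simps)
          ultimately have "q = xh" by (metis diff_add_cancel)
          then show False using that(2) by simp
        qed
        obtain \<tau>' where \<tau>': "\<tau>' > 0" "cball xh \<tau>' \<subseteq> \<Omega>" using \<Omega>(1) xhT(1) open_contains_cball by blast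
        define \<tau> where "\<tau> = min \<tau>' (R' / 2)"
        have \<tau>: "\<tau> > 0" "cball xh \<tau> \<subseteq> \<Omega>" "\<tau> \<le> R' / 2" using \<tau>' R' by (auto simp: \<tau>_def)
        have R2: "R' / 2 > 0" using R' by simp
        obtain A where A: "A > 0"
          "\<And>c x. \<lbrakk>c \<ge> 0; R' / 2 \<le> dist x z; dist x z \<le> 2 * R'\<rbrakk> \<Longrightarrow>
             pucci_minus \<gamma> \<Gamma> (- c *\<^sub>R gauss_hessian A z x) - \<delta>\<^sub>1 * norm (- c *\<^sub>R (- 2 * A * gauss A z x) *\<^sub>R (x - z)) \<ge> c * gauss A z x * (\<delta>\<^sub>0 + 1)"
          using gauss_barrier_parameter[OF R2, of "2 * R'"] by metis
        define k where "k = exp (- A * R'\<^sup>2)"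
        define Q where "Q = sphere xh \<tau> \<inter> cball z R'"
        \<comment> \<open>On the part of the small sphere around xh that lies in the tangent ball, w
          is bounded away from 0 by compactness, so a small multiple of the barrier may be added. On
          the rest of that sphere the barrier term is nonpositive.\<close>
        have "\<exists>\<epsilon>>0. \<forall>q\<in>Q. w q \<le> - \<epsilon>"
        proof (cases "Q = {}")
          case True
          then show ?thesis by (intro exI[of _ 1]) auto
        next
          case False
          have "compact Q" unfolding Q_def by (intro compact_Int compact_sphere compact_cball)
          moreover have "continuous_on Q w" using \<tau>(2) by (intro continuous_on_subset[OF contw]) (auto simp: Q_def)
          ultimately obtain q0 where q0: "q0 \<in> Q" "\<And>q. q \<in> Q \<Longrightarrow> w q \<le> w q0"
            using continuous_attains_sup[OF _ False] by blast
          have "w q0 < 0" using q0(1) \<tau>(1) by (intro neg') (auto simp: Q_def)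
          then show ?thesis using q0(2) by (intro exI[of _ "- w q0"]) auto
        qed
        then obtain \<epsilon> where \<epsilon>: "\<epsilon> > 0" "\<And>q. q \<in> Q \<Longrightarrow> w q \<le> - \<epsilon>" by blast
        define h where "h = (\<lambda>q. w q + \<epsilon> * (gauss A z q - k))"
        have hx: "h xh = 0"
        proof -
          have "gauss A z xh = k" using zx(1) by (simp add: gauss_def k_def dist_norm norm_minus_commute dot_square_norm)
          then show ?thesis by (simp add: h_def xhT)
        qed
        have hs: "h q \<le> 0" if q: "q \<in> sphere xh \<tau>" for q
        proof (cases "q \<in> cball z R'")
          case True
          have "gauss A z q \<le> 1" using A(1) by (simp add: gauss_def)
          moreover have "k \<ge> 0" by (simp add: k_def)
          ultimately have "\<epsilon> * (gauss A z q - k) \<le> \<epsilon> * 1" using \<epsilon>(1) by (intro mult_left_mono) linarith+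
          then show ?thesis using \<epsilon>(2)[of q] q True by (simp add: h_def Q_def)
        next
          case False
          then have "gauss A z q \<le> k" unfolding k_def using A(1) R' by (intro gauss_le) (auto simp: dist_commute)
          then have "\<epsilon> * (gauss A z q - k) \<le> 0" using \<epsilon>(1) by (simp add: mult_le_0_iff)
          moreover have "w q \<le> 0" using q \<tau>(2) by (intro w0) auto
          ultimately show ?thesis by (simp add: h_def)
        qed
        have "continuous_on (cball xh \<tau>) h"
          unfolding h_def by (intro continuous_intros continuous_on_subset[OF contw \<tau>(2)])
        then obtain p0 where p0: "p0 \<in> cball xh \<tau>" "\<And>q. q \<in> cball xh \<tau> \<Longrightarrow> h q \<le> h p0"
          using continuous_attains_sup[OF compact_cball, of xh \<tau> h] \<tau>(1) by auto
        \<comment> \<open>A maximum point of value 0 might lie on the sphere; then xh, where h is 0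
          as well, takes its place. So p is always an interior maximum point.\<close>
        define p where "p = (if h p0 = 0 then xh else p0)"
        have hp0: "h p0 \<ge> 0" using p0(2)[of xh] hx \<tau>(1) by simp
        have p: "p \<in> ball xh \<tau>" "\<And>q. q \<in> cball xh \<tau> \<Longrightarrow> h q \<le> h p" "h p \<ge> 0"
        proof -
          show "p \<in> ball xh \<tau>"
          proof (cases "h p0 = 0")
            case False
            then have "p0 \<notin> sphere xh \<tau>" using hs[of p0] hp0 by auto
            then show ?thesis using False p0(1) by (auto simp: p_def)
          qed (use \<tau> in \<open>simp add: p_def\<close>)
          show "h q \<le> h p" if "q \<in> cball xh \<tau>" for q using p0(2)[OF that] hx by (simp add: p_def)
          show "h p \<ge> 0" using hp0 hx by (simp add: p_def)
        qed
        have p\<Omega>: "p \<in> \<Omega>" using p(1) \<tau>(2) by auto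
        have pd: "R' / 2 \<le> dist p z" "dist p z \<le> 2 * R'"
          using dist_triangle[of xh z p] dist_triangle[of p z xh] p(1) zx(1) \<tau>(3) R' by (auto simp: dist_commute)
        show False
        proof (rule no_touching_gauss_barrier[OF \<Omega>(1) sub super cont fg[OF p\<Omega>] A(2)[OF less_imp_le[OF \<epsilon>(1)] pd] _ p\<Omega>])
          have g: "gauss A z p > 0" by (rule gauss_pos)
          have "- w p \<le> \<epsilon> * (gauss A z p - k)" using p(3) by (simp add: h_def)
          also have "\<dots> \<le> \<epsilon> * gauss A z p" using \<epsilon>(1) by (intro mult_left_mono) (auto simp: k_def)
          finally have "\<bar>w p\<bar> \<le> \<epsilon> * gauss A z p" using w0[OF p\<Omega>] by simp
          then have "\<delta>\<^sub>0 * \<bar>w p\<bar> \<le> \<delta>\<^sub>0 * (\<epsilon> * gauss A z p)" using \<delta>\<^sub>0_nonneg by (rule mult_left_mono)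
          also have "\<dots> < \<epsilon> * gauss A z p * (\<delta>\<^sub>0 + 1)" using g \<epsilon>(1) by (simp add: algebra_simps)
          finally show "\<delta>\<^sub>0 * \<bar>u p - v p\<bar> < \<epsilon> * gauss A z p * (\<delta>\<^sub>0 + 1)" by (simp add: w_def)
          show "\<tau> - dist xh p > 0" using p(1) by simp
          fix q assume "q \<in> ball p (\<tau> - dist xh p)"
          then have "q \<in> cball xh \<tau>" using dist_triangle[of xh q p] by simp
          from p(2)[OF this] show "u q - v q + \<epsilon> * gauss A z q \<le> u p - v p + \<epsilon> * gauss A z p"
            by (simp add: h_def w_def algebra_simps)
        qed
      qed
      then show ?thesis using \<rho>(1) by blast
    qed
    then have "open T" by (simp add: open_contains_ball)
    moreover have "T \<subseteq> \<Omega>" by (auto simp: T_def)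
    ultimately show ?thesis using openin_open_eq[OF \<Omega>(1)] by blast
  qed
  then have "T = {} \<or> T = \<Omega>" using \<Omega>(2) closedT by (auto simp: connected_clopen)
  moreover have "x1 \<in> T" using x1 by (simp add: T_def w_def)
  ultimately have "x \<in> T" using x by auto
  then show ?thesis by (simp add: T_def w_def)
qed

end

section \<open>Comparison near the boundary\<close>

text \<open>Smoothness is given through partial derivatives, so x is reached from y by changing one
  coordinate at a time, with the mean value theorem on each edge. All intermediate points stay
  within |x - y| of y.\<close>

lemma partial_derivative_expansion:
  fixes h :: "real^'n \<Rightarrow> real"
  assumes der: "\<And>\<xi> i. norm (\<xi> - y) \<le> norm (x - y) \<Longrightarrow> ((\<lambda>t. h (\<xi> + t *\<^sub>R axis i 1)) has_real_derivative dh i \<xi>) (at 0)"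
    and close: "\<And>\<xi> i. norm (\<xi> - y) \<le> norm (x - y) \<Longrightarrow> \<bar>dh i \<xi> - G $ i\<bar> \<le> E"
  shows "\<bar>h x - h y - G \<bullet> (x - y)\<bar> \<le> real CARD('n) * E * norm (x - y)"
proof -
  define mix where "mix = (\<lambda>S. \<chi> i. if i \<in> S then x $ i else y $ i)"
  have "\<bar>h (mix S) - h y - (\<Sum>i\<in>S. G $ i * (x $ i - y $ i))\<bar> \<le> E * (\<Sum>i\<in>S. \<bar>x $ i - y $ i\<bar>)" if "finite S" for S
    using that
  proof (induction S rule: finite_induct)
    case empty
    have "mix {} = y" by (simp add: mix_def vec_eq_iff)
    then show ?case by simp
  next
    case (insert j S)
    define c where "c = x $ j - y $ j"
    define P where "P = (\<lambda>t. mix S + (t * c) *\<^sub>R axis j 1)"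
    have P0: "P 0 = mix S" by (simp add: P_def)
    have P1: "P 1 = mix (insert j S)"
      using insert.hyps(2) by (auto simp: P_def mix_def c_def vec_eq_iff axis_def)
    have near: "norm (P t - y) \<le> norm (x - y)" if "0 \<le> t" "t \<le> 1" for t
    proof (rule norm_le_componentwise_cart)
      fix i
      have "\<bar>t * c\<bar> \<le> \<bar>c\<bar>" using that by (simp add: abs_mult mult_left_le_one_le)
      then show "norm ((P t - y) $ i) \<le> norm ((x - y) $ i)"
        using insert.hyps(2) by (auto simp: P_def mix_def c_def axis_def)
    qed
    have d: "((\<lambda>t. h (P t)) has_real_derivative dh j (P t) * c) (at t)" if "0 \<le> t" "t \<le> 1" for t
    proof -
      have "((\<lambda>\<tau>. h (P t + \<tau> *\<^sub>R axis j 1)) has_real_derivative dh j (P t)) (at ((t - t) * c))"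
        using der[OF near[OF that], of j] by simp
      moreover have "((\<lambda>s. (s - t) * c) has_real_derivative c) (at t)" by (auto intro!: derivative_eq_intros)
      ultimately have "((\<lambda>s. h (P t + ((s - t) * c) *\<^sub>R axis j 1)) has_real_derivative dh j (P t) * c) (at t)"
        by (rule DERIV_chain2)
      moreover have "P t + ((s - t) * c) *\<^sub>R axis j 1 = P s" for s by (simp add: P_def algebra_simps)
      ultimately show ?thesis by simp
    qed
    obtain \<xi> where \<xi>: "0 < \<xi>" "\<xi> < 1" "h (P 1) - h (P 0) = (1 - 0) * (dh j (P \<xi>) * c)"
      using MVT2[of 0 1 "\<lambda>t. h (P t)" "\<lambda>t. dh j (P t) * c"] d by auto
    have "\<bar>(dh j (P \<xi>) - G $ j) * c\<bar> \<le> E * \<bar>c\<bar>"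
      using close[OF near[of \<xi>], of j] \<xi> by (simp add: abs_mult mult_right_mono)
    then have "\<bar>h (mix (insert j S)) - h (mix S) - G $ j * c\<bar> \<le> E * \<bar>c\<bar>"
      using \<xi>(3) by (simp add: P0 P1 left_diff_distrib)
    moreover have "h (mix (insert j S)) - h y - (\<Sum>i\<in>insert j S. G $ i * (x $ i - y $ i))
      = (h (mix (insert j S)) - h (mix S) - G $ j * c) + (h (mix S) - h y - (\<Sum>i\<in>S. G $ i * (x $ i - y $ i)))"
      using insert.hyps by (simp add: c_def)
    moreover have "E * (\<Sum>i\<in>insert j S. \<bar>x $ i - y $ i\<bar>) = E * \<bar>c\<bar> + E * (\<Sum>i\<in>S. \<bar>x $ i - y $ i\<bar>)"
      using insert.hyps by (simp add: c_def distrib_left)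
    ultimately show ?case using insert.IH by linarith
  qed
  from this[of UNIV] have "\<bar>h (mix UNIV) - h y - (\<Sum>i\<in>UNIV. G $ i * (x $ i - y $ i))\<bar> \<le> E * (\<Sum>i\<in>UNIV. \<bar>x $ i - y $ i\<bar>)" by simp
  moreover have "mix UNIV = x" by (simp add: mix_def vec_eq_iff)
  moreover have "G \<bullet> (x - y) = (\<Sum>i\<in>UNIV. G $ i * (x $ i - y $ i))" by (simp add: inner_vec_def)
  moreover have "E * (\<Sum>i\<in>UNIV. \<bar>x $ i - y $ i\<bar>) \<le> E * (real CARD('n) * norm (x - y))"
  proof (rule mult_left_mono)
    have "\<bar>x $ i - y $ i\<bar> \<le> norm (x - y)" for i using component_le_norm_cart[of "x - y" i] by simp
    then have "(\<Sum>i\<in>UNIV. \<bar>x $ i - y $ i\<bar>) \<le> (\<Sum>i\<in>(UNIV::'n set). norm (x - y))" by (intro sum_mono)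
    then show "(\<Sum>i\<in>UNIV. \<bar>x $ i - y $ i\<bar>) \<le> real CARD('n) * norm (x - y)" by simp
    show "0 \<le> E" using close[of y undefined] abs_ge_zero[of "dh undefined y - G $ undefined"] by (simp del: abs_ge_zero)
  qed
  ultimately show ?thesis by (simp add: mult_ac)
qed

text \<open>Bounded second derivatives give \<rho> x \<ge> \<rho> y + G . (x - y) - C |x - y|^2 near
  x0, with |G| bounded below. At a frontier point y, where \<rho> y \<ge> 0, the right side is
  positive on the open ball tangent at y with centre in the direction of G, as long as its radius is
  at most |G|/(2 C).\<close>

lemma local_exterior_ball:
  fixes \<Omega> :: "(real^'n) set"
  assumes \<Omega>: "open \<Omega>" and r: "r > 0" and smooth: "smooth_on \<rho> (ball x0 r)"
    and nd: "d \<noteq> 0" "((\<lambda>t. \<rho> (x0 + t *\<^sub>R axis i 1)) has_real_derivative d) (at 0)"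
    and eq: "\<Omega> \<inter> ball x0 r = {x \<in> ball x0 r. \<rho> x < 0}"
  obtains t s0 where "t > 0" "s0 > 0"
    "\<And>y s. \<lbrakk>y \<in> frontier \<Omega>; dist x0 y < t; 0 < s; s \<le> s0\<rbrakk> \<Longrightarrow> \<exists>z. dist y z \<le> s \<and> ball z s \<inter> \<Omega> = {}"
proof -
  have mem: "x \<in> \<Omega> \<longleftrightarrow> \<rho> x < 0" if "x \<in> ball x0 r" for x
    using eq that by blast
  define n where "n = real CARD('n)"
  have n1: "n \<ge> 1" by (simp add: n_def Suc_leI)
  obtain \<F> where \<F>: "\<rho> \<in> \<F>" "\<And>h. h \<in> \<F> \<Longrightarrow> continuous_on (ball x0 r) h"
    "\<And>h i. h \<in> \<F> \<Longrightarrow> \<exists>h'\<in>\<F>. \<forall>x\<in>ball x0 r. ((\<lambda>t. h (x + t *\<^sub>R axis i 1)) has_real_derivative h' x) (at 0)"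
    using smooth unfolding smooth_on_def by blast
  have "\<forall>h i. \<exists>h'. h \<in> \<F> \<longrightarrow> h' \<in> \<F> \<and> (\<forall>x\<in>ball x0 r. ((\<lambda>t. h (x + t *\<^sub>R axis i 1)) has_real_derivative h' x) (at 0))"
    using \<F>(3) by blast
  then obtain D where D: "\<And>h i. h \<in> \<F> \<Longrightarrow> D h i \<in> \<F>"
    "\<And>h i x. h \<in> \<F> \<Longrightarrow> x \<in> ball x0 r \<Longrightarrow> ((\<lambda>t. h (x + t *\<^sub>R axis i 1)) has_real_derivative D h i x) (at 0)"
    by metis
  define g where "g = (\<lambda>i. D \<rho> i)"
  define gg where "gg = (\<lambda>i j. D (g i) j)"
  have g\<F>: "g i \<in> \<F>" for i unfolding g_def by (intro D \<F>)
  have gg\<F>: "gg i j \<in> \<F>" for i j unfolding gg_def by (intro D g\<F>)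
  define R where "R = r / 2"
  have R: "R > 0" "cball x0 R \<subseteq> ball x0 r" using r by (auto simp: R_def)
  have "\<exists>M>0. \<forall>x\<in>cball x0 R. \<bar>gg i j x\<bar> \<le> M" for i j
    using continuous_on_compact_bound[OF continuous_on_subset[OF \<F>(2)[OF gg\<F>] R(2)] compact_cball] by (metis real_norm_def)
  then obtain MM where MM: "\<And>i j. MM i j > 0" "\<And>i j x. x \<in> cball x0 R \<Longrightarrow> \<bar>gg i j x\<bar> \<le> MM i j" by metis
  define M where "M = (\<Sum>i\<in>UNIV. \<Sum>j\<in>UNIV. MM i j)"
  have M: "\<bar>gg i j x\<bar> \<le> M" if "x \<in> cball x0 R" for i j x
  proof -
    have "MM i j \<le> (\<Sum>j\<in>UNIV. MM i j)" using MM(1) by (intro member_le_sum) (auto intro: less_imp_le)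
    also have "\<dots> \<le> M" unfolding M_def using MM(1) by (intro member_le_sum) (auto intro!: sum_nonneg intro: less_imp_le)
    finally show ?thesis using MM(2)[OF that, of i j] by linarith
  qed
  have M0: "M \<ge> 0" using M[of x0] R(1) by (meson abs_ge_zero centre_in_cball less_imp_le order.trans)
  \<comment> \<open>Paths that change one coordinate at a time stay within |x - y| of y, so each of
    the two expansions below shrinks the radius by the factor 3.\<close>
  have inball: "norm (\<xi> - x0) < b" if "dist x0 x < b/3" "dist x0 y < b/3" "norm (\<xi> - y) \<le> norm (x - y)" for \<xi> x y :: "real^'n" and b
  proof -
    have "norm (x - y) \<le> dist x0 x + dist x0 y" using dist_triangle[of x y x0] by (simp add: dist_norm norm_minus_commute)
    moreover have "norm (\<xi> - x0) \<le> norm (\<xi> - y) + dist x0 y" using norm_triangle_ineq[of "\<xi> - y" "y - x0"] by (simp add: dist_norm norm_minus_commute)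
    ultimately show ?thesis using that by linarith
  qed
  define R1 where "R1 = R / 3"
  have glip: "\<bar>g i x - g i y\<bar> \<le> n * M * norm (x - y)" if "dist x0 x < R1" "dist x0 y < R1" for i x y
  proof -
    have near: "\<xi> \<in> cball x0 R" if "norm (\<xi> - y) \<le> norm (x - y)" for \<xi>
      using inball[of x R y \<xi>] that \<open>dist x0 x < R1\<close> \<open>dist x0 y < R1\<close> by (simp add: R1_def dist_norm norm_minus_commute)
    have "\<bar>g i x - g i y - 0 \<bullet> (x - y)\<bar> \<le> n * M * norm (x - y)"
      unfolding n_def
    proof (rule partial_derivative_expansion[where dh = "gg i"])
      fix \<xi> j assume "norm (\<xi> - y) \<le> norm (x - y)"
      then have \<xi>: "\<xi> \<in> cball x0 R" by (rule near)
      then show "((\<lambda>t. g i (\<xi> + t *\<^sub>R axis j 1)) has_real_derivative gg i j \<xi>) (at 0)"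
        unfolding gg_def using R(2) by (intro D(2) g\<F>) auto
      show "\<bar>gg i j \<xi> - 0 $ j\<bar> \<le> M" using M[OF \<xi>] by simp
    qed
    then show ?thesis by simp
  qed
  define R2 where "R2 = R1 / 3"
  define C where "C = n * (n * M) + 1"
  have C: "C > 0" using n1 M0 by (simp add: C_def add_nonneg_pos)
  have taylor: "\<rho> x \<ge> \<rho> y + (\<chi> i. g i y) \<bullet> (x - y) - C * (norm (x - y))\<^sup>2" if "dist x0 x < R2" "dist x0 y < R2" for x y
  proof -
    have near: "dist x0 \<xi> < R1" if "norm (\<xi> - y) \<le> norm (x - y)" for \<xi>
      using inball[of x R1 y \<xi>] that \<open>dist x0 x < R2\<close> \<open>dist x0 y < R2\<close> by (simp add: R2_def dist_norm norm_minus_commute)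
    have yR1: "dist x0 y < R1" using near[of y] by simp
    have "\<bar>\<rho> x - \<rho> y - (\<chi> i. g i y) \<bullet> (x - y)\<bar> \<le> n * (n * M * norm (x - y)) * norm (x - y)"
      unfolding n_def
    proof (rule partial_derivative_expansion[where dh = g])
      fix \<xi> i assume a: "norm (\<xi> - y) \<le> norm (x - y)"
      then have \<xi>: "dist x0 \<xi> < R1" by (rule near)
      then have "\<xi> \<in> ball x0 r" using r by (simp add: R1_def R_def)
      then show "((\<lambda>t. \<rho> (\<xi> + t *\<^sub>R axis i 1)) has_real_derivative g i \<xi>) (at 0)"
        unfolding g_def by (intro D(2) \<F>(1))
      have "\<bar>g i \<xi> - g i y\<bar> \<le> n * M * norm (\<xi> - y)" by (rule glip[OF \<xi> yR1])
      also have "\<dots> \<le> n * M * norm (x - y)" using a n1 M0 by (intro mult_left_mono) auto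
      finally show "\<bar>g i \<xi> - (\<chi> i. g i y) $ i\<bar> \<le> real CARD('n) * M * norm (x - y)" by (simp add: n_def)
    qed
    also have "\<dots> \<le> C * (norm (x - y))\<^sup>2" by (simp add: C_def power2_eq_square algebra_simps)
    finally show ?thesis by linarith
  qed
  have "g i x0 = d"
    unfolding g_def by (rule DERIV_unique[OF D(2)[OF \<F>(1)] nd(2)]) (use r in simp)
  define c where "c = \<bar>d\<bar> / 2"
  have c: "c > 0" using nd(1) by (simp add: c_def)
  have "continuous_on (ball x0 r) (g i)" by (rule \<F>(2)[OF g\<F>])
  then have "isCont (g i) x0" using r by (simp add: continuous_on_eq_continuous_at)
  then obtain R3 where R3: "R3 > 0" "\<And>y. dist x0 y < R3 \<Longrightarrow> \<bar>g i y - g i x0\<bar> < c"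
    using c unfolding continuous_at_eps_delta by (metis dist_commute dist_real_def)
  define R4 where "R4 = min R2 R3"
  have R4: "R4 > 0" "R4 \<le> R2" "R4 \<le> R3" "R4 < r" using R3(1) R(1) r by (auto simp: R4_def R2_def R1_def R_def min_def)
  \<comment> \<open>R4/4 keeps the whole ball in the range of the Taylor bound; c/(2 C) makes the
    quadratic term smaller than the linear one.\<close>
  define s0 where "s0 = min (R4 / 4) (c / (2 * C))"
  have s0: "s0 > 0" "s0 \<le> R4 / 4" "s0 \<le> c / (2 * C)" using R4(1) c C by (auto simp: s0_def)
  show ?thesis
  proof (rule that[of "R4 / 2" s0])
    fix y s assume y: "y \<in> frontier \<Omega>" "dist x0 y < R4 / 2" and s: "0 < s" "s \<le> s0"
    define G where "G = (\<chi> i. g i y)"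
    have "\<bar>g i y\<bar> \<ge> c"
      using R3(2)[of y] y(2) R4 \<open>g i x0 = d\<close> unfolding c_def by (simp add: abs_if split: if_splits)
    then have nG: "norm G \<ge> c" using component_le_norm_cart[of G i] by (simp add: G_def)
    then have G0: "norm G > 0" using c by linarith
    define z where "z = y + (s / norm G) *\<^sub>R G"
    have "y \<notin> \<Omega>" using y(1) \<Omega> by (simp add: frontier_def interior_open)
    moreover have "y \<in> ball x0 r" using y(2) R4 by simp
    ultimately have \<rho>y: "\<rho> y \<ge> 0" using mem[of y] by linarith
    have "x \<notin> \<Omega>" if x: "x \<in> ball z s" for x
    proof -
      define e where "e = x - y"
      have zy: "z - y = (s / norm G) *\<^sub>R G" by (simp add: z_def)
      have nzy: "norm (z - y) = s" unfolding zy using s(1) G0 by simp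
      have "norm (x - z) < s" using x by (simp add: dist_norm norm_minus_commute)
      then have "norm (e - (z - y)) < s" by (simp add: e_def)
      then have "(norm (e - (z - y)))\<^sup>2 < s\<^sup>2" by (intro power_strict_mono) auto
      moreover have "(norm (e - (z - y)))\<^sup>2 = (norm e)\<^sup>2 - 2 * (e \<bullet> (z - y)) + (norm (z - y))\<^sup>2"
        by (simp add: power2_norm_eq_inner inner_diff_left inner_diff_right inner_commute)
      \<comment> \<open>Membership in the tangent ball, rewritten. It shows that G . e is positive
        and that it dominates C |e|^2.\<close>
      ultimately have lt: "(norm e)\<^sup>2 < 2 * (s / norm G) * (G \<bullet> e)"
        unfolding nzy by (simp add: zy inner_commute)
      have "norm e < 2 * s"
        using norm_triangle_ineq[of "e - (z - y)" "z - y"] \<open>norm (e - (z - y)) < s\<close> nzy by simp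
      then have "norm e < R4 / 2" using s(2) s0(2) by linarith
      then have dx: "dist x0 x < R4" using dist_triangle[of x0 x y] y(2) by (simp add: e_def dist_norm norm_minus_commute)
      have "C * (norm e)\<^sup>2 \<le> C * (2 * (s / norm G) * (G \<bullet> e))" using lt C by (intro mult_left_mono) auto
      have Ge: "G \<bullet> e > 0"
      proof -
        have "0 < 2 * (s / norm G) * (G \<bullet> e)" using lt zero_le_power2[of "norm e"] by linarith
        then show ?thesis using s(1) G0 by (simp add: zero_less_mult_iff zero_less_divide_iff)
      qed
      have "C * (2 * (s / norm G)) \<le> 1"
      proof -
        have "s * (2 * C) \<le> s0 * (2 * C)" using s(2) C by (intro mult_right_mono) auto
        also have "\<dots> \<le> c" using s0(3) C by (simp add: le_divide_eq)
        finally have "s * (2 * C) \<le> c" .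
        then show ?thesis using nG G0 by (simp add: divide_le_eq mult_ac)
      qed
      then have "C * (2 * (s / norm G)) * (G \<bullet> e) \<le> 1 * (G \<bullet> e)" using Ge by (intro mult_right_mono) auto
      moreover have "C * (norm e)\<^sup>2 < C * (2 * (s / norm G) * (G \<bullet> e))" using lt C by (intro mult_strict_left_mono) auto
      ultimately have "C * (norm e)\<^sup>2 < G \<bullet> e" by (simp add: mult.assoc)
      moreover have "\<rho> x \<ge> \<rho> y + G \<bullet> e - C * (norm e)\<^sup>2"
        unfolding G_def e_def using dx y(2) R4 by (intro taylor) auto
      ultimately have "\<rho> x > 0" using \<rho>y by linarith
      moreover have "x \<in> ball x0 r" using dx R4 by simp
      ultimately show ?thesis using mem[of x] by linarith
    qed
    moreover have "dist y z \<le> s" using s(1) G0 by (simp add: z_def dist_norm)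
    ultimately show "\<exists>z. dist y z \<le> s \<and> ball z s \<inter> \<Omega> = {}" by blast
  qed (use R4 s0 in auto)
qed

lemma smooth_domain_exterior_ball:
  fixes \<Omega> :: "(real^'n) set"
  assumes dom: "smooth_domain \<Omega>" and bd: "bounded \<Omega>"
  obtains s where "s > 0" "\<And>y. y \<in> frontier \<Omega> \<Longrightarrow> \<exists>z. dist y z \<le> s \<and> ball z s \<inter> \<Omega> = {}"
proof -
  have op: "open \<Omega>" using dom by (simp add: smooth_domain_def)
  have "\<exists>t s0. t > 0 \<and> s0 > 0 \<and> (\<forall>y s. y \<in> frontier \<Omega> \<longrightarrow> dist x0 y < t \<longrightarrow> 0 < s \<longrightarrow> s \<le> s0 \<longrightarrow> (\<exists>z. dist y z \<le> s \<and> ball z s \<inter> \<Omega> = {}))"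
    if x0: "x0 \<in> frontier \<Omega>" for x0
  proof -
    obtain r \<rho> i d where "r > 0" "smooth_on \<rho> (ball x0 r)" "d \<noteq> 0"
      "((\<lambda>t. \<rho> (x0 + t *\<^sub>R axis i 1)) has_real_derivative d) (at 0)"
      "\<Omega> \<inter> ball x0 r = {x \<in> ball x0 r. \<rho> x < 0}"
      using dom x0 unfolding smooth_domain_def by blast
    from local_exterior_ball[OF op this] show ?thesis by metis
  qed
  then obtain t s0 where ts: "\<And>x0. x0 \<in> frontier \<Omega> \<Longrightarrow> t x0 > 0" "\<And>x0. x0 \<in> frontier \<Omega> \<Longrightarrow> s0 x0 > 0"
    "\<And>x0 y s. x0 \<in> frontier \<Omega> \<Longrightarrow> y \<in> frontier \<Omega> \<Longrightarrow> dist x0 y < t x0 \<Longrightarrow> 0 < s \<Longrightarrow> s \<le> s0 x0 \<Longrightarrow> \<exists>z. dist y z \<le> s \<and> ball z s \<inter> \<Omega> = {}"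
    by metis
  have "compact (frontier \<Omega>)" using bd by (rule compact_frontier_bounded)
  then obtain X where X: "X \<subseteq> frontier \<Omega>" "finite X" "frontier \<Omega> \<subseteq> (\<Union>x\<in>X. ball x (t x))"
    using ts(1) by (elim compactE_image[where C = "frontier \<Omega>" and f = "\<lambda>x. ball x (t x)"]) auto
  \<comment> \<open>The 1 covers the case of an empty X.\<close>
  define s where "s = Min (insert 1 (s0 ` X))"
  have s: "s > 0" "\<And>x. x \<in> X \<Longrightarrow> s \<le> s0 x"
    using X(1,2) ts(2) by (auto simp: s_def)
  show ?thesis
  proof (rule that[OF s(1)])
    fix y assume y: "y \<in> frontier \<Omega>"
    then obtain x where "x \<in> X" "dist x y < t x" using X(3) by auto
    then show "\<exists>z. dist y z \<le> s \<and> ball z s \<inter> \<Omega> = {}" using ts(3)[OF _ y _ s(1) s(2)] X(1) by blast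
  qed
qed

section \<open>Comparison in a boundary layer\<close>

context elliptic_operator
begin

text \<open>The functions are quantified inside, so that a single K can serve u together with every
  multiple of v.\<close>

definition comparison_set :: "(real^'n) set \<Rightarrow> bool" where
  "comparison_set K \<longleftrightarrow> (\<forall>u v f g. visc_sub F f u \<Omega> \<longrightarrow> visc_super F g v \<Omega> \<longrightarrow>
     continuous_on (closure \<Omega>) u \<longrightarrow> continuous_on (closure \<Omega>) v \<longrightarrow> continuous_on \<Omega> f \<longrightarrow> continuous_on \<Omega> g \<longrightarrow>
     (\<forall>x\<in>\<Omega>. f x \<le> g x) \<longrightarrow> (\<forall>x\<in>K \<union> frontier \<Omega>. u x \<le> v x) \<longrightarrow> (\<forall>x\<in>\<Omega>. u x \<le> v x))"

lemma comparison_setD: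
  assumes "comparison_set K" "visc_sub F f u \<Omega>" "visc_super F g v \<Omega>"
    "continuous_on (closure \<Omega>) u" "continuous_on (closure \<Omega>) v" "continuous_on \<Omega> f" "continuous_on \<Omega> g"
    "\<And>x. x \<in> \<Omega> \<Longrightarrow> f x \<le> g x" "\<And>x. x \<in> K \<Longrightarrow> u x \<le> v x" "\<And>x. x \<in> frontier \<Omega> \<Longrightarrow> u x \<le> v x" "x \<in> \<Omega>"
  shows "u x \<le> v x"
  using assms unfolding comparison_set_def by blast

text \<open>The barrier \<open>H\<close> of an exterior ball is at least 1 on the whole closure and
  at most 2 close to the ball. The quotient (u - v)/H is maximized over the points and over all
  exterior centres at once. Optimality in the centre brings it so near to the maximum point that
  this point lies in the annulus where the barrier inequality holds.\<close>

lemma comparison_near_boundary: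
  assumes \<Omega>: "open \<Omega>" "bounded \<Omega>" "\<Omega> \<noteq> {}" and r0: "r0 > 0"
    and ext: "\<And>y. y \<in> frontier \<Omega> \<Longrightarrow> \<exists>z. dist y z \<le> r0 \<and> ball z r0 \<inter> \<Omega> = {}"
  obtains K where "compact K" "K \<subseteq> \<Omega>" "comparison_set K"
proof -
  obtain A where A: "A > 0"
    "\<And>c z x. \<lbrakk>c \<ge> 0; r0 \<le> dist x z; dist x z \<le> 2 * r0\<rbrakk> \<Longrightarrow>
       pucci_minus \<gamma> \<Gamma> (- c *\<^sub>R gauss_hessian A z x) - \<delta>\<^sub>1 * norm (- c *\<^sub>R (- 2 * A * gauss A z x) *\<^sub>R (x - z)) \<ge> c * gauss A z (x::real^'n) * (\<delta>\<^sub>0 + 1)"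
    using gauss_barrier_parameter[OF r0, of "2 * r0"] by metis
  \<comment> \<open>Makes B times the Gaussian at least 2 on the annulus, so that the gain of the
    barrier exceeds \<open>\<delta>\<^sub>0\<close> times H, where H \<le> 2.\<close>
  define B where "B = 2 / exp (- A * (2 * r0)\<^sup>2)"
  have B: "B > 0" by (simp add: B_def)
  define H where "H = (\<lambda>x z. 1 + B * (exp (- A * r0\<^sup>2) - gauss A z (x::real^'n)))"
  \<comment> \<open>Looks for the width \<eta> of the layer: within distance r0 + \<eta> of the
    centre H is at most 2, and r0 + \<eta> \<le> 2 r0.\<close>
  have "((\<lambda>\<eta>. B * (exp (- A * r0\<^sup>2) - exp (- A * (r0 + \<eta>)\<^sup>2))) \<longlongrightarrow> B * (exp (- A * r0\<^sup>2) - exp (- A * (r0 + 0)\<^sup>2))) (at_right 0)"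
    by (intro tendsto_intros)
  then have "\<forall>\<^sub>F \<eta> in at_right 0. B * (exp (- A * r0\<^sup>2) - exp (- A * (r0 + \<eta>)\<^sup>2)) < 1"
    by (intro order_tendstoD(2)) auto
  moreover have "\<forall>\<^sub>F \<eta> in at_right 0. \<eta> < r0" using r0 eventually_at_right_field by blast
  moreover have "\<forall>\<^sub>F \<eta> in at_right 0. (0::real) < \<eta>" by (simp add: eventually_at_filter)
  ultimately have "\<forall>\<^sub>F \<eta> in at_right 0. B * (exp (- A * r0\<^sup>2) - exp (- A * (r0 + \<eta>)\<^sup>2)) < 1 \<and> \<eta> < r0 \<and> 0 < \<eta>"
    by eventually_elim simp
  then obtain \<eta> where \<eta>: "B * (exp (- A * r0\<^sup>2) - exp (- A * (r0 + \<eta>)\<^sup>2)) < 1" "\<eta> < r0" "0 < \<eta>"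
    using eventually_happens trivial_limit_at_right_real by blast
  define K where "K = {x \<in> closure \<Omega>. infdist x (frontier \<Omega>) \<ge> \<eta>}"
  have fr0: "frontier \<Omega> \<noteq> {}"
    using \<Omega>(2,3) by (metis frontier_eq_empty not_bounded_UNIV)
  have ccl: "compact (closure \<Omega>)" using \<Omega>(2) by simp
  have clo: "closure \<Omega> = \<Omega> \<union> frontier \<Omega>" using closure_Un_frontier by blast
  have K\<Omega>: "K \<subseteq> \<Omega>"
  proof
    fix x assume "x \<in> K"
    then have "x \<in> closure \<Omega>" "x \<notin> frontier \<Omega>" using \<eta>(3) by (auto simp: K_def)
    then show "x \<in> \<Omega>" using clo by blast
  qed
  have cK: "compact K"
  proof -
    have "K = closure \<Omega> \<inter> {x. infdist x (frontier \<Omega>) \<ge> \<eta>}" by (auto simp: K_def)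
    moreover have "closed {x. infdist x (frontier \<Omega>) \<ge> \<eta>}" by (intro closed_Collect_le continuous_intros)
    ultimately show ?thesis using ccl by (simp add: compact_Int_closed)
  qed
  have cmp: "u x \<le> v x" if sub: "visc_sub F f u \<Omega>" and super: "visc_super F g v \<Omega>"
    and cu: "continuous_on (closure \<Omega>) u" and cv: "continuous_on (closure \<Omega>) v" and cf: "continuous_on \<Omega> f" and cg: "continuous_on \<Omega> g"
    and fg: "\<And>x. x \<in> \<Omega> \<Longrightarrow> f x \<le> g x" and uvK: "\<And>x. x \<in> K \<Longrightarrow> u x \<le> v x" and uvf: "\<And>x. x \<in> frontier \<Omega> \<Longrightarrow> u x \<le> v x"
    and x: "x \<in> \<Omega>" for u v f g x
  proof (rule ccontr)
    assume "\<not> u x \<le> v x"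
    then have pos: "u x - v x > 0" by simp
    have cu': "continuous_on \<Omega> u" and cv': "continuous_on \<Omega> v"
      using cu cv closure_subset continuous_on_subset by blast+
    obtain M where M: "\<And>x. x \<in> closure \<Omega> \<Longrightarrow> norm x \<le> M"
      using compact_imp_bounded[OF ccl] unfolding bounded_iff by blast
    \<comment> \<open>The admissible centres: at distance at least r0 from \<Omega>, in a ball large
      enough to contain a suitable centre for each frontier point. Compactness allows the maximum to
      be taken over centres too.\<close>
    define Zs where "Zs = cball 0 (M + r0) \<inter> {z. \<forall>x\<in>\<Omega>. r0 \<le> dist x z}"
    have "closed {z. \<forall>x\<in>\<Omega>. r0 \<le> dist x z}"
    proof -
      have "{z. \<forall>x\<in>\<Omega>. r0 \<le> dist x z} = (\<Inter>x\<in>\<Omega>. {z. r0 \<le> dist x z})" by auto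
      moreover have "closed (\<Inter>x\<in>\<Omega>. {z. r0 \<le> dist x z})" by (intro closed_INT ballI closed_Collect_le continuous_intros)
      ultimately show ?thesis by simp
    qed
    then have cZ: "compact Zs" unfolding Zs_def by (intro compact_Int_closed compact_cball)
    have extZ: "\<exists>z\<in>Zs. dist y z \<le> r0" if y: "y \<in> frontier \<Omega>" for y
    proof -
      obtain z where z: "dist y z \<le> r0" "ball z r0 \<inter> \<Omega> = {}" using ext[OF y] by blast
      have "norm z \<le> norm y + dist y z" using norm_triangle_ineq[of y "z - y"] by (simp add: dist_norm norm_minus_commute)
      then have "norm z \<le> M + r0" using z(1) M[of y] y clo by auto
      moreover have "r0 \<le> dist x z" if "x \<in> \<Omega>" for x
      proof (rule ccontr)
        assume "\<not> r0 \<le> dist x z"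
        then have "x \<in> ball z r0" by (simp add: dist_commute)
        then show False using z(2) that by blast
      qed
      ultimately show ?thesis using z(1) by (auto simp: Zs_def)
    qed
    have Zne: "Zs \<noteq> {}" using extZ fr0 by blast
    have dZ: "r0 \<le> dist x z" if "z \<in> Zs" "x \<in> closure \<Omega>" for x z
    proof -
      have "closure \<Omega> \<subseteq> {x. r0 \<le> dist x z}"
        using that(1) by (intro closure_minimal closed_Collect_le continuous_intros) (auto simp: Zs_def)
      then show ?thesis using that(2) by blast
    qed
    have H1: "H x z \<ge> 1" if "z \<in> Zs" "x \<in> closure \<Omega>" for x z
    proof -
      have "gauss A z x \<le> exp (- A * r0\<^sup>2)" using A(1) r0 dZ[OF that] by (intro gauss_le) auto
      then show ?thesis using B by (simp add: H_def)
    qed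
    define q where "q = (\<lambda>y. (u (fst y) - v (fst y)) / H (fst y) (snd y))"
    have contq: "continuous_on (closure \<Omega> \<times> Zs) q"
      unfolding q_def H_def
    proof (intro continuous_intros continuous_on_compose2[OF cu] continuous_on_compose2[OF cv])
      show "\<forall>y\<in>closure \<Omega> \<times> Zs. 1 + B * (exp (- A * r0\<^sup>2) - gauss A (snd y) (fst y)) \<noteq> 0"
        using H1 unfolding H_def by force
    qed auto
    have "closure \<Omega> \<times> Zs \<noteq> {}" using Zne \<Omega>(3) by auto
    then obtain y where y: "y \<in> closure \<Omega> \<times> Zs" "\<And>y'. y' \<in> closure \<Omega> \<times> Zs \<Longrightarrow> q y' \<le> q y"
      using continuous_attains_sup[OF compact_Times[OF ccl cZ] _ contq] by blast
    define a where "a = fst y"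
    define z where "z = snd y"
    have az: "a \<in> closure \<Omega>" "z \<in> Zs" using y(1) by (auto simp: a_def z_def)
    define c where "c = q y"
    have qle: "(u x - v x) / H x z' \<le> c" if "x \<in> closure \<Omega>" "z' \<in> Zs" for x z'
      using y(2)[of "(x, z')"] that by (simp add: q_def c_def)
    have qeq: "u a - v a = c * H a z"
      using H1[OF az(2,1)] by (simp add: c_def q_def a_def z_def)
    have c: "c > 0"
    proof -
      have xcl: "x \<in> closure \<Omega>" using x clo by blast
      have "0 < (u x - v x) / H x z" using pos H1[OF az(2) xcl] by (intro divide_pos_pos) auto
      then show ?thesis using qle[OF xcl az(2)] by linarith
    qed
    have wa: "u a - v a > 0" unfolding qeq using c H1[OF az(2,1)] by (intro mult_pos_pos) auto
    then have a\<Omega>: "a \<in> \<Omega>" and aK: "a \<notin> K" using uvf[of a] uvK[of a] az(1) clo by force+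
    have "infdist a (frontier \<Omega>) < \<eta>" using aK az(1) by (auto simp: K_def)
    then obtain b where b: "b \<in> frontier \<Omega>" "dist a b < \<eta>"
      using fr0 by (auto simp: infdist_def cINF_less_iff split: if_splits)
    obtain z' where z': "z' \<in> Zs" "dist b z' \<le> r0" using extZ[OF b(1)] by blast
    \<comment> \<open>H increases with the distance to the centre and u - v is positive at a, so a
      maximum of the quotient selects an admissible centre nearest to a.\<close>
    have "dist a z \<le> dist a z'"
    proof -
      have "c * H a z / H a z' \<le> c" using qle[OF az(1) z'(1)] unfolding qeq .
      then have "c * H a z \<le> c * H a z'" using H1[OF z'(1) az(1)] by (simp add: divide_le_eq)
      then have "H a z \<le> H a z'" using c by simp
      then have "gauss A z' a \<le> gauss A z a" using B by (simp add: H_def)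
      then have "(dist a z)\<^sup>2 \<le> (dist a z')\<^sup>2" using A(1) by (simp add: gauss_def dist_norm dot_square_norm)
      then show ?thesis using zero_le_dist power2_le_imp_le by blast
    qed
    also have "\<dots> \<le> dist a b + dist b z'" by (rule dist_triangle)
    finally have daz: "dist a z \<le> r0 + \<eta>" using b(2) z'(2) by linarith
    have daz': "r0 \<le> dist a z" "dist a z \<le> 2 * r0" using dZ[OF az(2,1)] daz \<eta>(2) by auto
    have "H a z \<le> 2"
    proof -
      have "exp (- A * (r0 + \<eta>)\<^sup>2) \<le> gauss A z a" using A(1) daz by (intro gauss_ge) auto
      then have "B * (exp (- A * r0\<^sup>2) - gauss A z a) \<le> B * (exp (- A * r0\<^sup>2) - exp (- A * (r0 + \<eta>)\<^sup>2))"
        using B by (intro mult_left_mono) auto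
      then show ?thesis using \<eta>(1) unfolding H_def by linarith
    qed
    have cB: "c * B \<ge> 0" using c B by simp
    show False
    proof (rule no_touching_gauss_barrier[OF \<Omega>(1) sub super cu' cv' cf cg fg[OF a\<Omega>] A(2)[OF cB daz'] _ a\<Omega>])
      have "exp (- A * (2 * r0)\<^sup>2) \<le> gauss A z a" using A(1) daz' by (intro gauss_ge) auto
      then have "2 \<le> B * gauss A z a" unfolding B_def by (simp add: le_divide_eq)
      then have "(c * (\<delta>\<^sub>0 + 1)) * 2 \<le> (c * (\<delta>\<^sub>0 + 1)) * (B * gauss A z a)" using c \<delta>\<^sub>0_nonneg by (intro mult_left_mono) auto
      moreover have "\<delta>\<^sub>0 * (c * H a z) \<le> \<delta>\<^sub>0 * (c * 2)" using \<open>H a z \<le> 2\<close> c \<delta>\<^sub>0_nonneg by (intro mult_left_mono) auto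
      moreover have "\<bar>u a - v a\<bar> = c * H a z" using qeq wa by simp
      ultimately show "\<delta>\<^sub>0 * \<bar>u a - v a\<bar> < c * B * gauss A z a * (\<delta>\<^sub>0 + 1)"
        using c by (simp add: algebra_simps)
      show "(1::real) > 0" by simp
      fix y assume "y \<in> \<Omega>"
      then have ycl: "y \<in> closure \<Omega>" using clo by blast
      have "u y - v y \<le> c * H y z" using qle[OF ycl az(2)] H1[OF az(2) ycl] by (simp add: divide_le_eq)
      then show "u y - v y + c * B * gauss A z y \<le> u a - v a + c * B * gauss A z a"
        unfolding qeq H_def by (simp add: algebra_simps)
    qed
  qed
  show thesis
  proof (rule that[OF cK K\<Omega>])
    show "comparison_set K"
      unfolding comparison_set_def by (intro allI impI ballI, rule cmp) (assumption | rule bspec, assumption, blast)+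
  qed
qed

end

section \<open>Proportionality\<close>

lemma second_difference:
  fixes \<phi> :: "real^'n \<Rightarrow> real"
  assumes C2: "C2_with \<phi> D\<phi> D2\<phi> S" and t: "t > 0"
    and S: "\<And>s r. \<lbrakk>0 \<le> s; s \<le> t; 0 \<le> r; r \<le> t\<rbrakk> \<Longrightarrow> x + s *\<^sub>R a + r *\<^sub>R b \<in> S"
  obtains s r where "0 \<le> s" "s \<le> t" "0 \<le> r" "r \<le> t"
    "\<phi> (x + t *\<^sub>R a + t *\<^sub>R b) - \<phi> (x + t *\<^sub>R a) - \<phi> (x + t *\<^sub>R b) + \<phi> x = t * t * (a \<bullet> (D2\<phi> (x + s *\<^sub>R a + r *\<^sub>R b) *v b))"
proof -
  have d: "(\<phi> has_derivative (\<lambda>h. D\<phi> y \<bullet> h)) (at y)" "(D\<phi> has_derivative (\<lambda>h. D2\<phi> y *v h)) (at y)" if "y \<in> S" for y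
    using C2 that by (auto simp: C2_with_def)
  have d1: "((\<lambda>s. \<phi> (x + s *\<^sub>R a + r *\<^sub>R b)) has_real_derivative D\<phi> (x + s *\<^sub>R a + r *\<^sub>R b) \<bullet> a) (at s)"
    if "0 \<le> s" "s \<le> t" "0 \<le> r" "r \<le> t" for s r
  proof -
    have "((\<lambda>s. x + s *\<^sub>R a + r *\<^sub>R b) has_derivative (\<lambda>h. h *\<^sub>R a)) (at s)"
      by (auto intro!: derivative_eq_intros)
    from has_derivative_compose[OF this d(1)[OF S[OF that]]] show ?thesis
      by (simp add: has_field_derivative_def mult_commute_abs)
  qed
  have d2: "((\<lambda>r. D\<phi> (x + s *\<^sub>R a + r *\<^sub>R b) \<bullet> a) has_real_derivative a \<bullet> (D2\<phi> (x + s *\<^sub>R a + r *\<^sub>R b) *v b)) (at r)"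
    if "0 \<le> s" "s \<le> t" "0 \<le> r" "r \<le> t" for s r
  proof -
    have "((\<lambda>r. x + s *\<^sub>R a + r *\<^sub>R b) has_derivative (\<lambda>h. h *\<^sub>R b)) (at r)"
      by (auto intro!: derivative_eq_intros)
    from has_derivative_inner_left[OF has_derivative_compose[OF this d(2)[OF S[OF that]]], of a] show ?thesis
      by (simp add: has_field_derivative_def mult_commute_abs matrix_vector_mult_scaleR inner_commute)
  qed
  have d3: "((\<lambda>s. \<phi> (x + s *\<^sub>R a + t *\<^sub>R b) - \<phi> (x + s *\<^sub>R a + 0 *\<^sub>R b)) has_real_derivative
      D\<phi> (x + s *\<^sub>R a + t *\<^sub>R b) \<bullet> a - D\<phi> (x + s *\<^sub>R a + 0 *\<^sub>R b) \<bullet> a) (at s)" if "0 \<le> s" "s \<le> t" for s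
    using t that by (intro DERIV_diff d1) auto
  obtain s where s: "0 < s" "s < t" "(\<phi> (x + t *\<^sub>R a + t *\<^sub>R b) - \<phi> (x + t *\<^sub>R a + 0 *\<^sub>R b)) - (\<phi> (x + 0 *\<^sub>R a + t *\<^sub>R b) - \<phi> (x + 0 *\<^sub>R a + 0 *\<^sub>R b))
      = (t - 0) * (D\<phi> (x + s *\<^sub>R a + t *\<^sub>R b) \<bullet> a - D\<phi> (x + s *\<^sub>R a + 0 *\<^sub>R b) \<bullet> a)"
    using MVT2[OF t d3] by metis
  obtain r where r: "0 < r" "r < t" "D\<phi> (x + s *\<^sub>R a + t *\<^sub>R b) \<bullet> a - D\<phi> (x + s *\<^sub>R a + 0 *\<^sub>R b) \<bullet> a
      = (t - 0) * (a \<bullet> (D2\<phi> (x + s *\<^sub>R a + r *\<^sub>R b) *v b))"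
    using MVT2[OF t d2[OF less_imp_le[OF s(1)] less_imp_le[OF s(2)]]] by metis
  show ?thesis
  proof (rule that[of s r])
    have "\<phi> (x + t *\<^sub>R a + t *\<^sub>R b) - \<phi> (x + t *\<^sub>R a) - (\<phi> (x + t *\<^sub>R b) - \<phi> x) = t * (t * (a \<bullet> (D2\<phi> (x + s *\<^sub>R a + r *\<^sub>R b) *v b)))"
      using s(3) unfolding r(3) by simp
    then show "\<phi> (x + t *\<^sub>R a + t *\<^sub>R b) - \<phi> (x + t *\<^sub>R a) - \<phi> (x + t *\<^sub>R b) + \<phi> x = t * t * (a \<bullet> (D2\<phi> (x + s *\<^sub>R a + r *\<^sub>R b) *v b))"
      unfolding mult.assoc by linarith
  qed (use s r in auto)
qed

text \<open>\<open>C2_with\<close> does not include symmetry of the Hessian, while homogeneity and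
  ellipticity are stated for symmetric matrices. The second difference is symmetric in the two
  directions, and continuity of the Hessian permits the step to shrink to 0.\<close>

lemma C2_with_symmetric:
  fixes \<phi> :: "real^'n \<Rightarrow> real"
  assumes C2: "C2_with \<phi> D\<phi> D2\<phi> S" and S: "open S" "x \<in> S"
  shows "symmetric_mat (D2\<phi> x)"
proof (rule symmetric_matI)
  fix i j
  define a where "a = (axis i 1 :: real^'n)"
  define b where "b = (axis j 1 :: real^'n)"
  have n: "norm a = 1" "norm b = 1" by (simp_all add: a_def b_def)
  have "\<bar>D2\<phi> x $ i $ j - D2\<phi> x $ j $ i\<bar> \<le> e" if e: "e > 0" for e
  proof -
    have "isCont D2\<phi> x" using C2 S by (simp add: C2_with_def continuous_on_eq_continuous_at)
    then obtain d where d: "d > 0" "\<And>y. dist y x < d \<Longrightarrow> dist (D2\<phi> y) (D2\<phi> x) < e/2"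
      using e unfolding continuous_at_eps_delta by (metis half_gt_zero)
    obtain d' where d': "d' > 0" "ball x d' \<subseteq> S" using S openE by blast
    define t where "t = min d d' / 3"
    have t: "t > 0" "2 * t < min d d'" using d(1) d'(1) by (auto simp: t_def)
    have near: "dist (x + s *\<^sub>R a' + r *\<^sub>R b') x < min d d'"
      if "0 \<le> s" "s \<le> t" "0 \<le> r" "r \<le> t" "norm a' = 1" "norm b' = 1" for s r and a' b' :: "real^'n"
    proof -
      have "norm (s *\<^sub>R a' + r *\<^sub>R b') \<le> s + r" using norm_triangle_ineq[of "s *\<^sub>R a'" "r *\<^sub>R b'"] that by simp
      also have "\<dots> < min d d'" using that t by linarith
      finally show ?thesis by (simp add: dist_norm add.assoc)
    qed
    have inS: "x + s *\<^sub>R a' + r *\<^sub>R b' \<in> S"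
      if "0 \<le> s" "s \<le> t" "0 \<le> r" "r \<le> t" "norm a' = 1" "norm b' = 1" for s r and a' b' :: "real^'n"
      using near[OF that] d'(2) by (auto simp: dist_commute)
    have entry: "axis k 1 \<bullet> (M *v axis l 1) = M $ k $ l" for k l and M :: "real^'n^'n"
      by (simp add: inner_axis' matrix_vector_mult_basis column_def)
    have close: "\<bar>D2\<phi> y $ k $ l - D2\<phi> x $ k $ l\<bar> \<le> e/2" if "dist y x < min d d'" for y k l
    proof -
      have "\<bar>(D2\<phi> y - D2\<phi> x) $ k $ l\<bar> \<le> norm ((D2\<phi> y - D2\<phi> x) $ k)" by (rule component_le_norm_cart)
      also have "\<dots> \<le> norm (D2\<phi> y - D2\<phi> x)" by (rule Finite_Cartesian_Product.norm_nth_le)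
      finally show ?thesis using d(2)[of y] that by (simp add: dist_norm)
    qed
    obtain s r where 1: "0 \<le> s" "s \<le> t" "0 \<le> r" "r \<le> t"
      "\<phi> (x + t *\<^sub>R a + t *\<^sub>R b) - \<phi> (x + t *\<^sub>R a) - \<phi> (x + t *\<^sub>R b) + \<phi> x = t * t * (a \<bullet> (D2\<phi> (x + s *\<^sub>R a + r *\<^sub>R b) *v b))"
      by (rule second_difference[OF C2 t(1) inS[OF _ _ _ _ n]])
    obtain s' r' where 2: "0 \<le> s'" "s' \<le> t" "0 \<le> r'" "r' \<le> t"
      "\<phi> (x + t *\<^sub>R b + t *\<^sub>R a) - \<phi> (x + t *\<^sub>R b) - \<phi> (x + t *\<^sub>R a) + \<phi> x = t * t * (b \<bullet> (D2\<phi> (x + s' *\<^sub>R b + r' *\<^sub>R a) *v a))"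
      by (rule second_difference[OF C2 t(1) inS[OF _ _ _ _ n(2,1)]])
    have swap: "x + t *\<^sub>R b + t *\<^sub>R a = x + t *\<^sub>R a + t *\<^sub>R b" by simp
    have "t * t * (a \<bullet> (D2\<phi> (x + s *\<^sub>R a + r *\<^sub>R b) *v b)) = t * t * (b \<bullet> (D2\<phi> (x + s' *\<^sub>R b + r' *\<^sub>R a) *v a))"
      using 1(5) 2(5)[unfolded swap] by linarith
    then have "D2\<phi> (x + s *\<^sub>R a + r *\<^sub>R b) $ i $ j = D2\<phi> (x + s' *\<^sub>R b + r' *\<^sub>R a) $ j $ i"
      using t(1) by (simp add: a_def b_def entry)
    then show ?thesis
      using close[OF near[OF 1(1-4) n], of i j] close[OF near[OF 2(1-4) n(2,1)], of j i] by linarith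
  qed
  then have "\<bar>D2\<phi> x $ i $ j - D2\<phi> x $ j $ i\<bar> \<le> 0" by (rule field_le_epsilon[of _ 0, simplified])
  then show "D2\<phi> x $ i $ j = D2\<phi> x $ j $ i" by simp
qed

section \<open>Multiples of a positive supersolution\<close>

context elliptic_operator
begin

text \<open>If \<phi> touches t v from below, then \<phi>/t touches v from below at the same
  point.\<close>

lemma visc_super_scale:
  assumes super: "visc_super F g v \<Omega>" and \<Omega>: "open \<Omega>" and t: "t > 0"
  shows "visc_super F (\<lambda>x. t * g x) (\<lambda>x. t * v x) \<Omega>"
  unfolding visc_super_def
proof (intro allI impI, elim conjE exE)
  fix \<phi> D\<phi> D2\<phi> x0 e
  assume C2: "C2_with \<phi> D\<phi> D2\<phi> \<Omega>" and x0: "x0 \<in> \<Omega>" and e: "0 < e" "\<forall>y\<in>ball x0 e \<inter> \<Omega>. t * v y - \<phi> y \<ge> t * v x0 - \<phi> x0"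
  have "v y - 1/t * \<phi> y \<ge> v x0 - 1/t * \<phi> x0" if "y \<in> ball x0 e \<inter> \<Omega>" for y
  proof -
    have "t * (v y - 1/t * \<phi> y) \<ge> t * (v x0 - 1/t * \<phi> x0)" using e(2) that t by (simp add: right_diff_distrib)
    then show ?thesis using t by simp
  qed
  then have "\<exists>e>0. \<forall>y\<in>ball x0 e \<inter> \<Omega>. v y - 1/t * \<phi> y \<ge> v x0 - 1/t * \<phi> x0"
    using e(1) by blast
  then have "g x0 \<le> F ((1/t) *\<^sub>R D2\<phi> x0) ((1/t) *\<^sub>R D\<phi> x0) (v x0) x0"
    using super C2_with_scale[OF C2, of "1/t"] x0 unfolding visc_super_def by blast
  then have "t * g x0 \<le> t * F ((1/t) *\<^sub>R D2\<phi> x0) ((1/t) *\<^sub>R D\<phi> x0) (v x0) x0" using t by simp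
  also have "\<dots> = F (t *\<^sub>R (1/t) *\<^sub>R D2\<phi> x0) (t *\<^sub>R (1/t) *\<^sub>R D\<phi> x0) (t * v x0) x0"
    using t x0 by (intro homogeneous[symmetric] symmetric_mat_scaleR C2_with_symmetric[OF C2 \<Omega>]) auto
  finally show "F (D2\<phi> x0) (D\<phi> x0) (t * v x0) x0 \<ge> t * g x0" using t by simp
qed

lemma proportional_of_positive_supersolution:
  assumes \<Omega>: "open \<Omega>" "connected \<Omega>" "bounded \<Omega>" and r0: "r0 > 0"
    and ext: "\<And>y. y \<in> frontier \<Omega> \<Longrightarrow> \<exists>z. dist y z \<le> r0 \<and> ball z r0 \<inter> \<Omega> = {}"
    and sub: "visc_sub F f u \<Omega>" and super: "visc_super F f v \<Omega>"
    and cont: "continuous_on (closure \<Omega>) u" "continuous_on (closure \<Omega>) v" "continuous_on \<Omega> f"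
    and pos: "\<And>x. x \<in> \<Omega> \<Longrightarrow> f x \<ge> 0" "\<And>x. x \<in> \<Omega> \<Longrightarrow> v x > 0"
    and bdy: "\<And>x. x \<in> frontier \<Omega> \<Longrightarrow> u x \<le> 0"
    and x1: "x1 \<in> \<Omega>" "u x1 > v x1"
  obtains t where "t > 0" "\<And>x. x \<in> closure \<Omega> \<Longrightarrow> u x = t * v x"
proof -
  have ne: "\<Omega> \<noteq> {}" using x1(1) by blast
  have sc: "\<Omega> \<subseteq> closure \<Omega>" by (rule closure_subset)
  obtain K where K: "compact K" "K \<subseteq> \<Omega>" "comparison_set K"
    using comparison_near_boundary[OF \<Omega>(1,3) ne r0 ext] by blast
  \<comment> \<open>Positivity inside gives v \<ge> 0 on the frontier, so the boundary values u
    \<le> 0 lie below every multiple t v.\<close>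
  have v_cl: "v x \<ge> 0" if "x \<in> closure \<Omega>" for x
    by (rule continuous_ge_on_closure[OF cont(2) that]) (use pos(2) in \<open>auto intro: less_imp_le\<close>)
  have f_le: "f x \<le> t * f x" if "t \<ge> 1" "x \<in> \<Omega>" for x t
    using mult_right_mono[OF that(1) pos(1)[OF that(2)]] by simp
  have global: "u x \<le> t * v x" if t: "t \<ge> 1" and le: "\<And>x. x \<in> K \<Longrightarrow> u x \<le> t * v x" and x: "x \<in> \<Omega>" for t x
  proof (rule comparison_setD[OF K(3) sub visc_super_scale[OF super \<Omega>(1)] cont(1) _ cont(3)])
    show "t > 0" using t by simp
    show "continuous_on (closure \<Omega>) (\<lambda>x. t * v x)" "continuous_on \<Omega> (\<lambda>x. t * f x)" by (intro continuous_intros cont)+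
    show "u y \<le> t * v y" if "y \<in> frontier \<Omega>" for y
    proof -
      have "0 \<le> t * v y" using v_cl[of y] that t by (simp add: frontier_def)
      then show ?thesis using bdy[OF that] by linarith
    qed
  qed (use f_le[OF t] le x in auto)
  \<comment> \<open>On an empty K comparison with t = 1 would give u \<le> v everywhere, against x1.
    The same contradiction shows t \<ge> 1 below.\<close>
  have Kne: "K \<noteq> {}" using global[of 1 x1] x1 by force
  have cu: "continuous_on \<Omega> u" and cv: "continuous_on \<Omega> v"
    by (rule continuous_on_subset[OF cont(1) sc] continuous_on_subset[OF cont(2) sc])+
  have "continuous_on K (\<lambda>x. u x / v x)"
    using K(2) pos(2) by (intro continuous_intros continuous_on_subset[OF cu] continuous_on_subset[OF cv]) force+
  then obtain x0 where x0: "x0 \<in> K" "\<And>x. x \<in> K \<Longrightarrow> u x / v x \<le> u x0 / v x0"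
    using continuous_attains_sup[OF K(1) Kne] by blast
  define t where "t = u x0 / v x0"
  have uK: "u x \<le> s * v x" if "x \<in> K" "t \<le> s" for x s
  proof -
    have "u x / v x \<le> s" using x0(2)[OF that(1)] that(2) by (simp add: t_def)
    then show ?thesis using pos(2)[of x] K(2) that(1) by (auto simp: divide_le_eq)
  qed
  have t1: "t \<ge> 1"
  proof (rule ccontr)
    assume "\<not> t \<ge> 1"
    then show False using global[of 1 x1] uK[of _ 1] x1 by force
  qed
  have eq: "u x = t * v x" if "x \<in> \<Omega>" for x
  proof (rule strong_maximum_principle[OF \<Omega>(1,2) sub visc_super_scale[OF super \<Omega>(1)] cu _ cont(3)])
    show "t > 0" using t1 by simp
    show "continuous_on \<Omega> (\<lambda>x. t * v x)" "continuous_on \<Omega> (\<lambda>x. t * f x)" by (intro continuous_intros cv cont(3))+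
    show "x0 \<in> \<Omega>" using x0(1) K(2) by blast
    then show "u x0 = t * v x0" using pos(2)[of x0] by (simp add: t_def)
  qed (use f_le[OF t1] global[OF t1 uK] that in auto)
  show thesis
  proof (rule that)
    show "t > 0" using t1 by simp
    show "u x = t * v x" if "x \<in> closure \<Omega>" for x
    proof -
      have c: "continuous_on (closure \<Omega>) (\<lambda>x. u x - t * v x)" by (intro continuous_intros cont)
      have "u x - t * v x = 0"
        by (rule continuous_constant_on_closure[OF c _ that]) (use eq in simp)
      then show ?thesis by simp
    qed
  qed
qed

text \<open>The difference of flipped values at M and N is that of F at -N and -M, and -N - (-M) = M
  - N: the lower ellipticity bound is reproduced with the same constants.\<close>

lemma elliptic_operator_flip: "elliptic_operator (flip_op F) \<Omega> \<gamma> \<Gamma> \<delta>\<^sub>0 \<delta>\<^sub>1 \<nu> \<omega>"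
proof unfold_locales
  fix M N :: "real^'n^'n" and p q z w x
  assume M: "symmetric_mat M" "symmetric_mat N" "x \<in> \<Omega>"
  show "pucci_minus \<gamma> \<Gamma> (M - N) - \<delta>\<^sub>1 * norm (p - q) - \<delta>\<^sub>0 * \<bar>z - w\<bar> \<le> flip_op F M p z x - flip_op F N q w x"
    using elliptic[OF symmetric_mat_minus[OF M(2)] symmetric_mat_minus[OF M(1)] M(3), of "- q" "- p" "- w" "- z"]
    by (simp add: flip_op_def)
next
  fix t z :: real and M :: "real^'n^'n" and p x :: "real^'n"
  assume a: "0 \<le> t" "symmetric_mat M" "x \<in> \<Omega>"
  show "flip_op F (t *\<^sub>R M) (t *\<^sub>R p) (t * z) x = t * flip_op F M p z x"
    using homogeneous[OF a(1) symmetric_mat_minus[OF a(2)] a(3), of "- p" "- z"] by (simp add: flip_op_def)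
next
  fix M :: "real^'n^'n" and p x y :: "real^'n" and z :: real
  assume "symmetric_mat M" "norm p \<le> 1" "\<bar>z\<bar> \<le> 1" "x \<in> \<Omega>" "y \<in> \<Omega>"
  then show "\<bar>flip_op F M p z x - flip_op F M p z y\<bar> \<le> \<omega> (dist x y powr \<nu> * (norm M + 1))"
    using modulus[OF symmetric_mat_minus, of M "- p" "- z" x y] by (simp add: flip_op_def abs_minus_commute)
qed (fact \<gamma>_pos \<gamma>_le_\<Gamma> \<delta>\<^sub>0_nonneg \<delta>\<^sub>1_nonneg \<nu>_gt \<nu>_le \<omega>_mono \<omega>_cont \<omega>_0 \<omega>_nonneg)+

end

theorem theorem3p3:
  fixes \<Omega> :: "(real^'n) set"
    and F :: "real^'n^'n \<Rightarrow> real^'n \<Rightarrow> real \<Rightarrow> real^'n \<Rightarrow> real"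
    and u v f :: "real^'n \<Rightarrow> real"
    and \<delta>\<^sub>1 \<delta>\<^sub>0 \<gamma> \<Gamma> :: real
  assumes dom: "bounded \<Omega>" "smooth_domain \<Omega>" "connected \<Omega>" "open \<Omega>" "\<Omega> \<noteq> {}"
    and F1: "\<forall>K>0. \<exists>\<omega> \<nu>. mono_on {0..} \<omega> \<and> continuous_on {0..} \<omega> \<and> \<omega> 0 = 0 \<and>
               (\<forall>s\<ge>0. \<omega> s \<ge> 0) \<and> 1/2 < \<nu> \<and> \<nu> \<le> 1 \<and>
               (\<forall>M p z x y. symmetric_mat M \<and> norm p \<le> K \<and> \<bar>z\<bar> \<le> K \<and> x \<in> \<Omega> \<and> y \<in> \<Omega> \<longrightarrow>
                  \<bar>F M p z x - F M p z y\<bar> \<le> \<omega> (dist x y powr \<nu> * (norm M + 1)))"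
    and F2consts: "\<delta>\<^sub>1 \<ge> 0" "\<delta>\<^sub>0 \<ge> 0" "0 < \<gamma>" "\<gamma> \<le> \<Gamma>"
    and F2: "\<forall>M N p q z w x. symmetric_mat M \<and> symmetric_mat N \<and> x \<in> \<Omega> \<longrightarrow>
               pucci_minus \<gamma> \<Gamma> (M - N) - \<delta>\<^sub>1 * norm (p - q) - \<delta>\<^sub>0 * \<bar>z - w\<bar>
                 \<le> F M p z x - F N q w x \<and>
               F M p z x - F N q w x
                 \<le> pucci_plus \<gamma> \<Gamma> (M - N) + \<delta>\<^sub>1 * norm (p - q) + \<delta>\<^sub>0 * \<bar>z - w\<bar>"
    and F3: "\<forall>t M p z x. t \<ge> 0 \<and> symmetric_mat M \<and> x \<in> \<Omega> \<longrightarrow>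
               F (t *\<^sub>R M) (t *\<^sub>R p) (t * z) x = t * F M p z x"
    and cont: "continuous_on (closure \<Omega>) u" "continuous_on (closure \<Omega>) v" "continuous_on \<Omega> f"
    and sub: "visc_sub F f u \<Omega>"
    and super: "visc_super F f v \<Omega>"
    and xt: "\<exists>x\<in>\<Omega>. u x > v x"
    and cases: "((\<forall>x\<in>\<Omega>. f x \<le> 0 \<and> u x < 0) \<and> (\<forall>x\<in>frontier \<Omega>. v x \<ge> 0)) \<or>
                ((\<forall>x\<in>\<Omega>. f x \<ge> 0 \<and> v x > 0) \<and> (\<forall>x\<in>frontier \<Omega>. u x \<le> 0))"
  shows "\<exists>t>0. \<forall>x\<in>closure \<Omega>. v x = t * u x"
proof -
  \<comment> \<open>The modulus for K = 1; larger arguments are reached by homogeneity.\<close>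
  obtain \<omega> \<nu> where \<omega>: "mono_on {0..} \<omega>" "continuous_on {0..} \<omega>" "\<omega> 0 = 0" "\<And>s. 0 \<le> s \<Longrightarrow> 0 \<le> \<omega> s" "1/2 < \<nu>" "\<nu> \<le> 1"
    and F1': "\<And>M p z x y. symmetric_mat M \<Longrightarrow> norm p \<le> 1 \<Longrightarrow> \<bar>z\<bar> \<le> 1 \<Longrightarrow> x \<in> \<Omega> \<Longrightarrow> y \<in> \<Omega> \<Longrightarrow>
       \<bar>F M p z x - F M p z y\<bar> \<le> \<omega> (dist x y powr \<nu> * (norm M + 1))"
    using F1[rule_format, OF zero_less_one] by metis
  interpret elliptic_operator F \<Omega> \<gamma> \<Gamma> \<delta>\<^sub>0 \<delta>\<^sub>1 \<nu> \<omega>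
  proof unfold_locales
    show "pucci_minus \<gamma> \<Gamma> (M - N) - \<delta>\<^sub>1 * norm (p - q) - \<delta>\<^sub>0 * \<bar>z - w\<bar> \<le> F M p z x - F N q w x"
      if "symmetric_mat M" "symmetric_mat N" "x \<in> \<Omega>" for M N p q z w x
      using F2 that by blast
    show "F (t *\<^sub>R M) (t *\<^sub>R p) (t * z) x = t * F M p z x" if "0 \<le> t" "symmetric_mat M" "x \<in> \<Omega>" for t M p z x
      using F3 that by blast
  qed (fact \<omega> F1' F2consts)+
  obtain r0 where r0: "r0 > 0" and ext: "\<And>y. y \<in> frontier \<Omega> \<Longrightarrow> \<exists>z. dist y z \<le> r0 \<and> ball z r0 \<inter> \<Omega> = {}"
    using smooth_domain_exterior_ball[OF dom(2,1)] by blast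
  obtain x1 where x1: "x1 \<in> \<Omega>" "u x1 > v x1" using xt by blast
  from cases show ?thesis
  proof (elim disjE conjE)
    assume s: "\<forall>x\<in>\<Omega>. f x \<le> 0 \<and> u x < 0" "\<forall>x\<in>frontier \<Omega>. v x \<ge> 0"
    \<comment> \<open>In the flipped problem -v is the subsolution and -u the positive
      supersolution.\<close>
    obtain t where "t > 0" "\<And>x. x \<in> closure \<Omega> \<Longrightarrow> - v x = t * - u x"
      by (rule elliptic_operator.proportional_of_positive_supersolution[OF elliptic_operator_flip dom(4,3,1) r0 ext
            visc_super_imp_sub_flip[OF super] visc_sub_imp_super_flip[OF sub] _ _ _ _ _ _ x1(1)])
         (use s x1(2) cont in \<open>auto intro!: continuous_intros\<close>)
    then show ?thesis by (intro exI[of _ t]) auto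
  next
    assume s: "\<forall>x\<in>\<Omega>. f x \<ge> 0 \<and> v x > 0" "\<forall>x\<in>frontier \<Omega>. u x \<le> 0"
    obtain t where t: "t > 0" "\<And>x. x \<in> closure \<Omega> \<Longrightarrow> u x = t * v x"
      by (rule proportional_of_positive_supersolution[OF dom(4,3,1) r0 ext sub super cont _ _ _ x1])
         (use s in auto)
    then show ?thesis by (intro exI[of _ "1/t"]) auto
  qed
qed

end
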